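(* Let $\Lambda=\{(q,p)\in\mathbb{R}^2 : p>q\}$ and, for $\mu=(q,p)\in\Lambda$, let $X_\mu$ be the planar vector field on $\{(x,y)\in\mathbb{R}^2 : x>-1\}$ associated with the system $$\dot x=-y,\qquad \dot y=(x+1)^p-(x+1)^q,$$ which has a non-degenerate center at the origin. Consider the period function of this center, let $\Pi_\mu$ be the outer boundary of its period annulus, and let $f(p)=\left(\tfrac{3+3p}{2}\right)^{\frac{3+3p}{1+3p}}-3p-2$. Then the following hold: (a) If $\hat\mu=(-\tfrac13,\hat p)$ with $\hat p\in(-\tfrac13,+\infty)\setminus\{p_1\}$, where $p_1\approx 1.15685$ is the unique zero of $f$ on $(-\tfrac13,+\infty)$, then $\mathrm{Crit}\bigl((\Pi_{\hat\mu},X_{\hat\mu}),X_\mu\bigr)=0$. (b) If $\hat\mu=(0,\hat p)$ with $\hat p\in(0,+\infty)\setminus\{1\}$, then $\mathrm{Crit}\bigl((\Pi_{\hat\mu},X_{\hat\mu}),X_\mu\bigr)=1$.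
   Context: The period annulus $\mathscr P_\mu$ of the center at the origin of $X_\mu$ is the largest punctured neighborhood of the origin entirely foliated by periodic orbits of $X_\mu$ surrounding it. After embedding $\mathscr P_\mu$ into $\mathbb{RP}^2$, the outer boundary is $\Pi_\mu:=\partial\mathscr P_\mu\setminus\{(0,0)\}$, with the boundary taken in $\mathbb{RP}^2$. The period function assigns to each periodic orbit in $\mathscr P_\mu$ its minimal period; a critical periodic orbit is a periodic orbit in $\mathscr P_\mu$ at which the derivative of the period function (with respect to an analytic parametrization of the orbits of the annulus, e.g. by the energy) vanishes. Criticality. Let $\{X_\mu\}_{\mu\in\Lambda}$ be a continuous family of planar analytic vector fields with a center and fix $\hat\mu\in\Lambda$. Let $d_H$ be the Hausdorff distance between compact subsets of $\mathbb{RP}^2$, and suppose that the outer boundary varies continuously at $\hat\mu$, i.e. for every $\varepsilon>0$ there is $\delta>0$ with $d_H(\Pi_\mu,\Pi_{\hat\mu})\le\varepsilon$ whenever $\|\mu-\hat\mu\|\le\delta$. Set $$N(\delta,\varepsilon):=\sup\{\#\text{ critical periodic orbits }\gamma\text{ of }X_\mu\text{ in }\mathscr P_\mu\text{ with }d_H(\gamma,\Pi_{\hat\mu})\le\varepsilon\text{ and }\|\mu-\hat\mu\|\le\delta\}.$$ Then $\mathrm{Crit}\bigl((\Pi_{\hat\mu},X_{\hat\mu}),X_\mu\bigr):=\inf_{\delta,\varepsilon}N(\delta,\varepsilon)$. *)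

theory Defs
  imports "HOL-Analysis.Analysis" "HOL-Library.Extended_Nat"
begin

section \<open>The real projective plane and the Hausdorff distance\<close>

typedef rp2 = "{L :: (real \<times> real \<times> real) set. subspace L \<and> dim L = 1}"
  morphisms line_of Abs_rp2
proof -
  have "subspace (span {(1, 0, 0) :: real \<times> real \<times> real})"
    by (rule subspace_span)
  moreover have "dim (span {(1, 0, 0) :: real \<times> real \<times> real}) = 1"
    by (simp add: dim_insert prod_eq_iff)
  ultimately show ?thesis by blast
qed

lemma line_inter_sphere:
  fixes u :: "'a :: real_normed_vector"
  assumes "norm u = 1"
  shows "range (\<lambda>k. k *\<^sub>R u) \<inter> sphere 0 1 = {u, - u}"
proof -
  have "range (\<lambda>k. k *\<^sub>R u) \<inter> sphere 0 1 = (\<lambda>k. k *\<^sub>R u) ` {k. \<bar>k\<bar> = 1}"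
    using assms by auto
  also have "{k :: real. \<bar>k\<bar> = 1} = {1, -1}"
    by auto
  finally show ?thesis by simp
qed

lemma rp2_unit:
  obtains u where "norm u = 1" "line_of L \<inter> sphere 0 1 = {u, - u}"
proof -
  have sub: "subspace (line_of L)" and dim: "dim (line_of L) = 1"
    using line_of [of L] by auto
  obtain B where B: "B \<subseteq> line_of L" "independent B" "line_of L \<subseteq> span B" "card B = 1"
    using basis_exists [of "line_of L"] dim by metis
  then obtain b where b: "B = {b}"
    by (metis card_1_singletonE)
  then have b0: "b \<noteq> 0"
    using B(2) dependent_zero by blast
  have span: "line_of L = span {b}"
    using B sub b by (metis span_minimal subset_antisym)
  define u where "u = b /\<^sub>R norm b"
  have u: "norm u = 1"
    using b0 by (simp add: u_def)
  have "line_of L = range (\<lambda>k. k *\<^sub>R u)"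
  proof -
    have "\<exists>k'. k *\<^sub>R b = k' *\<^sub>R u" for k
      by (rule exI [of _ "k * norm b"]) (use b0 in \<open>simp add: u_def\<close>)
    moreover have "k *\<^sub>R u = (k / norm b) *\<^sub>R b" for k
      by (simp add: u_def divide_inverse)
    ultimately show ?thesis
      unfolding span span_singleton by blast
  qed
  then have "line_of L \<inter> sphere 0 1 = {u, - u}"
    using line_inter_sphere [OF u] by simp
  then show ?thesis
    using that u by simp
qed

lemma setdist_antipodal:
  fixes u v :: "'a :: real_normed_vector"
  shows "setdist {u, - u} {v, - v} = min (norm (u - v)) (norm (u + v))"
proof (rule antisym)
  have *: "norm (- u - v) = norm (u + v)" "norm (v - u) = norm (u - v)"
    by (metis minus_add_distrib norm_minus_cancel uminus_add_conv_diff add.commute)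
      (rule norm_minus_commute)
  show "setdist {u, - u} {v, - v} \<le> min (norm (u - v)) (norm (u + v))"
    using setdist_le_dist [of u "{u, - u}" v "{v, - v}"]
      setdist_le_dist [of u "{u, - u}" "- v" "{v, - v}"]
    by (simp add: dist_norm)
  show "min (norm (u - v)) (norm (u + v)) \<le> setdist {u, - u} {v, - v}"
    by (rule le_setdistI) (auto simp: dist_norm *)
qed

instantiation rp2 :: metric_space
begin

text \<open>The quotient of the Euclidean metric of the unit sphere by the antipodal map.\<close>

definition dist_rp2 :: "rp2 \<Rightarrow> rp2 \<Rightarrow> real"
  where "dist L M = setdist (line_of L \<inter> sphere 0 1) (line_of M \<inter> sphere 0 1)"

definition uniformity_rp2 :: "(rp2 \<times> rp2) filter"
  where "uniformity = (INF e\<in>{0 <..}. principal {(L :: rp2, M). dist L M < e})"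

definition open_rp2 :: "rp2 set \<Rightarrow> bool"
  where "open (U :: rp2 set) \<longleftrightarrow> (\<forall>x\<in>U. eventually (\<lambda>(x', y). x' = x \<longrightarrow> y \<in> U) uniformity)"

instance
proof
  fix L M N :: rp2
  obtain u where u: "norm u = 1" "line_of L \<inter> sphere 0 1 = {u, - u}" by (rule rp2_unit)
  obtain v where v: "norm v = 1" "line_of M \<inter> sphere 0 1 = {v, - v}" by (rule rp2_unit)
  obtain w where w: "norm w = 1" "line_of N \<inter> sphere 0 1 = {w, - w}" by (rule rp2_unit)
  show "dist L M = 0 \<longleftrightarrow> L = M"
  proof
    assume "dist L M = 0"
    then have "u = v \<or> u = - v"
      by (auto simp: dist_rp2_def u v setdist_antipodal min_def add_eq_0_iff2 split: if_splits)
    then have eq: "line_of L \<inter> sphere 0 1 = line_of M \<inter> sphere 0 1"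
      using u v by auto
    have *: "line_of K \<subseteq> line_of K'"
      if "line_of K \<inter> sphere 0 1 = line_of K' \<inter> sphere 0 1" for K K' :: rp2
    proof
      fix x assume x: "x \<in> line_of K"
      have sub: "subspace (line_of K)" "subspace (line_of K')"
        using line_of by auto
      show "x \<in> line_of K'"
      proof (cases "x = 0")
        case True
        then show ?thesis using sub subspace_0 by blast
      next
        case False
        then have "x /\<^sub>R norm x \<in> line_of K \<inter> sphere 0 1"
          using x sub by (simp add: subspace_scale)
        then have "norm x *\<^sub>R (x /\<^sub>R norm x) \<in> line_of K'"
          using that sub(2) by (blast intro: subspace_scale)
        then show ?thesis using False by simp
      qed
    qed
    show "L = M"
      using * [OF eq] * [OF eq [symmetric]] line_of_inject by blast
  qed (simp add: dist_rp2_def u v setdist_antipodal)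
  have tri: "norm (u - v) \<le> norm (u - w) + norm (v - w)"
    "norm (u - v) \<le> norm (u + w) + norm (v + w)"
    "norm (u + v) \<le> norm (u - w) + norm (v + w)"
    "norm (u + v) \<le> norm (u + w) + norm (v - w)"
    using norm_triangle_ineq4 [of "u - w" "v - w"] norm_triangle_ineq4 [of "u + w" "v + w"]
      norm_triangle_ineq [of "u - w" "v + w"] norm_triangle_ineq [of "u + w" "v - w"]
    by (simp_all add: algebra_simps)
  show "dist L M \<le> dist L N + dist M N"
    unfolding dist_rp2_def u v w setdist_antipodal using tri by linarith
qed (simp_all add: uniformity_rp2_def open_rp2_def)

end

definition to_rp2 :: "real \<times> real \<Rightarrow> rp2"
  where "to_rp2 z = Abs_rp2 (span {(fst z, snd z, 1)})"

definition hausdorff_dist :: "'a :: metric_space set \<Rightarrow> 'a set \<Rightarrow> real"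
  where "hausdorff_dist A B = max (SUP a\<in>A. infdist a B) (SUP b\<in>B. infdist b A)"


section \<open>Periodic orbits and the period annulus of a center\<close>

text \<open>\<^term>\<open>U\<close> is the open domain of the planar vector field \<^term>\<open>X\<close>; values of \<^term>\<open>X\<close>
  outside \<^term>\<open>U\<close> play no role.\<close>

definition periodic_solution ::
    "(real \<times> real) set \<Rightarrow> (real \<times> real \<Rightarrow> real \<times> real) \<Rightarrow> (real \<Rightarrow> real \<times> real) \<Rightarrow> real \<Rightarrow> bool"
  where "periodic_solution U X \<phi> T \<longleftrightarrow>
    (\<forall>t. \<phi> t \<in> U \<and> (\<phi> has_vector_derivative X (\<phi> t)) (at t)) \<and>
    (\<exists>t. \<phi> t \<noteq> \<phi> 0) \<and>
    T > 0 \<and> (\<forall>t. \<phi> (t + T) = \<phi> t)"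

definition periodic_orbit ::
    "(real \<times> real) set \<Rightarrow> (real \<times> real \<Rightarrow> real \<times> real) \<Rightarrow> (real \<times> real) set \<Rightarrow> bool"
  where "periodic_orbit U X \<gamma> \<longleftrightarrow> (\<exists>\<phi> T. periodic_solution U X \<phi> T \<and> range \<phi> = \<gamma>)"

definition minimal_period ::
    "(real \<times> real) set \<Rightarrow> (real \<times> real \<Rightarrow> real \<times> real) \<Rightarrow> (real \<times> real) set \<Rightarrow> real"
  where "minimal_period U X \<gamma> = (LEAST T. \<exists>\<phi>. periodic_solution U X \<phi> T \<and> range \<phi> = \<gamma>)"

definition foliated_nbhd ::
    "(real \<times> real) set \<Rightarrow> (real \<times> real \<Rightarrow> real \<times> real) \<Rightarrow> real \<times> real \<Rightarrow> (real \<times> real) set \<Rightarrow> bool"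
  where "foliated_nbhd U X c V \<longleftrightarrow>
    open V \<and> connected V \<and> c \<in> V \<and>
    (\<forall>z \<in> V - {c}. \<exists>\<gamma>. periodic_orbit U X \<gamma> \<and> c \<in> inside \<gamma> \<and> z \<in> \<gamma> \<and> \<gamma> \<subseteq> V - {c})"

definition center :: "(real \<times> real) set \<Rightarrow> (real \<times> real \<Rightarrow> real \<times> real) \<Rightarrow> real \<times> real \<Rightarrow> bool"
  where "center U X c \<longleftrightarrow> c \<in> U \<and> X c = 0 \<and> (\<exists>V. foliated_nbhd U X c V)"

text \<open>The linear part at the center has the eigenvalues \<open>\<plusminus>\<i>\<omega>\<close> with \<open>\<omega> \<noteq> 0\<close>: the two equations
  are the real and the imaginary part of \<open>D (v + \<i>w) = \<i>\<omega> (v + \<i>w)\<close>.\<close>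

definition nondegenerate_center ::
    "(real \<times> real) set \<Rightarrow> (real \<times> real \<Rightarrow> real \<times> real) \<Rightarrow> real \<times> real \<Rightarrow> bool"
  where "nondegenerate_center U X c \<longleftrightarrow> center U X c \<and>
    (\<exists>D \<omega> v w. (X has_derivative D) (at c) \<and> \<omega> \<noteq> 0 \<and> (v, w) \<noteq> (0, 0) \<and>
       D v = - \<omega> *\<^sub>R w \<and> D w = \<omega> *\<^sub>R v)"

text \<open>If there is a foliated neighbourhood at all, the union is itself one, hence the largest.\<close>

definition period_annulus ::
    "(real \<times> real) set \<Rightarrow> (real \<times> real \<Rightarrow> real \<times> real) \<Rightarrow> real \<times> real \<Rightarrow> (real \<times> real) set"
  where "period_annulus U X c = \<Union> {V. foliated_nbhd U X c V} - {c}"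

definition outer_boundary ::
    "(real \<times> real) set \<Rightarrow> (real \<times> real \<Rightarrow> real \<times> real) \<Rightarrow> real \<times> real \<Rightarrow> rp2 set"
  where "outer_boundary U X c = frontier (to_rp2 ` period_annulus U X c) - {to_rp2 c}"


section \<open>Critical periodic orbits\<close>

definition real_analytic_on :: "(real \<Rightarrow> 'a :: real_normed_vector) \<Rightarrow> real set \<Rightarrow> bool"
  where "real_analytic_on f S \<longleftrightarrow>
    (\<forall>s\<in>S. \<exists>r>0. \<exists>a. \<forall>t. \<bar>t - s\<bar> < r \<longrightarrow> (\<lambda>n. (t - s) ^ n *\<^sub>R a n) sums f t)"

text \<open>An analytic parametrization \<open>s \<mapsto> \<gamma>\<^sub>s\<close> of the orbits of the annulus is given by an analytic
  curve \<^term>\<open>\<xi>\<close> that is transverse to \<^term>\<open>X\<close> and meets every orbit of the annulus exactly once.\<close>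

definition orbit_parametrization ::
    "(real \<times> real) set \<Rightarrow> (real \<times> real \<Rightarrow> real \<times> real) \<Rightarrow> real \<times> real \<Rightarrow>
     real \<Rightarrow> real \<Rightarrow> (real \<Rightarrow> real \<times> real) \<Rightarrow> bool"
  where "orbit_parametrization U X c a b \<xi> \<longleftrightarrow>
    real_analytic_on \<xi> {a<..<b} \<and>
    (\<forall>s\<in>{a<..<b}. \<xi> s \<in> period_annulus U X c \<and>
       (let u = X (\<xi> s); v = vector_derivative \<xi> (at s) in fst u * snd v - snd u * fst v \<noteq> 0)) \<and>
    (\<forall>\<gamma>. periodic_orbit U X \<gamma> \<and> \<gamma> \<subseteq> period_annulus U X c \<longrightarrow> (\<exists>!s. s \<in> {a<..<b} \<and> \<xi> s \<in> \<gamma>))"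

definition orbit_through ::
    "(real \<times> real) set \<Rightarrow> (real \<times> real \<Rightarrow> real \<times> real) \<Rightarrow> real \<times> real \<Rightarrow> (real \<times> real) set"
  where "orbit_through U X z = (THE \<gamma>. periodic_orbit U X \<gamma> \<and> z \<in> \<gamma>)"

text \<open>Two orbit parametrizations differ by a change of parameter with nowhere vanishing derivative,
  so the choice of \<^term>\<open>\<xi>\<close> is immaterial.\<close>

definition critical_periodic_orbit ::
    "(real \<times> real) set \<Rightarrow> (real \<times> real \<Rightarrow> real \<times> real) \<Rightarrow> real \<times> real \<Rightarrow> (real \<times> real) set \<Rightarrow> bool"
  where "critical_periodic_orbit U X c \<gamma> \<longleftrightarrow>
    periodic_orbit U X \<gamma> \<and> \<gamma> \<subseteq> period_annulus U X c \<and>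
    (\<exists>a b \<xi> s. orbit_parametrization U X c a b \<xi> \<and> s \<in> {a<..<b} \<and> \<xi> s \<in> \<gamma> \<and>
       ((\<lambda>s. minimal_period U X (orbit_through U X (\<xi> s))) has_real_derivative 0) (at s))"


section \<open>Criticality at the outer boundary\<close>

definition ecard :: "'a set \<Rightarrow> enat"
  where "ecard A = (if finite A then enat (card A) else \<infinity>)"

definition outer_boundary_continuous_at ::
    "'p :: metric_space set \<Rightarrow> (real \<times> real) set \<Rightarrow> ('p \<Rightarrow> real \<times> real \<Rightarrow> real \<times> real) \<Rightarrow>
     real \<times> real \<Rightarrow> 'p \<Rightarrow> bool"
  where "outer_boundary_continuous_at \<Lambda> U X c \<mu>0 \<longleftrightarrow>
    (\<forall>\<epsilon>>0. \<exists>\<delta>>0. \<forall>\<mu>\<in>\<Lambda>. dist \<mu> \<mu>0 \<le> \<delta> \<longrightarrow>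
       hausdorff_dist (outer_boundary U (X \<mu>) c) (outer_boundary U (X \<mu>0) c) \<le> \<epsilon>)"

definition crit_bound ::
    "'p :: metric_space set \<Rightarrow> (real \<times> real) set \<Rightarrow> ('p \<Rightarrow> real \<times> real \<Rightarrow> real \<times> real) \<Rightarrow>
     real \<times> real \<Rightarrow> 'p \<Rightarrow> real \<Rightarrow> real \<Rightarrow> enat"
  where "crit_bound \<Lambda> U X c \<mu>0 \<delta> \<epsilon> =
    (SUP \<mu> \<in> {\<mu> \<in> \<Lambda>. dist \<mu> \<mu>0 \<le> \<delta>}.
       ecard {\<gamma>. critical_periodic_orbit U (X \<mu>) c \<gamma> \<and>
                 hausdorff_dist (to_rp2 ` \<gamma>) (outer_boundary U (X \<mu>0) c) \<le> \<epsilon>})"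

definition Crit ::
    "'p :: metric_space set \<Rightarrow> (real \<times> real) set \<Rightarrow> ('p \<Rightarrow> real \<times> real \<Rightarrow> real \<times> real) \<Rightarrow>
     real \<times> real \<Rightarrow> 'p \<Rightarrow> enat"
  where "Crit \<Lambda> U X c \<mu>0 = (INF \<delta>\<in>{0<..}. INF \<epsilon>\<in>{0<..}. crit_bound \<Lambda> U X c \<mu>0 \<delta> \<epsilon>)"


section \<open>The family\<close>

definition half_plane :: "(real \<times> real) set"
  where "half_plane = {(x, y). x > -1}"

definition param_space :: "(real \<times> real) set"
  where "param_space = {(q, p). p > q}"

definition X_field :: "real \<times> real \<Rightarrow> real \<times> real \<Rightarrow> real \<times> real"
  where "X_field = (\<lambda>(q, p) (x, y). (- y, (x + 1) powr p - (x + 1) powr q))"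

definition f_fun :: "real \<Rightarrow> real"
  where "f_fun p = ((3 + 3 * p) / 2) powr ((3 + 3 * p) / (1 + 3 * p)) - 3 * p - 2"

end

theory Submission
  imports Defs
begin

text \<open>Write \<open>V\<close> for the potential, \<open>G = sgn x * sqrt (2 V)\<close>, and \<open>k\<close> for the derivative of \<open>G\<inverse>\<close>. In the coordinates
  \<open>G x = - r cos \<phi>\<close>, \<open>y = - r sin \<phi>\<close> the system becomes \<open>\<phi>' = 1 / k\<close> on the orbit of energy \<open>r\<^sup>2 / 2\<close>, so its period is
  \<open>\<integral> k (- r cos \<phi>) d\<phi>\<close> over \<open>[0, 2 \<pi>]\<close>. For \<open>q > -1\<close> the annulus is the sublevel set \<open>r < R\<close>, where \<open>R\<^sup>2 / 2 = V (-1)\<close>.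
  Near \<open>x = -1\<close> the function \<open>k'\<close> behaves like \<open>-q R\<^sup>2 (x + 1) powr (-1 - 2 q)\<close>.

  At \<open>q = -1/3\<close> this has a fixed sign and produces a logarithmically divergent integral as \<open>r\<close> tends to \<open>R\<close>, so by
  Fatou's lemma the derivative of the period does not vanish near the outer boundary.

  Near \<open>q = 0\<close> put \<open>s = (R\<^sup>2 - r\<^sup>2) / 2\<close> and \<open>\<alpha> = 1 / (q + 1) - 1 / 2\<close>. Then \<open>(s powr (1 - \<alpha>) T' r / r)'\<close> equals, up to a positive
  factor, an integral \<open>E\<close> from which the bifurcating singular term has disappeared. At \<open>q = 0\<close> its limit is a nonzero multiple
  of \<open>T' R\<close> (or infinite), whose sign follows from the strict monotonicity of \<open>k'\<close>; hence \<open>E\<close> has a fixed sign near the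
  outer boundary and \<open>T'\<close> has at most one zero there. A zero exists for suitable small \<open>q \<noteq> 0\<close>, because the
  singular term makes \<open>T'\<close> tend to infinity with the sign opposite to that of the limiting \<open>T'\<close>.\<close>

section \<open>Potential wells\<close>

text \<open>Near q = 0 the zero count can be read off a heuristic expansion. On the left branch
  \<open>k\<close> behaves like u powr (-q) while the energy deficit behaves like u powr (q + 1),
  with u = x + 1; integrating over the angle gives the period a term of order s powr \<alpha> whose
  coefficient vanishes with q. So T' is to leading order a constant plus a multiple of q times s
  powr (\<alpha> - 1), and the weight s powr (1 - \<alpha>) turns that singular summand into a
  constant, which differentiation removes. The exponent moves with q, so it has to be part of the
  weight. At q = -1/3 one has \<alpha> = 1, the resonance behind the logarithm. The obstacle is
  uniformity: each sign must hold on a whole neighbourhood of the pair (parameter, boundary radius),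
  where the integrands need not have a common integrable majorant. One-sided bounds do exist: away
  from x = -1 the integrands are bounded, and near x = -1 they have a known sign or are bounded.
  Hence Fatou's lemma, rather than dominated convergence or an asymptotic expansion, governs the
  integrals.\<close>

lemma lim_quotient_0:
  fixes f :: "real \<Rightarrow> real"
  assumes "(f has_real_derivative D) (at 0)" "f 0 = 0"
  shows "((\<lambda>x. f x / x) \<longlongrightarrow> D) (at 0)"
  using assms by (simp add: has_field_derivative_iff)

text \<open>\<open>R\<close> is only required to be small enough for both branches to reach energy
  \<open>R\<^sup>2 / 2\<close>, which is \<open>G_onto\<close>. The same theory thus serves a small
  well, all that the center property needs, and the largest one, which carries the period
  annulus.\<close>

locale potential_well =
  fixes F f f' :: "real \<Rightarrow> real" and R :: real
  assumes F0: "F 0 = 0"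
    and F_deriv: "\<And>x. x > -1 \<Longrightarrow> (F has_real_derivative f x) (at x)"
    and f_deriv: "\<And>x. x > -1 \<Longrightarrow> (f has_real_derivative f' x) (at x)"
    and f'_cont: "continuous_on {-1<..} f'"
    and f_pos: "\<And>x. x > 0 \<Longrightarrow> f x > 0"
    and f_neg: "\<And>x. -1 < x \<Longrightarrow> x < 0 \<Longrightarrow> f x < 0"
    and f'0: "f' 0 > 0"
    and R_pos: "R > 0"
    and G_onto: "\<And>z. \<bar>z\<bar> < R \<Longrightarrow> \<exists>x>-1. sgn x * sqrt (2 * F x) = z"
begin

definition G :: "real \<Rightarrow> real" where "G x = sgn x * sqrt (2 * F x)"

lemma f0: "f 0 = 0"
proof -
  have "isCont f 0" using f_deriv[of 0] DERIV_isCont by simp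
  hence *: "(f \<longlongrightarrow> f 0) (at 0)" by (simp add: isCont_def)
  have "(f \<longlongrightarrow> f 0) (at_right 0)" "(f \<longlongrightarrow> f 0) (at_left 0)"
    using * by (simp_all add: filterlim_at_split)
  moreover have "eventually (\<lambda>x. f x \<ge> 0) (at_right 0)"
    using eventually_at_right_less[of "0::real"] by eventually_elim (use f_pos less_imp_le in blast)
  moreover have "eventually (\<lambda>x. f x \<le> 0) (at_left 0)"
    using eventually_at_left_real[of "-1" 0] by simp (erule eventually_mono, use f_neg less_imp_le in auto)
  ultimately show ?thesis
    using tendsto_lowerbound[of f "f 0" "at_right 0" 0] tendsto_upperbound[of f "f 0" "at_left 0" 0] 
    by (simp add: order.antisym)
qed

lemma F_cont_on: "-1 < x \<Longrightarrow> continuous_on {x..y} F"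
  by (rule continuous_at_imp_continuous_on) (meson DERIV_isCont F_deriv atLeastAtMost_iff less_le_trans)

lemma F_strict_mono: assumes "0 \<le> x" "x < y" shows "F x < F y"
proof (rule DERIV_pos_imp_increasing_open[OF assms(2)])
  show "\<exists>D. (F has_real_derivative D) (at t) \<and> 0 < D" if "x < t" for t
    using F_deriv[of t] f_pos[of t] that assms(1) by (intro exI[of _ "f t"]) auto
qed (use F_cont_on assms in auto)

lemma F_strict_antimono: assumes "-1 < x" "x < y" "y \<le> 0" shows "F y < F x"
proof (rule DERIV_neg_imp_decreasing_open[OF assms(2)])
  show "\<exists>D. (F has_real_derivative D) (at t) \<and> D < 0" if "x < t" "t < y" for t
    using F_deriv[of t] f_neg[of t] that assms by (intro exI[of _ "f t"]) auto
qed (use F_cont_on assms in auto)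

lemma F_pos: "x > -1 \<Longrightarrow> x \<noteq> 0 \<Longrightarrow> F x > 0"
  using F_strict_mono[of 0 x] F_strict_antimono[of x 0] F0 by linarith

lemma F_nonneg: "x > -1 \<Longrightarrow> F x \<ge> 0"
  using F_pos F0 by (cases "x = 0") (auto simp: less_imp_le)

lemma G_sq: "x > -1 \<Longrightarrow> (G x)\<^sup>2 = 2 * F x"
  using F_nonneg[of x] F0 by (cases "x = 0") (auto simp: G_def power_mult_distrib sgn_real_def)

lemma G_0 [simp]: "G 0 = 0" by (simp add: G_def)

lemma G_pos: "x > 0 \<Longrightarrow> G x > 0" using F_pos[of x] by (simp add: G_def)
lemma G_neg: "-1 < x \<Longrightarrow> x < 0 \<Longrightarrow> G x < 0" using F_pos[of x] by (simp add: G_def)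

lemma G_strict_mono: "-1 < x \<Longrightarrow> x < y \<Longrightarrow> G x < G y"
proof -
  assume a: "-1 < x" "x < y"
  consider "x \<ge> 0" | "x < 0" "y > 0" | "y \<le> 0" by linarith
  then show ?thesis
  proof cases
    case 1 thus ?thesis using F_strict_mono[of x y] a F_nonneg[of x] F0 by (cases "x = 0") (auto simp: G_def)
  next
    case 2 thus ?thesis using G_pos[of y] G_neg[of x] a by linarith
  next
    case 3 thus ?thesis using F_strict_antimono[of x y] a F_nonneg[of y] F0 by (cases "y = 0") (auto simp: G_def)
  qed
qed

lemma G_inj: "-1 < x \<Longrightarrow> -1 < y \<Longrightarrow> G x = G y \<Longrightarrow> x = y"
  using G_strict_mono[of x y] G_strict_mono[of y x] by (cases x y rule: linorder_cases) auto

lemma G_deriv: "x > -1 \<Longrightarrow> x \<noteq> 0 \<Longrightarrow> (G has_real_derivative f x / G x) (at x)"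
proof -
  assume a: "x > -1" "x \<noteq> 0"
  have "((\<lambda>t. sgn x * sqrt (2 * F t)) has_real_derivative sgn x * (f x / sqrt (2 * F x))) (at x)"
    using F_pos[OF a] F_deriv[OF a(1)]
    by (auto intro!: derivative_eq_intros simp: field_simps)
  moreover have "sgn x * (f x / sqrt (2 * F x)) = f x / G x"
    using a by (auto simp: G_def sgn_real_def)
  moreover have "eventually (\<lambda>t. sgn x * sqrt (2 * F t) = G t) (nhds x)"
  proof -
    have "eventually (\<lambda>t. sgn t = sgn x) (nhds x)"
    proof (cases "x > 0")
      case True
      hence "eventually (\<lambda>t. t > 0) (nhds x)" using eventually_nhds_in_open[of "{0<..}" x] by simp
      thus ?thesis by eventually_elim (use True in auto)
    next
      case False
      hence "eventually (\<lambda>t. t < 0) (nhds x)" using a eventually_nhds_in_open[of "{..<0}" x] by simp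
      thus ?thesis by eventually_elim (use a False in auto)
    qed
    thus ?thesis by eventually_elim (auto simp: G_def)
  qed
  ultimately show ?thesis
    by (simp add: DERIV_cong_ev)
qed

text \<open>One l'Hopital step reduces this to \<open>f x / (2 * x)\<close>. It makes
  \<open>G\<close> differentiable at 0, where the square root and \<open>sgn\<close> are each
  singular.\<close>

lemma F_over_sq: "((\<lambda>x. F x / x\<^sup>2) \<longlongrightarrow> f' 0 / 2) (at 0)"
proof (rule lhopital[where f' = f and g' = "\<lambda>x. 2 * x"])
  have "isCont F 0" using F_deriv[of 0] DERIV_isCont by simp
  thus "(F \<longlongrightarrow> 0) (at 0)" using F0 by (simp add: isCont_def)
  have ev: "eventually (\<lambda>x::real. x > -1) (at 0)"
    by (rule order_tendstoD(1)[OF tendsto_ident_at]) simp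
  show "((\<lambda>x::real. x\<^sup>2) \<longlongrightarrow> 0) (at 0)" by (auto intro!: tendsto_eq_intros)
  show "eventually (\<lambda>x::real. x\<^sup>2 \<noteq> 0) (at 0)" "eventually (\<lambda>x::real. 2 * x \<noteq> 0) (at 0)"
    by (auto simp: eventually_at_filter)
  show "eventually (\<lambda>x. (F has_real_derivative f x) (at x)) (at 0)"
    using ev by eventually_elim (rule F_deriv)
  show "eventually (\<lambda>x. (power2 has_real_derivative 2 * x) (at x)) (at 0)"
    by (auto intro!: always_eventually derivative_eq_intros)
  have "((\<lambda>x. f x / x / 2) \<longlongrightarrow> f' 0 / 2) (at 0)"
    by (intro tendsto_divide lim_quotient_0 f_deriv f0 tendsto_const) auto
  thus "((\<lambda>x. f x / (2 * x)) \<longlongrightarrow> f' 0 / 2) (at 0)" by (simp add: field_simps)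
qed

lemma G_deriv_0: "(G has_real_derivative sqrt (f' 0)) (at 0)"
proof -
  have "((\<lambda>x. sqrt (2 * (F x / x\<^sup>2))) \<longlongrightarrow> sqrt (2 * (f' 0 / 2))) (at 0)"
    by (intro tendsto_intros F_over_sq)
  moreover have "sqrt (2 * (F x / x\<^sup>2)) = G x / x" if "x \<noteq> 0" for x
    using that by (auto simp: G_def real_sqrt_mult real_sqrt_divide sgn_real_def)
  ultimately have "((\<lambda>x. G x / x) \<longlongrightarrow> sqrt (f' 0)) (at 0)"
    by (auto simp: eventually_at_filter intro: Lim_transform_eventually)
  thus ?thesis by (simp add: has_field_derivative_iff)
qed

lemma G_cont: "x > -1 \<Longrightarrow> isCont G x"
  using G_deriv G_deriv_0 DERIV_isCont by (cases "x = 0") blast+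

definition ginv :: "real \<Rightarrow> real" where "ginv z = (THE x. x > -1 \<and> G x = z)"

lemma ginv_props: assumes "\<bar>z\<bar> < R" shows "ginv z > -1" "G (ginv z) = z"
proof -
  obtain x where x: "x > -1" "G x = z" using G_onto[OF assms] by (auto simp: G_def)
  hence "ginv z = x" unfolding ginv_def using G_inj by (intro the_equality) auto
  thus "ginv z > -1" "G (ginv z) = z" using x by auto
qed

lemma ginv_G: "x > -1 \<Longrightarrow> ginv (G x) = x"
  unfolding ginv_def using G_inj by (intro the_equality) auto

lemma ginv_0 [simp]: "ginv 0 = 0" using ginv_G[of 0] by simp

lemma ginv_eq_0_iff: "\<bar>z\<bar> < R \<Longrightarrow> ginv z = 0 \<longleftrightarrow> z = 0"
  using ginv_props[of z] by (metis G_0 ginv_0)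

lemma F_ginv: "\<bar>z\<bar> < R \<Longrightarrow> 2 * F (ginv z) = z\<^sup>2"
  using ginv_props[of z] G_sq by metis

lemma ginv_strict_mono: "\<bar>z\<bar> < R \<Longrightarrow> \<bar>w\<bar> < R \<Longrightarrow> z < w \<Longrightarrow> ginv z < ginv w"
  using ginv_props[of z] ginv_props[of w] G_strict_mono[of "ginv w" "ginv z"] 
  by (metis linorder_neqE less_asym)

lemma ginv_mono: "\<bar>z\<bar> < R \<Longrightarrow> \<bar>w\<bar> < R \<Longrightarrow> z \<le> w \<Longrightarrow> ginv z \<le> ginv w"
  using ginv_strict_mono[of z w] by (cases "z = w") auto

lemma ginv_pos: "0 < z \<Longrightarrow> z < R \<Longrightarrow> ginv z > 0"
  using ginv_strict_mono[of 0 z] R_pos by simp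

lemma ginv_neg: "-R < z \<Longrightarrow> z < 0 \<Longrightarrow> ginv z < 0"
  using ginv_strict_mono[of z 0] R_pos by simp

lemma ginv_cont: assumes "\<bar>z\<bar> < R" shows "isCont ginv z"
proof -
  obtain a b where ab: "-R < a" "a < z" "z < b" "b < R"
    using dense[of "-R" z] dense[of z R] assms by (auto simp: abs_less_iff)
  have "isCont ginv (G (ginv z))"
  proof (rule isCont_inverse_function2[where f = G and x = "ginv z" and a = "ginv a" and b = "ginv b"])
    show "ginv a < ginv z" "ginv z < ginv b" using ab assms by (auto intro!: ginv_strict_mono)
    have a1: "ginv a > -1" using ab assms by (intro ginv_props) auto
    show "ginv (G t) = t" "isCont G t" if "ginv a \<le> t" "t \<le> ginv b" for t
      using that a1 by (auto intro!: ginv_G G_cont)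
  qed
  thus ?thesis using ginv_props[OF assms] by simp
qed

text \<open>From \<open>(G x)\<^sup>2 = 2 * F x\<close> one gets G' = f / G, so the inverse of
  \<open>G\<close> has derivative z / f at z. The value at 0 is the reciprocal of
  \<open>sqrt (f' 0)\<close>, the slope of \<open>G\<close> there.\<close>

definition k :: "real \<Rightarrow> real" where "k z = (if z = 0 then 1 / sqrt (f' 0) else z / f (ginv z))"

lemma ginv_deriv: assumes "\<bar>z\<bar> < R" shows "(ginv has_real_derivative k z) (at z)"
proof -
  note c = ginv_props[OF assms]
  have 1: "(G has_real_derivative (if z = 0 then sqrt (f' 0) else f (ginv z) / z)) (at (ginv z))"
    using G_deriv[of "ginv z"] G_deriv_0 c ginv_eq_0_iff[OF assms] by auto
  have 2: "f (ginv z) \<noteq> 0" if "z \<noteq> 0"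
    using f_pos[of "ginv z"] f_neg[of "ginv z"] c(1) ginv_eq_0_iff[OF assms] that by fastforce
  have "(ginv has_real_derivative inverse (if z = 0 then sqrt (f' 0) else f (ginv z) / z)) (at z)"
    by (rule DERIV_inverse_function[where f = G and a = "-R" and b = R], rule 1)
       (use 2 f'0 assms ginv_cont ginv_props in \<open>auto simp: abs_less_iff\<close>)
  thus ?thesis by (simp add: k_def inverse_eq_divide split: if_splits)
qed

lemma k_pos: assumes "\<bar>z\<bar> < R" shows "k z > 0"
proof -
  consider "z = 0" | "z > 0" | "z < 0" by linarith
  thus ?thesis
  proof cases
    case 2 thus ?thesis using f_pos[OF ginv_pos[of z]] assms by (auto simp: k_def)
  next
    case 3 thus ?thesis using f_neg[OF _ ginv_neg[of z]] assms ginv_props[OF assms]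
      by (auto simp: k_def divide_neg_neg)
  qed (use f'0 in \<open>auto simp: k_def\<close>)
qed

lemma k_times_f: "\<bar>z\<bar> < R \<Longrightarrow> k z * f (ginv z) = z"
  using k_pos[of z] f0 by (cases "z = 0") (auto simp: k_def)

lemma f_isCont: "x > -1 \<Longrightarrow> isCont f x" using f_deriv DERIV_isCont by blast

lemma k_cont: assumes "\<bar>z\<bar> < R" shows "isCont k z"
proof (cases "z = 0")
  case False
  have ev: "eventually (\<lambda>t. t / f (ginv t) = k t) (nhds z)"
    using t1_space_nhds[OF False] by eventually_elim (simp add: k_def)
  have nz: "f (ginv z) \<noteq> 0" using k_times_f[OF assms] False by auto
  have "isCont (\<lambda>t. f (ginv t)) z"
    using isCont_o2[OF ginv_cont[OF assms] f_isCont] ginv_props[OF assms] by blast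
  hence "isCont (\<lambda>t. t / f (ginv t)) z" using nz by (intro continuous_intros) auto
  thus ?thesis using isCont_cong[OF ev] by simp
next
  case True
  have R0: "\<bar>0\<bar> < R" using R_pos by simp
  have l1: "((\<lambda>z. ginv z / z) \<longlongrightarrow> k 0) (at 0)" by (rule lim_quotient_0[OF ginv_deriv[OF R0]]) simp
  have "((\<lambda>x. f x / x) \<longlongrightarrow> f' 0) (at 0)" by (intro lim_quotient_0 f_deriv f0) simp
  moreover have "filterlim ginv (at 0) (at 0)"
  proof (rule filterlim_atI)
    show "(ginv \<longlongrightarrow> 0) (at 0)" using ginv_cont[OF R0] by (simp add: isCont_def)
    have "eventually (\<lambda>z. \<bar>z\<bar> < R) (at 0)"
      using R_pos by (auto simp: eventually_at intro!: exI[of _ R])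
    moreover have "eventually (\<lambda>z::real. z \<noteq> 0) (at 0)" by (simp add: eventually_at_filter)
    ultimately show "eventually (\<lambda>z. ginv z \<noteq> 0) (at 0)" by eventually_elim (auto simp: ginv_eq_0_iff)
  qed
  ultimately have l2: "((\<lambda>z. f (ginv z) / ginv z) \<longlongrightarrow> f' 0) (at 0)" by (rule filterlim_compose)
  \<comment> \<open>Inserting \<open>ginv z\<close> splits f (ginv z) / z into two difference
    quotients with known limits; \<open>f' 0 * k 0\<close> is \<open>sqrt (f' 0)\<close>, the
    reciprocal of \<open>k 0\<close>.\<close>
  have "((\<lambda>z. inverse ((f (ginv z) / ginv z) * (ginv z / z))) \<longlongrightarrow> inverse (f' 0 * k 0)) (at 0)"
    using f'0 by (intro tendsto_intros l1 l2) (auto simp: k_def)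
  moreover have "inverse (f' 0 * k 0) = k 0" using f'0
    by (simp add: k_def field_simps)
  moreover have "eventually (\<lambda>z. inverse ((f (ginv z) / ginv z) * (ginv z / z)) = k z) (at 0)"
  proof -
    have "eventually (\<lambda>z. \<bar>z\<bar> < R) (at 0)"
      using R_pos by (auto simp: eventually_at intro!: exI[of _ R])
    moreover have "eventually (\<lambda>z::real. z \<noteq> 0) (at 0)" by (simp add: eventually_at_filter)
    ultimately show ?thesis by eventually_elim (auto simp: ginv_eq_0_iff k_def)
  qed
  ultimately show ?thesis unfolding isCont_def True by (auto intro: Lim_transform_eventually)
qed

end

section \<open>Periodic orbits of a potential well\<close>

context potential_well begin

definition X :: "real \<times> real \<Rightarrow> real \<times> real" where "X z = (- snd z, f (fst z))"

definition energy :: "real \<times> real \<Rightarrow> real" where "energy z = (snd z)\<^sup>2 + 2 * F (fst z)"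

definition level :: "real \<Rightarrow> (real \<times> real) set"
  where "level r = {z. fst z > -1 \<and> energy z = r\<^sup>2}"

definition disc :: "real \<Rightarrow> (real \<times> real) set"
  where "disc r = {z. fst z > -1 \<and> energy z < r\<^sup>2}"

definition period :: "real \<Rightarrow> real"
  where "period r = integral {0..2 * pi} (\<lambda>\<phi>. k (- r * cos \<phi>))"

definition solution :: "(real \<Rightarrow> real \<times> real) \<Rightarrow> bool"
  where "solution \<phi> \<longleftrightarrow> (\<forall>t. fst (\<phi> t) > -1 \<and> (\<phi> has_vector_derivative X (\<phi> t)) (at t))"

lemma abs_r_cos: assumes "0 < r" "r < R" shows "\<bar>- r * cos \<phi>\<bar> < R"
proof -
  have "\<bar>- r * cos \<phi>\<bar> \<le> r * 1"
    unfolding abs_mult using assms by (intro mult_mono) auto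
  thus ?thesis using assms by simp
qed

lemma k_r_cos_cont: "0 < r \<Longrightarrow> r < R \<Longrightarrow> isCont (\<lambda>\<phi>. k (- r * cos \<phi>)) \<phi>"
  by (rule isCont_o2[where f = "\<lambda>\<phi>. - r * cos \<phi>" and g = k])
     (auto intro!: continuous_intros k_cont abs_r_cos[simplified])

text \<open>Time as a function of the angle is the antiderivative \<open>\<tau>\<close> of the
  positive function k (- r cos \<phi>). It is strictly increasing and gains \<open>period r\<close>
  per turn, hence is a bijection of the line; \<open>\<Theta>\<close> is its inverse and solves the
  angle equation globally in time.\<close>

lemma angle_flow:
  assumes r: "0 < r" "r < R"
  obtains \<Theta> where "\<And>t. (\<Theta> has_real_derivative 1 / k (- r * cos (\<Theta> t))) (at t)"
    "\<Theta> 0 = 0" "\<And>t. \<Theta> (t + period r) = \<Theta> t + 2 * pi" "strict_mono \<Theta>" "surj \<Theta>" "period r > 0"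
proof -
  let ?\<kappa> = "\<lambda>\<phi>. k (- r * cos \<phi>)"
  have kpos: "?\<kappa> \<phi> > 0" for \<phi> using k_pos[OF abs_r_cos[OF r]] .
  obtain \<tau>0 where "\<And>\<phi>. (\<tau>0 has_vector_derivative ?\<kappa> \<phi>) (at \<phi>)"
    using einterval_antiderivative[of "-\<infinity>" \<infinity> ?\<kappa>] k_r_cos_cont[OF r] by auto
  hence d0: "(\<tau>0 has_real_derivative ?\<kappa> \<phi>) (at \<phi>)" for \<phi>
    by (simp add: has_real_derivative_iff_has_vector_derivative)
  define \<tau> where "\<tau> \<phi> = \<tau>0 \<phi> - \<tau>0 0" for \<phi>
  have d: "(\<tau> has_real_derivative ?\<kappa> \<phi>) (at \<phi>)" for \<phi>
    unfolding \<tau>_def by (auto intro!: derivative_eq_intros d0)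
  have \<tau>0: "\<tau> 0 = 0" by (simp add: \<tau>_def)
  have mono: "\<tau> a < \<tau> b" if "a < b" for a b
    by (rule DERIV_pos_imp_increasing[OF that]) (use d kpos in blast)
  have T: "\<tau> (2 * pi) = period r"
  proof -
    have "(?\<kappa> has_integral (\<tau> (2 * pi) - \<tau> 0)) {0..2 * pi}"
      by (rule fundamental_theorem_of_calculus)
         (use d in \<open>auto intro!: has_field_derivative_at_within[OF d, simplified] simp flip: has_real_derivative_iff_has_vector_derivative\<close>)
    thus ?thesis by (simp add: period_def \<tau>0 integral_unique)
  qed
  have Tpos: "period r > 0" using mono[of 0 "2 * pi"] \<tau>0 T by simp
  have per: "\<tau> (\<phi> + 2 * pi) = \<tau> \<phi> + period r" for \<phi>
  proof -
    \<comment> \<open>The difference is constant because the integrand is 2 \<pi>-periodic.\<close>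
    have "((\<lambda>\<phi>. \<tau> (\<phi> + 2 * pi) - \<tau> \<phi>) has_real_derivative 0) (at x)" for x
      using DERIV_shift[of \<tau> "?\<kappa> x" x "2 * pi"] d[of "x + 2 * pi"] d[of x]
      by (auto intro!: derivative_eq_intros)
    hence "\<tau> (\<phi> + 2 * pi) - \<tau> \<phi> = \<tau> (0 + 2 * pi) - \<tau> 0"
      by (intro DERIV_isconst_all) auto
    thus ?thesis using T \<tau>0 by simp
  qed
  have per_n: "\<tau> (2 * pi * real n) = real n * period r" "\<tau> (- (2 * pi * real n)) = - (real n * period r)" for n
  proof (induction n)
    case (Suc n)
    have "\<tau> (2 * pi * real (Suc n)) = \<tau> (2 * pi * real n + 2 * pi)" by (simp add: algebra_simps)
    thus "\<tau> (2 * pi * real (Suc n)) = real (Suc n) * period r"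
      unfolding per Suc by (simp add: algebra_simps)
    have "\<tau> (- (2 * pi * real n)) = \<tau> (- (2 * pi * real (Suc n)) + 2 * pi)" by (simp add: algebra_simps)
    thus "\<tau> (- (2 * pi * real (Suc n))) = - (real (Suc n) * period r)"
      unfolding per Suc by (simp add: algebra_simps)
  qed (simp_all add: \<tau>0)
  have cont: "isCont \<tau> \<phi>" for \<phi> using d DERIV_isCont by blast
  have surj: "\<exists>\<phi>. \<tau> \<phi> = t" for t
  proof -
    obtain n where "\<bar>t\<bar> < real n * period r" using reals_Archimedean3[OF Tpos] by blast
    hence "\<tau> (- (2 * pi * real n)) \<le> t" "t \<le> \<tau> (2 * pi * real n)" by (auto simp: per_n)
    thus ?thesis using IVT[of \<tau> "- (2 * pi * real n)" t "2 * pi * real n"] cont by auto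
  qed
  define \<Theta> where "\<Theta> = inv \<tau>"
  have inj: "inj \<tau>" by (rule injI) (metis mono linorder_neqE less_irrefl)
  have \<tau>\<Theta>: "\<tau> (\<Theta> t) = t" for t unfolding \<Theta>_def using surj by (metis surj_f_inv_f surj_def)
  have \<Theta>\<tau>: "\<Theta> (\<tau> \<phi>) = \<phi>" for \<phi> unfolding \<Theta>_def using inj by simp
  have "isCont \<Theta> (\<tau> (\<Theta> t))" for t
    by (rule isCont_inverse_function2[where f = \<tau> and x = "\<Theta> t" and a = "\<Theta> t - 1" and b = "\<Theta> t + 1"]) (use \<Theta>\<tau> cont in auto)
  hence \<Theta>_cont: "isCont \<Theta> t" for t by (simp add: \<tau>\<Theta>)
  show ?thesis
  proof
    show "(\<Theta> has_real_derivative 1 / ?\<kappa> (\<Theta> t)) (at t)" for t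
      unfolding inverse_eq_divide[symmetric]
      by (rule DERIV_inverse_function[where f = \<tau> and a = "t - 1" and b = "t + 1"], rule d)
         (use kpos[of "\<Theta> t"] \<tau>\<Theta> \<Theta>_cont in auto)
    show "\<Theta> 0 = 0" using \<Theta>\<tau>[of 0] \<tau>0 by simp
    show "\<Theta> (t + period r) = \<Theta> t + 2 * pi" for t
      using \<Theta>\<tau>[of "\<Theta> t + 2 * pi"] by (simp add: per \<tau>\<Theta>)
    show "strict_mono \<Theta>"
      by (rule strict_monoI) (metis mono \<tau>\<Theta> linorder_neqE less_asym)
    show "surj \<Theta>" using \<Theta>\<tau> by (metis surjI)
    show "period r > 0" by (rule Tpos)
  qed
qed

lemma level_fst:
  assumes "z \<in> level r" "0 < r" 
  shows "\<bar>G (fst z)\<bar> \<le> r" "(G (fst z))\<^sup>2 + (snd z)\<^sup>2 = r\<^sup>2"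
proof -
  show *: "(G (fst z))\<^sup>2 + (snd z)\<^sup>2 = r\<^sup>2" using assms G_sq[of "fst z"] by (simp add: level_def energy_def)
  have "(G (fst z))\<^sup>2 \<le> r\<^sup>2" using * by (metis le_add_same_cancel1 zero_le_power2)
  thus "\<bar>G (fst z)\<bar> \<le> r" using assms(2) by (simp add: abs_le_square_iff[symmetric])
qed

lemma periodic_flow:
  assumes r: "0 < r" "r < R"
  obtains \<phi> where "solution \<phi>" "range \<phi> = level r" "\<And>t. \<phi> (t + period r) = \<phi> t"
    "\<And>t. t > 0 \<Longrightarrow> \<phi> t = \<phi> 0 \<Longrightarrow> t \<ge> period r" "period r > 0"
proof -
  obtain \<Theta> where \<Theta>: "\<And>t. (\<Theta> has_real_derivative 1 / k (- r * cos (\<Theta> t))) (at t)"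
    "\<Theta> 0 = 0" "\<And>t. \<Theta> (t + period r) = \<Theta> t + 2 * pi" "strict_mono \<Theta>" "surj \<Theta>" "period r > 0"
    using angle_flow[OF r] by blast
  define \<phi> where "\<phi> t = (ginv (- r * cos (\<Theta> t)), - r * sin (\<Theta> t))" for t
  note b = abs_r_cos[OF r]
  have lev: "(ginv (- r * cos a), - r * sin a) \<in> level r" for a
    using ginv_props[OF b, of a] F_ginv[OF b, of a] sin_cos_squared_add[of a] 
    by (simp add: level_def energy_def power_mult_distrib flip: distrib_left)
  have sol: "solution \<phi>" unfolding solution_def
  proof (intro allI conjI)
    fix t
    show "fst (\<phi> t) > -1" using ginv_props[OF b] by (simp add: \<phi>_def)
    have kp: "k (- r * cos (\<Theta> t)) > 0" by (rule k_pos[OF b])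
    have 1: "((\<lambda>t. ginv (- r * cos (\<Theta> t))) has_real_derivative - (snd (\<phi> t))) (at t)"
    proof -
      have "((\<lambda>t. - r * cos (\<Theta> t)) has_real_derivative r * sin (\<Theta> t) * (1 / k (- r * cos (\<Theta> t)))) (at t)"
        by (auto intro!: derivative_eq_intros \<Theta>(1))
      from DERIV_chain2[where g = "\<lambda>t. - r * cos (\<Theta> t)", OF ginv_deriv[OF b] this]
      show ?thesis using kp by (simp add: \<phi>_def)
    qed
    have "f (ginv (- r * cos (\<Theta> t))) = - r * cos (\<Theta> t) / k (- r * cos (\<Theta> t))"
      using k_times_f[OF b, of "\<Theta> t"] kp by (simp add: field_simps)
    hence 2: "((\<lambda>t. - r * sin (\<Theta> t)) has_real_derivative f (fst (\<phi> t))) (at t)"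
      by (auto intro!: derivative_eq_intros \<Theta>(1) simp: \<phi>_def)
    show "(\<phi> has_vector_derivative X (\<phi> t)) (at t)"
      unfolding X_def using 1 2
      by (auto simp: \<phi>_def[abs_def] has_real_derivative_iff_has_vector_derivative intro: has_vector_derivative_Pair)
  qed
  have ran: "range \<phi> = level r"
  proof
    show "range \<phi> \<subseteq> level r" using lev by (auto simp: \<phi>_def)
    show "level r \<subseteq> range \<phi>"
    proof
      fix z assume z: "z \<in> level r"
      have "(- G (fst z) / r)\<^sup>2 + (- snd z / r)\<^sup>2 = 1"
        using level_fst(2)[OF z r(1)] r(1) by (simp add: power_divide add_divide_distrib[symmetric])
      then obtain a where a: "- G (fst z) / r = cos a" "- snd z / r = sin a"
        using sincos_total_2pi by metis
      obtain t where t: "\<Theta> t = a" using \<Theta>(5) by (metis surjD)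
      have "G (fst z) = - r * cos a" "snd z = - r * sin a" using a r(1) by (auto simp: field_simps)
      hence "z = \<phi> t" using t ginv_G[of "fst z"] z by (auto simp: \<phi>_def level_def prod_eq_iff)
      thus "z \<in> range \<phi>" by blast
    qed
  qed
  show ?thesis
  proof (rule that[OF sol ran])
    show "\<phi> (t + period r) = \<phi> t" for t by (simp add: \<phi>_def \<Theta>(3))
    fix t :: real assume t: "t > 0" "\<phi> t = \<phi> 0"
    \<comment> \<open>\<open>\<phi> 0\<close> is the leftmost point of the level curve, the only one
      with cos = 1, so a return forces a whole number of turns.\<close>
    have "- r * cos (\<Theta> t) = - r * cos (\<Theta> 0)"
      using t(2) ginv_props[OF b] by (metis \<phi>_def fst_conv)
    hence "cos (\<Theta> t) = 1" using r \<Theta>(2) by simp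
    then obtain n :: int where n: "\<Theta> t = real_of_int n * 2 * pi" using cos_one_2pi_int[of "\<Theta> t"] by blast
    have "\<Theta> t > 0" using \<Theta>(2,4) t(1) by (metis strict_monoD)
    hence "n \<ge> 1" using n by (simp add: zero_less_mult_iff)
    hence "\<Theta> t \<ge> 2 * pi" using n by simp
    hence "\<Theta> t \<ge> \<Theta> (0 + period r)" by (simp only: \<Theta>(3) \<Theta>(2)) 
    thus "t \<ge> period r" using \<Theta>(4) by (simp add: strict_mono_less_eq)
  qed (rule \<Theta>(6))
qed

lemma solution_components:
  assumes "solution \<phi>"
  shows "((\<lambda>t. fst (\<phi> t)) has_real_derivative - snd (\<phi> t)) (at t)"
    and "((\<lambda>t. snd (\<phi> t)) has_real_derivative f (fst (\<phi> t))) (at t)"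
  using assms bounded_linear.has_vector_derivative[OF bounded_linear_fst, of \<phi> "X (\<phi> t)" "at t"]
    bounded_linear.has_vector_derivative[OF bounded_linear_snd, of \<phi> "X (\<phi> t)" "at t"]
  by (auto simp: solution_def has_real_derivative_iff_has_vector_derivative X_def)

lemma energy_const:
  assumes "solution \<phi>" shows "energy (\<phi> t) = energy (\<phi> s)"
proof -
  have "((\<lambda>t. energy (\<phi> t)) has_real_derivative 0) (at t)" for t
  proof -
    have "((\<lambda>t. F (fst (\<phi> t))) has_real_derivative f (fst (\<phi> t)) * - snd (\<phi> t)) (at t)"
      by (rule DERIV_chain2[where f = F, OF F_deriv solution_components(1)[OF assms]])
         (use assms in \<open>auto simp: solution_def\<close>)
    thus ?thesis unfolding energy_def
      by (auto intro!: derivative_eq_intros solution_components(2)[OF assms])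
  qed
  thus ?thesis by (intro DERIV_isconst_all) auto
qed

lemma f_lipschitz:
  assumes "-1 < a"
  obtains L where "L \<ge> 0" "\<And>x y. x \<in> {a..b} \<Longrightarrow> y \<in> {a..b} \<Longrightarrow> \<bar>f x - f y\<bar> \<le> L * \<bar>x - y\<bar>"
proof -
  have "compact (f' ` {a..b})"
    using assms by (intro compact_continuous_image continuous_on_subset[OF f'_cont]) auto
  then obtain L where L: "L > 0" "\<And>x. x \<in> {a..b} \<Longrightarrow> \<bar>f' x\<bar> \<le> L"
    using compact_imp_bounded bounded_pos by (metis imageI real_norm_def)
  have "\<bar>f x - f y\<bar> \<le> L * \<bar>x - y\<bar>" if "x \<in> {a..b}" "y \<in> {a..b}" for x y
  proof -
    have "norm (f x - f y) \<le> L * norm (x - y)"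
    proof (rule field_differentiable_bound[where S = "{a..b}" and f' = f'])
      show "(f has_field_derivative f' z) (at z within {a..b})" if "z \<in> {a..b}" for z
        by (rule has_field_derivative_at_within[OF f_deriv]) (use that assms in auto)
    qed (use that L in auto)
    thus ?thesis by simp
  qed
  thus ?thesis using L that[of L] by auto
qed

text \<open>A Gronwall estimate. On the compact strip \<open>f\<close> is Lipschitz, so the squared
  distance \<open>E\<close> satisfies |E'| \<le> (1 + L) E; multiplying by a decaying exponential
  forwards and by a growing one backwards keeps \<open>E\<close> at 0 on both sides of
  \<open>t0\<close>.\<close>

lemma solution_unique:
  assumes s: "solution \<phi>" "solution \<psi>" and a: "-1 < a"
    and strip: "\<And>t. fst (\<phi> t) \<in> {a..b}" "\<And>t. fst (\<psi> t) \<in> {a..b}"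
    and eq: "\<phi> t0 = \<psi> t0"
  shows "\<phi> t = \<psi> t"
proof -
  obtain L where L: "L \<ge> 0" "\<And>x y. x \<in> {a..b} \<Longrightarrow> y \<in> {a..b} \<Longrightarrow> \<bar>f x - f y\<bar> \<le> L * \<bar>x - y\<bar>"
    using f_lipschitz[OF a] by blast
  define d1 where "d1 t = fst (\<phi> t) - fst (\<psi> t)" for t
  define d2 where "d2 t = snd (\<phi> t) - snd (\<psi> t)" for t
  define E where "E t = (d1 t)\<^sup>2 + (d2 t)\<^sup>2" for t
  define E' where "E' t = 2 * d1 t * (- d2 t) + 2 * d2 t * (f (fst (\<phi> t)) - f (fst (\<psi> t)))" for t
  have der: "(E has_real_derivative E' t) (at t)" for t
    unfolding E_def d1_def d2_def E'_def
    by (rule derivative_eq_intros solution_components[OF s(1)] solution_components[OF s(2)] refl)+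
       (auto simp: algebra_simps)
  have bd: "\<bar>E' t\<bar> \<le> (1 + L) * E t" for t
  proof -
    have "\<bar>E' t\<bar> \<le> 2 * \<bar>d1 t\<bar> * \<bar>d2 t\<bar> + 2 * \<bar>d2 t\<bar> * \<bar>f (fst (\<phi> t)) - f (fst (\<psi> t))\<bar>"
      unfolding E'_def by (rule order_trans[OF abs_triangle_ineq]) (simp add: abs_mult)
    also have "\<dots> \<le> 2 * \<bar>d1 t\<bar> * \<bar>d2 t\<bar> + 2 * \<bar>d2 t\<bar> * (L * \<bar>d1 t\<bar>)"
      using L(2)[OF strip(1)[of t] strip(2)[of t]] by (intro add_left_mono mult_left_mono) (auto simp: d1_def)
    also have "\<dots> = (1 + L) * (2 * \<bar>d1 t\<bar> * \<bar>d2 t\<bar>)" by (simp add: algebra_simps)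
    also have "2 * \<bar>d1 t\<bar> * \<bar>d2 t\<bar> \<le> E t"
      using sum_squares_bound[of "\<bar>d1 t\<bar>" "\<bar>d2 t\<bar>"] by (simp add: E_def)
    finally show ?thesis using L(1) by (simp add: mult_left_mono)
  qed
  have E0: "E t0 = 0" by (simp add: E_def d1_def d2_def eq)
  have "E t \<le> 0"
  proof (cases "t0 \<le> t")
    case True
    have "E t * exp (- (1 + L) * t) \<le> E t0 * exp (- (1 + L) * t0)"
    proof (rule DERIV_nonpos_imp_nonincreasing[OF True])
      fix x
      have "((\<lambda>t. E t * exp (- (1 + L) * t)) has_real_derivative (E' x - (1 + L) * E x) * exp (- (1 + L) * x)) (at x)"
        by (rule derivative_eq_intros der refl)+ (auto simp: algebra_simps)
      moreover have "(E' x - (1 + L) * E x) * exp (- (1 + L) * x) \<le> 0"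
        using bd[of x] by (intro mult_nonpos_nonneg) auto
      ultimately show "\<exists>y. ((\<lambda>t. E t * exp (- (1 + L) * t)) has_real_derivative y) (at x) \<and> y \<le> 0" by blast
    qed
    thus ?thesis by (simp add: E0 mult_le_0_iff)
  next
    case False
    hence "t \<le> t0" by simp
    have "E t * exp ((1 + L) * t) \<le> E t0 * exp ((1 + L) * t0)"
    proof (rule DERIV_nonneg_imp_nondecreasing[OF \<open>t \<le> t0\<close>])
      fix x
      have "((\<lambda>t. E t * exp ((1 + L) * t)) has_real_derivative (E' x + (1 + L) * E x) * exp ((1 + L) * x)) (at x)"
        by (rule derivative_eq_intros der refl)+ (auto simp: algebra_simps)
      moreover have "(E' x + (1 + L) * E x) * exp ((1 + L) * x) \<ge> 0"
        using bd[of x] by (intro mult_nonneg_nonneg) auto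
      ultimately show "\<exists>y. ((\<lambda>t. E t * exp ((1 + L) * t)) has_real_derivative y) (at x) \<and> 0 \<le> y" by blast
    qed
    thus ?thesis by (simp add: E0 mult_le_0_iff)
  qed
  hence "d1 t = 0" "d2 t = 0"
    by (auto simp: E_def sum_power2_le_zero_iff)
  thus ?thesis by (auto simp: d1_def d2_def prod_eq_iff)
qed

lemma solution_shift: assumes "solution \<phi>" shows "solution (\<lambda>t. \<phi> (t + c))"
  unfolding solution_def
proof (intro allI conjI)
  fix t
  show "fst (\<phi> (t + c)) > -1" using assms by (simp add: solution_def)
  have "((\<lambda>t. t + c) has_vector_derivative 1) (at t)"
    by (auto intro!: derivative_eq_intros)
  moreover have "(\<phi> has_vector_derivative X (\<phi> (t + c))) (at (t + c))"
    using assms by (simp add: solution_def)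
  ultimately have "(\<phi> \<circ> (\<lambda>t. t + c) has_vector_derivative 1 *\<^sub>R X (\<phi> (t + c))) (at t)"
    by (rule vector_diff_chain_at)
  thus "((\<lambda>t. \<phi> (t + c)) has_vector_derivative X (\<phi> (t + c))) (at t)" by (simp add: o_def)
qed

text \<open>A solution of the same energy starts on the curve \<open>range \<phi>\<close> and stays
  in the strip between \<open>ginv (- r)\<close> and \<open>ginv r\<close>, so uniqueness makes it a
  time shift of \<open>\<phi>\<close>. Hence a level curve is a single orbit, and all its
  parametrizations by solutions share their periods.\<close>

lemma solution_is_flow:
  assumes r: "0 < r" "r < R" and \<phi>: "solution \<phi>" "range \<phi> = level r"
    and \<psi>: "solution \<psi>" "energy (\<psi> 0) = r\<^sup>2"
  shows "\<exists>c. \<forall>t. \<psi> t = \<phi> (t + c)"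
proof -
  have lev: "\<psi> t \<in> level r" for t
    using \<psi> energy_const[OF \<psi>(1), of t 0] by (auto simp: level_def solution_def)
  have strip: "fst z \<in> {ginv (-r)..ginv r}" if "z \<in> level r" for z
  proof -
    have "\<bar>G (fst z)\<bar> \<le> r" by (rule level_fst[OF that r(1)])
    hence "ginv (-r) \<le> ginv (G (fst z))" "ginv (G (fst z)) \<le> ginv r"
      using r by (auto intro!: ginv_mono)
    thus ?thesis using that by (simp add: ginv_G level_def)
  qed
  obtain c where "\<psi> 0 = \<phi> c" using lev[of 0] \<phi>(2) by blast
  moreover have "-1 < ginv (-r)" using r by (intro ginv_props) auto
  moreover have "fst (\<phi> t) \<in> {ginv (-r)..ginv r}" for t using strip \<phi>(2) by blast
  ultimately have "\<psi> t = \<phi> (t + c)" for t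
    by (intro solution_unique[OF \<psi>(1) solution_shift[OF \<phi>(1), of c], of "ginv (-r)" "ginv r" 0 t] strip[OF lev]) simp_all
  thus ?thesis by blast
qed

lemma half_plane_iff: "z \<in> half_plane \<longleftrightarrow> fst z > -1"
  by (cases z) (simp add: half_plane_def)

lemma periodic_solution_iff:
  "periodic_solution half_plane X \<phi> T \<longleftrightarrow> solution \<phi> \<and> (\<exists>t. \<phi> t \<noteq> \<phi> 0) \<and> T > 0 \<and> (\<forall>t. \<phi> (t + T) = \<phi> t)"
  by (auto simp: periodic_solution_def solution_def half_plane_iff)

lemma level_two_points: "0 < r \<Longrightarrow> r < R \<Longrightarrow> (0, r) \<in> level r \<and> (0, -r) \<in> level r"
  by (simp add: level_def energy_def F0)

lemma flow_nonconst: "0 < r \<Longrightarrow> r < R \<Longrightarrow> range \<phi> = level r \<Longrightarrow> \<exists>t. \<phi> t \<noteq> \<phi> 0"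
proof (rule ccontr)
  assume a: "0 < r" "r < R" "range \<phi> = level r" and "\<nexists>t. \<phi> t \<noteq> \<phi> 0"
  hence "\<And>z. z \<in> level r \<Longrightarrow> z = \<phi> 0" by (metis rangeE)
  hence "(0::real, r) = (0, -r)" using level_two_points[OF a(1,2)] by metis
  thus False using a(1) by simp
qed

lemma periodic_orbit_level: "0 < r \<Longrightarrow> r < R \<Longrightarrow> periodic_orbit half_plane X (level r)"
  unfolding periodic_orbit_def periodic_solution_iff
proof -
  assume r: "0 < r" "r < R"
  obtain \<phi> where \<phi>: "solution \<phi>" "range \<phi> = level r" "\<And>t. \<phi> (t + period r) = \<phi> t" "period r > 0"
    using periodic_flow[OF r] by metis
  show "\<exists>\<phi> T. (solution \<phi> \<and> (\<exists>t. \<phi> t \<noteq> \<phi> 0) \<and> T > 0 \<and> (\<forall>t. \<phi> (t + T) = \<phi> t)) \<and> range \<phi> = level r"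
    using \<phi> flow_nonconst[OF r \<phi>(2)] by blast
qed

lemma periodic_orbit_eq_level:
  assumes r: "0 < r" "r < R" and \<gamma>: "periodic_orbit half_plane X \<gamma>" and z: "z \<in> \<gamma>" "energy z = r\<^sup>2"
  shows "\<gamma> = level r"
proof -
  obtain \<psi> T where \<psi>: "solution \<psi>" "range \<psi> = \<gamma>" using \<gamma> by (auto simp: periodic_orbit_def periodic_solution_iff)
  obtain \<phi> where \<phi>: "solution \<phi>" "range \<phi> = level r" using periodic_flow[OF r] by metis
  have "energy (\<psi> 0) = r\<^sup>2" using z \<psi>(2) energy_const[OF \<psi>(1)] by (metis rangeE)
  then obtain c where c: "\<And>t. \<psi> t = \<phi> (t + c)" using solution_is_flow[OF r \<phi> \<psi>(1)] by blast
  have "range \<psi> = range \<phi>"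
  proof
    show "range \<phi> \<subseteq> range \<psi>"
    proof
      fix w assume "w \<in> range \<phi>" then obtain t where "w = \<phi> t" by blast
      hence "w = \<psi> (t - c)" by (simp add: c)
      thus "w \<in> range \<psi>" by blast
    qed
  qed (auto simp: c)
  thus ?thesis using \<phi>(2) \<psi>(2) by simp
qed

lemma minimal_period_level:
  assumes r: "0 < r" "r < R"
  shows "minimal_period half_plane X (level r) = period r"
proof -
  obtain \<phi> where \<phi>: "solution \<phi>" "range \<phi> = level r" "\<And>t. \<phi> (t + period r) = \<phi> t"
    "\<And>t. t > 0 \<Longrightarrow> \<phi> t = \<phi> 0 \<Longrightarrow> t \<ge> period r" "period r > 0"
    using periodic_flow[OF r] by metis
  show ?thesis unfolding minimal_period_def periodic_solution_iff
  proof (rule Least_equality)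
    show "\<exists>\<phi>. (solution \<phi> \<and> (\<exists>t. \<phi> t \<noteq> \<phi> 0) \<and> 0 < period r \<and> (\<forall>t. \<phi> (t + period r) = \<phi> t)) \<and> range \<phi> = level r"
      using \<phi> flow_nonconst[OF r \<phi>(2)] by blast
    fix T assume "\<exists>\<phi>. (solution \<phi> \<and> (\<exists>t. \<phi> t \<noteq> \<phi> 0) \<and> 0 < T \<and> (\<forall>t. \<phi> (t + T) = \<phi> t)) \<and> range \<phi> = level r"
    then obtain \<psi> where \<psi>: "solution \<psi>" "T > 0" "\<And>t. \<psi> (t + T) = \<psi> t" "range \<psi> = level r" by blast
    have "energy (\<psi> 0) = r\<^sup>2" using \<psi>(4) by (auto simp: level_def)
    then obtain c where c: "\<And>t. \<psi> t = \<phi> (t + c)" using solution_is_flow[OF r \<phi>(1,2) \<psi>(1)] by blast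
    \<comment> \<open>Evaluating the periodicity of \<open>\<psi>\<close> at time - c undoes the
      shift.\<close>
    have "\<phi> T = \<phi> 0" using \<psi>(3)[of "-c"] by (simp add: c)
    thus "period r \<le> T" using \<phi>(4) \<psi>(2) by blast
  qed
qed

lemma orbit_through_eq:
  assumes r: "0 < r" "r < R" and z: "z \<in> level r"
  shows "orbit_through half_plane X z = level r"
  unfolding orbit_through_def
proof (rule the_equality)
  show "periodic_orbit half_plane X (level r) \<and> z \<in> level r" using periodic_orbit_level[OF r] z by blast
  show "\<gamma> = level r" if "periodic_orbit half_plane X \<gamma> \<and> z \<in> \<gamma>" for \<gamma>
    using that z by (intro periodic_orbit_eq_level[OF r, of \<gamma> z]) (auto simp: level_def)
qed

end

section \<open>The period annulus\<close>

context potential_well begin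

lemma F_isCont: "x > -1 \<Longrightarrow> isCont F x" using F_deriv DERIV_isCont by blast

lemma half_plane_open: "open {z :: real \<times> real. fst z > -1}"
  by (intro open_Collect_less continuous_intros)

lemma energy_cont: "continuous_on {z. fst z > -1} energy"
proof -
  have "continuous_on {-1<..} F" by (intro continuous_at_imp_continuous_on) (use F_isCont in auto)
  hence "continuous_on {z::real\<times>real. fst z > -1} (\<lambda>z. F (fst z))"
    by (rule continuous_on_compose2) (auto intro!: continuous_intros)
  thus ?thesis unfolding energy_def by (intro continuous_intros)
qed

lemma disc_open: "open (disc r)"
proof -
  have "disc r = {z. fst z > -1} \<inter> energy -` {..<r\<^sup>2}" by (auto simp: disc_def)
  thus ?thesis using continuous_open_preimage[OF energy_cont half_plane_open, of "{..<r\<^sup>2}"] by simp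
qed

lemma energy_nonneg: "fst z > -1 \<Longrightarrow> energy z \<ge> 0" using F_nonneg by (simp add: energy_def)

lemma energy_eq_0_iff: "fst z > -1 \<Longrightarrow> energy z = 0 \<longleftrightarrow> z = (0, 0)"
  using F_pos[of "fst z"] F0 F_nonneg[of "fst z"]
  by (cases "fst z = 0") (auto simp: energy_def prod_eq_iff add_nonneg_eq_0_iff)

lemma energy_G: "fst z > -1 \<Longrightarrow> energy z = (G (fst z))\<^sup>2 + (snd z)\<^sup>2"
  using G_sq by (simp add: energy_def)

text \<open>The coordinates straighten sublevel sets into round balls, from which connectedness
  follows. The case \<open>r = R\<close> is included because the open ball stays in the domain of
  \<open>ginv\<close>.\<close>

lemma disc_eq_image:
  assumes "0 < r" "r \<le> R"
  shows "disc r = (\<lambda>w. (ginv (fst w), snd w)) ` ball 0 r"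
proof
  show "disc r \<subseteq> (\<lambda>w. (ginv (fst w), snd w)) ` ball 0 r"
  proof
    fix z assume z: "z \<in> disc r"
    hence "(G (fst z))\<^sup>2 + (snd z)\<^sup>2 < r\<^sup>2" using energy_G[of z] by (simp add: disc_def)
    hence "norm (G (fst z), snd z) < r"
      using assms by (auto simp: norm_Pair intro: real_less_lsqrt)
    thus "z \<in> (\<lambda>w. (ginv (fst w), snd w)) ` ball 0 r"
      using z by (intro image_eqI[of _ _ "(G (fst z), snd z)"]) (auto simp: disc_def ginv_G)
  qed
  show "(\<lambda>w. (ginv (fst w), snd w)) ` ball 0 r \<subseteq> disc r"
  proof safe
    fix a b :: real assume "(a, b) \<in> ball 0 r"
    hence n: "norm (a, b) < r" by simp
    hence "\<bar>a\<bar> < R" using assms norm_fst_le[of a b] by simp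
    moreover have "a\<^sup>2 + b\<^sup>2 < r\<^sup>2"
      using n assms by (metis norm_Pair real_norm_def power2_abs real_sqrt_less_iff real_sqrt_abs abs_of_pos)
    ultimately show "(ginv (fst (a, b)), snd (a, b)) \<in> disc r"
      using ginv_props[of a] F_ginv[of a] by (simp add: disc_def energy_def)
  qed
qed

lemma disc_connected: assumes "0 < r" "r \<le> R" shows "connected (disc r)"
proof -
  have 1: "continuous_on {-R<..<R} ginv"
    by (intro continuous_at_imp_continuous_on) (auto intro!: ginv_cont)
  have "continuous_on (ball 0 r) (\<lambda>w::real\<times>real. ginv (fst w))"
  proof (rule continuous_on_compose2[OF 1])
    show "fst ` ball (0::real\<times>real) r \<subseteq> {-R<..<R}"
    proof safe
      fix a b :: real assume "(a, b) \<in> ball 0 r"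
      hence "\<bar>a\<bar> < R" using assms norm_fst_le[of a b] by simp
      thus "fst (a, b) \<in> {-R<..<R}" by auto
    qed
  qed (auto intro!: continuous_intros)
  thus ?thesis unfolding disc_eq_image[OF assms]
    by (intro connected_continuous_image continuous_intros) auto
qed

lemma origin_in_disc: "0 < r \<Longrightarrow> (0, 0) \<in> disc r" by (simp add: disc_def energy_def F0)

lemma disc_bounded: assumes "0 < r" "r < R" shows "bounded (disc r)"
proof -
  have "disc r \<subseteq> cbox (ginv (-r), -r) (ginv r, r)"
  proof
    fix z assume z: "z \<in> disc r"
    hence s: "(G (fst z))\<^sup>2 + (snd z)\<^sup>2 < r\<^sup>2" using energy_G[of z] by (simp add: disc_def)
    have "(G (fst z))\<^sup>2 < r\<^sup>2" "(snd z)\<^sup>2 < r\<^sup>2" using s zero_le_power2[of "snd z"] zero_le_power2[of "G (fst z)"] by linarith+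
    hence b: "\<bar>G (fst z)\<bar> < r" "\<bar>snd z\<bar> < r" using assms power2_less_imp_less[of "\<bar>_\<bar>" r] by auto
    have "ginv (-r) \<le> ginv (G (fst z))" "ginv (G (fst z)) \<le> ginv r"
      using b assms by (auto intro!: ginv_mono)
    thus "z \<in> cbox (ginv (-r), -r) (ginv r, r)"
      using z b by (cases z) (auto simp: ginv_G disc_def)
  qed
  thus ?thesis using bounded_subset bounded_cbox by blast
qed

text \<open>For \<open>r < R\<close> the sublevel set stays to the right of
  \<open>ginv (- r) > -1\<close>, so limit points cannot reach the edge of the half plane and
  continuity of \<open>energy\<close> applies to them.\<close>

lemma closure_disc: assumes "0 < r" "r < R" shows "closure (disc r) \<subseteq> disc r \<union> level r"
proof
  fix z assume "z \<in> closure (disc r)"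
  then obtain w where w: "\<And>n. w n \<in> disc r" "w \<longlonglongrightarrow> z" unfolding closure_sequential by blast
  have "fst (w n) \<ge> ginv (-r)" for n
  proof -
    have s: "(G (fst (w n)))\<^sup>2 + (snd (w n))\<^sup>2 < r\<^sup>2" using w(1)[of n] energy_G[of "w n"] by (simp add: disc_def)
    have "(G (fst (w n)))\<^sup>2 < r\<^sup>2" using s zero_le_power2[of "snd (w n)"] by linarith
    hence b: "\<bar>G (fst (w n))\<bar> < r" using assms power2_less_imp_less[of "\<bar>_\<bar>" r] by auto
    have "ginv (-r) \<le> ginv (G (fst (w n)))" using b assms by (auto intro!: ginv_mono)
    thus ?thesis using w(1)[of n] by (auto simp: ginv_G disc_def)
  qed
  hence "fst z \<ge> ginv (-r)" using tendsto_fst[OF w(2)] by (intro tendsto_lowerbound[of _ "fst z" sequentially]) auto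
  hence z1: "fst z > -1" using ginv_props(1)[of "-r"] assms by auto
  have "isCont energy z" using energy_cont half_plane_open z1 continuous_on_eq_continuous_at by blast
  hence "(\<lambda>n. energy (w n)) \<longlonglongrightarrow> energy z" using w(2) isCont_tendsto_compose by blast
  hence "energy z \<le> r\<^sup>2" using w(1) by (intro tendsto_upperbound[of _ "energy z" sequentially]) (auto simp: disc_def intro!: always_eventually less_imp_le)
  thus "z \<in> disc r \<union> level r" using z1 by (auto simp: disc_def level_def)
qed

text \<open>The component of the complement containing the origin cannot leave the sublevel set
  without meeting its frontier, which lies on the level curve; so it is bounded.\<close>

lemma origin_inside_level: assumes r: "0 < r" "r < R" shows "(0, 0) \<in> inside (level r)"
proof -
  have o: "(0, 0) \<notin> level r" using r by (simp add: level_def energy_def F0)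
  let ?C = "connected_component_set (- level r) (0, 0)"
  have "?C \<subseteq> disc r"
  proof (rule ccontr)
    assume "\<not> ?C \<subseteq> disc r"
    moreover have "?C \<inter> disc r \<noteq> {}"
      using o origin_in_disc[OF r(1)] connected_component_refl[of "(0, 0)" "- level r"] by blast
    ultimately have "?C \<inter> frontier (disc r) \<noteq> {}"
      by (intro connected_Int_frontier) auto
    moreover have "frontier (disc r) \<subseteq> level r"
      using closure_disc[OF r] disc_open by (auto simp: frontier_def interior_open)
    moreover have "?C \<subseteq> - level r" by (rule connected_component_subset)
    ultimately show False by blast
  qed
  thus ?thesis using o disc_bounded[OF r] bounded_subset by (auto simp: inside_def)
qed

lemma foliated_disc: assumes r: "0 < r" "r \<le> R" shows "foliated_nbhd half_plane X (0, 0) (disc r)"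
  unfolding foliated_nbhd_def
proof (intro conjI ballI)
  fix z assume z: "z \<in> disc r - {(0, 0)}"
  define s where "s = sqrt (energy z)"
  have e: "energy z > 0" using z energy_nonneg[of z] energy_eq_0_iff[of z] by (auto simp: disc_def less_le)
  hence s: "s > 0" "energy z = s\<^sup>2" by (auto simp: s_def)
  have "s\<^sup>2 < r\<^sup>2" using z s by (simp add: disc_def)
  hence sr: "s < r" using r power2_less_imp_less by (metis less_imp_le)
  have lev: "level s \<subseteq> disc r - {(0, 0)}" using \<open>s\<^sup>2 < r\<^sup>2\<close> s by (auto simp: level_def disc_def energy_def F0)
  show "\<exists>\<gamma>. periodic_orbit half_plane X \<gamma> \<and> (0, 0) \<in> inside \<gamma> \<and> z \<in> \<gamma> \<and> \<gamma> \<subseteq> disc r - {(0, 0)}"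
    using periodic_orbit_level[of s] origin_inside_level[of s] s sr r lev z
    by (intro exI[of _ "level s"]) (auto simp: level_def disc_def)
qed (use disc_open disc_connected[OF r] origin_in_disc[OF r(1)] in auto)

theorem nondegenerate: "nondegenerate_center half_plane X (0, 0)"
proof -
  have "(f has_derivative (\<lambda>h. h * f' 0)) (at 0)" using f_deriv[of 0] by (simp add: has_field_derivative_def mult_commute_abs)
  hence "((\<lambda>z. f (fst z)) has_derivative (\<lambda>h. fst h * f' 0)) (at (0::real, 0::real))"
    using has_derivative_compose[of fst fst "(0::real, 0::real)" UNIV f "\<lambda>h. h * f' 0"]
    by (simp add: bounded_linear_imp_has_derivative bounded_linear_fst)
  hence d: "(X has_derivative (\<lambda>h. (- snd h, fst h * f' 0))) (at (0, 0))"
    unfolding X_def[abs_def]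
    by (intro has_derivative_Pair has_derivative_minus bounded_linear_imp_has_derivative bounded_linear_snd)
  have s: "sqrt (f' 0) * sqrt (f' 0) = f' 0" using f'0 by simp
  \<comment> \<open>The eigenvector is (1, 0) - i (0, \<open>sqrt (f' 0)\<close>) with eigenvalue i
    \<open>sqrt (f' 0)\<close>.\<close>
  have "\<exists>D \<omega> v w. (X has_derivative D) (at (0, 0)) \<and> \<omega> \<noteq> 0 \<and> (v, w) \<noteq> (0, 0) \<and>
       D v = - \<omega> *\<^sub>R w \<and> D w = \<omega> *\<^sub>R v"
    using d f'0 s
    by (intro exI[of _ "\<lambda>h. (- snd h, fst h * f' 0)"] exI[of _ "sqrt (f' 0)"] exI[of _ "(1, 0)"]
          exI[of _ "(0, - sqrt (f' 0))"]) (auto simp: zero_prod_def)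
  thus ?thesis using foliated_disc[of R] R_pos
    by (auto simp: nondegenerate_center_def center_def half_plane_def X_def f0 zero_prod_def)
qed

end

text \<open>The left branch stays below energy \<open>R\<^sup>2 / 2\<close>, so an orbit of at least
  that energy finds no turning point on the left. The right branch may rise higher.\<close>

locale maximal_well = potential_well +
  assumes F_left: "\<And>x. -1 < x \<Longrightarrow> x < 0 \<Longrightarrow> 2 * F x < R\<^sup>2"
begin

text \<open>On an orbit of energy at least \<open>R\<^sup>2\<close> the point of minimal abscissa has \<open>y = 0\<close>, hence lies in
  \<open>x > 0\<close>; then \<open>y\<close> is strictly increasing along the orbit, which is impossible.\<close>

lemma periodic_orbit_in_disc:
  assumes \<gamma>: "periodic_orbit half_plane X \<gamma>" shows "\<gamma> \<subseteq> disc R"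
proof -
  obtain \<phi> T where \<phi>: "solution \<phi>" "range \<phi> = \<gamma>" "T > 0" "\<And>t. \<phi> (t + T) = \<phi> t"
    using \<gamma> by (auto simp: periodic_orbit_def periodic_solution_iff)
  let ?x = "\<lambda>t. fst (\<phi> t)"
  have xc: "isCont ?x t" for t using solution_components(1)[OF \<phi>(1)] DERIV_isCont by blast
  have "compact {0..T}" "{0..T} \<noteq> {}" "continuous_on {0..T} ?x"
    using \<phi>(3) xc by (auto intro: continuous_at_imp_continuous_on)
  then obtain m where m: "m \<in> {0..T}" "\<And>t. t \<in> {0..T} \<Longrightarrow> ?x m \<le> ?x t"
    using continuous_attains_inf by metis
  have per_n: "\<phi> (t + real n * T) = \<phi> t" for t n
  proof (induction n)
    case (Suc n)
    have "\<phi> (t + real (Suc n) * T) = \<phi> (t + real n * T + T)" by (simp add: algebra_simps)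
    thus ?case unfolding \<phi>(4) using Suc by simp
  qed simp
  have per_i: "\<phi> (t + of_int i * T) = \<phi> t" for t i
  proof (cases "i \<ge> 0")
    case True thus ?thesis using per_n[of t "nat i"] by simp
  next
    case False thus ?thesis using per_n[of "t + of_int i * T" "nat (- i)"] by simp
  qed
  have min: "?x m \<le> ?x t" for t
  proof -
    have "\<phi> t = \<phi> (t + of_int (- \<lfloor>t / T\<rfloor>) * T)" by (rule per_i[symmetric])
    moreover have "t + of_int (- \<lfloor>t / T\<rfloor>) * T = frac (t / T) * T"
      using \<phi>(3) by (simp add: frac_def field_simps)
    moreover have "frac (t / T) * T \<in> {0..T}"
      using \<phi>(3) frac_ge_0[of "t/T"] frac_lt_1[of "t/T"] by (auto simp: mult_le_cancel_right1)
    ultimately show ?thesis using m(2) by metis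
  qed
  have y0: "snd (\<phi> m) = 0"
    using DERIV_local_min[OF solution_components(1)[OF \<phi>(1), of m], of 1] min by simp
  have E: "energy (\<phi> t) = 2 * F (?x m)" for t
    using energy_const[OF \<phi>(1), of t m] y0 by (simp add: energy_def)
  have xm: "?x m > -1" using \<phi>(1) by (simp add: solution_def)
  have "?x m \<le> 0"
  proof (rule ccontr)
    assume "\<not> ?x m \<le> 0"
    hence "f (?x t) > 0" for t using min[of t] f_pos by auto
    hence "\<exists>y. ((\<lambda>t. snd (\<phi> t)) has_real_derivative y) (at t) \<and> y > 0" for t
      using solution_components(2)[OF \<phi>(1), of t] by blast
    hence "snd (\<phi> 0) < snd (\<phi> (0 + T))"
      using \<phi>(3) by (intro DERIV_pos_imp_increasing[of 0 "0 + T" "\<lambda>t. snd (\<phi> t)"]) auto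
    thus False unfolding \<phi>(4) by simp
  qed
  hence "2 * F (?x m) < R\<^sup>2" using F_left[of "?x m"] xm F0 R_pos by (cases "?x m = 0") auto
  thus ?thesis using \<phi>(1,2) E by (auto simp: disc_def solution_def)
qed

lemma period_annulus_eq: "period_annulus half_plane X (0, 0) = disc R - {(0, 0)}"
proof -
  have "V - {(0, 0)} \<subseteq> disc R" if V: "foliated_nbhd half_plane X (0, 0) V" for V
  proof
    fix z assume z: "z \<in> V - {(0, 0)}"
    obtain \<gamma> where "periodic_orbit half_plane X \<gamma>" "z \<in> \<gamma>"
      using V z unfolding foliated_nbhd_def by blast
    thus "z \<in> disc R" using periodic_orbit_in_disc by blast
  qed
  moreover have "foliated_nbhd half_plane X (0, 0) (disc R)" using foliated_disc R_pos by blast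
  ultimately show ?thesis unfolding period_annulus_def by blast
qed

lemma orbit_cases:
  assumes "periodic_orbit half_plane X \<gamma>" "\<gamma> \<subseteq> period_annulus half_plane X (0, 0)"
  obtains r where "0 < r" "r < R" "\<gamma> = level r"
proof -
  obtain z where z: "z \<in> \<gamma>" using assms(1) unfolding periodic_orbit_def by blast
  hence z': "z \<in> disc R" "z \<noteq> (0, 0)" using assms(2) period_annulus_eq by auto
  define s where "s = sqrt (energy z)"
  have e: "energy z > 0" using z' energy_nonneg[of z] energy_eq_0_iff[of z] by (auto simp: disc_def less_le)
  hence s: "s > 0" "energy z = s\<^sup>2" by (auto simp: s_def)
  have "s\<^sup>2 < R\<^sup>2" using z' s by (simp add: disc_def)
  hence sr: "s < R" using R_pos power2_less_imp_less by (metis less_imp_le)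
  thus ?thesis using that[of s] periodic_orbit_eq_level[of s \<gamma> z] assms(1) z s by blast
qed

lemma level_in_annulus: "0 < r \<Longrightarrow> r < R \<Longrightarrow> level r \<subseteq> period_annulus half_plane X (0, 0)"
  unfolding period_annulus_eq
  using power_strict_mono[of r R 2] by (auto simp: level_def disc_def energy_def F0)

end

section \<open>Critical periodic orbits as zeros of the derivative of the period\<close>

lemma power_series_DERIV:
  fixes g :: "real \<Rightarrow> real"
  assumes r: "r > 0" and "\<And>t. \<bar>t - s\<bar> < r \<Longrightarrow> (\<lambda>n. (t - s) ^ n * c n) sums g t"
  shows "\<exists>D. (g has_real_derivative D) (at s)"
proof -
  have "(\<lambda>n. c n * z ^ n) sums g (z + s)" if "norm z < r" for z
    using assms(2)[of "z + s"] that by (simp add: mult.commute)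
  note sums = this
  have "((\<lambda>z. \<Sum>n. c n * z ^ n) has_real_derivative (\<Sum>n. diffs c n * 0 ^ n)) (at 0)"
    by (rule termdiffs_strong'[where K = r]) (use r sums_summable[OF sums] in auto)
  moreover have "eventually (\<lambda>z. (\<Sum>n. c n * z ^ n) = g (z + s)) (nhds 0)"
    using eventually_nhds_in_open[of "{-r<..<r}" 0] r
    by (auto elim!: eventually_mono intro!: sums_unique[symmetric] sums)
  ultimately have "((\<lambda>z. g (z + s)) has_real_derivative (\<Sum>n. diffs c n * 0 ^ n)) (at 0)"
    by (simp add: DERIV_cong_ev)
  thus ?thesis using DERIV_shift[of g _ 0 s] by auto
qed

lemma real_analytic_on_differentiable:
  fixes \<xi> :: "real \<Rightarrow> real \<times> real"
  assumes "real_analytic_on \<xi> S" "s \<in> S"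
  shows "(\<xi> has_vector_derivative vector_derivative \<xi> (at s)) (at s)"
proof -
  obtain r a where r: "r > 0" and s: "\<And>t. \<bar>t - s\<bar> < r \<Longrightarrow> (\<lambda>n. (t - s) ^ n *\<^sub>R a n) sums \<xi> t"
    using assms unfolding real_analytic_on_def by blast
  have "(\<lambda>n. (t - s) ^ n * fst (a n)) sums fst (\<xi> t)" if "\<bar>t - s\<bar> < r" for t
    using bounded_linear.sums[OF bounded_linear_fst s[OF that]] by simp
  then obtain D1 where "((\<lambda>t. fst (\<xi> t)) has_real_derivative D1) (at s)"
    using power_series_DERIV[OF r, of s "\<lambda>n. fst (a n)" "\<lambda>t. fst (\<xi> t)"] by blast
  moreover have "(\<lambda>n. (t - s) ^ n * snd (a n)) sums snd (\<xi> t)" if "\<bar>t - s\<bar> < r" for t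
    using bounded_linear.sums[OF bounded_linear_snd s[OF that]] by simp
  then obtain D2 where "((\<lambda>t. snd (\<xi> t)) has_real_derivative D2) (at s)"
    using power_series_DERIV[OF r, of s "\<lambda>n. snd (a n)" "\<lambda>t. snd (\<xi> t)"] by blast
  ultimately have "((\<lambda>t. (fst (\<xi> t), snd (\<xi> t))) has_vector_derivative (D1, D2)) (at s)"
    by (intro has_vector_derivative_Pair) (simp_all add: has_real_derivative_iff_has_vector_derivative)
  thus ?thesis using vector_derivative_works differentiableI_vector by force
qed

context maximal_well begin

lemma sqrt_energy_level:
  assumes "z \<in> period_annulus half_plane X (0, 0)"
  shows "0 < sqrt (energy z)" "sqrt (energy z) < R" "z \<in> level (sqrt (energy z))"
proof -
  have z': "z \<in> disc R" "z \<noteq> (0, 0)" using assms period_annulus_eq by auto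
  have e: "energy z > 0" using z' energy_nonneg[of z] energy_eq_0_iff[of z] by (auto simp: disc_def less_le)
  thus "0 < sqrt (energy z)" "z \<in> level (sqrt (energy z))" using z' by (auto simp: level_def disc_def)
  show "sqrt (energy z) < R" using z' R_pos by (auto simp: disc_def intro: real_less_lsqrt)
qed

text \<open>Along any parametrization the period is \<open>period\<close> composed with the square
  root of the energy. Transversality says exactly that the energy has nonzero derivative along
  \<open>\<xi>\<close>, so the chain rule transfers the zero to \<open>P'\<close>.\<close>

lemma critical_imp_zero:
  assumes der: "\<And>r. 0 < r \<Longrightarrow> r < R \<Longrightarrow> (period has_real_derivative P' r) (at r)"
    and crit: "critical_periodic_orbit half_plane X (0, 0) \<gamma>"
  obtains r where "0 < r" "r < R" "\<gamma> = level r" "P' r = 0"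
proof -
  let ?T = "\<lambda>z. minimal_period half_plane X (orbit_through half_plane X z)"
  obtain a b \<xi> s where \<xi>: "orbit_parametrization half_plane X (0, 0) a b \<xi>" and s: "s \<in> {a<..<b}" "\<xi> s \<in> \<gamma>"
    and d: "((\<lambda>s. ?T (\<xi> s)) has_real_derivative 0) (at s)"
    and \<gamma>: "periodic_orbit half_plane X \<gamma>" "\<gamma> \<subseteq> period_annulus half_plane X (0, 0)"
    using crit unfolding critical_periodic_orbit_def by blast
  obtain r where r: "0 < r" "r < R" "\<gamma> = level r" by (rule orbit_cases[OF \<gamma>])
  define v where "v = vector_derivative \<xi> (at s)"
  have ann: "\<xi> t \<in> period_annulus half_plane X (0, 0)" if "t \<in> {a<..<b}" for t
    using \<xi> that unfolding orbit_parametrization_def by blast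
  have T: "?T (\<xi> t) = period (sqrt (energy (\<xi> t)))" if "t \<in> {a<..<b}" for t
    by (simp only: orbit_through_eq[OF sqrt_energy_level[OF ann[OF that]]]
          minimal_period_level[OF sqrt_energy_level(1,2)[OF ann[OF that]]])
  have tr: "- snd (\<xi> s) * snd v - f (fst (\<xi> s)) * fst v \<noteq> 0"
    using \<xi> s(1) unfolding orbit_parametrization_def by (auto simp: X_def v_def Let_def)
  have "(\<xi> has_vector_derivative v) (at s)"
    unfolding v_def using \<xi> s(1) unfolding orbit_parametrization_def
    by (blast intro: real_analytic_on_differentiable)
  hence d1: "((\<lambda>t. fst (\<xi> t)) has_real_derivative fst v) (at s)"
    and d2: "((\<lambda>t. snd (\<xi> t)) has_real_derivative snd v) (at s)"
    unfolding has_real_derivative_iff_has_vector_derivative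
    by (blast intro: bounded_linear.has_vector_derivative[OF bounded_linear_fst]
          bounded_linear.has_vector_derivative[OF bounded_linear_snd])+
  have en: "energy (\<xi> s) = r\<^sup>2" and fx: "fst (\<xi> s) > -1" using s(2) r by (auto simp: level_def)
  have d3: "((\<lambda>t. F (fst (\<xi> t))) has_real_derivative f (fst (\<xi> s)) * fst v) (at s)"
    by (rule DERIV_chain2[where f = F, OF F_deriv d1]) (rule fx)
  define e where "e = 2 * (snd (\<xi> s) * snd v + f (fst (\<xi> s)) * fst v)"
  have e0: "e \<noteq> 0" using tr by (simp add: e_def)
  have "((\<lambda>t. energy (\<xi> t)) has_real_derivative e) (at s)"
    unfolding energy_def by (auto intro!: derivative_eq_intros d2 d3 simp: e_def)
  hence "((\<lambda>t. sqrt (energy (\<xi> t))) has_real_derivative e / (2 * r)) (at s)"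
    using r en by (auto intro!: derivative_eq_intros simp: field_simps)
  moreover have "(period has_real_derivative P' r) (at (sqrt (energy (\<xi> s))))" using der r en by simp
  ultimately have "((\<lambda>t. period (sqrt (energy (\<xi> t)))) has_real_derivative P' r * (e / (2 * r))) (at s)"
    by (intro DERIV_chain2[where f = period])
  moreover have "eventually (\<lambda>t. period (sqrt (energy (\<xi> t))) = ?T (\<xi> t)) (nhds s)"
    using eventually_nhds_in_open[of "{a<..<b}" s] s(1) by (auto elim!: eventually_mono simp: T)
  ultimately have "((\<lambda>s. ?T (\<xi> s)) has_real_derivative P' r * (e / (2 * r))) (at s)"
    by (simp add: DERIV_cong_ev)
  hence "P' r * (e / (2 * r)) = 0" using d DERIV_unique by blast
  hence "P' r = 0" using e0 r by simp
  thus ?thesis using that r by blast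
qed

text \<open>The positive y-axis meets each level curve once, at height \<open>r\<close>, and is
  transverse because \<open>f 0 = 0\<close> makes the field horizontal there. It is thus an
  admissible parametrization whose parameter is \<open>r\<close> itself.\<close>

lemma zero_imp_critical:
  assumes r: "0 < r" "r < R" and der: "(period has_real_derivative 0) (at r)"
  shows "critical_periodic_orbit half_plane X (0, 0) (level r)"
proof -
  let ?\<xi> = "\<lambda>s::real. (0::real, s)"
  have lev: "?\<xi> t \<in> level s \<longleftrightarrow> t = s" if "0 < t" "0 < s" for s t
    using that by (auto simp: level_def energy_def F0 power2_eq_iff)
  have vd: "(?\<xi> has_vector_derivative (0, 1)) (at t)" for t
    by (auto intro!: has_vector_derivative_Pair derivative_eq_intros)
  have "real_analytic_on ?\<xi> {0<..<R}" unfolding real_analytic_on_def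
  proof (intro ballI exI conjI allI impI)
    fix s t :: real
    let ?a = "\<lambda>n::nat. if n = 0 then (0::real, s) else if n = 1 then (0, 1) else 0"
    have "(\<lambda>n. (t - s) ^ n *\<^sub>R ?a n) sums (\<Sum>n\<in>{0, 1}. (t - s) ^ n *\<^sub>R ?a n)"
      by (rule sums_finite) auto
    thus "(\<lambda>n. (t - s) ^ n *\<^sub>R ?a n) sums ?\<xi> t" by simp
  qed (rule zero_less_one)
  moreover have "?\<xi> t \<in> period_annulus half_plane X (0, 0)" if "t \<in> {0<..<R}" for t
    using level_in_annulus[of t] lev[of t t] that by auto
  moreover have "\<exists>!s. s \<in> {0<..<R} \<and> ?\<xi> s \<in> \<gamma>" 
    if orb: "periodic_orbit half_plane X \<gamma>" "\<gamma> \<subseteq> period_annulus half_plane X (0, 0)" for \<gamma>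
  proof -
    obtain r where "0 < r" "r < R" "\<gamma> = level r" using orbit_cases[OF orb] by metis
    thus ?thesis by (intro ex1I[of _ r]) (auto simp: lev)
  qed
  ultimately have param: "orbit_parametrization half_plane X (0, 0) 0 R ?\<xi>"
    unfolding orbit_parametrization_def using vector_derivative_at[OF vd] by (auto simp: X_def Let_def)
  have "eventually (\<lambda>t. period t = minimal_period half_plane X (orbit_through half_plane X (?\<xi> t))) (nhds r)"
    using eventually_nhds_in_open[of "{0<..<R}" r] r
    by (auto elim!: eventually_mono simp: orbit_through_eq lev minimal_period_level)
  hence "((\<lambda>t. minimal_period half_plane X (orbit_through half_plane X (?\<xi> t))) has_real_derivative 0) (at r)"
    using der by (simp add: DERIV_cong_ev)
  thus ?thesis unfolding critical_periodic_orbit_def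
    using periodic_orbit_level[OF r] level_in_annulus[OF r] param r lev[of r r]
    by (intro conjI exI[of _ 0] exI[of _ R] exI[of _ ?\<xi>] exI[of _ r]) auto
qed

end

section \<open>Derivatives of the period\<close>

text \<open>L'Hopital on the difference quotient. It carries the derivatives of \<open>k\<close> and
  \<open>k1\<close> across z = 0, where only limits of the quotient formulas are available.\<close>

lemma removable_DERIV:
  fixes g :: "real \<Rightarrow> real"
  assumes c: "isCont g 0" and d: "eventually (\<lambda>t. (g has_real_derivative g' t) (at t)) (at 0)"
    and L: "(g' \<longlongrightarrow> L) (at 0)"
  shows "(g has_real_derivative L) (at 0)"
proof -
  have "((\<lambda>t. (g t - g 0) / t) \<longlongrightarrow> L) (at 0)"
  proof (rule lhopital[where f' = g' and g' = "\<lambda>_. 1"])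
    show "((\<lambda>t. g t - g 0) \<longlongrightarrow> 0) (at 0)"
      using c by (auto simp: isCont_def intro!: tendsto_eq_intros)
    show "eventually (\<lambda>t. ((\<lambda>t. g t - g 0) has_real_derivative g' t) (at t)) (at 0)"
      using d by eventually_elim (auto intro!: derivative_eq_intros)
  qed (use L in \<open>auto simp: eventually_at_filter intro!: tendsto_eq_intros always_eventually\<close>)
  thus ?thesis by (simp add: has_field_derivative_iff)
qed

locale smooth_well = maximal_well +
  fixes f2 f3 :: "real \<Rightarrow> real"
  assumes f'_deriv: "\<And>x. x > -1 \<Longrightarrow> (f' has_real_derivative f2 x) (at x)"
    and f2_deriv: "\<And>x. x > -1 \<Longrightarrow> (f2 has_real_derivative f3 x) (at x)"
    and f3_cont: "\<And>x. x > -1 \<Longrightarrow> isCont f3 x"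
begin

definition N :: "real \<Rightarrow> real" where "N x = (f x)\<^sup>2 - 2 * F x * f' x"
definition P :: "real \<Rightarrow> real"
  where "P x = 6 * F x * (f' x)\<^sup>2 - 3 * (f x)\<^sup>2 * f' x - 2 * F x * f x * f2 x"

text \<open>The values at \<open>0\<close> are the limits; elsewhere \<open>k1 = k'\<close> and \<open>k2 = k''\<close> are obtained from \<open>k z = z / f x\<close> with \<open>2 * F x = z\<^sup>2\<close>.\<close>

definition k1 :: "real \<Rightarrow> real"
  where "k1 z = (if z = 0 then - f2 0 / (3 * (f' 0)\<^sup>2) else N (ginv z) / f (ginv z) ^ 3)"

definition k2 :: "real \<Rightarrow> real"
  where "k2 z = (if z = 0 then 1 / sqrt (f' 0) *
      (- 5 * f2 0 / (4 * f' 0) * (- f2 0 / (3 * (f' 0)\<^sup>2)) - 1 / (2 * f' 0) * f3 0 / (2 * f' 0))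
    else z * P (ginv z) / f (ginv z) ^ 5)"

lemma f_eq_0_iff: "x > -1 \<Longrightarrow> f x = 0 \<longleftrightarrow> x = 0"
  using f_pos[of x] f_neg[of x] f0 by (cases x "0::real" rule: linorder_cases) auto

text \<open>The terms 2 f f' cancel and leave the factor \<open>F\<close>; a similar cancellation
  makes the derivative of \<open>P\<close> fall back on \<open>N\<close>. So \<open>N\<close> and
  \<open>P\<close> vanish at 0 to orders at least 3 and 4, which compensates the powers of
  \<open>f\<close> in the denominators of \<open>k1\<close> and \<open>k2\<close>.\<close>

lemma N_deriv: "x > -1 \<Longrightarrow> (N has_real_derivative - 2 * F x * f2 x) (at x)"
  unfolding N_def by (auto intro!: derivative_eq_intros F_deriv f_deriv f'_deriv simp: algebra_simps power2_eq_square)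

lemma P_deriv: "x > -1 \<Longrightarrow> (P has_real_derivative - 5 * f2 x * N x - 2 * F x * f x * f3 x) (at x)"
  unfolding P_def N_def
  by (auto intro!: derivative_eq_intros F_deriv f_deriv f'_deriv f2_deriv simp: algebra_simps power2_eq_square)

lemma near_0:
  shows "eventually (\<lambda>x::real. x > -1) (at 0)" "eventually (\<lambda>x. x > -1 \<and> x \<noteq> 0 \<and> f x \<noteq> 0 \<and> f' x \<noteq> 0) (at 0)"
proof -
  show 1: "eventually (\<lambda>x::real. x > -1) (at 0)"
    by (rule order_tendstoD(1)[OF tendsto_ident_at]) simp
  have "isCont f' 0" using f'_deriv[of 0] DERIV_isCont by simp
  hence "eventually (\<lambda>x. f' x > 0) (at 0)" using f'0 by (simp add: isCont_def order_tendstoD(1))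
  moreover have "eventually (\<lambda>x::real. x \<noteq> 0) (at 0)" by (simp add: eventually_at_filter)
  ultimately show "eventually (\<lambda>x. x > -1 \<and> x \<noteq> 0 \<and> f x \<noteq> 0 \<and> f' x \<noteq> 0) (at 0)"
    using 1 by eventually_elim (auto simp: f_eq_0_iff)
qed

lemma lims_0:
  shows "(f \<longlongrightarrow> 0) (at 0)" "(f' \<longlongrightarrow> f' 0) (at 0)" "(f2 \<longlongrightarrow> f2 0) (at 0)" "(f3 \<longlongrightarrow> f3 0) (at 0)" "(F \<longlongrightarrow> 0) (at 0)"
  using DERIV_isCont[OF f_deriv[of 0]] DERIV_isCont[OF f'_deriv[of 0]] DERIV_isCont[OF f2_deriv[of 0]] 
    f3_cont[of 0] DERIV_isCont[OF F_deriv[of 0]]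
  by (simp_all add: isCont_def f0 F0)

text \<open>The three limits form a chain: after one l'Hopital step powers of \<open>f\<close>
  cancel in the quotient for \<open>N\<close>, leaving \<open>F\<close> over the square of
  \<open>f\<close>, and in the quotient for \<open>P\<close>, leaving both earlier
  quotients.\<close>

lemma F_over_f2: "((\<lambda>x. F x / (f x)\<^sup>2) \<longlongrightarrow> 1 / (2 * f' 0)) (at 0)"
proof -
  have "((\<lambda>x. (F x / x\<^sup>2) / (f x / x)\<^sup>2) \<longlongrightarrow> (f' 0 / 2) / (f' 0)\<^sup>2) (at 0)"
    using f'0 by (intro tendsto_intros F_over_sq lim_quotient_0 f_deriv f0) auto
  moreover have "(f' 0 / 2) / (f' 0)\<^sup>2 = 1 / (2 * f' 0)" using f'0 by (simp add: power2_eq_square field_simps)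
  moreover have "eventually (\<lambda>x. (F x / x\<^sup>2) / (f x / x)\<^sup>2 = F x / (f x)\<^sup>2) (at 0)"
    using near_0(2) by eventually_elim (auto simp: power_divide)
  ultimately show ?thesis by (auto intro: Lim_transform_eventually)
qed

lemma N_over_f3: "((\<lambda>x. N x / f x ^ 3) \<longlongrightarrow> - f2 0 / (3 * (f' 0)\<^sup>2)) (at 0)"
proof (rule lhopital[where f' = "\<lambda>x. - 2 * F x * f2 x" and g' = "\<lambda>x. 3 * (f x)\<^sup>2 * f' x"])
  show "(N \<longlongrightarrow> 0) (at 0)" unfolding N_def by (auto intro!: tendsto_eq_intros lims_0)
  show "((\<lambda>x. f x ^ 3) \<longlongrightarrow> 0) (at 0)" by (auto intro!: tendsto_eq_intros lims_0)
  show "eventually (\<lambda>x. f x ^ 3 \<noteq> 0) (at 0)" "eventually (\<lambda>x. 3 * (f x)\<^sup>2 * f' x \<noteq> 0) (at 0)"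
    using near_0(2) by (eventually_elim; simp)+
  show "eventually (\<lambda>x. (N has_real_derivative - 2 * F x * f2 x) (at x)) (at 0)"
    using near_0(1) by eventually_elim (rule N_deriv)
  show "eventually (\<lambda>x. ((\<lambda>x. f x ^ 3) has_real_derivative 3 * (f x)\<^sup>2 * f' x) (at x)) (at 0)"
    using near_0(1) by eventually_elim (auto intro!: derivative_eq_intros f_deriv)
  have "((\<lambda>x. - 2 * (F x / (f x)\<^sup>2) * f2 x / (3 * f' x)) \<longlongrightarrow> - 2 * (1 / (2 * f' 0)) * f2 0 / (3 * f' 0)) (at 0)"
    using f'0 by (intro tendsto_intros F_over_f2 lims_0) auto
  moreover have "- 2 * (1 / (2 * f' 0)) * f2 0 / (3 * f' 0) = - f2 0 / (3 * (f' 0)\<^sup>2)"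
    using f'0 by (simp add: power2_eq_square field_simps)
  moreover have "(\<lambda>x. - 2 * (F x / (f x)\<^sup>2) * f2 x / (3 * f' x)) = (\<lambda>x. - 2 * F x * f2 x / (3 * (f x)\<^sup>2 * f' x))"
    by (simp add: fun_eq_iff mult_ac)
  ultimately show "((\<lambda>x. - 2 * F x * f2 x / (3 * (f x)\<^sup>2 * f' x)) \<longlongrightarrow> - f2 0 / (3 * (f' 0)\<^sup>2)) (at 0)"
    by (simp only:)
qed

lemma P_over_f4: "((\<lambda>x. P x / f x ^ 4) \<longlongrightarrow>
   - 5 * f2 0 / (4 * f' 0) * (- f2 0 / (3 * (f' 0)\<^sup>2)) - 1 / (2 * f' 0) * f3 0 / (2 * f' 0)) (at 0)"
proof (rule lhopital[where f' = "\<lambda>x. - 5 * f2 x * N x - 2 * F x * f x * f3 x" and g' = "\<lambda>x. 4 * f x ^ 3 * f' x"])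
  show "(P \<longlongrightarrow> 0) (at 0)" unfolding P_def by (auto intro!: tendsto_eq_intros lims_0)
  show "((\<lambda>x. f x ^ 4) \<longlongrightarrow> 0) (at 0)" by (auto intro!: tendsto_eq_intros lims_0)
  show "eventually (\<lambda>x. f x ^ 4 \<noteq> 0) (at 0)" "eventually (\<lambda>x. 4 * f x ^ 3 * f' x \<noteq> 0) (at 0)"
    using near_0(2) by (eventually_elim; simp)+
  show "eventually (\<lambda>x. (P has_real_derivative - 5 * f2 x * N x - 2 * F x * f x * f3 x) (at x)) (at 0)"
    using near_0(1) by eventually_elim (rule P_deriv)
  show "eventually (\<lambda>x. ((\<lambda>x. f x ^ 4) has_real_derivative 4 * f x ^ 3 * f' x) (at x)) (at 0)"
    using near_0(1) by eventually_elim (auto intro!: derivative_eq_intros f_deriv)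
  have "((\<lambda>x. - 5 * f2 x / (4 * f' x) * (N x / f x ^ 3) - F x / (f x)\<^sup>2 * f3 x / (2 * f' x)) \<longlongrightarrow>
     - 5 * f2 0 / (4 * f' 0) * (- f2 0 / (3 * (f' 0)\<^sup>2)) - 1 / (2 * f' 0) * f3 0 / (2 * f' 0)) (at 0)"
    using f'0 by (intro tendsto_intros F_over_f2 N_over_f3 lims_0) auto
  moreover have "eventually (\<lambda>x. - 5 * f2 x / (4 * f' x) * (N x / f x ^ 3) - F x / (f x)\<^sup>2 * f3 x / (2 * f' x)
     = (- 5 * f2 x * N x - 2 * F x * f x * f3 x) / (4 * f x ^ 3 * f' x)) (at 0)"
    using near_0(2) by eventually_elim (simp add: field_simps power2_eq_square power3_eq_cube)
  ultimately show "((\<lambda>x. (- 5 * f2 x * N x - 2 * F x * f x * f3 x) / (4 * f x ^ 3 * f' x)) \<longlongrightarrow>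
    - 5 * f2 0 / (4 * f' 0) * (- f2 0 / (3 * (f' 0)\<^sup>2)) - 1 / (2 * f' 0) * f3 0 / (2 * f' 0)) (at 0)"
    by (rule Lim_transform_eventually)
qed

lemma z_near_0: "eventually (\<lambda>z. \<bar>z\<bar> < R \<and> z \<noteq> 0) (at 0)"
  using R_pos by (auto simp: eventually_at intro!: exI[of _ R])

lemma ginv_at_0: "filterlim ginv (at 0) (at 0)"
proof (rule filterlim_atI)
  show "(ginv \<longlongrightarrow> 0) (at 0)" using ginv_cont[of 0] R_pos by (simp add: isCont_def)
  show "eventually (\<lambda>z. ginv z \<noteq> 0) (at 0)"
    using z_near_0 by eventually_elim (auto simp: ginv_eq_0_iff)
qed

lemma f_ginv_neq_0: "\<bar>z\<bar> < R \<Longrightarrow> z \<noteq> 0 \<Longrightarrow> f (ginv z) \<noteq> 0"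
  using ginv_props[of z] f_eq_0_iff[of "ginv z"] ginv_eq_0_iff[of z] by auto

lemma k1_lim: "(k1 \<longlongrightarrow> k1 0) (at 0)"
proof -
  have "((\<lambda>z. N (ginv z) / f (ginv z) ^ 3) \<longlongrightarrow> k1 0) (at 0)"
    using filterlim_compose[OF N_over_f3 ginv_at_0] by (simp add: k1_def)
  moreover have "eventually (\<lambda>z. N (ginv z) / f (ginv z) ^ 3 = k1 z) (at 0)"
    by (auto simp: eventually_at_filter k1_def)
  ultimately show ?thesis by (rule Lim_transform_eventually)
qed

lemma k2_lim: "(k2 \<longlongrightarrow> k2 0) (at 0)"
proof -
  have "((\<lambda>z. k z * (P (ginv z) / f (ginv z) ^ 4)) \<longlongrightarrow> k2 0) (at 0)"
  proof -
    have "(k \<longlongrightarrow> k 0) (at 0)" using k_cont[of 0] R_pos by (simp add: isCont_def)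
    from tendsto_mult[OF this filterlim_compose[OF P_over_f4 ginv_at_0]]
    show ?thesis by (simp add: k2_def k_def)
  qed
  moreover have "eventually (\<lambda>z. k z * (P (ginv z) / f (ginv z) ^ 4) = k2 z) (at 0)"
    by (auto simp: eventually_at_filter k2_def k_def numeral_eq_Suc)
  ultimately show ?thesis by (rule Lim_transform_eventually)
qed

lemma k_deriv_nz:
  assumes z: "\<bar>z\<bar> < R" "z \<noteq> 0" shows "(k has_real_derivative k1 z) (at z)"
proof -
  note x = ginv_props[OF z(1)] and fz = f_ginv_neq_0[OF z]
  have ev: "eventually (\<lambda>t. t / f (ginv t) = k t) (nhds z)"
    using t1_space_nhds[OF z(2)] by eventually_elim (simp add: k_def)
  have d: "((\<lambda>t. f (ginv t)) has_real_derivative f' (ginv z) * k z) (at z)"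
    by (rule DERIV_chain2[where f = f, OF f_deriv[OF x(1)] ginv_deriv[OF z(1)]])
  have "((\<lambda>t. t / f (ginv t)) has_real_derivative (1 * f (ginv z) - z * (f' (ginv z) * k z)) / (f (ginv z) * f (ginv z))) (at z)"
    by (rule DERIV_divide[OF DERIV_ident d fz])
  moreover have "(1 * f (ginv z) - z * (f' (ginv z) * k z)) / (f (ginv z) * f (ginv z)) = k1 z"
    using z fz F_ginv[OF z(1)] by (simp add: k1_def k_def N_def field_simps power2_eq_square power3_eq_cube)
  ultimately show ?thesis using DERIV_cong_ev[OF refl ev refl] by simp
qed

lemma k1_deriv_nz:
  assumes z: "\<bar>z\<bar> < R" "z \<noteq> 0" shows "(k1 has_real_derivative k2 z) (at z)"
proof -
  note x = ginv_props[OF z(1)] and fz = f_ginv_neq_0[OF z]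
  let ?x = "ginv z"
  have ev: "eventually (\<lambda>t. N (ginv t) / f (ginv t) ^ 3 = k1 t) (nhds z)"
    using t1_space_nhds[OF z(2)] by eventually_elim (simp add: k1_def)
  have d: "((\<lambda>t. f (ginv t)) has_real_derivative f' ?x * k z) (at z)"
    by (rule DERIV_chain2[where f = f, OF f_deriv[OF x(1)] ginv_deriv[OF z(1)]])
  have d': "((\<lambda>t. N (ginv t)) has_real_derivative - 2 * F ?x * f2 ?x * k z) (at z)"
    by (rule DERIV_chain2[where f = N, OF N_deriv[OF x(1)] ginv_deriv[OF z(1)]])
  have "((\<lambda>t. N (ginv t) / f (ginv t) ^ 3) has_real_derivative 
    ((- 2 * F ?x * f2 ?x * k z) * f ?x ^ 3 - N ?x * (3 * (f ?x)\<^sup>2 * (f' ?x * k z))) / (f ?x ^ 3 * f ?x ^ 3)) (at z)"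
    using fz by (auto intro!: derivative_eq_intros d d')
  moreover have "((- 2 * F ?x * f2 ?x * k z) * f ?x ^ 3 - N ?x * (3 * (f ?x)\<^sup>2 * (f' ?x * k z))) / (f ?x ^ 3 * f ?x ^ 3) = k2 z"
    using z fz by (simp add: k2_def k_def N_def P_def field_simps numeral_eq_Suc)
  ultimately show ?thesis using DERIV_cong_ev[OF refl ev refl] by simp
qed

lemma k_deriv: "\<bar>z\<bar> < R \<Longrightarrow> (k has_real_derivative k1 z) (at z)"
proof (cases "z = 0")
  case True
  have "eventually (\<lambda>t. (k has_real_derivative k1 t) (at t)) (at 0)"
    using z_near_0 by eventually_elim (auto intro: k_deriv_nz)
  thus ?thesis using removable_DERIV[of k k1] k_cont[of 0] R_pos k1_lim True by simp
qed (rule k_deriv_nz)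

lemma k1_cont: "\<bar>z\<bar> < R \<Longrightarrow> isCont k1 z"
  using k1_deriv_nz[of z] k1_lim DERIV_isCont by (cases "z = 0") (auto simp: isCont_def)

lemma k1_deriv: "\<bar>z\<bar> < R \<Longrightarrow> (k1 has_real_derivative k2 z) (at z)"
proof (cases "z = 0")
  case True
  have "eventually (\<lambda>t. (k1 has_real_derivative k2 t) (at t)) (at 0)"
    using z_near_0 by eventually_elim (auto intro: k1_deriv_nz)
  thus ?thesis using removable_DERIV[of k1 k2] k1_cont[of 0] R_pos k2_lim True by simp
qed (rule k1_deriv_nz)

lemma k2_cont: assumes z: "\<bar>z\<bar> < R" shows "isCont k2 z"
proof (cases "z = 0")
  case False
  have ev: "eventually (\<lambda>t. t * P (ginv t) / f (ginv t) ^ 5 = k2 t) (nhds z)"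
    using t1_space_nhds[OF False] by eventually_elim (simp add: k2_def)
  have "isCont (\<lambda>t. P (ginv t)) z" "isCont (\<lambda>t. f (ginv t)) z"
    using isCont_o2[OF ginv_cont[OF z] DERIV_isCont[OF P_deriv]] isCont_o2[OF ginv_cont[OF z] DERIV_isCont[OF f_deriv]] 
      ginv_props[OF z] by auto
  hence "isCont (\<lambda>t. t * P (ginv t) / f (ginv t) ^ 5) z"
    using f_ginv_neq_0[OF z False] by (intro continuous_intros) auto
  thus ?thesis using isCont_cong[OF ev] by simp
qed (use k2_lim in \<open>simp add: isCont_def\<close>)

section \<open>Differentiation of the period under the integral sign\<close>

definition hper :: "real \<Rightarrow> real" where "hper r = integral {0..pi} (\<lambda>\<phi>. k (- r * cos \<phi>))"
definition dper :: "real \<Rightarrow> real" where "dper r = integral {0..pi} (\<lambda>\<phi>. - cos \<phi> * k1 (- r * cos \<phi>))"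
definition ddper :: "real \<Rightarrow> real" where "ddper r = integral {0..pi} (\<lambda>\<phi>. (cos \<phi>)\<^sup>2 * k2 (- r * cos \<phi>))"

lemma comp_cont_on:
  assumes "\<And>z. \<bar>z\<bar> < R \<Longrightarrow> isCont h z"
  shows "continuous_on ({0<..<R} \<times> S) (\<lambda>(r, \<phi>). h (- r * cos \<phi>))"
proof -
  have h: "continuous_on {-R<..<R} h" using assms by (intro continuous_at_imp_continuous_on) auto
  have "continuous_on ({0<..<R} \<times> S) (\<lambda>p. h (- fst p * cos (snd p)))"
  proof (rule continuous_on_compose2[OF h])
    show "(\<lambda>p. - fst p * cos (snd p)) ` ({0<..<R} \<times> S) \<subseteq> {-R<..<R}"
      using abs_r_cos by (fastforce simp: abs_less_iff)
  qed (auto intro!: continuous_intros)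
  thus ?thesis by (simp add: case_prod_beta)
qed

lemma comp_cont_on1:
  assumes "\<And>z. \<bar>z\<bar> < R \<Longrightarrow> isCont h z" "0 < r" "r < R"
  shows "continuous_on S (\<lambda>\<phi>. h (- r * cos \<phi>))"
proof (rule continuous_at_imp_continuous_on, rule ballI)
  fix x
  show "isCont (\<lambda>\<phi>. h (- r * cos \<phi>)) x"
    by (rule isCont_o2[where g = h]) (auto intro!: continuous_intros assms(1) abs_r_cos[OF assms(2,3), simplified])
qed

lemma comp_deriv:
  assumes "\<And>z. \<bar>z\<bar> < R \<Longrightarrow> (h has_real_derivative h' z) (at z)" "0 < r" "r < R"
  shows "((\<lambda>r. h (- r * cos \<phi>)) has_real_derivative - cos \<phi> * h' (- r * cos \<phi>)) (at r)"
proof -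
  have "((\<lambda>r. - r * cos \<phi>) has_real_derivative - cos \<phi>) (at r)" by (auto intro!: derivative_eq_intros)
  from DERIV_chain2[where f = h, OF assms(1)[OF abs_r_cos[OF assms(2,3)]] this]
  show ?thesis by (simp add: mult.commute)
qed

lemma hper_deriv: assumes r: "0 < r" "r < R" shows "(hper has_real_derivative dper r) (at r)"
proof -
  have "((\<lambda>r. integral (cbox 0 pi) (\<lambda>\<phi>. k (- r * cos \<phi>))) has_field_derivative
      integral (cbox 0 pi) (\<lambda>\<phi>. - cos \<phi> * k1 (- r * cos \<phi>))) (at r within {0<..<R})"
  proof (rule leibniz_rule_field_derivative)
    show "((\<lambda>r. k (- r * cos t)) has_field_derivative - cos t * k1 (- x * cos t)) (at x within {0<..<R})"
      if "x \<in> {0<..<R}" for x t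
      by (rule has_field_derivative_at_within, rule comp_deriv[OF k_deriv]) (use that in auto)
    show "(\<lambda>\<phi>. k (- x * cos \<phi>)) integrable_on cbox 0 pi" if "x \<in> {0<..<R}" for x
      using that by (intro integrable_continuous comp_cont_on1 k_cont) auto
    show "continuous_on ({0<..<R} \<times> cbox 0 pi) (\<lambda>(r, \<phi>). - cos \<phi> * k1 (- r * cos \<phi>))"
      using comp_cont_on[of k1, OF k1_cont] unfolding case_prod_beta by (intro continuous_intros) auto
  qed (use r in auto)
  thus ?thesis using r at_within_open[of r "{0<..<R}"] by (simp add: hper_def[abs_def] dper_def)
qed

lemma dper_deriv: assumes r: "0 < r" "r < R" shows "(dper has_real_derivative ddper r) (at r)"
proof -
  have "((\<lambda>r. integral (cbox 0 pi) (\<lambda>\<phi>. - cos \<phi> * k1 (- r * cos \<phi>))) has_field_derivative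
      integral (cbox 0 pi) (\<lambda>\<phi>. (cos \<phi>)\<^sup>2 * k2 (- r * cos \<phi>))) (at r within {0<..<R})"
  proof (rule leibniz_rule_field_derivative)
    show "((\<lambda>r. - cos t * k1 (- r * cos t)) has_field_derivative (cos t)\<^sup>2 * k2 (- x * cos t)) (at x within {0<..<R})"
      if "x \<in> {0<..<R}" for x t
    proof (rule has_field_derivative_at_within)
      have "((\<lambda>r. k1 (- r * cos t)) has_real_derivative - cos t * k2 (- x * cos t)) (at x)"
        by (rule comp_deriv[OF k1_deriv]) (use that in auto)
      from DERIV_cmult[OF this, of "- cos t"]
      show "((\<lambda>r. - cos t * k1 (- r * cos t)) has_real_derivative (cos t)\<^sup>2 * k2 (- x * cos t)) (at x)"
        by (simp add: power2_eq_square mult.assoc)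
    qed
    show "(\<lambda>\<phi>. - cos \<phi> * k1 (- x * cos \<phi>)) integrable_on cbox 0 pi" if "x \<in> {0<..<R}" for x
      using that by (intro integrable_continuous comp_cont_on1 k1_cont continuous_intros) auto
    show "continuous_on ({0<..<R} \<times> cbox 0 pi) (\<lambda>(r, \<phi>). (cos \<phi>)\<^sup>2 * k2 (- r * cos \<phi>))"
      using comp_cont_on[of k2, OF k2_cont] unfolding case_prod_beta by (intro continuous_intros) auto
  qed (use r in auto)
  thus ?thesis using r at_within_open[of r "{0<..<R}"] by (simp add: dper_def[abs_def] ddper_def)
qed

text \<open>The orbit is symmetric in the x-axis: reflecting the second half turn and shifting by 2
  \<pi> gives the first one, with the same values of cos.\<close>

lemma period_eq_hper: assumes r: "0 < r" "r < R" shows "period r = 2 * hper r"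
proof -
  let ?h = "\<lambda>\<phi>. k (- r * cos \<phi>)"
  have c: "continuous_on S ?h" for S using r by (intro comp_cont_on1 k_cont) auto
  have "integral {0..2 * pi} ?h = integral {0..pi} ?h + integral {pi..2 * pi} ?h"
    by (rule Henstock_Kurzweil_Integration.integral_combine[symmetric]) (use integrable_continuous_real[OF c] in auto)
  also have "integral {pi..2 * pi} ?h = integral {- (2 * pi)..- pi} (\<lambda>\<phi>. ?h (- \<phi>))"
    using Henstock_Kurzweil_Integration.integral_reflect_real[of "2 * pi" pi "\<lambda>\<phi>. ?h (- \<phi>)"] by simp
  also have "\<dots> = integral {- (2 * pi)..- pi} (\<lambda>\<phi>. ?h (\<phi> + 2 * pi))" by simp
  also have "\<dots> = integral {0..pi} ?h"
    using integral_shift_cbox[of 0 "2 * pi" pi ?h] by simp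
  finally show ?thesis by (simp add: period_def hper_def)
qed

lemma period_deriv: assumes r: "0 < r" "r < R" shows "(period has_real_derivative 2 * dper r) (at r)"
proof -
  have "eventually (\<lambda>r. 2 * hper r = period r) (nhds r)"
    using eventually_nhds_in_open[of "{0<..<R}" r] r by (auto elim!: eventually_mono simp: period_eq_hper)
  thus ?thesis using DERIV_cmult[OF hper_deriv[OF r], of 2] by (simp add: DERIV_cong_ev)
qed

text \<open>\<open>\<Phi> A\<close> is the second derivative of \<open>(R\<^sup>2 - z\<^sup>2) / 2 * k + A * z * u\<close>, where \<open>u = ginv + 1\<close>. For the potential considered below and
  \<open>A = 1 / (q + 1)\<close>, integration along the Euler field \<open>u d/du\<close> shows that this function is a multiple of \<open>u powr (p + 1) * k\<close>,
  which is much flatter at the left end than \<open>k\<close>.\<close>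

definition \<Phi> :: "real \<Rightarrow> real \<Rightarrow> real"
  where "\<Phi> A z = (R\<^sup>2 - z\<^sup>2) / 2 * k2 z + (A - 2) * z * k1 z + (2 * A - 1) * k z"

definition EE :: "real \<Rightarrow> real \<Rightarrow> real"
  where "EE A r = integral {0..pi} (\<lambda>\<phi>. \<Phi> A (- r * cos \<phi>) * ((cos \<phi>)\<^sup>2 - (sin \<phi>)\<^sup>2))"

text \<open>The right side is the combination that arises when a power of R^2 - r^2 times
  \<open>dper r / r\<close> is differentiated. The integrands of the two sides differ by the
  derivative of \<open>?Q\<close>, and every term of \<open>?Q\<close> contains sin, which vanishes
  at 0 and pi.\<close>

lemma EE_eq:
  assumes r: "0 < r" "r < R"
  shows "EE A r = (R\<^sup>2 - r\<^sup>2) / 2 * (ddper r - dper r / r) - (3/2 - A) * r * dper r"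
proof -
  define s where "s = (R\<^sup>2 - r\<^sup>2) / 2"
  let ?z = "\<lambda>\<phi>. - r * cos \<phi>"
  \<comment> \<open>The summands come from integrating by parts the \<open>s\<close> part of the
    \<open>k2\<close> terms, their sin^2 part, and the \<open>k\<close> term, in this order; the
    leftover sin^2 cos \<open>k1\<close> terms cancel.\<close>
  let ?Q = "\<lambda>\<phi>. - (s / r) * sin \<phi> * k1 (?z \<phi>) + r / 2 * (sin \<phi> - 2 * sin \<phi> ^ 3) * k1 (?z \<phi>) + (2 * A - 1) * sin \<phi> * cos \<phi> * k (?z \<phi>)"
  let ?I = "\<lambda>\<phi>. \<Phi> A (?z \<phi>) * ((cos \<phi>)\<^sup>2 - (sin \<phi>)\<^sup>2)"
  let ?d = "\<lambda>\<phi>. - cos \<phi> * k1 (?z \<phi>)" and ?dd = "\<lambda>\<phi>. (cos \<phi>)\<^sup>2 * k2 (?z \<phi>)"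
  have dz: "(?z has_real_derivative r * sin \<phi>) (at \<phi>)" for \<phi> by (auto intro!: derivative_eq_intros)
  have dk: "((\<lambda>\<phi>. k (?z \<phi>)) has_real_derivative k1 (?z \<phi>) * (r * sin \<phi>)) (at \<phi>)" for \<phi>
    by (rule DERIV_chain2[where f = k, OF k_deriv[OF abs_r_cos[OF r]] dz])
  have dk1: "((\<lambda>\<phi>. k1 (?z \<phi>)) has_real_derivative k2 (?z \<phi>) * (r * sin \<phi>)) (at \<phi>)" for \<phi>
    by (rule DERIV_chain2[where f = k1, OF k1_deriv[OF abs_r_cos[OF r]] dz])
  have dQ: "(?Q has_real_derivative ?I \<phi> - (s * (?dd \<phi> - ?d \<phi> / r) - (3/2 - A) * r * ?d \<phi>)) (at \<phi>)" for \<phi>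
  proof -
    have s2: "(R\<^sup>2 - (?z \<phi>)\<^sup>2) / 2 = s + r\<^sup>2 * (sin \<phi>)\<^sup>2 / 2"
      by (simp add: s_def power_mult_distrib cos_squared_eq field_simps)
    have c2: "cos \<phi> * cos \<phi> = 1 - sin \<phi> * sin \<phi>" using cos_squared_eq[of \<phi>] by (simp add: power2_eq_square)
    have c3: "cos \<phi> * (cos \<phi> * x) = (1 - sin \<phi> * sin \<phi>) * x" for x using c2 by (simp add: mult.assoc[symmetric])
    define \<kappa> where "\<kappa> \<phi> = k (?z \<phi>)" for \<phi>
    define \<kappa>1 where "\<kappa>1 \<phi> = k1 (?z \<phi>)" for \<phi>
    define \<kappa>2 where "\<kappa>2 \<phi> = k2 (?z \<phi>)" for \<phi>
    have d: "(\<kappa> has_real_derivative \<kappa>1 \<phi> * (r * sin \<phi>)) (at \<phi>)" "(\<kappa>1 has_real_derivative \<kappa>2 \<phi> * (r * sin \<phi>)) (at \<phi>)"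
      unfolding \<kappa>_def[abs_def] \<kappa>1_def[abs_def] \<kappa>2_def by (rule dk dk1)+
    have "((\<lambda>\<phi>. - (s / r) * sin \<phi> * \<kappa>1 \<phi> + r / 2 * (sin \<phi> - 2 * sin \<phi> ^ 3) * \<kappa>1 \<phi> + (2 * A - 1) * sin \<phi> * cos \<phi> * \<kappa> \<phi>)
      has_real_derivative ((s + r\<^sup>2 * (sin \<phi>)\<^sup>2 / 2) * \<kappa>2 \<phi> + (A - 2) * (- r * cos \<phi>) * \<kappa>1 \<phi> + (2 * A - 1) * \<kappa> \<phi>) * ((cos \<phi>)\<^sup>2 - (sin \<phi>)\<^sup>2)
        - (s * ((cos \<phi>)\<^sup>2 * \<kappa>2 \<phi> - - cos \<phi> * \<kappa>1 \<phi> / r) - (3/2 - A) * r * (- cos \<phi> * \<kappa>1 \<phi>))) (at \<phi>)"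
      using r
      apply (auto intro!: derivative_eq_intros d)
      apply (simp add: field_simps power2_eq_square power3_eq_cube c2 c3)
      done
    thus ?thesis unfolding \<Phi>_def s2 \<kappa>_def \<kappa>1_def \<kappa>2_def .
  qed
  have "((\<lambda>\<phi>. ?I \<phi> - (s * (?dd \<phi> - ?d \<phi> / r) - (3/2 - A) * r * ?d \<phi>)) has_integral (?Q pi - ?Q 0)) {0..pi}"
    by (rule fundamental_theorem_of_calculus)
       (use dQ in \<open>auto intro!: has_field_derivative_at_within[OF dQ, simplified] simp flip: has_real_derivative_iff_has_vector_derivative\<close>)
  from integral_unique[OF this]
  have 0: "integral {0..pi} (\<lambda>\<phi>. ?I \<phi> - (s * (?dd \<phi> - ?d \<phi> / r) - (3/2 - A) * r * ?d \<phi>)) = 0"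
    by (simp only: sin_pi sin_zero) simp
  have cI: "?I integrable_on {0..pi}"
    unfolding \<Phi>_def by (intro integrable_continuous_real continuous_intros comp_cont_on1 k_cont k1_cont k2_cont r) auto
  have cd: "?d integrable_on {0..pi}"
    by (intro integrable_continuous_real continuous_intros comp_cont_on1 k1_cont r) auto
  have cdd: "?dd integrable_on {0..pi}"
    by (intro integrable_continuous_real continuous_intros comp_cont_on1 k2_cont r) auto
  have hi: "((\<lambda>\<phi>. ?I \<phi> - (s * (?dd \<phi> - ?d \<phi> / r) - (3/2 - A) * r * ?d \<phi>)) has_integral
     EE A r - (s * (ddper r - dper r / r) - (3/2 - A) * r * dper r)) {0..pi}"
    unfolding EE_def ddper_def dper_def
    by (intro has_integral_diff has_integral_mult_right has_integral_divide integrable_integral cI cd cdd)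
  show ?thesis using integral_unique[OF hi] 0 by (simp add: s_def)
qed

lemma weighted_dper_deriv:
  assumes r: "0 < r" "r < R"
  shows "((\<lambda>r. ((R\<^sup>2 - r\<^sup>2) / 2) powr (3/2 - A) * dper r / r) has_real_derivative
     ((R\<^sup>2 - r\<^sup>2) / 2) powr (3/2 - A - 1) / r * EE A r) (at r)"
proof -
  define c where "c = 3/2 - A"
  define s where "s = (\<lambda>r. (R\<^sup>2 - r\<^sup>2) / 2)"
  have s: "s r > 0" using r power_strict_mono[of r R 2] by (simp add: s_def)
  have ds: "(s has_real_derivative - r) (at r)" unfolding s_def by (auto intro!: derivative_eq_intros)
  have dp: "((\<lambda>r. s r powr c) has_real_derivative c * s r powr (c - 1) * (- r)) (at r)"
    using DERIV_powr[OF ds s, of "\<lambda>_. c" 0] s by (simp add: powr_diff field_simps)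
  have 1: "((\<lambda>r. s r powr c * dper r / r) has_real_derivative
     ((c * s r powr (c - 1) * (- r) * dper r + s r powr c * ddper r) * r - s r powr c * dper r) / (r * r)) (at r)"
    by (rule DERIV_cong[OF DERIV_divide[OF DERIV_mult'[OF dp dper_deriv[OF r]] DERIV_ident]]) (use r in \<open>auto simp: algebra_simps\<close>)
  have sp: "s r powr c = s r powr (c - 1) * s r" using s by (simp add: powr_diff)
  have "((c * s r powr (c - 1) * (- r) * dper r + s r powr c * ddper r) * r - s r powr c * dper r) / (r * r)
     = s r powr (c - 1) / r * (s r * (ddper r - dper r / r) - c * r * dper r)"
    unfolding sp using r by (simp add: field_simps)
  also have "s r * (ddper r - dper r / r) - c * r * dper r = EE A r"
    unfolding EE_eq[OF r] s_def c_def by simp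
  finally show ?thesis using 1 unfolding s_def c_def by simp
qed

lemma dper_zero_unique:
  assumes r0: "0 \<le> r0" and sg: "\<sigma> \<noteq> 0" "\<And>r. r0 < r \<Longrightarrow> r < R \<Longrightarrow> \<sigma> * EE A r > 0"
    and a: "r0 < a" "a < R" "dper a = 0" and b: "r0 < b" "b < R" "dper b = 0"
  shows "a = b"
proof -
  let ?Y = "\<lambda>r. ((R\<^sup>2 - r\<^sup>2) / 2) powr (3/2 - A) * dper r / r"
  have False if "r0 < a" "a < b" "b < R" "dper a = 0" "dper b = 0" for a b
  proof -
    have "\<sigma> * ?Y a < \<sigma> * ?Y b"
    proof (rule DERIV_pos_imp_increasing[OF that(2)])
      fix r assume "a \<le> r" "r \<le> b"
      hence r: "0 < r" "r < R" "r0 < r" using that r0 by auto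
      have "R\<^sup>2 - r\<^sup>2 > 0" using r power_strict_mono[of r R 2] by simp
      hence "((R\<^sup>2 - r\<^sup>2) / 2) powr (3/2 - A - 1) / r * (\<sigma> * EE A r) > 0"
        using r by (intro mult_pos_pos[OF divide_pos_pos sg(2)]) auto
      thus "\<exists>y. ((\<lambda>r. \<sigma> * ?Y r) has_real_derivative y) (at r) \<and> 0 < y"
        using DERIV_cmult[OF weighted_dper_deriv[OF r(1,2)], of \<sigma>] by (intro exI conjI) (auto simp: mult_ac)
    qed
    thus False using that by simp
  qed
  thus ?thesis using a b by (metis linorder_neqE)
qed

end

section \<open>The affine chart of the projective plane\<close>

definition unit3 :: "real \<times> real \<Rightarrow> real \<times> real \<times> real"
  where "unit3 z = (fst z, snd z, 1) /\<^sub>R norm (fst z, snd z, 1::real)"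

lemma norm_lift_pos: "norm (fst z, snd z, 1::real) > 0"
  by (simp add: zero_prod_def)

lemma norm_unit3 [simp]: "norm (unit3 z) = 1"
proof -
  have "norm (unit3 z) = \<bar>inverse (norm (fst z, snd z, 1::real))\<bar> * norm (fst z, snd z, 1::real)"
    unfolding unit3_def norm_scaleR ..
  thus ?thesis using norm_lift_pos[of z] by (simp only: abs_inverse abs_norm_cancel) simp
qed

lemma line_of_to_rp2_sphere: "line_of (to_rp2 z) \<inter> sphere 0 1 = {unit3 z, - unit3 z}"
proof -
  let ?v = "(fst z, snd z, 1::real)"
  have "dim (span {?v}) = 1" by (simp add: dim_insert prod_eq_iff)
  hence "line_of (to_rp2 z) = span {?v}" unfolding to_rp2_def by (subst Abs_rp2_inverse) (auto simp: subspace_span)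
  also have "\<dots> = range (\<lambda>k. k *\<^sub>R unit3 z)"
  proof -
    have "\<exists>k'. k *\<^sub>R ?v = k' *\<^sub>R unit3 z" for k
      by (rule exI [of _ "k * norm ?v"]) (use norm_lift_pos[of z] in \<open>simp add: unit3_def\<close>)
    moreover have "k *\<^sub>R unit3 z = (k / norm ?v) *\<^sub>R ?v" for k
      by (simp add: unit3_def divide_inverse)
    ultimately show ?thesis unfolding span_singleton by blast
  qed
  finally show ?thesis using line_inter_sphere[of "unit3 z"] by simp
qed

lemma dist_rp2_le_2: "dist (L :: rp2) M \<le> 2"
proof -
  obtain u where u: "norm u = 1" "line_of L \<inter> sphere 0 1 = {u, - u}" by (rule rp2_unit)
  obtain v where v: "norm v = 1" "line_of M \<inter> sphere 0 1 = {v, - v}" by (rule rp2_unit)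
  show ?thesis unfolding dist_rp2_def u v setdist_antipodal
    using norm_triangle_ineq4[of u v] u v by linarith
qed

lemma dist_to_rp2_le: "dist (to_rp2 z) (to_rp2 w) \<le> norm (unit3 z - unit3 w)"
  unfolding dist_rp2_def line_of_to_rp2_sphere setdist_antipodal by simp

lemma unit3_cont: "continuous_on S unit3"
  unfolding unit3_def[abs_def] using norm_lift_pos by (intro continuous_intros) (auto simp: less_imp_neq[symmetric])

lemma to_rp2_cont: "continuous_on S to_rp2"
proof -
  have "isCont to_rp2 z" for z
  proof -
    have "isCont unit3 z" using unit3_cont[of UNIV] continuous_on_eq_continuous_at[OF open_UNIV] by blast
    hence "((\<lambda>w. norm (unit3 w - unit3 z)) \<longlongrightarrow> 0) (at z)"
      by (simp add: isCont_def LIM_zero_iff tendsto_norm_zero_iff)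
    hence "((\<lambda>w. dist (to_rp2 w) (to_rp2 z)) \<longlongrightarrow> 0) (at z)"
      by (rule Lim_null_comparison[rotated]) (auto intro!: always_eventually dist_to_rp2_le)
    thus ?thesis unfolding isCont_def by (simp add: tendsto_dist_iff[of to_rp2])
  qed
  thus ?thesis by (simp add: continuous_at_imp_continuous_on)
qed

text \<open>A line near \<open>to_rp2 z\<close> has a unit vector near \<open>unit3 z\<close>, after
  a choice of sign; its third coordinate is then positive, and dividing by it recovers an affine
  point. This makes the embedding open and lets points near an affine point be treated in the
  plane.\<close>

lemma to_rp2_local_inverse:
  assumes "\<epsilon> > 0"
  obtains \<delta> where "\<delta> > 0" "\<And>L. dist L (to_rp2 z) < \<delta> \<Longrightarrow> \<exists>w. L = to_rp2 w \<and> dist w z < \<epsilon>"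
proof -
  define h where "h v = (fst v / snd (snd v), fst (snd v) / snd (snd v))" for v :: "real \<times> real \<times> real"
  let ?u = "unit3 z"
  have pos: "snd (snd ?u) > 0" using norm_lift_pos[of z] by (simp add: unit3_def)
  have hu: "h ?u = z" using norm_lift_pos[of z] by (simp add: h_def unit3_def)
  have "isCont h ?u" unfolding h_def using pos by (intro continuous_intros) auto
  then obtain d1 where d1: "d1 > 0" "\<And>v. dist v ?u < d1 \<Longrightarrow> dist (h v) z < \<epsilon>"
    using assms hu unfolding continuous_at_eps_delta by metis
  have third: "\<bar>snd (snd v) - snd (snd ?u)\<bar> \<le> dist v ?u" for v
    using order_trans[OF dist_snd_le dist_snd_le, of "v" ?u] by (simp add: dist_real_def)
  \<comment> \<open>The second entry keeps the third coordinate of the chosen unit vector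
    positive.\<close>
  define \<delta> where "\<delta> = min d1 (snd (snd ?u))"
  show ?thesis
  proof (rule that)
    show "\<delta> > 0" using d1 pos by (simp add: \<delta>_def)
    fix L assume L: "dist L (to_rp2 z) < \<delta>"
    obtain v0 where v0: "norm v0 = 1" "line_of L \<inter> sphere 0 1 = {v0, - v0}" by (rule rp2_unit)
    have "norm (v0 - ?u) < \<delta> \<or> norm (v0 + ?u) < \<delta>"
      using L unfolding dist_rp2_def line_of_to_rp2_sphere v0 setdist_antipodal by linarith
    moreover have "norm (v0 + ?u) = norm (- v0 - ?u)" by (metis minus_add_distrib norm_minus_cancel uminus_add_conv_diff add.commute)
    then obtain v where v: "norm v = 1" "line_of L \<inter> sphere 0 1 = {v, - v}" "dist v ?u < \<delta>"
    proof (cases "norm (v0 - ?u) < \<delta>")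
      case False
      thus ?thesis using that[of "- v0"] v0 \<open>norm (v0 - ?u) < \<delta> \<or> norm (v0 + ?u) < \<delta>\<close>
          \<open>norm (v0 + ?u) = norm (- v0 - ?u)\<close> by (simp add: dist_norm insert_commute)
    qed (use that[of v0] v0 in \<open>simp add: dist_norm\<close>)
    have p: "snd (snd v) > 0" using third[of v] v(3) by (auto simp: \<delta>_def)
    let ?c = "snd (snd v)"
    have "(fst (h v), snd (h v), 1) = (1 / ?c) *\<^sub>R v" using p by (simp add: h_def prod_eq_iff)
    hence "unit3 (h v) = v" unfolding unit3_def using p v(1) by simp
    hence "dist L (to_rp2 (h v)) = 0"
      unfolding dist_rp2_def line_of_to_rp2_sphere v(2) setdist_antipodal by simp
    hence "L = to_rp2 (h v)" by simp
    thus "\<exists>w. L = to_rp2 w \<and> dist w z < \<epsilon>" using d1(2)[of v] v(3) by (intro exI[of _ "h v"]) (auto simp: \<delta>_def)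
  qed
qed

lemma to_rp2_inj: "inj to_rp2"
proof (rule injI)
  fix z w assume "to_rp2 z = to_rp2 w"
  hence "{unit3 z, - unit3 z} = {unit3 w, - unit3 w}" by (metis line_of_to_rp2_sphere)
  hence "unit3 z = unit3 w \<or> unit3 z = - unit3 w" by auto
  moreover have pos: "snd (snd (unit3 x)) > 0" for x using norm_lift_pos[of x] by (simp add: unit3_def)
  ultimately have eq: "unit3 z = unit3 w" using pos[of z] pos[of w] by (metis less_asym neg_0_less_iff_less snd_uminus)
  have "x = (fst (unit3 x) / snd (snd (unit3 x)), fst (snd (unit3 x)) / snd (snd (unit3 x)))" for x
    using norm_lift_pos[of x] by (simp add: unit3_def)
  thus "z = w" using eq by metis
qed

lemma to_rp2_open: assumes "open S" shows "open (to_rp2 ` S)"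
  unfolding open_dist
proof (intro ballI)
  fix L assume "L \<in> to_rp2 ` S"
  then obtain z where z: "z \<in> S" "L = to_rp2 z" by blast
  obtain e where e: "e > 0" "\<And>w. dist w z < e \<Longrightarrow> w \<in> S" using assms z(1) by (auto simp: open_dist)
  obtain \<delta> where \<delta>: "\<delta> > 0" "\<And>L. dist L (to_rp2 z) < \<delta> \<Longrightarrow> \<exists>w. L = to_rp2 w \<and> dist w z < e"
    using to_rp2_local_inverse[OF e(1), of z] by blast
  thus "\<exists>e>0. \<forall>y. dist y L < e \<longrightarrow> y \<in> to_rp2 ` S" using e(2) z(2) by blast
qed

text \<open>Boundedness keeps the closure compact, so the closure in the projective plane acquires
  no points at infinity; openness and injectivity of the embedding take care of the
  interior.\<close>

lemma to_rp2_frontier: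
  assumes "bounded A" shows "frontier (to_rp2 ` A) = to_rp2 ` frontier A"
proof -
  have cl: "closure (to_rp2 ` A) = to_rp2 ` closure A"
  proof
    have "compact (to_rp2 ` closure A)" using assms by (intro compact_continuous_image to_rp2_cont) simp
    thus "closure (to_rp2 ` A) \<subseteq> to_rp2 ` closure A"
      by (intro closure_minimal image_mono closure_subset compact_imp_closed)
    show "to_rp2 ` closure A \<subseteq> closure (to_rp2 ` A)"
      by (rule image_closure_subset[OF to_rp2_cont]) (auto intro: closure_subset[THEN subsetD])
  qed
  have int: "interior (to_rp2 ` A) = to_rp2 ` interior A"
  proof
    show "to_rp2 ` interior A \<subseteq> interior (to_rp2 ` A)"
      by (intro interior_maximal image_mono interior_subset to_rp2_open open_interior)
    show "interior (to_rp2 ` A) \<subseteq> to_rp2 ` interior A"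
    proof
      fix L assume L: "L \<in> interior (to_rp2 ` A)"
      then obtain z where z: "L = to_rp2 z" using interior_subset by blast
      have o: "open (to_rp2 -` interior (to_rp2 ` A))"
        using to_rp2_cont[of UNIV] open_interior by (rule open_vimage[rotated])
      have "to_rp2 -` interior (to_rp2 ` A) \<subseteq> A"
        using interior_subset[of "to_rp2 ` A"] to_rp2_inj by (auto dest: injD)
      hence "z \<in> interior A" using o L z by (intro interiorI[OF o]) auto
      thus "L \<in> to_rp2 ` interior A" using z by blast
    qed
  qed
  show ?thesis unfolding frontier_def cl int using to_rp2_inj by (simp add: image_set_diff)
qed

lemma hausdorff_dist_images_le:
  assumes "I \<noteq> {}" "\<And>i. i \<in> I \<Longrightarrow> dist (\<alpha> i) (\<beta> i) \<le> e"
  shows "hausdorff_dist (\<alpha> ` I) (\<beta> ` I) \<le> e"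
  unfolding hausdorff_dist_def
proof (rule max.boundedI)
  show "(SUP a\<in>\<alpha> ` I. infdist a (\<beta> ` I)) \<le> e"
    using assms by (intro cSUP_least) (auto intro: infdist_le2)
  show "(SUP b\<in>\<beta> ` I. infdist b (\<alpha> ` I)) \<le> e"
    using assms by (intro cSUP_least) (auto intro: infdist_le2 simp: dist_commute)
qed

lemma hausdorff_dist_rp2_near:
  fixes A B :: "rp2 set"
  assumes "hausdorff_dist A B < e" "A \<noteq> {}" "b \<in> B"
  obtains a where "a \<in> A" "dist b a < e"
proof -
  \<comment> \<open>A real \<open>SUP\<close> is known to bound its members only for sets bounded
    above; here the bound comes from the diameter of the projective plane.\<close>
  have "infdist x A \<le> 2" for x
    using assms(2) dist_rp2_le_2 by (auto intro: infdist_le2)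
  hence "bdd_above ((\<lambda>b. infdist b A) ` B)" by (intro bdd_aboveI2)
  hence "infdist b A \<le> (SUP b\<in>B. infdist b A)" using assms(3) by (rule cSUP_upper[rotated])
  hence "infdist b A < e" using assms(1) by (simp add: hausdorff_dist_def)
  thus ?thesis using that assms(2) by (auto simp: infdist_notempty cINF_less_iff)
qed

section \<open>A version of Fatou's lemma\<close>

lemma has_integral_minus_points:
  fixes g :: "real \<Rightarrow> real"
  assumes "continuous_on {a..b} g"
  shows "(g has_integral integral {a..b} g) ({a<..<b} - {c})"
proof -
  have "(g has_integral integral {a..b} g) {a..b}"
    using assms by (intro integrable_integral integrable_continuous_real)
  thus ?thesis
    by (rule has_integral_spike_set_eq[THEN iffD1, rotated -1]; intro negligible_subset[OF negligible_finite[of "{a, b, c}"]]) auto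
qed

text \<open>Fatou's lemma for g + M. The limit need not be integrable: it is only compared with a
  continuous minorant \<open>h\<close> on a subinterval, the rest costing at most M times its
  length. The angle pi/2 is left out because there z = 0, where \<open>k1\<close> and
  \<open>k2\<close> are not given by their quotient formulas.\<close>

lemma integral_eventually_gt:
  fixes g :: "'p::metric_space \<Rightarrow> real \<Rightarrow> real"
  assumes cont: "\<And>\<theta>. \<theta> \<in> D \<Longrightarrow> continuous_on {0..pi} (g \<theta>)"
    and lower: "eventually (\<lambda>\<theta>. \<forall>\<phi>\<in>{0<..<pi} - {pi/2}. - M \<le> g \<theta> \<phi>) (at \<theta>0 within D)"
    and lim: "\<And>\<phi>. \<phi> \<in> {0<..<pi} - {pi/2} \<Longrightarrow> ((\<lambda>\<theta>. g \<theta> \<phi>) \<longlongrightarrow> g0 \<phi>) (at \<theta>0 within D)"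
    and h: "0 \<le> a" "a \<le> b" "b \<le> pi" "continuous_on {a..b} h"
      "\<And>\<phi>. \<phi> \<in> {a<..<b} - {pi/2} \<Longrightarrow> h \<phi> \<le> g0 \<phi>"
    and big: "integral {a..b} h > c + M * (pi - (b - a))"
  shows "eventually (\<lambda>\<theta>. integral {0..pi} (g \<theta>) > c) (at \<theta>0 within D)"
proof (rule sequentially_imp_eventually_within, intro allI impI)
  fix \<theta> :: "nat \<Rightarrow> 'p" assume \<theta>: "(\<forall>n. \<theta> n \<in> D \<and> \<theta> n \<noteq> \<theta>0) \<and> \<theta> \<longlonglongrightarrow> \<theta>0"
  let ?\<Omega> = "{0<..<pi} - {pi/2}" and ?\<Omega>' = "{a<..<b} - {pi/2}"
  show "eventually (\<lambda>n. integral {0..pi} (g (\<theta> n)) > c) sequentially"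
  proof (rule ccontr)
    assume "\<not> ?thesis"
    then obtain s :: "nat \<Rightarrow> nat" where s: "strict_mono s" "\<And>n. \<not> integral {0..pi} (g (\<theta> (s n))) > c"
      using not_eventually_sequentiallyD[of "\<lambda>n. integral {0..pi} (g (\<theta> n)) > c"] by blast
    define t where "t n = \<theta> (s n)" for n
    have tD: "t n \<in> D" for n using \<theta> by (simp add: t_def)
    have tf: "filterlim t (at \<theta>0 within D) sequentially"
      using \<theta> s(1) unfolding t_def
      by (auto simp: filterlim_at o_def intro!: LIMSEQ_subseq_LIMSEQ[of \<theta> \<theta>0 s, unfolded o_def])
    have "eventually (\<lambda>n. \<forall>\<phi>\<in>?\<Omega>. - M \<le> g (t n) \<phi>) sequentially"
      using tf lower by (rule eventually_compose_filterlim[rotated])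
    then obtain n0 where n0: "\<And>n. n \<ge> n0 \<Longrightarrow> \<forall>\<phi>\<in>?\<Omega>. - M \<le> g (t n) \<phi>" by (auto simp: eventually_sequentially)
    define g' where "g' n = g (t (n + n0))" for n
    have g'c: "continuous_on {0..pi} (g' n)" for n unfolding g'_def by (rule cont[OF tD])
    have g'b: "- M \<le> g' n \<phi>" if "\<phi> \<in> ?\<Omega>" for n \<phi> using n0[of "n + n0"] that by (simp add: g'_def)
    have g'i: "integral {0..pi} (g' n) \<le> c" for n using s(2)[of "n + n0"] by (simp add: g'_def t_def)
    have g'l: "(\<lambda>n. g' n \<phi>) \<longlonglongrightarrow> g0 \<phi>" if "\<phi> \<in> ?\<Omega>" for \<phi>
      unfolding g'_def using LIMSEQ_ignore_initial_segment[OF filterlim_compose[OF lim[OF that] tf]] .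
    \<comment> \<open>Raising \<open>h\<close> to at least - M makes h' + M nonnegative, as the
      nonnegative integral requires; the limit dominates - M anyway.\<close>
    define h' where "h' \<phi> = max (h \<phi>) (- M)" for \<phi>
    have h'c: "continuous_on {a..b} h'" unfolding h'_def by (intro continuous_intros h)
    have h'g: "h' \<phi> \<le> g0 \<phi>" if "\<phi> \<in> ?\<Omega>'" for \<phi>
    proof -
      have o: "\<phi> \<in> ?\<Omega>" using that h by auto
      have "- M \<le> g0 \<phi>" using g'l[OF o] by (rule LIMSEQ_le_const) (use g'b[OF o] in blast)
      thus ?thesis using h(5)[OF that] by (simp add: h'_def)
    qed
    let ?u = "\<lambda>n \<phi>. ennreal (indicat_real ?\<Omega> \<phi> * (g' n \<phi> + M))"
    have i1: "((\<lambda>\<phi>. g' n \<phi> + M) has_integral (integral {0..pi} (g' n) + M * pi)) ?\<Omega>" for n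
    proof -
      have "((\<lambda>\<phi>. g' n \<phi> + M) has_integral integral {0..pi} (\<lambda>\<phi>. g' n \<phi> + M)) ?\<Omega>"
        by (intro has_integral_minus_points continuous_intros g'c)
      moreover have "integral {0..pi} (\<lambda>\<phi>. g' n \<phi> + M) = integral {0..pi} (g' n) + M * pi"
        by (subst integral_add) (auto intro!: integrable_continuous_real g'c)
      ultimately show ?thesis by simp
    qed
    have i1n: "integral {0..pi} (g' n) + M * pi \<ge> 0" for n
      using has_integral_nonneg[OF i1] g'b by (smt (verit))
    have n1: "(\<integral>\<^sup>+ \<phi>. ?u n \<phi> \<partial>lborel) = ennreal (integral {0..pi} (g' n) + M * pi)" for n
      by (rule nn_integral_has_integral_lebesgue[OF _ i1]) (use g'b[of _ n] in force)
    have i2: "((\<lambda>\<phi>. h' \<phi> + M) has_integral (integral {a..b} h' + M * (b - a))) ?\<Omega>'"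
    proof -
      have "((\<lambda>\<phi>. h' \<phi> + M) has_integral integral {a..b} (\<lambda>\<phi>. h' \<phi> + M)) ?\<Omega>'"
        by (intro has_integral_minus_points continuous_intros h'c)
      moreover have "integral {a..b} (\<lambda>\<phi>. h' \<phi> + M) = integral {a..b} h' + M * (b - a)"
        using h(2) by (subst integral_add) (auto intro!: integrable_continuous_real h'c)
      ultimately show ?thesis by simp
    qed
    have n2: "(\<integral>\<^sup>+ \<phi>. ennreal (indicat_real ?\<Omega>' \<phi> * (h' \<phi> + M)) \<partial>lborel) = ennreal (integral {a..b} h' + M * (b - a))"
      by (rule nn_integral_has_integral_lebesgue[OF _ i2]) (simp add: h'_def)
    have "ennreal (integral {a..b} h' + M * (b - a)) \<le> (\<integral>\<^sup>+ \<phi>. liminf (\<lambda>n. ?u n \<phi>) \<partial>lborel)"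
      unfolding n2[symmetric]
    proof (rule nn_integral_mono)
      fix \<phi>
      show "ennreal (indicat_real ?\<Omega>' \<phi> * (h' \<phi> + M)) \<le> liminf (\<lambda>n. ?u n \<phi>)"
      proof (cases "\<phi> \<in> ?\<Omega>'")
        case True
        hence o: "\<phi> \<in> ?\<Omega>" using h by auto
        have "(\<lambda>n. ?u n \<phi>) \<longlonglongrightarrow> ennreal (indicat_real ?\<Omega> \<phi> * (g0 \<phi> + M))"
          by (intro tendsto_ennrealI tendsto_intros g'l o)
        hence "liminf (\<lambda>n. ?u n \<phi>) = ennreal (indicat_real ?\<Omega> \<phi> * (g0 \<phi> + M))"
          by (intro lim_imp_Liminf) auto
        moreover have "ennreal (indicat_real ?\<Omega>' \<phi> * (h' \<phi> + M)) \<le> ennreal (indicat_real ?\<Omega> \<phi> * (g0 \<phi> + M))"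
          using True o h'g[OF True] by (intro ennreal_leI) simp
        ultimately show ?thesis by simp
      qed simp
    qed
    also have "\<dots> \<le> liminf (\<lambda>n. \<integral>\<^sup>+ \<phi>. ?u n \<phi> \<partial>lborel)"
    proof (rule nn_integral_liminf)
      fix n
      have "(\<lambda>\<phi>. indicat_real ?\<Omega> \<phi> *\<^sub>R (g' n \<phi> + M)) \<in> borel_measurable borel"
        by (rule borel_measurable_continuous_on_indicator)
           (auto intro!: continuous_intros continuous_on_subset[OF g'c])
      thus "?u n \<in> borel_measurable lborel" by simp
    qed
    also have "\<dots> \<le> ennreal (c + M * pi)"
      unfolding n1 by (intro Liminf_le) (auto intro!: always_eventually ennreal_leI g'i)
    finally have "integral {a..b} h' + M * (b - a) \<le> c + M * pi"
      using i1n[of 0] g'i[of 0] by (subst (asm) ennreal_le_iff) auto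
    moreover have "integral {a..b} h \<le> integral {a..b} h'"
      by (intro integral_le integrable_continuous_real h h'c) (simp add: h'_def)
    ultimately show False using big by (simp add: algebra_simps)
  qed
qed

lemma integral_inverse_large:
  fixes C :: real assumes "C > 0" "b > 0"
  obtains a where "0 < a" "a < b" "integral {a..b} (\<lambda>x. C / x) > K"
proof -
  \<comment> \<open>Chosen so that C ln (b / a) equals |K| + 1.\<close>
  define a where "a = b * exp (- (\<bar>K\<bar> + 1) / C)"
  have a: "0 < a" using assms by (simp add: a_def)
  have e: "exp (- (\<bar>K\<bar> + 1) / C) < 1" using assms(1) by (simp add: divide_neg_pos)
  have ab: "a < b" using assms(2) e by (simp add: a_def)
  have "((\<lambda>x. C / x) has_integral (C * ln b - C * ln a)) {a..b}"
  proof (rule fundamental_theorem_of_calculus)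
    fix x assume "x \<in> {a..b}"
    hence "x > 0" using a by auto
    hence "((\<lambda>x. C * ln x) has_real_derivative C / x) (at x within {a..b})"
      by (auto intro!: derivative_eq_intros)
    thus "((\<lambda>x. C * ln x) has_vector_derivative C / x) (at x within {a..b})"
      by (simp add: has_real_derivative_iff_has_vector_derivative)
  qed (use ab in simp)
  moreover have "C * ln b - C * ln a = \<bar>K\<bar> + 1"
    using assms by (simp add: a_def ln_mult field_simps)
  ultimately have "integral {a..b} (\<lambda>x. C / x) = \<bar>K\<bar> + 1" by (simp add: integral_unique)
  thus ?thesis using that[OF a ab] by simp
qed

text \<open>The integral of C / \<phi> over [a, b] beats any constant as a shrinks, while the loss
  outside [a, b] stays below |M| pi.\<close>

lemma integral_eventually_gt_divergent:
  fixes g :: "'p::metric_space \<Rightarrow> real \<Rightarrow> real"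
  assumes cont: "\<And>\<theta>. \<theta> \<in> D \<Longrightarrow> continuous_on {0..pi} (g \<theta>)"
    and lower: "eventually (\<lambda>\<theta>. \<forall>\<phi>\<in>{0<..<pi} - {pi/2}. - M \<le> g \<theta> \<phi>) (at \<theta>0 within D)"
    and lim: "\<And>\<phi>. \<phi> \<in> {0<..<pi} - {pi/2} \<Longrightarrow> ((\<lambda>\<theta>. g \<theta> \<phi>) \<longlongrightarrow> g0 \<phi>) (at \<theta>0 within D)"
    and C: "C > 0" "0 < b" "b \<le> pi" "\<And>\<phi>. \<phi> \<in> {0<..<b} - {pi/2} \<Longrightarrow> C / \<phi> \<le> g0 \<phi>"
  shows "eventually (\<lambda>\<theta>. integral {0..pi} (g \<theta>) > c) (at \<theta>0 within D)"
proof -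
  obtain a where a: "0 < a" "a < b" "integral {a..b} (\<lambda>x. C / x) > c + \<bar>M\<bar> * pi"
    using integral_inverse_large[OF C(1,2)] by metis
  have "\<bar>M\<bar> * (pi - (b - a)) \<le> \<bar>M\<bar> * pi" using a by (intro mult_left_mono) auto
  hence big: "integral {a..b} (\<lambda>x. C / x) > c + \<bar>M\<bar> * (pi - (b - a))" using a(3) by linarith
  show ?thesis
  proof (rule integral_eventually_gt[where a = a and b = b and h = "\<lambda>x. C / x" and M = "\<bar>M\<bar>" and ?g0.0 = g0, OF cont _ lim])
    show "eventually (\<lambda>\<theta>. \<forall>\<phi>\<in>{0<..<pi} - {pi/2}. - \<bar>M\<bar> \<le> g \<theta> \<phi>) (at \<theta>0 within D)"
      using lower by eventually_elim (auto intro: order_trans[of _ "- M"])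
    show "continuous_on {a..b} (\<lambda>x. C / x)" using a by (intro continuous_intros) auto
    show "C / \<phi> \<le> g0 \<phi>" if "\<phi> \<in> {a<..<b} - {pi/2}" for \<phi> using C(4)[of \<phi>] that a by auto
  qed (use a C big in auto)
qed

section \<open>The two-power potential\<close>

definition prim :: "real \<Rightarrow> real \<Rightarrow> real"
  where "prim e u = (if e = -1 then ln u else (u powr (e + 1) - 1) / (e + 1))"

definition pot :: "real \<Rightarrow> real \<Rightarrow> real \<Rightarrow> real"
  where "pot q p x = prim p (x + 1) - prim q (x + 1)"

definition frc :: "real \<Rightarrow> real \<Rightarrow> real \<Rightarrow> real"
  where "frc q p x = (x + 1) powr p - (x + 1) powr q"

definition frc1 :: "real \<Rightarrow> real \<Rightarrow> real \<Rightarrow> real"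
  where "frc1 q p x = p * (x + 1) powr (p - 1) - q * (x + 1) powr (q - 1)"

definition frc2 :: "real \<Rightarrow> real \<Rightarrow> real \<Rightarrow> real"
  where "frc2 q p x = p * (p - 1) * (x + 1) powr (p - 2) - q * (q - 1) * (x + 1) powr (q - 2)"

definition frc3 :: "real \<Rightarrow> real \<Rightarrow> real \<Rightarrow> real"
  where "frc3 q p x = p * (p - 1) * (p - 2) * (x + 1) powr (p - 3) - q * (q - 1) * (q - 2) * (x + 1) powr (q - 3)"

definition Rad :: "real \<Rightarrow> real \<Rightarrow> real"
  where "Rad q p = sqrt (2 * (1 / (q + 1) - 1 / (p + 1)))"

lemma powr_shift_deriv:
  "x > -1 \<Longrightarrow> ((\<lambda>x. (x + 1) powr e) has_real_derivative e * (x + 1) powr (e - 1)) (at x)"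
  by (auto intro!: derivative_eq_intros simp: powr_diff field_simps)

lemma prim_deriv: "x > -1 \<Longrightarrow> ((\<lambda>x. prim e (x + 1)) has_real_derivative (x + 1) powr e) (at x)"
proof (cases "e = -1")
  case True
  assume "x > -1"
  thus ?thesis using True by (auto intro!: derivative_eq_intros simp: prim_def powr_minus_divide)
next
  case False
  assume x: "x > -1"
  have "((\<lambda>x. ((x + 1) powr (e + 1) - 1) / (e + 1)) has_real_derivative ((e + 1) * (x + 1) powr (e + 1 - 1) - 0) / (e + 1)) (at x)"
    by (intro DERIV_cdivide DERIV_diff powr_shift_deriv x DERIV_const)
  thus ?thesis using False by (simp add: prim_def[abs_def])
qed

lemma pot_deriv: "x > -1 \<Longrightarrow> (pot q p has_real_derivative frc q p x) (at x)"
  unfolding pot_def[abs_def] frc_def by (intro DERIV_diff prim_deriv)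

lemma frc_deriv: "x > -1 \<Longrightarrow> (frc q p has_real_derivative frc1 q p x) (at x)"
  unfolding frc_def[abs_def] frc1_def by (intro DERIV_diff powr_shift_deriv)

lemma frc1_deriv: "x > -1 \<Longrightarrow> (frc1 q p has_real_derivative frc2 q p x) (at x)"
  unfolding frc1_def[abs_def] frc2_def
  using DERIV_diff[OF DERIV_cmult[OF powr_shift_deriv[of x "p - 1"], of p] DERIV_cmult[OF powr_shift_deriv[of x "q - 1"], of q]]
  by (simp add: mult.assoc)

lemma frc2_deriv: "x > -1 \<Longrightarrow> (frc2 q p has_real_derivative frc3 q p x) (at x)"
  unfolding frc2_def[abs_def] frc3_def
  using DERIV_diff[OF DERIV_cmult[OF powr_shift_deriv[of x "p - 2"], of "p * (p - 1)"]
      DERIV_cmult[OF powr_shift_deriv[of x "q - 2"], of "q * (q - 1)"]]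
  by (simp add: mult.assoc)

lemma frc3_cont: "x > -1 \<Longrightarrow> isCont (frc3 q p) x"
  unfolding frc3_def[abs_def] by (intro continuous_intros) auto

lemma pot_0 [simp]: "pot q p 0 = 0" by (simp add: pot_def prim_def)

lemma frc_sgn: assumes "q < p" "x > -1" shows "x > 0 \<Longrightarrow> frc q p x > 0" "x < 0 \<Longrightarrow> frc q p x < 0"
  using assms powr_less_mono[of q p "x + 1"] powr_less_mono'[of "x + 1" q p] by (auto simp: frc_def)

lemma well_onto:
  fixes F :: "real \<Rightarrow> real"
  assumes c: "continuous_on {a..b} F" "a < 0" "0 < b" "F 0 = 0" and z: "z\<^sup>2 \<le> 2 * F a" "z\<^sup>2 \<le> 2 * F b"
  shows "\<exists>x\<in>{a..b}. sgn x * sqrt (2 * F x) = z"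
proof (cases "z \<ge> 0")
  case True
  have "\<exists>x\<ge>0. x \<le> b \<and> F x = z\<^sup>2 / 2"
    by (rule IVT') (use c z in \<open>auto intro: continuous_on_subset\<close>)
  then obtain x where x: "0 \<le> x" "x \<le> b" "2 * F x = z\<^sup>2" by auto
  hence "sgn x * sqrt (2 * F x) = z" using True c(4) by (cases "x = 0") auto
  thus ?thesis using x c by force
next
  case False
  have "\<exists>x\<ge>a. x \<le> 0 \<and> F x = z\<^sup>2 / 2"
    by (rule IVT2') (use c z in \<open>auto intro: continuous_on_subset\<close>)
  then obtain x where x: "a \<le> x" "x \<le> 0" "2 * F x = z\<^sup>2" by auto
  hence "sgn x * sqrt (2 * F x) = z" using False c(4) by (cases "x = 0") auto
  thus ?thesis using x c by force
qed

lemma pot_pos: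
  assumes "q < p" and x: "x > -1" "x \<noteq> 0"
  shows "pot q p x > 0"
proof -
  have c: "continuous_on {s..t} (pot q p)" if "s > -1" for s t
    by (rule continuous_at_imp_continuous_on) (meson DERIV_isCont pot_deriv that atLeastAtMost_iff less_le_trans)
  show ?thesis
  proof (cases "x > 0")
    case True
    have "pot q p 0 < pot q p x"
    proof (rule DERIV_pos_imp_increasing_open[OF True])
      show "\<exists>y. (pot q p has_real_derivative y) (at t) \<and> y > 0" if "0 < t" for t
        using pot_deriv[of t q p] frc_sgn(1)[OF assms(1), of t] that by (intro exI[of _ "frc q p t"]) auto
    qed (use c in auto)
    thus ?thesis by simp
  next
    case False
    have "pot q p 0 < pot q p x"
    proof (rule DERIV_neg_imp_decreasing_open[where a = x])
      show "\<exists>y. (pot q p has_real_derivative y) (at t) \<and> y < 0" if "x < t" "t < 0" for t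
        using pot_deriv[of t q p] frc_sgn(2)[OF assms(1), of t] that x by (intro exI[of _ "frc q p t"]) auto
    qed (use c x False in auto)
    thus ?thesis by simp
  qed
qed

text \<open>For \<open>q \<le> -1\<close> the potential is unbounded at the left end, so there is no
  finite left height such as \<open>Rad\<close> describes. The center property is local, and the
  values at the ends of [-1/2, 1] already supply a well.\<close>

lemma small_well:
  assumes "q < p" shows "\<exists>R. potential_well (pot q p) (frc q p) (frc1 q p) R"
proof -
  define R where "R = sqrt (2 * min (pot q p (-1/2)) (pot q p 1))"
  have pos: "pot q p (-1/2) > 0" "pot q p 1 > 0" by (intro pot_pos assms; simp)+
  have "potential_well (pot q p) (frc q p) (frc1 q p) R"
  proof
    show "continuous_on {-1<..} (frc1 q p)"
      by (rule continuous_at_imp_continuous_on) (use DERIV_isCont[OF frc1_deriv] in auto)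
    show "frc1 q p 0 > 0" using assms by (simp add: frc1_def)
    show "R > 0" using pos by (simp add: R_def)
    fix z :: real assume z: "\<bar>z\<bar> < R"
    have "z\<^sup>2 \<le> R\<^sup>2" using z by (simp add: abs_le_square_iff[symmetric])
    also have "\<dots> = 2 * min (pot q p (-1/2)) (pot q p 1)" using pos by (simp add: R_def)
    finally have "\<exists>x\<in>{-1/2..1}. sgn x * sqrt (2 * pot q p x) = z"
      by (intro well_onto) (auto intro!: continuous_at_imp_continuous_on DERIV_isCont pot_deriv)
    thus "\<exists>x>-1. sgn x * sqrt (2 * pot q p x) = z" by force
  qed (use assms frc_sgn in \<open>auto intro: pot_deriv frc_deriv\<close>)
  thus ?thesis by blast
qed

lemma X_field_eq: "X_field (q, p) = (\<lambda>z. (- snd z, frc q p (fst z)))"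
  by (auto simp: X_field_def frc_def)

lemma center_X_field: "q < p \<Longrightarrow> nondegenerate_center half_plane (X_field (q, p)) (0, 0)"
proof -
  assume "q < p"
  then obtain R where "potential_well (pot q p) (frc q p) (frc1 q p) R" using small_well by blast
  then interpret potential_well "pot q p" "frc q p" "frc1 q p" R .
  show ?thesis using nondegenerate by (simp add: X_field_eq X_def[abs_def])
qed

text \<open>From here on \<open>q > -1\<close>, so that the potential extends continuously to \<open>x = -1\<close>.\<close>

lemma pot_powr: "-1 < q \<Longrightarrow> q < p \<Longrightarrow>
  pot q p x = ((x + 1) powr (p + 1) - 1) / (p + 1) - ((x + 1) powr (q + 1) - 1) / (q + 1)"
  by (simp add: pot_def prim_def)

lemma pot_m1: "-1 < q \<Longrightarrow> q < p \<Longrightarrow> pot q p (-1) = 1 / (q + 1) - 1 / (p + 1)"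
  by (simp add: pot_powr)

lemma pot_cont_on: assumes "-1 < q" "q < p" shows "continuous_on {-1..} (pot q p)"
proof -
  have "continuous_on {-1..} (\<lambda>x::real. (x + 1) powr e)" if "e > 0" for e :: real
    using that by (intro continuous_on_powr' continuous_intros) auto
  note c = this
  have "continuous_on {-1..} (\<lambda>x. ((x + 1) powr (p + 1) - 1) / (p + 1) - ((x + 1) powr (q + 1) - 1) / (q + 1))"
    by (intro continuous_on_diff continuous_on_divide c continuous_on_const) (use assms in auto)
  thus ?thesis by (simp add: pot_powr[OF assms, abs_def])
qed

lemma Rad_pos: "-1 < q \<Longrightarrow> q < p \<Longrightarrow> Rad q p > 0"
  by (simp add: Rad_def frac_less2)

lemma Rad_sq: "-1 < q \<Longrightarrow> q < p \<Longrightarrow> (Rad q p)\<^sup>2 = 2 * pot q p (-1)"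
  using Rad_pos[of q p] by (simp add: pot_m1 Rad_def)

text \<open>The point x > 0 at the height of the left end: V(x) = V(-1) means u^(p+1) / (p+1) =
  u^(q+1) / (q+1) for u = x + 1.\<close>

definition right_end :: "real \<Rightarrow> real \<Rightarrow> real"
  where "right_end q p = ((p + 1) / (q + 1)) powr (1 / (p - q)) - 1"

lemma right_end: assumes "-1 < q" "q < p" shows "right_end q p > 0" "pot q p (right_end q p) = pot q p (-1)"
proof -
  define u where "u = ((p + 1) / (q + 1)) powr (1 / (p - q))"
  have g: "(p + 1) / (q + 1) > 1" using assms by simp
  have u: "u > 1" unfolding u_def using g assms by (intro gr_one_powr) auto
  thus "right_end q p > 0" by (simp add: right_end_def u_def)
  have "u powr (p - q) = (p + 1) / (q + 1)" unfolding u_def powr_powr using g assms by simp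
  hence "u powr (p + 1) = (p + 1) / (q + 1) * u powr (q + 1)"
    by (metis add_diff_cancel_right' diff_add_cancel add.commute add_diff_eq powr_add)
  hence "u powr (p + 1) / (p + 1) = u powr (q + 1) / (q + 1)" using assms by simp
  thus "pot q p (right_end q p) = pot q p (-1)"
    using assms by (simp add: pot_m1 pot_powr right_end_def u_def[symmetric] diff_divide_distrib)
qed

lemma pot_left_less: assumes "-1 < q" "q < p" "-1 < x" "x \<le> 0" shows "pot q p x < pot q p (-1)"
proof (rule DERIV_neg_imp_decreasing_open[OF assms(3)])
  show "\<exists>y. (pot q p has_real_derivative y) (at t) \<and> y < 0" if "-1 < t" "t < x" for t
    using pot_deriv[of t q p] frc_sgn(2)[OF assms(2), of t] that assms by (intro exI[of _ "frc q p t"]) auto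
  show "continuous_on {-1..x} (pot q p)" by (rule continuous_on_subset[OF pot_cont_on]) (use assms in auto)
qed

lemma well: assumes "-1 < q" "q < p"
  shows "smooth_well (pot q p) (frc q p) (frc1 q p) (Rad q p) (frc2 q p) (frc3 q p)"
proof
  show "continuous_on {-1<..} (frc1 q p)"
    by (rule continuous_at_imp_continuous_on) (use DERIV_isCont[OF frc1_deriv] in auto)
  show "frc1 q p 0 > 0" using assms by (simp add: frc1_def)
  show "Rad q p > 0" using assms by (rule Rad_pos)
  show "2 * pot q p x < (Rad q p)\<^sup>2" if "-1 < x" "x < 0" for x
    using pot_left_less[of q p x] that assms by (simp add: Rad_sq)
  fix z :: real assume z: "\<bar>z\<bar> < Rad q p"
  have "z\<^sup>2 < (Rad q p)\<^sup>2" using z power_strict_mono[of "\<bar>z\<bar>" "Rad q p" 2] by simp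
  hence z2: "z\<^sup>2 < 2 * pot q p (-1)" using assms by (simp add: Rad_sq)
  have "\<exists>x\<in>{-1..right_end q p}. sgn x * sqrt (2 * pot q p x) = z"
    by (intro well_onto continuous_on_subset[OF pot_cont_on]) (use assms z2 right_end in auto)
  then obtain x where x: "x \<ge> -1" "sgn x * sqrt (2 * pot q p x) = z" by auto
  have "pot q p (-1) > 0" using z2 zero_le_power2[of z] by linarith
  hence "x \<noteq> -1" using x(2) z2 by (auto simp: power_mult_distrib)
  thus "\<exists>x>-1. sgn x * sqrt (2 * pot q p x) = z" using x by force
qed (use assms frc_sgn in \<open>auto intro: pot_deriv frc_deriv frc1_deriv frc2_deriv frc3_cont\<close>)

section \<open>The wells as a family in the parameters, including the boundary orbit\<close>

definition Lam :: "(real \<times> real) set" where "Lam = {\<mu>. -1 < fst \<mu> \<and> fst \<mu> < snd \<mu>}"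

definition rad :: "real \<times> real \<Rightarrow> real" where "rad \<mu> = Rad (fst \<mu>) (snd \<mu>)"

definition Gc :: "real \<times> real \<Rightarrow> real \<Rightarrow> real"
  where "Gc \<mu> x = sgn x * sqrt (2 * pot (fst \<mu>) (snd \<mu>) x)"

text \<open>Unlike \<open>ginv\<close> this inverse admits x = -1; it therefore covers the closed
  interval |z| \<le> \<open>rad \<mu>\<close> and reaches the boundary orbit.\<close>

definition xinv :: "real \<times> real \<Rightarrow> real \<Rightarrow> real"
  where "xinv \<mu> z = (THE x. x \<ge> -1 \<and> Gc \<mu> x = z)"

definition kk :: "real \<times> real \<Rightarrow> real \<Rightarrow> real"
  where "kk \<mu> = potential_well.k (pot (fst \<mu>) (snd \<mu>)) (frc (fst \<mu>) (snd \<mu>)) (frc1 (fst \<mu>) (snd \<mu>))"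
definition kk1 :: "real \<times> real \<Rightarrow> real \<Rightarrow> real"
  where "kk1 \<mu> = smooth_well.k1 (pot (fst \<mu>) (snd \<mu>)) (frc (fst \<mu>) (snd \<mu>)) (frc1 (fst \<mu>) (snd \<mu>)) (frc2 (fst \<mu>) (snd \<mu>))"
definition kk2 :: "real \<times> real \<Rightarrow> real \<Rightarrow> real"
  where "kk2 \<mu> = smooth_well.k2 (pot (fst \<mu>) (snd \<mu>)) (frc (fst \<mu>) (snd \<mu>)) (frc1 (fst \<mu>) (snd \<mu>)) (frc2 (fst \<mu>) (snd \<mu>)) (frc3 (fst \<mu>) (snd \<mu>))"

lemma Lam_well:
  assumes "\<mu> \<in> Lam"
  shows "smooth_well (pot (fst \<mu>) (snd \<mu>)) (frc (fst \<mu>) (snd \<mu>)) (frc1 (fst \<mu>) (snd \<mu>)) (rad \<mu>) (frc2 (fst \<mu>) (snd \<mu>)) (frc3 (fst \<mu>) (snd \<mu>))"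
  using well[of "fst \<mu>" "snd \<mu>"] assms by (simp add: Lam_def rad_def)

lemma rad_pos: "\<mu> \<in> Lam \<Longrightarrow> rad \<mu> > 0" by (simp add: Lam_def rad_def Rad_pos)

lemma rad_sq: "\<mu> \<in> Lam \<Longrightarrow> (rad \<mu>)\<^sup>2 = 2 * pot (fst \<mu>) (snd \<mu>) (-1)"
  by (simp add: Lam_def rad_def Rad_sq)

lemma Lam_open: "open Lam"
proof -
  have "Lam = {\<mu>. -1 < fst \<mu>} \<inter> {\<mu>. fst \<mu> < snd \<mu>}" by (auto simp: Lam_def)
  moreover have "open {\<mu> :: real \<times> real. -1 < fst \<mu>}" "open {\<mu> :: real \<times> real. fst \<mu> < snd \<mu>}"
    by (intro open_Collect_less continuous_intros)+
  ultimately show ?thesis by (metis open_Int)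
qed

lemma Gc_m1: "\<mu> \<in> Lam \<Longrightarrow> Gc \<mu> (-1) = - rad \<mu>"
  using rad_sq[of \<mu>] rad_pos[of \<mu>] by (metis Gc_def abs_of_pos mult_minus_left mult_1 real_sqrt_abs sgn_minus sgn_1)

lemma Gc_strict_mono:
  assumes \<mu>: "\<mu> \<in> Lam" and "-1 \<le> x" "x < y" shows "Gc \<mu> x < Gc \<mu> y"
proof -
  interpret smooth_well "pot (fst \<mu>) (snd \<mu>)" "frc (fst \<mu>) (snd \<mu>)" "frc1 (fst \<mu>) (snd \<mu>)" "rad \<mu>" 
    "frc2 (fst \<mu>) (snd \<mu>)" "frc3 (fst \<mu>) (snd \<mu>)" by (rule Lam_well[OF \<mu>])
  have G: "Gc \<mu> = G" by (simp add: fun_eq_iff Gc_def G_def)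
  show ?thesis
  proof (cases "x = -1")
    case False thus ?thesis using assms G_strict_mono[of x y] by (simp add: G)
  next
    case True
    have lt: "- rad \<mu> < G y'" if "-1 < y'" "y' \<le> 0" for y'
    proof -
      have "(G y')\<^sup>2 < (rad \<mu>)\<^sup>2"
        using that \<mu> pot_left_less[of "fst \<mu>" "snd \<mu>" y'] by (simp add: G_sq rad_sq Lam_def)
      hence "\<bar>G y'\<bar> < rad \<mu>" using rad_pos[OF \<mu>] power2_less_imp_less[of "\<bar>G y'\<bar>" "rad \<mu>"] by simp
      thus ?thesis by linarith
    qed
    have "- rad \<mu> < G y"
    proof (cases "y \<le> 0")
      case False thus ?thesis using G_pos[of y] rad_pos[OF \<mu>] by linarith
    qed (use lt assms True in auto)
    thus ?thesis using True Gc_m1[OF \<mu>] by (simp add: G)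
  qed
qed

lemma xinv_props:
  assumes \<mu>: "\<mu> \<in> Lam" and z: "\<bar>z\<bar> \<le> rad \<mu>"
  shows "xinv \<mu> z \<ge> -1" "Gc \<mu> (xinv \<mu> z) = z"
proof -
  have qp: "-1 < fst \<mu>" "fst \<mu> < snd \<mu>" using \<mu> by (auto simp: Lam_def)
  have "z\<^sup>2 \<le> (rad \<mu>)\<^sup>2" using power_mono[OF z, of 2] by simp
  hence z2: "z\<^sup>2 \<le> 2 * pot (fst \<mu>) (snd \<mu>) (-1)" using \<mu> by (simp add: rad_sq)
  have "\<exists>x\<in>{-1..right_end (fst \<mu>) (snd \<mu>)}. sgn x * sqrt (2 * pot (fst \<mu>) (snd \<mu>) x) = z"
    by (intro well_onto continuous_on_subset[OF pot_cont_on]) (use qp z2 right_end in auto)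
  then obtain x where x: "x \<ge> -1" "Gc \<mu> x = z" by (auto simp: Gc_def)
  hence "xinv \<mu> z = x" unfolding xinv_def
    using Gc_strict_mono[OF \<mu>] by (intro the_equality) (metis linorder_neqE less_irrefl)+
  thus "xinv \<mu> z \<ge> -1" "Gc \<mu> (xinv \<mu> z) = z" using x by auto
qed

lemma xinv_Gc: "\<mu> \<in> Lam \<Longrightarrow> x \<ge> -1 \<Longrightarrow> xinv \<mu> (Gc \<mu> x) = x"
  unfolding xinv_def using Gc_strict_mono[of \<mu>] by (intro the_equality) (metis linorder_neqE less_irrefl)+

lemma xinv_less_iff:
  assumes "\<mu> \<in> Lam" "\<bar>z\<bar> \<le> rad \<mu>" "x \<ge> -1"
  shows "xinv \<mu> z < x \<longleftrightarrow> z < Gc \<mu> x" "x < xinv \<mu> z \<longleftrightarrow> Gc \<mu> x < z"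
  using xinv_props[OF assms(1,2)] Gc_strict_mono[OF assms(1), of x "xinv \<mu> z"]
    Gc_strict_mono[OF assms(1), of "xinv \<mu> z" x] assms(3)
  by (cases x "xinv \<mu> z" rule: linorder_cases; force)+

lemma ginv_eq_xinv:
  assumes \<mu>: "\<mu> \<in> Lam" and z: "\<bar>z\<bar> < rad \<mu>"
  shows "potential_well.ginv (pot (fst \<mu>) (snd \<mu>)) z = xinv \<mu> z" "xinv \<mu> z > -1"
proof -
  interpret smooth_well "pot (fst \<mu>) (snd \<mu>)" "frc (fst \<mu>) (snd \<mu>)" "frc1 (fst \<mu>) (snd \<mu>)" "rad \<mu>" 
    "frc2 (fst \<mu>) (snd \<mu>)" "frc3 (fst \<mu>) (snd \<mu>)" by (rule Lam_well[OF \<mu>])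
  have G: "Gc \<mu> = G" by (simp add: fun_eq_iff Gc_def G_def)
  have "xinv \<mu> (Gc \<mu> (ginv z)) = ginv z" using ginv_props[OF z] by (intro xinv_Gc[OF \<mu>]) auto
  thus "ginv z = xinv \<mu> z" using ginv_props[OF z] by (simp add: G)
  thus "xinv \<mu> z > -1" using ginv_props[OF z] by simp
qed

lemma xinv_0: "\<mu> \<in> Lam \<Longrightarrow> xinv \<mu> 0 = 0"
  using xinv_Gc[of \<mu> 0] by (simp add: Gc_def)

lemma xinv_neg: "\<mu> \<in> Lam \<Longrightarrow> \<bar>z\<bar> \<le> rad \<mu> \<Longrightarrow> z < 0 \<Longrightarrow> xinv \<mu> z < 0"
  using xinv_less_iff(1)[of \<mu> z 0] by (simp add: Gc_def)

lemma xinv_pos: "\<mu> \<in> Lam \<Longrightarrow> \<bar>z\<bar> \<le> rad \<mu> \<Longrightarrow> z > 0 \<Longrightarrow> xinv \<mu> z > 0"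
  using xinv_less_iff(2)[of \<mu> z 0] by (simp add: Gc_def)

lemma pot_xinv: "\<mu> \<in> Lam \<Longrightarrow> \<bar>z\<bar> \<le> rad \<mu> \<Longrightarrow> 2 * pot (fst \<mu>) (snd \<mu>) (xinv \<mu> z) = z\<^sup>2"
proof -
  assume a: "\<mu> \<in> Lam" "\<bar>z\<bar> \<le> rad \<mu>"
  note x = xinv_props[OF a]
  have "pot (fst \<mu>) (snd \<mu>) (xinv \<mu> z) \<ge> 0"
    using pot_pos[of "fst \<mu>" "snd \<mu>" "xinv \<mu> z"] x(1) a rad_sq[OF a(1)] zero_le_power2[of "rad \<mu>"]
    by (cases "xinv \<mu> z = 0"; cases "xinv \<mu> z = -1") (auto simp: Lam_def less_imp_le)
  hence "(Gc \<mu> (xinv \<mu> z))\<^sup>2 = 2 * pot (fst \<mu>) (snd \<mu>) (xinv \<mu> z)"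
    by (cases "xinv \<mu> z = 0") (auto simp: Gc_def power_mult_distrib sgn_real_def)
  thus ?thesis using x(2) by simp
qed

lemma kk_formulas:
  assumes \<mu>: "\<mu> \<in> Lam" and z: "\<bar>z\<bar> < rad \<mu>" "z \<noteq> 0"
  defines "x \<equiv> xinv \<mu> z" and "f \<equiv> frc (fst \<mu>) (snd \<mu>)" and "f1 \<equiv> frc1 (fst \<mu>) (snd \<mu>)" and "f2 \<equiv> frc2 (fst \<mu>) (snd \<mu>)"
  shows "f x \<noteq> 0" "kk \<mu> z = z / f x" "kk1 \<mu> z = ((f x)\<^sup>2 - z\<^sup>2 * f1 x) / f x ^ 3"
    "kk2 \<mu> z = z * (3 * z\<^sup>2 * (f1 x)\<^sup>2 - 3 * (f x)\<^sup>2 * f1 x - z\<^sup>2 * f x * f2 x) / f x ^ 5"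
proof -
  interpret smooth_well "pot (fst \<mu>) (snd \<mu>)" "frc (fst \<mu>) (snd \<mu>)" "frc1 (fst \<mu>) (snd \<mu>)" "rad \<mu>" 
    "frc2 (fst \<mu>) (snd \<mu>)" "frc3 (fst \<mu>) (snd \<mu>)" by (rule Lam_well[OF \<mu>])
  have x: "ginv z = x" unfolding x_def by (rule ginv_eq_xinv[OF \<mu> z(1)])
  have F2: "2 * pot (fst \<mu>) (snd \<mu>) x = z\<^sup>2" using F_ginv[OF z(1)] x by simp
  show "f x \<noteq> 0" using f_ginv_neq_0[OF z] x by (simp add: f_def)
  show "kk \<mu> z = z / f x" using z by (simp add: kk_def k_def x f_def)
  show "kk1 \<mu> z = ((f x)\<^sup>2 - z\<^sup>2 * f1 x) / f x ^ 3" using z F2 by (simp add: kk1_def k1_def x f_def f1_def N_def)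
  have "P x = 3 * z\<^sup>2 * (f1 x)\<^sup>2 - 3 * (f x)\<^sup>2 * f1 x - z\<^sup>2 * f x * f2 x"
    unfolding P_def F2[symmetric] f_def f1_def f2_def by simp
  thus "kk2 \<mu> z = z * (3 * z\<^sup>2 * (f1 x)\<^sup>2 - 3 * (f x)\<^sup>2 * f1 x - z\<^sup>2 * f x * f2 x) / f x ^ 5"
    using z by (simp add: kk2_def k2_def x f_def)
qed

lemma eventually_Lam: "(m \<longlongrightarrow> \<mu>) F \<Longrightarrow> \<mu> \<in> Lam \<Longrightarrow> eventually (\<lambda>t. m t \<in> Lam) F"
  using topological_tendstoD[OF _ Lam_open] by blast

lemma rad_tendsto:
  assumes "(m \<longlongrightarrow> \<mu>) F" "\<mu> \<in> Lam" shows "((\<lambda>t. rad (m t)) \<longlongrightarrow> rad \<mu>) F"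
  unfolding rad_def Rad_def using assms(2) by (intro tendsto_intros assms(1)) (auto simp: Lam_def)

lemma pot_tendsto:
  assumes m: "(m \<longlongrightarrow> \<mu>) F" "\<mu> \<in> Lam" and X: "(X \<longlongrightarrow> x) F" "x > -1"
  shows "((\<lambda>t. pot (fst (m t)) (snd (m t)) (X t)) \<longlongrightarrow> pot (fst \<mu>) (snd \<mu>) x) F"
proof -
  have "((\<lambda>t. ((X t + 1) powr (snd (m t) + 1) - 1) / (snd (m t) + 1) - ((X t + 1) powr (fst (m t) + 1) - 1) / (fst (m t) + 1)) \<longlongrightarrow>
     ((x + 1) powr (snd \<mu> + 1) - 1) / (snd \<mu> + 1) - ((x + 1) powr (fst \<mu> + 1) - 1) / (fst \<mu> + 1)) F"
    using m(2) X by (intro tendsto_intros m(1) X) (auto simp: Lam_def)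
  moreover have "eventually (\<lambda>t. ((X t + 1) powr (snd (m t) + 1) - 1) / (snd (m t) + 1) - ((X t + 1) powr (fst (m t) + 1) - 1) / (fst (m t) + 1)
     = pot (fst (m t)) (snd (m t)) (X t)) F"
    using eventually_Lam[OF m] by eventually_elim (simp add: pot_powr Lam_def)
  ultimately show ?thesis using m(2) by (auto simp: pot_powr Lam_def intro: Lim_transform_eventually)
qed

lemma Gc_tendsto:
  assumes m: "(m \<longlongrightarrow> \<mu>) F" "\<mu> \<in> Lam" and x: "x \<ge> -1"
  shows "((\<lambda>t. Gc (m t) x) \<longlongrightarrow> Gc \<mu> x) F"
proof (cases "x = -1")
  case True
  have "eventually (\<lambda>t. - rad (m t) = Gc (m t) x) F"
    using eventually_Lam[OF m] by eventually_elim (simp add: True Gc_m1)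
  with tendsto_minus[OF rad_tendsto[OF m]] show ?thesis
    by (simp add: True Gc_m1 m(2)) (rule Lim_transform_eventually)
next
  case False
  thus ?thesis unfolding Gc_def using x by (intro tendsto_intros pot_tendsto m) auto
qed

text \<open>Joint continuity in parameter and argument, up to the endpoint. Monotonicity turns a <
  \<open>xinv (m t) (Z t)\<close> into \<open>Gc (m t) a < Z t\<close>, a strict inequality between
  quantities that converge for fixed a.\<close>

lemma xinv_tendsto:
  assumes m: "(m \<longlongrightarrow> \<mu>) F" "\<mu> \<in> Lam" and Z: "(Z \<longlongrightarrow> z) F"
    and b: "eventually (\<lambda>t. \<bar>Z t\<bar> \<le> rad (m t)) F" "\<bar>z\<bar> \<le> rad \<mu>"
  shows "((\<lambda>t. xinv (m t) (Z t)) \<longlongrightarrow> xinv \<mu> z) F"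
proof (rule order_tendstoI)
  note ev = eventually_Lam[OF m]
  fix a assume a: "a < xinv \<mu> z"
  show "eventually (\<lambda>t. a < xinv (m t) (Z t)) F"
  proof (cases "a < -1")
    case True
    show ?thesis using ev b(1) by eventually_elim (rule less_le_trans[OF True xinv_props(1)])
  next
    case False
    hence "Gc \<mu> a < z" using a xinv_less_iff(2)[OF m(2) b(2), of a] by simp
    hence "((\<lambda>t. Z t - Gc (m t) a) \<longlongrightarrow> z - Gc \<mu> a) F" "z - Gc \<mu> a > 0"
      using False by (auto intro!: tendsto_intros Z Gc_tendsto m)
    hence "eventually (\<lambda>t. Z t - Gc (m t) a > 0) F" by (rule order_tendstoD)
    thus ?thesis using ev b(1)
    proof eventually_elim
      case (elim t) thus ?case using False xinv_less_iff(2)[of "m t" "Z t" a] by simp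
    qed
  qed
next
  note ev = eventually_Lam[OF m]
  fix a assume a: "xinv \<mu> z < a"
  hence a1: "a \<ge> -1" using xinv_props(1)[OF m(2) b(2)] by simp
  hence "z < Gc \<mu> a" using a xinv_less_iff(1)[OF m(2) b(2), of a] by simp
  hence "((\<lambda>t. Gc (m t) a - Z t) \<longlongrightarrow> Gc \<mu> a - z) F" "Gc \<mu> a - z > 0"
    using a1 by (auto intro!: tendsto_intros Z Gc_tendsto m)
  hence "eventually (\<lambda>t. Gc (m t) a - Z t > 0) F" by (rule order_tendstoD)
  thus "eventually (\<lambda>t. xinv (m t) (Z t) < a) F" 
    using ev b(1)
  proof eventually_elim
    case (elim t) thus ?case using a1 xinv_less_iff(1)[of "m t" "Z t" a] by simp
  qed
qed

lemma kk_tendsto: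
  assumes m: "(m \<longlongrightarrow> \<mu>) F" "\<mu> \<in> Lam" and Z: "(Z \<longlongrightarrow> z) F" and z: "\<bar>z\<bar> < rad \<mu>" "z \<noteq> 0"
  shows "((\<lambda>t. kk (m t) (Z t)) \<longlongrightarrow> kk \<mu> z) F" "((\<lambda>t. kk1 (m t) (Z t)) \<longlongrightarrow> kk1 \<mu> z) F"
    "((\<lambda>t. kk2 (m t) (Z t)) \<longlongrightarrow> kk2 \<mu> z) F"
proof -
  have "((\<lambda>t. rad (m t) - \<bar>Z t\<bar>) \<longlongrightarrow> rad \<mu> - \<bar>z\<bar>) F" "rad \<mu> - \<bar>z\<bar> > 0"
    using z by (auto intro!: tendsto_intros rad_tendsto m Z)
  hence e1: "eventually (\<lambda>t. rad (m t) - \<bar>Z t\<bar> > 0) F" by (rule order_tendstoD)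
  have e2: "eventually (\<lambda>t. Z t \<noteq> 0) F" using Z z(2) by (rule tendsto_imp_eventually_ne)
  have ev: "eventually (\<lambda>t. m t \<in> Lam \<and> \<bar>Z t\<bar> < rad (m t) \<and> Z t \<noteq> 0) F"
    using eventually_Lam[OF m] e1 e2 by eventually_elim auto
  define x where "x = xinv \<mu> z"
  define X where "X t = xinv (m t) (Z t)" for t
  have X: "(X \<longlongrightarrow> x) F" unfolding X_def[abs_def] x_def
    by (rule xinv_tendsto[OF m Z]) (use ev z in \<open>auto elim!: eventually_mono\<close>)
  have x1: "x > -1" unfolding x_def by (rule ginv_eq_xinv[OF m(2) z(1)])
  have f: "((\<lambda>t. frc (fst (m t)) (snd (m t)) (X t)) \<longlongrightarrow> frc (fst \<mu>) (snd \<mu>) x) F"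
    "((\<lambda>t. frc1 (fst (m t)) (snd (m t)) (X t)) \<longlongrightarrow> frc1 (fst \<mu>) (snd \<mu>) x) F"
    "((\<lambda>t. frc2 (fst (m t)) (snd (m t)) (X t)) \<longlongrightarrow> frc2 (fst \<mu>) (snd \<mu>) x) F"
    unfolding frc_def frc1_def frc2_def using x1 by (auto intro!: tendsto_intros m(1) X)
  note form = kk_formulas[OF m(2) z, folded x_def]
  show "((\<lambda>t. kk (m t) (Z t)) \<longlongrightarrow> kk \<mu> z) F"
  proof (rule Lim_transform_eventually)
    show "((\<lambda>t. Z t / frc (fst (m t)) (snd (m t)) (X t)) \<longlongrightarrow> kk \<mu> z) F"
      unfolding form(2) by (intro tendsto_intros f Z form(1))
    show "eventually (\<lambda>t. Z t / frc (fst (m t)) (snd (m t)) (X t) = kk (m t) (Z t)) F"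
      using ev by eventually_elim (simp add: kk_formulas(2) X_def)
  qed
  show "((\<lambda>t. kk1 (m t) (Z t)) \<longlongrightarrow> kk1 \<mu> z) F"
  proof (rule Lim_transform_eventually)
    show "((\<lambda>t. ((frc (fst (m t)) (snd (m t)) (X t))\<^sup>2 - (Z t)\<^sup>2 * frc1 (fst (m t)) (snd (m t)) (X t)) / frc (fst (m t)) (snd (m t)) (X t) ^ 3) \<longlongrightarrow> kk1 \<mu> z) F"
      unfolding form(3) using form(1) by (intro tendsto_intros f Z) auto
    show "eventually (\<lambda>t. ((frc (fst (m t)) (snd (m t)) (X t))\<^sup>2 - (Z t)\<^sup>2 * frc1 (fst (m t)) (snd (m t)) (X t)) / frc (fst (m t)) (snd (m t)) (X t) ^ 3 = kk1 (m t) (Z t)) F"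
      using ev by eventually_elim (simp add: kk_formulas(3) X_def)
  qed
  show "((\<lambda>t. kk2 (m t) (Z t)) \<longlongrightarrow> kk2 \<mu> z) F"
  proof (rule Lim_transform_eventually)
    show "((\<lambda>t. Z t * (3 * (Z t)\<^sup>2 * (frc1 (fst (m t)) (snd (m t)) (X t))\<^sup>2 - 3 * (frc (fst (m t)) (snd (m t)) (X t))\<^sup>2 * frc1 (fst (m t)) (snd (m t)) (X t)
       - (Z t)\<^sup>2 * frc (fst (m t)) (snd (m t)) (X t) * frc2 (fst (m t)) (snd (m t)) (X t)) / frc (fst (m t)) (snd (m t)) (X t) ^ 5) \<longlongrightarrow> kk2 \<mu> z) F"
      unfolding form(4) using form(1) by (intro tendsto_intros f Z) auto
    show "eventually (\<lambda>t. Z t * (3 * (Z t)\<^sup>2 * (frc1 (fst (m t)) (snd (m t)) (X t))\<^sup>2 - 3 * (frc (fst (m t)) (snd (m t)) (X t))\<^sup>2 * frc1 (fst (m t)) (snd (m t)) (X t)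
       - (Z t)\<^sup>2 * frc (fst (m t)) (snd (m t)) (X t) * frc2 (fst (m t)) (snd (m t)) (X t)) / frc (fst (m t)) (snd (m t)) (X t) ^ 5 = kk2 (m t) (Z t)) F"
      using ev by eventually_elim (simp add: kk_formulas(4) X_def)
  qed
qed

section \<open>Uniform estimates away from the left end of the well\<close>

lemma primitive_power_bound:
  fixes g :: "real \<Rightarrow> real"
  assumes "g 0 = 0" "\<alpha> \<le> 0" "0 \<le> \<beta>" "x \<in> {\<alpha>..\<beta>}" "K \<ge> 0"
    and d: "\<And>t. t \<in> {\<alpha>..\<beta>} \<Longrightarrow> (g has_real_derivative g' t) (at t)"
    and b: "\<And>t. t \<in> {\<alpha>..\<beta>} \<Longrightarrow> \<bar>g' t\<bar> \<le> K * \<bar>t\<bar> ^ n"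
  shows "\<bar>g x\<bar> \<le> K * \<bar>x\<bar> ^ Suc n"
proof -
  have seg: "closed_segment 0 x \<subseteq> {\<alpha>..\<beta>}" using assms(2-4) by (auto simp: closed_segment_eq_real_ivl)
  have "norm (g x - g 0) \<le> (K * \<bar>x\<bar> ^ n) * norm (x - 0)"
  proof (rule field_differentiable_bound[where S = "closed_segment 0 x" and f' = g'])
    show "(g has_field_derivative g' t) (at t within closed_segment 0 x)" if "t \<in> closed_segment 0 x" for t
      by (rule has_field_derivative_at_within, rule d) (use that seg in auto)
    show "norm (g' t) \<le> K * \<bar>x\<bar> ^ n" if t: "t \<in> closed_segment 0 x" for t
    proof -
      have "\<bar>t\<bar> \<le> \<bar>x\<bar>" using t by (auto simp: closed_segment_eq_real_ivl split: if_splits)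
      hence "K * \<bar>t\<bar> ^ n \<le> K * \<bar>x\<bar> ^ n" using assms(5) by (intro mult_left_mono power_mono) auto
      thus ?thesis using b[of t] t seg by auto
    qed
  qed auto
  thus ?thesis using assms(1) by (simp add: mult_ac)
qed

context smooth_well begin

text \<open>Bounds that survive the removable singularity at z = 0. Integrating from 0 shows f, F,
  N, P to be of orders |x|, |x|^2, |x|^3, |x|^4, and |z| is of order |x|; after division by powers
  of |f x| \<ge> c |x| all powers of |x| cancel. The factor 12 is 5 * 2 + 2, from the two terms of
  the derivative of \<open>P\<close>.\<close>

lemma k_bounds:
  assumes \<alpha>: "-1 < \<alpha>" "\<alpha> \<le> 0" "0 \<le> \<beta>" and M: "M > 0" and c: "c > 0"
    and b: "\<And>x. x \<in> {\<alpha>..\<beta>} \<Longrightarrow> \<bar>f' x\<bar> \<le> M \<and> \<bar>f2 x\<bar> \<le> M \<and> \<bar>f3 x\<bar> \<le> M \<and> c * \<bar>x\<bar> \<le> \<bar>f x\<bar>"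
    and z: "\<bar>z\<bar> < R" "z \<noteq> 0" and x: "ginv z \<in> {\<alpha>..\<beta>}"
  shows "\<bar>k z\<bar> \<le> sqrt (2 * M) / c" "\<bar>k1 z\<bar> \<le> 2 * M\<^sup>2 / c ^ 3" "\<bar>k2 z\<bar> \<le> sqrt (2 * M) * (12 * M ^ 3) / c ^ 5"
proof -
  have in1: "t > -1" if "t \<in> {\<alpha>..\<beta>}" for t using that \<alpha> by auto
  have bf: "\<bar>f t\<bar> \<le> M * \<bar>t\<bar> ^ Suc 0" if "t \<in> {\<alpha>..\<beta>}" for t
    by (rule primitive_power_bound[where g = f and g' = f', OF f0 \<alpha>(2,3) that]) (use in1 b M f_deriv in auto)
  have bF: "\<bar>F t\<bar> \<le> M * \<bar>t\<bar> ^ Suc 1" if "t \<in> {\<alpha>..\<beta>}" for t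
    by (rule primitive_power_bound[where g = F and g' = f, OF F0 \<alpha>(2,3) that]) (use in1 bf M F_deriv in auto)
  have bN: "\<bar>N t\<bar> \<le> (2 * M\<^sup>2) * \<bar>t\<bar> ^ Suc 2" if "t \<in> {\<alpha>..\<beta>}" for t
  proof (rule primitive_power_bound[where g = N and g' = "\<lambda>x. - 2 * F x * f2 x", OF _ \<alpha>(2,3) that])
    show "N 0 = 0" by (simp add: N_def f0 F0)
    fix s assume s: "s \<in> {\<alpha>..\<beta>}"
    show "(N has_real_derivative - 2 * F s * f2 s) (at s)" by (rule N_deriv[OF in1[OF s]])
    have "\<bar>F s\<bar> * \<bar>f2 s\<bar> \<le> (M * \<bar>s\<bar> ^ Suc 1) * M" by (rule mult_mono) (use bF[OF s] b[OF s] M in auto)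
    thus "\<bar>- 2 * F s * f2 s\<bar> \<le> 2 * M\<^sup>2 * \<bar>s\<bar>\<^sup>2" by (simp add: abs_mult power2_eq_square mult_ac)
  qed simp
  have bP: "\<bar>P t\<bar> \<le> (12 * M ^ 3) * \<bar>t\<bar> ^ Suc 3" if "t \<in> {\<alpha>..\<beta>}" for t
  proof (rule primitive_power_bound[where g = P and g' = "\<lambda>x. - 5 * f2 x * N x - 2 * F x * f x * f3 x", OF _ \<alpha>(2,3) that])
    show "P 0 = 0" by (simp add: P_def f0 F0)
    fix s assume s: "s \<in> {\<alpha>..\<beta>}"
    show "(P has_real_derivative - 5 * f2 s * N s - 2 * F s * f s * f3 s) (at s)" by (rule P_deriv[OF in1[OF s]])
    have 1: "\<bar>f2 s\<bar> * \<bar>N s\<bar> \<le> M * ((2 * M\<^sup>2) * \<bar>s\<bar> ^ 3)" by (rule mult_mono) (use bN[OF s] b[OF s] M in \<open>auto simp: numeral_eq_Suc\<close>)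
    have "\<bar>F s\<bar> * \<bar>f s\<bar> * \<bar>f3 s\<bar> \<le> ((M * \<bar>s\<bar> ^ 2) * (M * \<bar>s\<bar>)) * M"
      by (intro mult_mono) (use bF[OF s] bf[OF s] b[OF s] M in \<open>auto simp: numeral_eq_Suc\<close>)
    hence 2: "\<bar>F s\<bar> * \<bar>f s\<bar> * \<bar>f3 s\<bar> \<le> M ^ 3 * \<bar>s\<bar> ^ 3" by (simp add: power2_eq_square power3_eq_cube mult_ac)
    have "\<bar>- 5 * f2 s * N s - 2 * F s * f s * f3 s\<bar> \<le> 5 * (\<bar>f2 s\<bar> * \<bar>N s\<bar>) + 2 * (\<bar>F s\<bar> * \<bar>f s\<bar> * \<bar>f3 s\<bar>)"
      by (rule order_trans[OF abs_triangle_ineq4]) (simp add: abs_mult mult_ac)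
    also have "\<dots> \<le> 5 * (M * ((2 * M\<^sup>2) * \<bar>s\<bar> ^ 3)) + 2 * (M ^ 3 * \<bar>s\<bar> ^ 3)"
      using 1 2 by linarith
    also have "\<dots> = 12 * M ^ 3 * \<bar>s\<bar> ^ 3" by (simp add: power2_eq_square power3_eq_cube algebra_simps)
    finally show "\<bar>- 5 * f2 s * N s - 2 * F s * f s * f3 s\<bar> \<le> 12 * M ^ 3 * \<bar>s\<bar> ^ 3" .
  qed (use M in simp)
  let ?x = "ginv z"
  have x0: "\<bar>?x\<bar> > 0" using z ginv_eq_0_iff by simp
  have fx: "\<bar>f ?x\<bar> \<ge> c * \<bar>?x\<bar>" "c * \<bar>?x\<bar> > 0" using b[OF x] c x0 by auto
  have "\<bar>z\<bar>\<^sup>2 \<le> (sqrt (2 * M) * \<bar>?x\<bar>)\<^sup>2"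
  proof -
    have "(sqrt (2 * M) * \<bar>?x\<bar>)\<^sup>2 = 2 * (M * \<bar>?x\<bar> ^ Suc 1)"
      unfolding power_mult_distrib using M by (simp add: power2_eq_square)
    moreover have "\<bar>z\<bar>\<^sup>2 = 2 * F ?x" using F_ginv[OF z(1)] by simp
    ultimately show ?thesis using bF[OF x] by linarith
  qed
  hence zx: "\<bar>z\<bar> \<le> sqrt (2 * M) * \<bar>?x\<bar>" by (rule power2_le_imp_le) (use M in auto)
  show "\<bar>k z\<bar> \<le> sqrt (2 * M) / c"
  proof -
    have "\<bar>k z\<bar> = \<bar>z\<bar> / \<bar>f ?x\<bar>" using z by (simp add: k_def)
    also have "\<dots> \<le> (sqrt (2 * M) * \<bar>?x\<bar>) / (c * \<bar>?x\<bar>)" by (intro frac_le zx fx) (use M in auto)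
    finally show ?thesis using x0 by simp
  qed
  show "\<bar>k1 z\<bar> \<le> 2 * M\<^sup>2 / c ^ 3"
  proof -
    have "\<bar>k1 z\<bar> = \<bar>N ?x\<bar> / \<bar>f ?x\<bar> ^ 3" using z by (simp add: k1_def power_abs)
    also have "\<dots> \<le> (2 * M\<^sup>2 * \<bar>?x\<bar> ^ 3) / (c * \<bar>?x\<bar>) ^ 3"
      by (intro frac_le power_mono fx) (use bN[OF x] fx in \<open>auto simp: numeral_eq_Suc\<close>)
    finally show ?thesis using x0 by (simp add: power_mult_distrib)
  qed
  show "\<bar>k2 z\<bar> \<le> sqrt (2 * M) * (12 * M ^ 3) / c ^ 5"
  proof -
    have "\<bar>k2 z\<bar> = \<bar>z\<bar> * \<bar>P ?x\<bar> / \<bar>f ?x\<bar> ^ 5" using z by (simp add: k2_def power_abs abs_mult)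
    also have "\<dots> \<le> ((sqrt (2 * M) * \<bar>?x\<bar>) * (12 * M ^ 3 * \<bar>?x\<bar> ^ 4)) / (c * \<bar>?x\<bar>) ^ 5"
      by (intro frac_le power_mono mult_mono fx zx) (use bP[OF x] fx M in \<open>auto simp: numeral_eq_Suc\<close>)
    also have "\<dots> = sqrt (2 * M) * (12 * M ^ 3) / c ^ 5"
    proof -
      have "(S * t) * (D * t ^ 4) / (c * t) ^ 5 = S * D / c ^ 5" if "t > 0" for S D t :: real
        using that c by (simp add: field_simps numeral_eq_Suc)
      thus ?thesis using x0 by blast
    qed
    finally show ?thesis .
  qed
qed

end

lemma powr_uniform_bounds:
  fixes \<alpha> \<beta> L :: real
  assumes "-1 < \<alpha>" "\<alpha> \<le> \<beta>"
  obtains C where "C \<ge> 1" "\<And>x e. x \<in> {\<alpha>..\<beta>} \<Longrightarrow> \<bar>e\<bar> \<le> L \<Longrightarrow> (x + 1) powr e \<le> C \<and> 1 / C \<le> (x + 1) powr e"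
proof -
  define l where "l = max \<bar>ln (\<alpha> + 1)\<bar> \<bar>ln (\<beta> + 1)\<bar>"
  define C where "C = exp (\<bar>L\<bar> * l)"
  show ?thesis
  proof (rule that[of C])
    show "C \<ge> 1" by (simp add: C_def l_def)
    fix x e assume x: "x \<in> {\<alpha>..\<beta>}" and e: "\<bar>e\<bar> \<le> L"
    have "ln (\<alpha> + 1) \<le> ln (x + 1)" "ln (x + 1) \<le> ln (\<beta> + 1)" using x assms by auto
    hence "\<bar>ln (x + 1)\<bar> \<le> l" unfolding l_def by linarith
    hence "\<bar>e\<bar> * \<bar>ln (x + 1)\<bar> \<le> \<bar>L\<bar> * l" using e by (intro mult_mono) auto
    hence "\<bar>e * ln (x + 1)\<bar> \<le> \<bar>L\<bar> * l" by (simp add: abs_mult)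
    hence "e * ln (x + 1) \<le> \<bar>L\<bar> * l" "- (\<bar>L\<bar> * l) \<le> e * ln (x + 1)" by linarith+
    thus "(x + 1) powr e \<le> C \<and> 1 / C \<le> (x + 1) powr e"
      using x assms by (auto simp: powr_def C_def exp_minus[symmetric] inverse_eq_divide[symmetric])
  qed
qed

lemma frc_uniform_bounds:
  assumes \<alpha>: "-1 < \<alpha>" "\<alpha> \<le> 0" "0 \<le> \<beta>" and d: "d > 0" and L: "L \<ge> 0"
  obtains M c where "M > 0" "c > 0"
    "\<And>q p x. \<bar>q\<bar> \<le> L \<Longrightarrow> \<bar>p\<bar> \<le> L \<Longrightarrow> p - q \<ge> d \<Longrightarrow> x \<in> {\<alpha>..\<beta>} \<Longrightarrow>
       \<bar>frc1 q p x\<bar> \<le> M \<and> \<bar>frc2 q p x\<bar> \<le> M \<and> \<bar>frc3 q p x\<bar> \<le> M \<and> c * \<bar>x\<bar> \<le> \<bar>frc q p x\<bar>"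
proof -
  \<comment> \<open>Large enough for all exponents that occur, such as a - 3 and
    \<open>p - q\<close>.\<close>
  define K where "K = 2 * L + 3"
  obtain C where C: "C \<ge> 1" "\<And>x e. x \<in> {\<alpha>..\<beta>} \<Longrightarrow> \<bar>e\<bar> \<le> K \<Longrightarrow> (x + 1) powr e \<le> C \<and> 1 / C \<le> (x + 1) powr e"
    using powr_uniform_bounds[of \<alpha> \<beta> K] \<alpha> by auto
  have K: "K \<ge> 1" "K \<ge> 0" using L by (auto simp: K_def)
  define M where "M = 2 * (K ^ 3 * C)"
  \<comment> \<open>The difference u powr (p - q) - 1 is compared with |x| through ln u \<ge> 1 - 1
    / u for u \<ge> 1 and - ln u \<ge> 1 - u for u < 1. The factors 1 / C are lower bounds for u
    powr q and, on the left, for u powr (p - q).\<close>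
  define c where "c = 1 / C * (d * (1 / C) / (\<beta> + 1))"
  show ?thesis
  proof (rule that[of M c])
    show "M > 0" using C K by (simp add: M_def)
    show "c > 0" using C d \<alpha> by (simp add: c_def)
    fix q p x assume q: "\<bar>q\<bar> \<le> L" and p: "\<bar>p\<bar> \<le> L" and pq: "p - q \<ge> d" and x: "x \<in> {\<alpha>..\<beta>}"
    have trm: "\<bar>A * (x + 1) powr e\<bar> \<le> K ^ 3 * C" if "\<bar>A\<bar> \<le> K ^ 3" "\<bar>e\<bar> \<le> K" for A e
      unfolding abs_mult using that C(2)[OF x that(2)] K C(1) by (intro mult_mono) auto
    have cK: "\<bar>a\<bar> \<le> K ^ 3" "\<bar>a * (a - 1)\<bar> \<le> K ^ 3" "\<bar>a * (a - 1) * (a - 2)\<bar> \<le> K ^ 3" if "\<bar>a\<bar> \<le> L" for a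
    proof -
      have a: "\<bar>a\<bar> \<le> K" "\<bar>a - 1\<bar> \<le> K" "\<bar>a - 2\<bar> \<le> K" using that L by (auto simp: K_def)
      have 3: "\<bar>a * (a - 1) * (a - 2)\<bar> \<le> K * K * K" unfolding abs_mult using a K by (intro mult_mono) auto
      have 2: "\<bar>a * (a - 1) * 1\<bar> \<le> K * K * K" unfolding abs_mult using a K by (intro mult_mono) auto
      have 1: "\<bar>a * 1 * 1\<bar> \<le> K * K * K" unfolding abs_mult using a K by (intro mult_mono) auto
      show "\<bar>a\<bar> \<le> K ^ 3" "\<bar>a * (a - 1)\<bar> \<le> K ^ 3" "\<bar>a * (a - 1) * (a - 2)\<bar> \<le> K ^ 3"
        using 1 2 3 by (simp_all add: power3_eq_cube)
    qed
    have e: "\<bar>a - 1\<bar> \<le> K" "\<bar>a - 2\<bar> \<le> K" "\<bar>a - 3\<bar> \<le> K" if "\<bar>a\<bar> \<le> L" for a using that L by (auto simp: K_def)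
    have dist: "\<bar>s - t\<bar> \<le> M" if "\<bar>s\<bar> \<le> K ^ 3 * C" "\<bar>t\<bar> \<le> K ^ 3 * C" for s t :: real
      using that unfolding M_def by linarith
    have b: "\<bar>frc1 q p x\<bar> \<le> M" "\<bar>frc2 q p x\<bar> \<le> M" "\<bar>frc3 q p x\<bar> \<le> M"
      unfolding frc1_def frc2_def frc3_def by (intro dist trm cK e p q)+
    let ?u = "x + 1"
    have u: "?u > 0" using x \<alpha> by auto
    have uq: "1 / C \<le> ?u powr q" using C(2)[OF x, of q] q L by (auto simp: K_def)
    have fr: "frc q p x = ?u powr q * (?u powr (p - q) - 1)"
      using u by (simp add: frc_def powr_diff right_diff_distrib)
    have "d * (1 / C) / (\<beta> + 1) * \<bar>x\<bar> \<le> \<bar>?u powr (p - q) - 1\<bar>"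
    proof (cases "x \<ge> 0")
      case True
      have "d * (1 / C) / (\<beta> + 1) * x \<le> d * 1 / (x + 1) * x"
        using C d x True by (intro mult_right_mono frac_le mult_left_mono) auto
      also have "\<dots> = d * (1 - 1 / ?u)" using u by (simp add: field_simps)
      also have "\<dots> \<le> (p - q) * (1 - 1 / ?u)" using pq True u by (intro mult_right_mono) auto
      also have "\<dots> \<le> (p - q) * ln ?u" 
        using pq d u ln_le_minus_one[of "1 / ?u"] by (intro mult_left_mono) (auto simp: ln_div)
      also have "\<dots> \<le> exp ((p - q) * ln ?u) - 1" using exp_ge_add_one_self[of "(p - q) * ln ?u"] by linarith
      also have "\<dots> = ?u powr (p - q) - 1" using u by (simp add: powr_def)
      finally show ?thesis using True by simp
    next
      case False
      have pq2: "1 / C \<le> ?u powr (p - q)" using C(2)[OF x, of "p - q"] q p L by (auto simp: K_def)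
      have "d * (1 / C) / (\<beta> + 1) * (- x) \<le> d * (1 / C) / 1 * (- x)"
        using C d False \<alpha> by (intro mult_right_mono frac_le) auto
      also have "\<dots> = (1 / C) * (d * (1 - ?u))" by simp
      also have "\<dots> \<le> ?u powr (p - q) * ((p - q) * (- ln ?u))"
        using pq2 pq d u ln_le_minus_one[of ?u] False C(1) 
        by (intro mult_mono) (auto intro: mult_nonneg_nonpos)
      also have "\<dots> \<le> ?u powr (p - q) * (exp (- ((p - q) * ln ?u)) - 1)"
        using exp_ge_add_one_self[of "- ((p - q) * ln ?u)"] by (intro mult_left_mono) auto
      also have "\<dots> = 1 - ?u powr (p - q)" using u by (simp add: powr_def right_diff_distrib exp_minus)
      finally show ?thesis using False by simp
    qed
    hence "c * \<bar>x\<bar> \<le> ?u powr q * \<bar>?u powr (p - q) - 1\<bar>"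
      unfolding c_def mult.assoc[of "1 / C"] using uq C d \<alpha> by (intro mult_mono) auto
    also have "\<dots> = \<bar>frc q p x\<bar>" by (simp add: fr abs_mult)
    finally show "\<bar>frc1 q p x\<bar> \<le> M \<and> \<bar>frc2 q p x\<bar> \<le> M \<and> \<bar>frc3 q p x\<bar> \<le> M \<and> c * \<bar>x\<bar> \<le> \<bar>frc q p x\<bar>"
      using b by blast
  qed
qed

lemma eventually_xinv_bounded:
  assumes "\<mu> \<in> Lam"
  obtains \<beta> where "\<beta> > 0" "eventually (\<lambda>m. \<forall>z. \<bar>z\<bar> \<le> rad m \<longrightarrow> xinv m z \<le> \<beta>) (nhds \<mu>)"
proof -
  define r where "r = right_end (fst \<mu>) (snd \<mu>)"
  have r: "r > 0" "Gc \<mu> r = rad \<mu>"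
    using right_end[of "fst \<mu>" "snd \<mu>"] assms rad_sq[OF assms] rad_pos[OF assms] unfolding r_def Gc_def
    by (auto simp: Lam_def) (metis abs_of_pos real_sqrt_abs rad_pos assms)
  have m: "((\<lambda>m. m) \<longlongrightarrow> \<mu>) (nhds \<mu>)" by (rule filterlim_ident)
  \<comment> \<open>One unit beyond \<open>right_end\<close> the value of \<open>Gc\<close> exceeds
    \<open>rad\<close> strictly, which persists for nearby parameters.\<close>
  have "Gc \<mu> (r + 1) > rad \<mu>" using Gc_strict_mono[OF assms, of r "r + 1"] r by simp
  moreover have "((\<lambda>m. Gc m (r + 1) - rad m) \<longlongrightarrow> Gc \<mu> (r + 1) - rad \<mu>) (nhds \<mu>)"
    using r by (intro tendsto_intros Gc_tendsto rad_tendsto m assms) auto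
  ultimately have "eventually (\<lambda>m. Gc m (r + 1) - rad m > 0) (nhds \<mu>)"
    by (intro order_tendstoD(1)[of _ "Gc \<mu> (r + 1) - rad \<mu>"]) auto
  hence "eventually (\<lambda>m. \<forall>z. \<bar>z\<bar> \<le> rad m \<longrightarrow> xinv m z \<le> r + 1) (nhds \<mu>)"
    using eventually_Lam[OF m assms]
  proof eventually_elim
    case (elim m)
    show ?case
    proof (intro allI impI)
      fix z assume z: "\<bar>z\<bar> \<le> rad m"
      thus "xinv m z \<le> r + 1" using xinv_less_iff(1)[OF elim(2) z, of "r + 1"] r elim(1) by auto
    qed
  qed
  thus ?thesis using that[of "r + 1"] r by simp
qed

text \<open>The only loss of compactness in the family is x tending to -1. Once x \<ge> \<alpha>,
  the bounds are uniform over nearby parameters and over all energies below the boundary.\<close>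

lemma kk_bounded:
  assumes \<mu>: "\<mu> \<in> Lam" and \<alpha>: "-1 < \<alpha>" "\<alpha> \<le> 0"
  obtains M where "M > 0" "eventually (\<lambda>m. m \<in> Lam \<and> (\<forall>z. \<bar>z\<bar> < rad m \<and> z \<noteq> 0 \<and> \<alpha> \<le> xinv m z \<longrightarrow>
     \<bar>kk m z\<bar> \<le> M \<and> \<bar>kk1 m z\<bar> \<le> M \<and> \<bar>kk2 m z\<bar> \<le> M)) (nhds \<mu>)"
proof -
  obtain \<beta> where \<beta>: "\<beta> > 0" and eb: "eventually (\<lambda>m. \<forall>z. \<bar>z\<bar> \<le> rad m \<longrightarrow> xinv m z \<le> \<beta>) (nhds \<mu>)"
    by (rule eventually_xinv_bounded[OF \<mu>])
  define L where "L = max \<bar>fst \<mu>\<bar> \<bar>snd \<mu>\<bar> + 1"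
  define d where "d = (snd \<mu> - fst \<mu>) / 2"
  have d: "d > 0" and L: "L \<ge> 0" using \<mu> by (auto simp: d_def L_def Lam_def)
  obtain M c where Mc: "M > 0" "c > 0"
    "\<And>q p x. \<bar>q\<bar> \<le> L \<Longrightarrow> \<bar>p\<bar> \<le> L \<Longrightarrow> p - q \<ge> d \<Longrightarrow> x \<in> {\<alpha>..\<beta>} \<Longrightarrow>
       \<bar>frc1 q p x\<bar> \<le> M \<and> \<bar>frc2 q p x\<bar> \<le> M \<and> \<bar>frc3 q p x\<bar> \<le> M \<and> c * \<bar>x\<bar> \<le> \<bar>frc q p x\<bar>"
    using frc_uniform_bounds[OF \<alpha> less_imp_le[OF \<beta>] d L] by blast
  define M' where "M' = max (sqrt (2 * M) / c) (max (2 * M\<^sup>2 / c ^ 3) (sqrt (2 * M) * (12 * M ^ 3) / c ^ 5))"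
  have m: "((\<lambda>m. m) \<longlongrightarrow> \<mu>) (nhds \<mu>)" by (rule filterlim_ident)
  have "((\<lambda>m. \<bar>fst m\<bar>) \<longlongrightarrow> \<bar>fst \<mu>\<bar>) (nhds \<mu>)" "((\<lambda>m. \<bar>snd m\<bar>) \<longlongrightarrow> \<bar>snd \<mu>\<bar>) (nhds \<mu>)" 
    "((\<lambda>m. snd m - fst m) \<longlongrightarrow> snd \<mu> - fst \<mu>) (nhds \<mu>)" by (intro tendsto_intros m)+
  moreover have "\<bar>fst \<mu>\<bar> < L" "\<bar>snd \<mu>\<bar> < L" "d < snd \<mu> - fst \<mu>" using d by (auto simp: L_def d_def)
  ultimately have "eventually (\<lambda>m. \<bar>fst m\<bar> < L) (nhds \<mu>)" "eventually (\<lambda>m. \<bar>snd m\<bar> < L) (nhds \<mu>)"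
    "eventually (\<lambda>m. d < snd m - fst m) (nhds \<mu>)" by (auto dest: order_tendstoD)
  hence "eventually (\<lambda>m. m \<in> Lam \<and> (\<forall>z. \<bar>z\<bar> < rad m \<and> z \<noteq> 0 \<and> \<alpha> \<le> xinv m z \<longrightarrow>
     \<bar>kk m z\<bar> \<le> M' \<and> \<bar>kk1 m z\<bar> \<le> M' \<and> \<bar>kk2 m z\<bar> \<le> M')) (nhds \<mu>)"
    using eb eventually_Lam[OF m \<mu>]
  proof eventually_elim
    case (elim m)
    interpret smooth_well "pot (fst m) (snd m)" "frc (fst m) (snd m)" "frc1 (fst m) (snd m)" "rad m" 
      "frc2 (fst m) (snd m)" "frc3 (fst m) (snd m)" by (rule Lam_well) (rule elim)
    have "\<bar>kk m z\<bar> \<le> M' \<and> \<bar>kk1 m z\<bar> \<le> M' \<and> \<bar>kk2 m z\<bar> \<le> M'" if z: "\<bar>z\<bar> < rad m" "z \<noteq> 0" "\<alpha> \<le> xinv m z" for z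
    proof -
      have x: "ginv z \<in> {\<alpha>..\<beta>}" using ginv_eq_xinv(1)[OF elim(5) z(1)] z elim(4) by auto
      have b: "\<bar>frc1 (fst m) (snd m) x\<bar> \<le> M \<and> \<bar>frc2 (fst m) (snd m) x\<bar> \<le> M \<and> \<bar>frc3 (fst m) (snd m) x\<bar> \<le> M \<and> c * \<bar>x\<bar> \<le> \<bar>frc (fst m) (snd m) x\<bar>"
        if "x \<in> {\<alpha>..\<beta>}" for x by (rule Mc(3)) (use elim that in auto)
      show ?thesis unfolding kk_def kk1_def kk2_def M'_def
        using k_bounds[OF \<alpha> less_imp_le[OF \<beta>] Mc(1,2) b z(1,2) x] by (auto simp: le_max_iff_disj)
    qed
    thus ?case using elim(5) by blast
  qed
  moreover have "M' > 0" unfolding M'_def using Mc by (simp add: less_max_iff_disj)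
  ultimately show ?thesis using that by blast
qed

section \<open>Behaviour at the left end of the well\<close>

definition Phi :: "real \<times> real \<Rightarrow> real \<Rightarrow> real"
  where "Phi \<mu> z = ((rad \<mu>)\<^sup>2 - z\<^sup>2) / 2 * kk2 \<mu> z + (1 / (fst \<mu> + 1) - 2) * z * kk1 \<mu> z + (2 / (fst \<mu> + 1) - 1) * kk \<mu> z"

text \<open>This is z^2 = 2 V(u - 1), written as R^2 minus twice the energy deficit so that the
  factor u powr (q + 1) of the deficit is explicit.\<close>

definition sqz :: "real \<times> real \<Rightarrow> real \<Rightarrow> real"
  where "sqz \<mu> u = (rad \<mu>)\<^sup>2 - 2 * u powr (fst \<mu> + 1) * (1 / (fst \<mu> + 1) - u powr (snd \<mu> - fst \<mu>) / (snd \<mu> + 1))"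

text \<open>On the left branch, with \<open>u = x + 1\<close>, \<open>w = u powr (q + 1)\<close>, \<open>v = u powr (p - q)\<close> and \<open>Z = z\<^sup>2\<close>, the functions \<open>k'\<close> and \<open>Phi\<close> are powers of \<open>u\<close>
  times \<open>B1\<close> and \<open>B2\<close>, which extend continuously to \<open>u = 0\<close>.\<close>

definition B1 :: "real \<times> real \<Rightarrow> real \<Rightarrow> real"
  where "B1 \<mu> u = (let q = fst \<mu>; p = snd \<mu>; w = u powr (q + 1); v = u powr (p - q); Z = sqz \<mu> u
    in - w / (1 - v) + Z * (p * v - q) / (1 - v) ^ 3)"

definition B2 :: "real \<times> real \<Rightarrow> real \<Rightarrow> real"
  where "B2 \<mu> u = (let q = fst \<mu>; p = snd \<mu>; w = u powr (q + 1); v = u powr (p - q); Z = sqz \<mu> u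
    in (p + 1) * p * Z / (1 - v) ^ 3 + 3 * (p + 1) / (1 - v) * (- w / (1 - v) + Z * (p * v - q) / (1 - v) ^ 3)
     + (3 * Z * (p * v - q)\<^sup>2 - 3 * w * (1 - v)\<^sup>2 * (p * v - q) + Z * (1 - v) * (p * (p - 1) * v - q * (q - 1))) / (1 - v) ^ 5)"

text \<open>Here f = - y D, f' = y s / u and f'' = y t / u^2 with y = u powr q and D = 1 - u powr (p
  - q). This identity and the next pull the powers of u out of k' and k''.\<close>

lemma left_algebra_1:
  fixes u y D :: real
  assumes "u \<noteq> 0" "y \<noteq> 0" "D \<noteq> 0"
  shows "((- y * D)\<^sup>2 - Z * (y / u * s)) / (- y * D) ^ 3 = (- (u * y) / D + Z * s / D ^ 3) / (u * y\<^sup>2)"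
  using assms by (simp add: divide_simps power2_eq_square power3_eq_cube) (simp add: algebra_simps)

lemma left_algebra_2:
  fixes u y D :: real
  assumes nz: "u \<noteq> 0" "y \<noteq> 0" "D \<noteq> 0"
  shows "z * (3 * Z * (y / u * s)\<^sup>2 - 3 * (- y * D)\<^sup>2 * (y / u * s) - Z * (- y * D) * (y / u\<^sup>2 * t)) / (- y * D) ^ 5
    = - (z / (u * y\<^sup>2)) * ((3 * Z * s\<^sup>2 - 3 * (u * y) * D\<^sup>2 * s + Z * D * t) / D ^ 5) / (u * y)"
proof -
  define Q where "Q = 3 * Z * s\<^sup>2 - 3 * (u * y) * D\<^sup>2 * s + Z * D * t"
  have 1: "3 * Z * (y / u * s)\<^sup>2 - 3 * (- y * D)\<^sup>2 * (y / u * s) - Z * (- y * D) * (y / u\<^sup>2 * t) = (y\<^sup>2 / u\<^sup>2) * Q"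
    using nz by (simp add: Q_def field_simps power2_eq_square)
  have 2: "(- y * D) ^ 5 = - (y ^ 5 * D ^ 5)" by (simp add: power_mult_distrib)
  show ?thesis unfolding 1 2 Q_def[symmetric] using nz by (simp add: divide_simps power2_eq_square numeral_eq_Suc)
qed

text \<open>With a = q + 1 and b = p + 1 this is the cancellation behind \<open>\<Phi>\<close>. With
  a general A in place of 1 / a in the last two coefficients, the value at v = 0 would be (A - 1 /
  a) ((a - 1) Z + 3 w); precisely A = 1 / a leaves a factor v = u powr (p - q).\<close>

lemma left_algebra_3:
  fixes v D :: real
  assumes D: "D = 1 - v" "D \<noteq> 0" and ab: "a \<noteq> 0" "b \<noteq> 0"
    and s: "s = (b - 1) * v - (a - 1)" and t: "t = (b - 1) * (b - 2) * v - (a - 1) * (a - 2)"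
    and Q: "Q = 3 * Z * s\<^sup>2 - 3 * w * D\<^sup>2 * s + Z * D * t" and E: "E = - w / D + Z * s / D ^ 3"
  shows "(1 / a - v / b) * (Q / D ^ 5) - (1 / a - 2) * E + (2 / a - 1) * (w / D)
    = (1 / a - 1 / b) * v * (b * (b - 1) * Z / D ^ 3 + 3 * b / D * E + Q / D ^ 5)"
proof -
  have key: "Q - (1 - 2 * a) * (- w * D ^ 3 + Z * s * D) + (2 - a) * w * D ^ 3
     = (b - a) * v * ((b - 1) * Z * D + 3 * (- w * D\<^sup>2 + Z * s))"
    unfolding Q s t D(1) by algebra
  have Ea: "E * D ^ 4 = - w * D ^ 3 + Z * s * D" unfolding E using D(2) by (simp add: field_simps numeral_eq_Suc)
  have Eb: "E * D ^ 3 = - w * D\<^sup>2 + Z * s" unfolding E using D(2) by (simp add: field_simps numeral_eq_Suc)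
  \<comment> \<open>Only the part of this coefficient proportional to D takes part in the
    cancellation; the rest carries the factor v already.\<close>
  have c: "1 / a - v / b = (1 / a - 1 / b) * v + D / a" using ab by (simp add: D(1) field_simps)
  have "(D / a) * (Q / D ^ 5) - (1 / a - 2) * E + (2 / a - 1) * (w / D) 
      = (1 / a - 1 / b) * v * (b * (b - 1) * Z / D ^ 3 + 3 * b / D * E)"
  proof -
    have "((D / a) * (Q / D ^ 5) - (1 / a - 2) * E + (2 / a - 1) * (w / D)) * (a * D ^ 4)
        = Q - (1 - 2 * a) * (E * D ^ 4) + (2 - a) * w * D ^ 3"
      using D(2) ab by (simp add: field_simps numeral_eq_Suc)
    moreover have "((1 / a - 1 / b) * v * (b * (b - 1) * Z / D ^ 3 + 3 * b / D * E)) * (a * D ^ 4)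
        = (b - a) * v * ((b - 1) * Z * D + 3 * (E * D ^ 3))"
      using D(2) ab by (simp add: field_simps numeral_eq_Suc)
    ultimately have "((D / a) * (Q / D ^ 5) - (1 / a - 2) * E + (2 / a - 1) * (w / D)) * (a * D ^ 4)
       = ((1 / a - 1 / b) * v * (b * (b - 1) * Z / D ^ 3 + 3 * b / D * E)) * (a * D ^ 4)"
      unfolding Ea Eb key by (simp only:)
    moreover have "a * D ^ 4 \<noteq> 0" using D(2) ab by simp
    ultimately show ?thesis by (simp only: mult_cancel_right) blast
  qed
  moreover have "(K + d) * Y - X1 + X2 = K * (W + Y)" if "d * Y - X1 + X2 = K * W" for K d Y X1 X2 W :: real
    using that by (simp add: algebra_simps)
  ultimately show ?thesis unfolding c by blast
qed

text \<open>Leading powers at u = 0. Without cancellation \<open>Phi\<close> would be of order u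
  powr (-1 - 2 q); \<open>left_algebra_3\<close> improves this to u powr (p - 1 - 3 q), a gain of p
  - q. At q = 0 this is integrable over the angle on the boundary orbit exactly for p > 1/2.\<close>

lemma left_forms:
  assumes \<mu>: "\<mu> \<in> Lam" and z: "\<bar>z\<bar> < rad \<mu>" "z < 0"
  defines "u \<equiv> xinv \<mu> z + 1" and "q \<equiv> fst \<mu>" and "p \<equiv> snd \<mu>"
  shows "0 < u" "u < 1" "z\<^sup>2 = sqz \<mu> u" "u powr (p - q) < 1"
    "kk1 \<mu> z = B1 \<mu> u * u powr (- 1 - 2 * q)"
    "Phi \<mu> z = - z * (1 / (q + 1) - 1 / (p + 1)) * B2 \<mu> u * u powr (p - 1 - 3 * q)"
    "kk \<mu> z = - z / (1 - u powr (p - q)) * u powr (- q)"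
proof -
  have qp: "-1 < q" "q < p" using \<mu> by (auto simp: Lam_def q_def p_def)
  show u: "0 < u" "u < 1"
    using ginv_eq_xinv(2)[OF \<mu> z(1)] xinv_neg[OF \<mu> _ z(2)] z(1) by (auto simp: u_def)
  define x where "x = xinv \<mu> z"
  define y where "y = u powr q"
  define v where "v = u powr (p - q)"
  define D where "D = 1 - v"
  define w where "w = u powr (q + 1)"
  define s where "s = p * v - q"
  define t where "t = p * (p - 1) * v - q * (q - 1)"
  define Z where "Z = sqz \<mu> u"
  have ux: "x + 1 = u" by (simp add: x_def u_def)
  show v1: "u powr (p - q) < 1" using u qp powr_less_one[of u "p - q"] powr_less_mono2[of "p - q" u 1] by simp
  have y: "y > 0" using u by (simp add: y_def)
  have D0: "D > 0" using v1 by (simp add: D_def v_def)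
  have w: "w = u * y" using u by (simp add: w_def y_def powr_add)
  have up: "u powr p = y * v" using u by (simp add: y_def v_def powr_add[symmetric])
  have up1: "u powr (p + 1) = w * v" using u up by (simp add: w powr_add mult_ac)
  have f: "frc q p x = - y * D" unfolding frc_def ux up by (simp add: D_def y_def[symmetric] algebra_simps)
  have pm: "u powr (e - 1) = u powr e / u" "u powr (e - 2) = u powr e / u\<^sup>2" for e
    using u by (simp_all add: powr_diff powr_numeral)
  have f1: "frc1 q p x = y / u * s" using u unfolding frc1_def ux pm up by (simp add: s_def y_def[symmetric] field_simps)
  have f2: "frc2 q p x = y / u\<^sup>2 * t" using u unfolding frc2_def ux pm up by (simp add: t_def y_def[symmetric] field_simps)
  have pot: "2 * pot q p x = z\<^sup>2" using pot_xinv[OF \<mu>, of z] z by (simp add: x_def q_def p_def)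
  have half: "((rad \<mu>)\<^sup>2 - z\<^sup>2) / 2 = w * (1 / (q + 1) - v / (p + 1))"
  proof -
    have r2: "(rad \<mu>)\<^sup>2 = 2 * (1 / (q + 1) - 1 / (p + 1))" using rad_sq[OF \<mu>] pot_m1[OF qp] by (simp add: q_def p_def)
    have pe: "pot q p x = (w * v - 1) / (p + 1) - (w - 1) / (q + 1)"
      using pot_powr[OF qp, of x] by (simp add: ux up1 w_def[symmetric])
    have h2: "(2 * A - 2 * P) / 2 = A - P" for A P :: real by simp
    show ?thesis unfolding r2 pot[symmetric] h2 pe by (simp add: diff_divide_distrib right_diff_distrib)
  qed
  show Z2: "z\<^sup>2 = sqz \<mu> u"
    using half by (simp add: sqz_def w_def v_def q_def p_def)
  have uy: "1 / (u * y\<^sup>2) = u powr (- 1 - 2 * q)"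
  proof -
    have "u powr (- 1 - 2 * q) = u powr (- (1 + (q + q)))" by (simp add: algebra_simps)
    also have "\<dots> = 1 / (u powr 1 * (u powr q * u powr q))"
      unfolding powr_minus_divide powr_add by simp
    finally show ?thesis using u by (simp add: y_def power2_eq_square)
  qed
  have zz: "\<bar>z\<bar> < rad \<mu>" "z \<noteq> 0" using z by auto
  note F = kk_formulas[OF \<mu> zz, folded q_def p_def x_def, unfolded f f1 f2]
  have B1e: "B1 \<mu> u = - w / D + Z * s / D ^ 3"
    by (simp add: B1_def Let_def w_def D_def v_def s_def Z_def q_def p_def)
  define Q where "Q = 3 * Z * s\<^sup>2 - 3 * w * D\<^sup>2 * s + Z * D * t"
  have B2e: "B2 \<mu> u = (p + 1) * p * Z / D ^ 3 + 3 * (p + 1) / D * B1 \<mu> u + Q / D ^ 5"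
    unfolding B1e by (simp add: B2_def Let_def w_def D_def v_def s_def t_def Z_def q_def p_def Q_def)
  have k1a: "kk1 \<mu> z = B1 \<mu> u / (u * y\<^sup>2)"
    unfolding F(3) B1e w Z_def Z2[symmetric] by (rule left_algebra_1) (use u y D0 in auto)
  thus "kk1 \<mu> z = B1 \<mu> u * u powr (- 1 - 2 * q)" by (simp add: uy[symmetric])
  have k2a: "kk2 \<mu> z = - (z / (u * y\<^sup>2)) * (Q / D ^ 5) / w"
    unfolding F(4) Q_def w Z_def Z2[symmetric] by (rule left_algebra_2) (use u y D0 in auto)
  have ka: "kk \<mu> z = - (z / (u * y\<^sup>2)) * (w / D)"
    unfolding F(2) w using u y D0 by (simp add: field_simps power2_eq_square)
  show "kk \<mu> z = - z / (1 - u powr (p - q)) * u powr (- q)"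
    unfolding F(2) using u y D0 by (simp add: y_def D_def v_def powr_minus_divide)
  have w0: "w \<noteq> 0" using u by (simp add: w_def)
  have "Phi \<mu> z = - (z / (u * y\<^sup>2)) * ((1 / (q + 1) - v / (p + 1)) * (Q / D ^ 5) - (1 / (q + 1) - 2) * B1 \<mu> u + (2 / (q + 1) - 1) * (w / D))"
  proof -
    have gen: "w * c * (- (z / U) * Y / w) + a * z * (B / U) + k * (- (z / U) * X) = - (z / U) * (c * Y - a * B + k * X)"
      for c U Y a B k X :: real
    proof -
      have "w * c * (- (z / U) * Y / w) = - (z / U) * (c * Y)" using w0 by simp
      moreover have "a * z * (B / U) = - (z / U) * (- (a * B))" by simp
      ultimately show ?thesis by (simp only: right_diff_distrib distrib_left mult_minus_right) (simp add: mult_ac)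
    qed
    show ?thesis unfolding Phi_def q_def[symmetric] half k2a k1a ka by (rule gen)
  qed
  also have "\<dots> = - (z / (u * y\<^sup>2)) * ((1 / (q + 1) - 1 / (p + 1)) * v * B2 \<mu> u)"
    unfolding B2e
    by (subst left_algebra_3[where D = D and v = v and a = "q + 1" and b = "p + 1" and s = s and t = t and Q = Q and Z = Z and w = w and E = "B1 \<mu> u"])
       (use D0 qp in \<open>auto simp: D_def s_def t_def Q_def B1e algebra_simps\<close>)
  also have "\<dots> = - z * (1 / (q + 1) - 1 / (p + 1)) * B2 \<mu> u * (v * (1 / (u * y\<^sup>2)))" by simp
  also have "v * (1 / (u * y\<^sup>2)) = u powr (p - 1 - 3 * q)" unfolding uy v_def powr_add[symmetric] by (simp add: algebra_simps)
  finally show "Phi \<mu> z = - z * (1 / (q + 1) - 1 / (p + 1)) * B2 \<mu> u * u powr (p - 1 - 3 * q)" .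
qed

text \<open>The limits are joint in parameter and u because the exponents q + 1 and p - q stay away
  from 0, so that w and v tend to 0. The first one shows why q = 0 is a bifurcation value: the
  leading coefficient of k' changes sign there.\<close>

lemma left_limits:
  assumes "\<mu> \<in> Lam"
  defines "F \<equiv> nhds \<mu> \<times>\<^sub>F at_right (0::real)" and "q \<equiv> fst \<mu>" and "p \<equiv> snd \<mu>"
  shows "((\<lambda>(m, u). B1 m u) \<longlongrightarrow> - q * (rad \<mu>)\<^sup>2) F"
    "((\<lambda>(m, u). B2 m u) \<longlongrightarrow> (rad \<mu>)\<^sup>2 * ((p + 1) * p - 3 * (p + 1) * q + 2 * q\<^sup>2 + q)) F"
    "((\<lambda>(m, u). sqz m u) \<longlongrightarrow> (rad \<mu>)\<^sup>2) F"
proof -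
  have qp: "-1 < q" "q < p" using assms(1) by (auto simp: Lam_def q_def p_def)
  have fs: "filterlim fst (nhds \<mu>) F" unfolding F_def by (rule filterlim_fst)
  have sn: "filterlim snd (at_right 0) F" unfolding F_def by (rule filterlim_snd)
  have sn0: "(snd \<longlongrightarrow> 0) F" using sn by (simp add: filterlim_at)
  have pos: "eventually (\<lambda>t. 0 \<le> snd t) F"
    using filterlim_iff[THEN iffD1, OF sn] eventually_at_right_less[of "0::real"] by (auto elim!: eventually_mono intro: less_imp_le)
  have m1: "((\<lambda>t. fst (fst t)) \<longlongrightarrow> q) F" "((\<lambda>t. snd (fst t)) \<longlongrightarrow> p) F"
    unfolding q_def p_def by (intro tendsto_intros fs)+
  have w: "((\<lambda>t. snd t powr (fst (fst t) + 1)) \<longlongrightarrow> 0) F"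
    by (rule tendsto_zero_powrI[OF sn0 _ pos, where b = "q + 1"]) (use qp in \<open>auto intro!: tendsto_intros m1\<close>)
  have v: "((\<lambda>t. snd t powr (snd (fst t) - fst (fst t))) \<longlongrightarrow> 0) F"
    by (rule tendsto_zero_powrI[OF sn0 _ pos, where b = "p - q"]) (use qp in \<open>auto intro!: tendsto_intros m1\<close>)
  have Z: "((\<lambda>t. sqz (fst t) (snd t)) \<longlongrightarrow> (rad \<mu>)\<^sup>2) F"
    unfolding sqz_def by (rule tendsto_eq_intros rad_tendsto[OF fs assms(1)] w v m1 refl | (use qp in force))+
  show "((\<lambda>(m, u). sqz m u) \<longlongrightarrow> (rad \<mu>)\<^sup>2) F" using Z by (simp add: case_prod_unfold)
  show "((\<lambda>(m, u). B1 m u) \<longlongrightarrow> - q * (rad \<mu>)\<^sup>2) F"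
    unfolding B1_def Let_def case_prod_beta by (rule tendsto_eq_intros w v Z m1 refl | simp)+
  show "((\<lambda>(m, u). B2 m u) \<longlongrightarrow> (rad \<mu>)\<^sup>2 * ((p + 1) * p - 3 * (p + 1) * q + 2 * q\<^sup>2 + q)) F"
    unfolding B2_def Let_def case_prod_beta 
    by (rule tendsto_eq_intros w v Z m1 refl | simp)+ (simp add: algebra_simps power2_eq_square)
qed

text \<open>A neighbourhood in the product filter contains a box, so one u0 serves all nearby
  parameters.\<close>

lemma eventually_left:
  assumes "eventually (\<lambda>(m, u). P m u) (nhds \<mu> \<times>\<^sub>F at_right (0::real))"
  obtains u0 where "0 < u0" "u0 < 1" "eventually (\<lambda>m. \<forall>u. 0 < u \<and> u < u0 \<longrightarrow> P m u) (nhds \<mu>)"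
proof -
  obtain Pf Pg where P: "eventually Pf (nhds \<mu>)" "eventually Pg (at_right (0::real))" "\<And>m u. Pf m \<Longrightarrow> Pg u \<Longrightarrow> P m u"
    using assms unfolding eventually_prod_filter by auto
  obtain b where b: "b > 0" "\<And>u. 0 < u \<Longrightarrow> u < b \<Longrightarrow> Pg u" using P(2) unfolding eventually_at_right_field by blast
  show ?thesis
  proof (rule that[of "min b (1/2)"])
    show "eventually (\<lambda>m. \<forall>u. 0 < u \<and> u < min b (1/2) \<longrightarrow> P m u) (nhds \<mu>)"
      using P(1) by eventually_elim (use P(3) b(2) in auto)
  qed (use b in auto)
qed

lemma left_near_boundary:
  assumes \<mu>: "\<mu> \<in> Lam"
  shows "filterlim (\<lambda>\<phi>. xinv \<mu> (- rad \<mu> * cos \<phi>) + 1) (at_right 0) (at_right 0)"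
proof -
  have b: "\<bar>- rad \<mu> * cos \<phi>\<bar> \<le> rad \<mu>" for \<phi>
    using rad_pos[OF \<mu>] mult_left_mono[OF abs_cos_le_one[of \<phi>], of "rad \<mu>"] by (simp add: abs_mult)
  have "((\<lambda>\<phi>. xinv \<mu> (- rad \<mu> * cos \<phi>)) \<longlongrightarrow> xinv \<mu> (- rad \<mu>)) (at_right 0)"
    by (rule xinv_tendsto[OF tendsto_const \<mu>]) (use b rad_pos[OF \<mu>] in \<open>auto intro!: tendsto_eq_intros\<close>)
  moreover have "xinv \<mu> (- rad \<mu>) = -1" using xinv_Gc[OF \<mu>, of "-1"] Gc_m1[OF \<mu>] by simp
  ultimately have 1: "((\<lambda>\<phi>. xinv \<mu> (- rad \<mu> * cos \<phi>) + 1) \<longlongrightarrow> 0) (at_right 0)"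
    by (auto intro!: tendsto_eq_intros)
  have "eventually (\<lambda>\<phi>::real. 0 < \<phi> \<and> \<phi> < pi / 2) (at_right 0)"
    using eventually_at_right_real[of 0 "pi/2"] by simp
  hence 2: "eventually (\<lambda>\<phi>. 0 < xinv \<mu> (- rad \<mu> * cos \<phi>) + 1) (at_right 0)"
  proof eventually_elim
    case (elim \<phi>)
    have "0 < cos \<phi>" "cos \<phi> < 1" using elim cos_gt_zero[of \<phi>] cos_monotone_0_pi[of 0 \<phi>] by auto
    hence "\<bar>- rad \<mu> * cos \<phi>\<bar> < rad \<mu>" using rad_pos[OF \<mu>] by (simp add: abs_mult)
    thus ?case using ginv_eq_xinv(2)[OF \<mu>] by fastforce
  qed
  show ?thesis using 1 2 by (auto simp: filterlim_at elim!: eventually_mono)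
qed

lemma left_sin:
  assumes \<mu>: "\<mu> \<in> Lam" and \<phi>: "0 < \<phi>" "\<phi> < pi / 2"
  defines "u \<equiv> xinv \<mu> (- rad \<mu> * cos \<phi>) + 1" and "q \<equiv> fst \<mu>" and "p \<equiv> snd \<mu>"
  shows "\<bar>- rad \<mu> * cos \<phi>\<bar> < rad \<mu>" "- rad \<mu> * cos \<phi> < 0"
    "(rad \<mu>)\<^sup>2 * (sin \<phi>)\<^sup>2 = 2 * u powr (q + 1) * (1 / (q + 1) - u powr (p - q) / (p + 1))"
proof -
  have "0 < cos \<phi>" "cos \<phi> < 1" using \<phi> cos_gt_zero[of \<phi>] cos_monotone_0_pi[of 0 \<phi>] by auto
  thus z: "\<bar>- rad \<mu> * cos \<phi>\<bar> < rad \<mu>" "- rad \<mu> * cos \<phi> < 0" using rad_pos[OF \<mu>] by (auto simp: abs_mult)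
  show "(rad \<mu>)\<^sup>2 * (sin \<phi>)\<^sup>2 = 2 * u powr (q + 1) * (1 / (q + 1) - u powr (p - q) / (p + 1))"
    using left_forms(3)[OF \<mu> z] unfolding u_def q_def p_def sqz_def
    by (simp add: power_mult_distrib cos_squared_eq algebra_simps)
qed

text \<open>On the boundary orbit the energy deficit is R^2 sin^2 \<phi> / 2, and it is at least
  (R^2 / 2) u powr (q + 1) because R^2 / 2 = 1 / (q + 1) - 1 / (p + 1). Hence u powr ((q + 1) / 2)
  \<le> \<phi>, and C = 1 works.\<close>

lemma left_divergence:
  assumes \<mu>: "\<mu> \<in> Lam"
  obtains C where "C > 0" "\<And>\<phi> e. 0 < \<phi> \<Longrightarrow> \<phi> < pi / 2 \<Longrightarrow> e \<ge> (fst \<mu> + 1) / 2 \<Longrightarrow>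
    C / \<phi> \<le> (xinv \<mu> (- rad \<mu> * cos \<phi>) + 1) powr (- e)"
proof -
  define q where "q = fst \<mu>"
  define p where "p = snd \<mu>"
  have qp: "-1 < q" "q < p" using \<mu> by (auto simp: Lam_def q_def p_def)
  define \<kappa> where "\<kappa> = 1 / (q + 1) - 1 / (p + 1)"
  have \<kappa>: "\<kappa> > 0" using qp by (simp add: \<kappa>_def frac_less2)
  have R: "rad \<mu> > 0" "(rad \<mu>)\<^sup>2 = 2 * \<kappa>"
    using rad_pos[OF \<mu>] rad_sq[OF \<mu>] pot_m1[OF qp] by (auto simp: q_def p_def \<kappa>_def)
  show ?thesis
  proof (rule that[of 1])
    fix \<phi> e :: real assume \<phi>: "0 < \<phi>" "\<phi> < pi / 2" and e: "e \<ge> (fst \<mu> + 1) / 2"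
    define u where "u = xinv \<mu> (- rad \<mu> * cos \<phi>) + 1"
    note s = left_sin[OF \<mu> \<phi>]
    note lf = left_forms[OF \<mu> s(1,2), folded u_def q_def p_def]
    have "2 * u powr (q + 1) * \<kappa> \<le> 2 * u powr (q + 1) * (1 / (q + 1) - u powr (p - q) / (p + 1))"
      unfolding \<kappa>_def using lf(4) qp by (intro mult_left_mono diff_left_mono divide_right_mono) auto
    also have "\<dots> = (rad \<mu>)\<^sup>2 * (sin \<phi>)\<^sup>2" using s(3) by (simp add: u_def q_def p_def)
    also have "\<dots> \<le> (rad \<mu>)\<^sup>2 * \<phi>\<^sup>2"
      using sin_x_le_x[of \<phi>] sin_gt_zero[of \<phi>] \<phi> by (intro mult_left_mono power_mono) auto
    finally have "u powr (q + 1) \<le> \<phi>\<^sup>2" using \<kappa> unfolding R(2) by (simp add: mult_le_cancel_left)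
    hence "(u powr ((q + 1) / 2))\<^sup>2 \<le> \<phi>\<^sup>2" using lf(1) by (simp add: power2_eq_square powr_add[symmetric])
    hence h: "u powr ((q + 1) / 2) \<le> \<phi>" by (rule power2_le_imp_le) (use \<phi> in simp)
    have "1 / \<phi> \<le> 1 / u powr ((q + 1) / 2)" using h lf(1) by (intro frac_le) auto
    also have "\<dots> = u powr (- ((q + 1) / 2))" by (simp add: powr_minus_divide)
    also have "\<dots> \<le> u powr (- e)" using lf(1,2) e by (intro powr_mono') (auto simp: q_def)
    finally show "1 / \<phi> \<le> (xinv \<mu> (- rad \<mu> * cos \<phi>) + 1) powr (- e)" by (simp add: u_def)
  qed simp
qed

section \<open>Signs of the derivative of the period\<close>

definition Dom :: "((real \<times> real) \<times> real) set"
  where "Dom = {\<theta>. fst \<theta> \<in> Lam \<and> 0 < snd \<theta> \<and> snd \<theta> < rad (fst \<theta>)}"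

text \<open>By symmetry of the orbits it suffices to integrate over half a turn; \<open>dp\<close> is minus half the derivative of the period.\<close>

definition dp :: "real \<times> real \<Rightarrow> real \<Rightarrow> real"
  where "dp \<mu> r = integral {0..pi} (\<lambda>\<phi>. cos \<phi> * kk1 \<mu> (- r * cos \<phi>))"

definition ee :: "real \<times> real \<Rightarrow> real \<Rightarrow> real"
  where "ee \<mu> r = integral {0..pi} (\<lambda>\<phi>. Phi \<mu> (- r * cos \<phi>) * ((cos \<phi>)\<^sup>2 - (sin \<phi>)\<^sup>2))"

lemma Dom_cont:
  assumes "\<mu> \<in> Lam" "0 < r" "r < rad \<mu>"
  shows "continuous_on S (\<lambda>\<phi>. kk1 \<mu> (- r * cos \<phi>))" "continuous_on S (\<lambda>\<phi>. Phi \<mu> (- r * cos \<phi>))"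
proof -
  interpret smooth_well "pot (fst \<mu>) (snd \<mu>)" "frc (fst \<mu>) (snd \<mu>)" "frc1 (fst \<mu>) (snd \<mu>)" "rad \<mu>" 
    "frc2 (fst \<mu>) (snd \<mu>)" "frc3 (fst \<mu>) (snd \<mu>)" by (rule Lam_well[OF assms(1)])
  show "continuous_on S (\<lambda>\<phi>. kk1 \<mu> (- r * cos \<phi>))"
    unfolding kk1_def by (intro comp_cont_on1 k1_cont assms)
  show "continuous_on S (\<lambda>\<phi>. Phi \<mu> (- r * cos \<phi>))"
    unfolding Phi_def kk_def kk1_def kk2_def by (intro continuous_intros comp_cont_on1 k_cont k1_cont k2_cont assms) auto
qed

lemma arg_bound:
  assumes "0 < r" "r \<le> R" "\<phi> \<in> {0<..<pi} - {pi/2}"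
  shows "\<bar>- r * cos \<phi>\<bar> < R" "- r * cos \<phi> \<noteq> 0"
proof -
  have "cos \<phi> < 1" "cos \<phi> > -1" using cos_monotone_0_pi[of 0 \<phi>] cos_monotone_0_pi[of \<phi> pi] assms(3) by auto
  hence c: "\<bar>cos \<phi>\<bar> < 1" by (simp add: abs_less_iff)
  have "r * \<bar>cos \<phi>\<bar> < r * 1" using c assms(1) by (intro mult_strict_left_mono)
  moreover have "\<bar>- r * cos \<phi>\<bar> = r * \<bar>cos \<phi>\<bar>" using assms(1) by (simp add: abs_mult)
  ultimately show "\<bar>- r * cos \<phi>\<bar> < R" using assms(2) by linarith
  have "cos \<phi> \<noteq> 0" using cos_monotone_0_pi[of \<phi> "pi/2"] cos_monotone_0_pi[of "pi/2" \<phi>] assms(3)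
    by (cases "\<phi> < pi/2") auto
  thus "- r * cos \<phi> \<noteq> 0" using assms(1) by simp
qed

lemma arg_neg_cos_pos: "0 < (r::real) \<Longrightarrow> - r * cos \<phi> < 0 \<Longrightarrow> cos \<phi> > 0"
  using mult_nonneg_nonpos[of r "cos \<phi>"] by (cases "cos \<phi> > 0") auto

lemma fst_at: "filterlim fst (nhds \<mu>) (at (\<mu>, r) within D)"
  using tendsto_fst[OF tendsto_ident_at[of "(\<mu>, r)" D]] by simp

lemma snd_at: "filterlim snd (nhds r) (at (\<mu>, r) within D)"
  using tendsto_snd[OF tendsto_ident_at[of "(\<mu>, r)" D]] by simp

lemma ev_fst: "eventually P (nhds \<mu>) \<Longrightarrow> eventually (\<lambda>\<theta>. P (fst \<theta>)) (at (\<mu>, r) within D)"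
  using fst_at by (rule eventually_compose_filterlim[rotated])

lemma ev_in: "eventually (\<lambda>\<theta>. \<theta> \<in> D) (at a within D)"
  by (simp add: eventually_at_filter)

lemma pointwise:
  assumes "\<mu> \<in> Lam" "0 < r" "r \<le> rad \<mu>" "\<phi> \<in> {0<..<pi} - {pi/2}"
  shows "((\<lambda>\<theta>. kk1 (fst \<theta>) (- snd \<theta> * cos \<phi>)) \<longlongrightarrow> kk1 \<mu> (- r * cos \<phi>)) (at (\<mu>, r) within D)"
    "((\<lambda>\<theta>. Phi (fst \<theta>) (- snd \<theta> * cos \<phi>)) \<longlongrightarrow> Phi \<mu> (- r * cos \<phi>)) (at (\<mu>, r) within D)"
proof -
  have Z: "((\<lambda>\<theta>. - snd \<theta> * cos \<phi>) \<longlongrightarrow> - r * cos \<phi>) (at (\<mu>, r) within D)"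
    by (intro tendsto_intros snd_at)
  note t = kk_tendsto[OF fst_at assms(1) Z arg_bound[OF assms(2-4)]]
  show "((\<lambda>\<theta>. kk1 (fst \<theta>) (- snd \<theta> * cos \<phi>)) \<longlongrightarrow> kk1 \<mu> (- r * cos \<phi>)) (at (\<mu>, r) within D)" by (rule t)
  have q: "fst \<mu> + 1 \<noteq> 0" using assms(1) by (auto simp: Lam_def)
  have f: "((\<lambda>\<theta>. fst (fst \<theta>)) \<longlongrightarrow> fst \<mu>) (at (\<mu>, r) within D)" by (intro tendsto_intros fst_at)
  show "((\<lambda>\<theta>. Phi (fst \<theta>) (- snd \<theta> * cos \<phi>)) \<longlongrightarrow> Phi \<mu> (- r * cos \<phi>)) (at (\<mu>, r) within D)"
    unfolding Phi_def by (intro tendsto_intros t Z rad_tendsto[OF fst_at assms(1)] f q fst_at snd_at) simp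
qed

text \<open>Where \<open>q \<noteq> 0\<close>, the derivative \<open>k'\<close> has near the left end of the well the sign of \<open>-q\<close> and, if \<open>q \<ge> -1/3\<close>,
  a singularity that is not integrable on the boundary orbit.\<close>

lemma dp_diverges:
  assumes \<mu>: "\<mu> \<in> Lam" and q: "fst \<mu> \<noteq> 0" "fst \<mu> \<ge> -1/3"
  shows "eventually (\<lambda>\<theta>. - sgn (fst \<mu>) * dp (fst \<theta>) (snd \<theta>) > c) (at (\<mu>, rad \<mu>) within Dom)"
proof -
  define \<tau> where "\<tau> = - sgn (fst \<mu>)"
  have \<tau>: "\<bar>\<tau>\<bar> = 1" "\<tau> * (- fst \<mu>) = \<bar>fst \<mu>\<bar>" using q(1) by (auto simp: \<tau>_def sgn_real_def)
  define l where "l = \<bar>fst \<mu>\<bar> * (rad \<mu>)\<^sup>2"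
  have l: "l > 0" using q(1) rad_pos[OF \<mu>] by (simp add: l_def)
  have "((\<lambda>t. \<tau> * (case t of (m, u) \<Rightarrow> B1 m u)) \<longlongrightarrow> \<tau> * (- fst \<mu> * (rad \<mu>)\<^sup>2)) (nhds \<mu> \<times>\<^sub>F at_right 0)"
    by (intro tendsto_intros left_limits(1)[OF \<mu>])
  moreover have "\<tau> * (- fst \<mu> * (rad \<mu>)\<^sup>2) = l" unfolding l_def \<tau>(2)[symmetric] by (rule mult.assoc[symmetric])
  ultimately have "eventually (\<lambda>t. \<tau> * (case t of (m, u) \<Rightarrow> B1 m u) > l / 2) (nhds \<mu> \<times>\<^sub>F at_right 0)"
    using l by (intro order_tendstoD(1)) auto
  hence "eventually (\<lambda>(m, u). \<tau> * B1 m u > l / 2) (nhds \<mu> \<times>\<^sub>F at_right 0)" by (simp add: case_prod_unfold)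
  then obtain u0 where u0: "0 < u0" "u0 < 1" "eventually (\<lambda>m. \<forall>u. 0 < u \<and> u < u0 \<longrightarrow> \<tau> * B1 m u > l / 2) (nhds \<mu>)"
    by (rule eventually_left)
  obtain M where M: "M > 0" "eventually (\<lambda>m. m \<in> Lam \<and> (\<forall>z. \<bar>z\<bar> < rad m \<and> z \<noteq> 0 \<and> u0 - 1 \<le> xinv m z \<longrightarrow>
     \<bar>kk m z\<bar> \<le> M \<and> \<bar>kk1 m z\<bar> \<le> M \<and> \<bar>kk2 m z\<bar> \<le> M)) (nhds \<mu>)"
    by (rule kk_bounded[OF \<mu>, of "u0 - 1"]) (use u0 in auto)
  obtain C where C: "C > 0" "\<And>\<phi> e. 0 < \<phi> \<Longrightarrow> \<phi> < pi / 2 \<Longrightarrow> e \<ge> (fst \<mu> + 1) / 2 \<Longrightarrow>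
    C / \<phi> \<le> (xinv \<mu> (- rad \<mu> * cos \<phi>) + 1) powr (- e)" by (rule left_divergence[OF \<mu>]) blast
  let ?u = "\<lambda>\<phi>. xinv \<mu> (- rad \<mu> * cos \<phi>) + 1"
  have B\<mu>: "\<tau> * B1 \<mu> u > l / 2" if "0 < u" "u < u0" for u
    using eventually_nhds_x_imp_x[OF u0(3)] that by blast
  have "eventually (\<lambda>u. u < u0) (at_right 0)" using u0(1) eventually_at_right_field by blast
  hence "eventually (\<lambda>\<phi>. ?u \<phi> < u0) (at_right 0)" using left_near_boundary[OF \<mu>] by (rule eventually_compose_filterlim)
  then obtain b0 where b0: "b0 > 0" "\<And>\<phi>. 0 < \<phi> \<Longrightarrow> \<phi> < b0 \<Longrightarrow> ?u \<phi> < u0" unfolding eventually_at_right_field by blast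
  \<comment> \<open>Below pi / 3 one has cos \<phi> \<ge> 1 / 2; together with the bound l / 2 for
    \<open>B1\<close> this gives the constant C * l / 4.\<close>
  define b where "b = min b0 (pi / 3)"
  have "eventually (\<lambda>\<theta>. integral {0..pi} (\<lambda>\<phi>. \<tau> * (cos \<phi> * kk1 (fst \<theta>) (- snd \<theta> * cos \<phi>))) > c) (at (\<mu>, rad \<mu>) within Dom)"
  proof (rule integral_eventually_gt_divergent[where M = M and C = "C * l / 4" and b = b])
    show "continuous_on {0..pi} (\<lambda>\<phi>. \<tau> * (cos \<phi> * kk1 (fst \<theta>) (- snd \<theta> * cos \<phi>)))" if "\<theta> \<in> Dom" for \<theta>
      using that by (intro continuous_intros Dom_cont) (auto simp: Dom_def)
    show "((\<lambda>\<theta>. \<tau> * (cos \<phi> * kk1 (fst \<theta>) (- snd \<theta> * cos \<phi>))) \<longlongrightarrow> \<tau> * (cos \<phi> * kk1 \<mu> (- rad \<mu> * cos \<phi>))) (at (\<mu>, rad \<mu>) within Dom)"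
      if "\<phi> \<in> {0<..<pi} - {pi/2}" for \<phi>
      by (intro tendsto_intros pointwise) (use \<mu> rad_pos that in auto)
    show "eventually (\<lambda>\<theta>. \<forall>\<phi>\<in>{0<..<pi} - {pi/2}. - M \<le> \<tau> * (cos \<phi> * kk1 (fst \<theta>) (- snd \<theta> * cos \<phi>))) (at (\<mu>, rad \<mu>) within Dom)"
      using ev_fst[OF u0(3)] ev_fst[OF M(2)] ev_in
    proof eventually_elim
      case (elim \<theta>)
      show ?case
      proof
        fix \<phi> assume \<phi>: "\<phi> \<in> {0<..<pi} - {pi/2}"
        let ?z = "- snd \<theta> * cos \<phi>"
        have d: "fst \<theta> \<in> Lam" "0 < snd \<theta>" "snd \<theta> < rad (fst \<theta>)" using elim(3) by (auto simp: Dom_def)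
        have z: "\<bar>?z\<bar> < rad (fst \<theta>)" "?z \<noteq> 0" using arg_bound[OF d(2) less_imp_le[OF d(3)] \<phi>] by auto
        \<comment> \<open>Away from the left end the integrand is bounded by M. Near it no uniform
          bound is at hand, but the sign of \<open>B1\<close> makes the integrand
          nonnegative.\<close>
        show "- M \<le> \<tau> * (cos \<phi> * kk1 (fst \<theta>) ?z)"
        proof (cases "u0 - 1 \<le> xinv (fst \<theta>) ?z")
          case True
          hence "\<bar>kk1 (fst \<theta>) ?z\<bar> \<le> M" using elim(2) z by blast
          hence "\<bar>cos \<phi>\<bar> * \<bar>kk1 (fst \<theta>) ?z\<bar> \<le> 1 * M" using M by (intro mult_mono) auto
          hence "\<bar>\<tau> * (cos \<phi> * kk1 (fst \<theta>) ?z)\<bar> \<le> M" using \<tau>(1) by (simp add: abs_mult)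
          thus ?thesis by linarith
        next
          case False
          have zn: "?z < 0"
          proof (rule ccontr)
            assume "\<not> ?z < 0"
            hence "?z > 0" using z(2) by linarith
            hence "xinv (fst \<theta>) ?z > 0" by (rule xinv_pos[OF d(1) less_imp_le[OF z(1)]])
            thus False using False u0 by linarith
          qed
          note lf = left_forms[OF d(1) z(1) zn]
          have "\<tau> * B1 (fst \<theta>) (xinv (fst \<theta>) ?z + 1) > l / 2" using elim(1) lf(1) False by auto
          moreover have "cos \<phi> > 0" using arg_neg_cos_pos[OF d(2) zn] .
          ultimately have "cos \<phi> * (\<tau> * B1 (fst \<theta>) (xinv (fst \<theta>) ?z + 1)) * (xinv (fst \<theta>) ?z + 1) powr (- 1 - 2 * fst (fst \<theta>)) \<ge> 0"
            using l mult_pos_pos[of "cos \<phi>" "\<tau> * B1 (fst \<theta>) (xinv (fst \<theta>) ?z + 1)"]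
            by (intro mult_nonneg_nonneg[OF less_imp_le powr_ge_zero]) linarith
          hence "\<tau> * (cos \<phi> * kk1 (fst \<theta>) ?z) \<ge> 0" unfolding lf(5) by (simp add: mult_ac)
          thus ?thesis using M(1) by linarith
        qed
      qed
    qed
    show "C * l / 4 / \<phi> \<le> \<tau> * (cos \<phi> * kk1 \<mu> (- rad \<mu> * cos \<phi>))" if \<phi>: "\<phi> \<in> {0<..<b} - {pi/2}" for \<phi>
    proof -
      have \<phi>': "0 < \<phi>" "\<phi> < pi / 2" "\<phi> < pi / 3" "\<phi> < b0" using \<phi> by (auto simp: b_def)
      note lf = left_forms[OF \<mu> left_sin(1,2)[OF \<mu> \<phi>'(1,2)]]
      have c2: "cos \<phi> \<ge> 1 / 2" using cos_monotone_0_pi_le[of \<phi> "pi/3"] \<phi>' cos_60 by simp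
      \<comment> \<open>The condition 1 + 2 q \<ge> (q + 1) / 2 is exactly q \<ge> -1/3.\<close>
      have "C / \<phi> \<le> ?u \<phi> powr (- (1 + 2 * fst \<mu>))" using q(2) by (intro C(2) \<phi>') auto
      moreover have "\<tau> * B1 \<mu> (?u \<phi>) > l / 2" using B\<mu> lf(1) b0(2) \<phi>' by auto
      ultimately have "(1 / 2) * (l / 2) * (C / \<phi>) \<le> cos \<phi> * (\<tau> * B1 \<mu> (?u \<phi>)) * ?u \<phi> powr (- (1 + 2 * fst \<mu>))"
        using c2 C(1) l \<phi>' by (intro mult_mono) auto
      thus ?thesis unfolding lf(5) by (simp add: mult_ac)
    qed
    show "b \<le> pi" unfolding b_def using pi_gt_zero by linarith
  qed (use C l b0 in \<open>auto simp: b_def\<close>)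
  thus ?thesis by (simp add: dp_def \<tau>_def)
qed

text \<open>At q = 0 the bracket is p T / u^2 times V2 E - 3 u f^2 with T = u powr p. Dividing by
  \<open>E\<close> isolates V2 and leaves \<open>Q\<close>, with Q(1) = 0 and derivative (p - 1) (2
  p + 1) (T - 1)^3 / E^2, whose sign is known on each side of 1. Where E \<le> 0, possible only for
  p < 1, no term of V2 E - 3 u f^2 is positive.\<close>

lemma P_sign:
  fixes p u :: real
  assumes p: "p > 0" "p \<noteq> 1" and u: "u > 0" "u \<noteq> 1"
  defines "V2 \<equiv> 2 * pot 0 p (u - 1)" and "f \<equiv> frc 0 p (u - 1)" and "f1 \<equiv> frc1 0 p (u - 1)" and "f2 \<equiv> frc2 0 p (u - 1)"
  shows "(p - 1) * (3 * V2 * f1\<^sup>2 - 3 * f\<^sup>2 * f1 - V2 * f * f2) > 0"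
proof -
  define E where "E t = (2 * p + 1) * t powr p + (p - 1)" for t :: real
  define Q where "Q t = 2 * pot 0 p (t - 1) - 3 * t * (t powr p - 1)\<^sup>2 / E t" for t :: real
  have dQ: "(Q has_real_derivative (p - 1) * (2 * p + 1) * (t powr p - 1) ^ 3 / (E t)\<^sup>2) (at t)"
    if t: "t > 0" "E t > 0" for t
  proof -
    define T where "T = t powr p"
    have dT: "((\<lambda>t. t powr p) has_real_derivative p * T / t) (at t)"
      using t by (auto intro!: derivative_eq_intros simp: T_def powr_diff)
    have dV: "((\<lambda>t. pot 0 p (t - 1)) has_real_derivative T - 1) (at t)"
      using DERIV_shift[of "pot 0 p" "frc 0 p (t - 1)" t "-1"] pot_deriv[of "t - 1" 0 p] t
      by (simp add: frc_def T_def)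
    have dE: "(E has_real_derivative (2 * p + 1) * (p * T / t)) (at t)"
      unfolding E_def[abs_def] by (rule dT derivative_eq_intros refl)+ simp
    have "(Q has_real_derivative 2 * (T - 1) - ((3 * (T - 1)\<^sup>2 + 3 * t * (2 * (T - 1) * (p * T / t))) * E t - 3 * t * (T - 1)\<^sup>2 * ((2 * p + 1) * (p * T / t))) / (E t * E t)) (at t)"
      unfolding Q_def using t
      by - (rule dT dV dE derivative_eq_intros refl | (simp add: T_def; fail))+
    moreover have "2 * (T - 1) - ((3 * (T - 1)\<^sup>2 + 3 * t * (2 * (T - 1) * (p * T / t))) * E t - 3 * t * (T - 1)\<^sup>2 * ((2 * p + 1) * (p * T / t))) / (E t * E t)
      = (p - 1) * (2 * p + 1) * (T - 1) ^ 3 / (E t)\<^sup>2"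
    proof -
      define e where "e = E t"
      have e: "e = (2 * p + 1) * T + (p - 1)" by (simp add: e_def E_def T_def)
      have "2 * (T - 1) * (e * e) - ((3 * (T - 1)\<^sup>2 + 6 * (T - 1) * (p * T)) * e - 3 * (T - 1)\<^sup>2 * ((2 * p + 1) * (p * T)))
         = (p - 1) * (2 * p + 1) * (T - 1) ^ 3" unfolding e by algebra
      moreover have "e > 0" using t by (simp add: e_def)
      ultimately have "2 * (T - 1) - ((3 * (T - 1)\<^sup>2 + 6 * (T - 1) * (p * T)) * e - 3 * (T - 1)\<^sup>2 * ((2 * p + 1) * (p * T))) / (e * e)
        = (p - 1) * (2 * p + 1) * (T - 1) ^ 3 / (e * e)" by (simp add: divide_simps)
      thus ?thesis using t unfolding e_def by (simp add: power2_eq_square mult_ac)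
    qed
    ultimately show ?thesis by (simp add: T_def)
  qed
  define T where "T = u powr p"
  have f: "f = T - 1" using u by (simp add: f_def frc_def T_def)
  have f1: "f1 = p * (T / u)" using u by (simp add: f1_def frc1_def T_def powr_diff)
  have f2: "f2 = p * (p - 1) * (T / u\<^sup>2)" using u by (simp add: f2_def frc2_def T_def powr_diff powr_numeral)
  have T: "T > 0" using u by (simp add: T_def)
  have T1: "T \<noteq> 1" using u p unfolding T_def by (metis powr_eq_one_iff_gen order_less_irrefl)
  have V2: "V2 > 0" unfolding V2_def using pot_pos[of 0 p "u - 1"] p u by simp
  have main: "3 * V2 * f1\<^sup>2 - 3 * f\<^sup>2 * f1 - V2 * f * f2 = p * (T / u\<^sup>2) * (V2 * E u - 3 * u * f\<^sup>2)"
    unfolding f f1 f2 E_def T_def[symmetric] using u by (simp add: field_simps power2_eq_square)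
  have c: "p * (T / u\<^sup>2) > 0" using p T u by simp
  show ?thesis
  proof (cases "E u > 0")
    case False
    have "(2 * p + 1) * T > 0" using p T by simp
    hence p1: "p < 1" using False unfolding E_def T_def[symmetric] by linarith
    have "3 * u * f\<^sup>2 > 0" using u T1 f by simp
    moreover have "V2 * E u \<le> 0" using V2 False by (simp add: mult_nonneg_nonpos)
    ultimately have "V2 * E u - 3 * u * f\<^sup>2 < 0" by linarith
    hence "p * (T / u\<^sup>2) * (V2 * E u - 3 * u * f\<^sup>2) < 0" by (rule mult_pos_neg[OF c])
    thus ?thesis unfolding main using p1 by (intro mult_neg_neg) auto
  next
    case True
    have E1: "E 1 > 0" using p by (simp add: E_def)
    have Emono: "E s \<le> E t" if "0 < s" "s \<le> t" for s t
      using that p unfolding E_def by (intro add_right_mono mult_left_mono powr_mono2) auto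
    have Q1: "Q 1 = 0" by (simp add: Q_def)
    have dQ': "((\<lambda>t. (p - 1) * Q t) has_real_derivative (p - 1)\<^sup>2 * (2 * p + 1) * (t powr p - 1) ^ 3 / (E t)\<^sup>2) (at t)"
      if "t > 0" "E t > 0" for t
      using DERIV_cmult[OF dQ[OF that], of "p - 1"] by (simp add: power2_eq_square mult_ac)
    have pp: "(p - 1)\<^sup>2 * (2 * p + 1) > 0" using p by simp
    have "(p - 1) * Q u > (p - 1) * Q 1"
    proof (cases "u > 1")
      case True
      have Et: "E t > 0" if "1 \<le> t" for t using Emono[of 1 t] E1 that by simp
      show ?thesis
      proof (rule DERIV_pos_imp_increasing_open[OF True])
        fix t assume t: "1 < t" "t < u"
        have "t powr p > 1" using t p by (simp add: gr_one_powr)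
        hence "(p - 1)\<^sup>2 * (2 * p + 1) * (t powr p - 1) ^ 3 / (E t)\<^sup>2 > 0"
          by (intro divide_pos_pos mult_pos_pos[OF pp]) (use Et[of t] t in auto)
        thus "\<exists>y. ((\<lambda>t. (p - 1) * Q t) has_real_derivative y) (at t) \<and> y > 0" using dQ'[of t] Et[of t] t by auto
      next
        show "continuous_on {1..u} (\<lambda>t. (p - 1) * Q t)"
          by (rule continuous_at_imp_continuous_on) (use DERIV_isCont[OF dQ'] Et in auto)
      qed
    next
      case False
      hence u1: "u < 1" using u by simp
      have Et: "E t > 0" if "u \<le> t" for t using Emono[of u t] True u that by simp
      show ?thesis
      proof (rule DERIV_neg_imp_decreasing_open[OF u1])
        fix t assume t: "u < t" "t < 1"
        have "t powr p < 1" using t p u powr_less_mono2[of p t 1] by simp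
        hence "(t powr p - 1) ^ 3 < 0" by (simp add: power_less_zero_eq)
        hence "(p - 1)\<^sup>2 * (2 * p + 1) * (t powr p - 1) ^ 3 / (E t)\<^sup>2 < 0"
          by (intro divide_neg_pos mult_pos_neg[OF pp]) (use Et[of t] t in auto)
        thus "\<exists>y. ((\<lambda>t. (p - 1) * Q t) has_real_derivative y) (at t) \<and> y < 0" using dQ'[of t] Et[of t] t u by auto
      next
        show "continuous_on {u..1} (\<lambda>t. (p - 1) * Q t)"
          by (rule continuous_at_imp_continuous_on) (use DERIV_isCont[OF dQ'] Et u in auto)
      qed
    qed
    hence Qu: "(p - 1) * Q u > 0" by (simp add: Q1)
    have "V2 * E u - 3 * u * f\<^sup>2 = Q u * E u"
      using True by (simp add: Q_def V2_def f T_def field_simps)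
    hence "(p - 1) * (p * (T / u\<^sup>2) * (V2 * E u - 3 * u * f\<^sup>2)) = p * (T / u\<^sup>2) * ((p - 1) * Q u * E u)" by simp
    also have "\<dots> > 0" by (rule mult_pos_pos[OF c mult_pos_pos[OF Qu True]])
    finally show ?thesis unfolding main .
  qed
qed

lemma kk1_monotone:
  assumes p: "p > 0" "p \<noteq> 1" and z: "\<bar>z\<bar> < rad (0, p)" "z \<noteq> 0"
  shows "(1 - p) * z * (kk1 (0, p) z - kk1 (0, p) 0) < 0"
proof -
  have \<mu>: "(0, p) \<in> Lam" using p by (simp add: Lam_def)
  interpret smooth_well "pot 0 p" "frc 0 p" "frc1 0 p" "rad (0, p)" "frc2 0 p" "frc3 0 p"
    using Lam_well[OF \<mu>] by simp
  have kk: "kk1 (0, p) = k1" "kk2 (0, p) = k2" by (simp_all add: kk1_def kk2_def)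
  have k2s: "(p - 1) * k2 w > 0" if w: "\<bar>w\<bar> < rad (0, p)" "w \<noteq> 0" for w
  proof -
    let ?x = "xinv (0, p) w"
    have x: "?x > -1" using ginv_eq_xinv(2)[OF \<mu> w(1)] .
    have xw: "?x > 0 \<longleftrightarrow> w > 0" "?x < 0 \<longleftrightarrow> w < 0"
      using xinv_pos[OF \<mu>, of w] xinv_neg[OF \<mu>, of w] w by force+
    have pw: "2 * pot 0 p ?x = w\<^sup>2" using pot_xinv[OF \<mu>, of w] w by simp
    have P: "(p - 1) * (3 * w\<^sup>2 * (frc1 0 p ?x)\<^sup>2 - 3 * (frc 0 p ?x)\<^sup>2 * frc1 0 p ?x - w\<^sup>2 * frc 0 p ?x * frc2 0 p ?x) > 0"
    proof -
      have "?x \<noteq> 0" using xw w(2) by auto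
      thus ?thesis using P_sign[OF p, of "?x + 1"] x by (simp add: pw)
    qed
    have s: "w / frc 0 p ?x ^ 5 > 0"
    proof (cases "w > 0")
      case True
      thus ?thesis using frc_sgn(1)[of 0 p ?x] p x xw by simp
    next
      case False
      hence "frc 0 p ?x ^ 5 < 0" using frc_sgn(2)[of 0 p ?x] p x xw w by (simp add: power_less_zero_eq)
      thus ?thesis using False w by (simp add: divide_neg_neg)
    qed
    have "k2 w = (w / frc 0 p ?x ^ 5) * (3 * w\<^sup>2 * (frc1 0 p ?x)\<^sup>2 - 3 * (frc 0 p ?x)\<^sup>2 * frc1 0 p ?x - w\<^sup>2 * frc 0 p ?x * frc2 0 p ?x)"
      using kk_formulas(4)[OF \<mu> w] unfolding kk fst_conv snd_conv by (simp only: times_divide_eq_left)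
    hence "(p - 1) * k2 w = (w / frc 0 p ?x ^ 5) * ((p - 1) * (3 * w\<^sup>2 * (frc1 0 p ?x)\<^sup>2 - 3 * (frc 0 p ?x)\<^sup>2 * frc1 0 p ?x - w\<^sup>2 * frc 0 p ?x * frc2 0 p ?x))"
      by simp
    thus ?thesis using mult_pos_pos[OF s P] by simp
  qed
  have d: "((\<lambda>z. (p - 1) * k1 z) has_real_derivative (p - 1) * k2 w) (at w)" if "\<bar>w\<bar> < rad (0, p)" for w
    by (rule DERIV_cmult[OF k1_deriv[OF that]])
  have cont: "continuous_on {a..b} (\<lambda>z. (p - 1) * k1 z)" if "\<bar>a\<bar> < rad (0, p)" "\<bar>b\<bar> < rad (0, p)" for a b
    by (rule continuous_at_imp_continuous_on) (use DERIV_isCont[OF d] that in \<open>auto simp: abs_less_iff\<close>)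
  \<comment> \<open>\<open>k2s\<close> gives the sign of \<open>k2\<close> only off 0, so the
    interval must lie on one side of 0.\<close>
  have mono: "(p - 1) * k1 a < (p - 1) * k1 b" if "a < b" "\<bar>a\<bar> < rad (0, p)" "\<bar>b\<bar> < rad (0, p)" "b \<le> 0 \<or> 0 \<le> a" for a b
  proof (rule DERIV_pos_imp_increasing_open[OF that(1)])
    fix t assume "a < t" "t < b"
    hence "\<bar>t\<bar> < rad (0, p)" "t \<noteq> 0" using that by auto
    thus "\<exists>y. ((\<lambda>z. (p - 1) * k1 z) has_real_derivative y) (at t) \<and> y > 0" using d[of t] k2s[of t] by blast
  qed (rule cont[OF that(2,3)])
  have R: "\<bar>0\<bar> < rad (0, p)" using R_pos by simp
  have "z * ((p - 1) * k1 z - (p - 1) * k1 0) > 0"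
  proof (cases "z > 0")
    case True thus ?thesis using mono[OF True R z(1)] by simp
  next
    case False
    hence zn: "z < 0" using z by simp
    show ?thesis using mono[OF zn z(1) R] zn by (simp add: mult_neg_neg)
  qed
  thus ?thesis unfolding kk by (simp add: algebra_simps)
qed

lemma integral_pos_on:
  fixes f :: "real \<Rightarrow> real"
  assumes c: "continuous_on {a..b} f" and nn: "\<And>x. x \<in> {a..b} \<Longrightarrow> f x \<ge> 0" and i: "a \<le> c" "c < d" "d \<le> b"
    and pos: "\<And>x. x \<in> {c..d} \<Longrightarrow> f x > 0"
  shows "integral {c..d} f > 0" "integral {c..d} f \<le> integral {a..b} f"
proof -
  have cc: "continuous_on {c..d} f" by (rule continuous_on_subset[OF c]) (use i in auto)
  have "compact {c..d}" "{c..d} \<noteq> {}" using i by auto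
  then obtain m where m: "m \<in> {c..d}" "\<And>x. x \<in> {c..d} \<Longrightarrow> f m \<le> f x" using continuous_attains_inf[OF _ _ cc] by metis
  have "0 < f m * (d - c)" using pos[OF m(1)] i by simp
  also have "\<dots> = integral {c..d} (\<lambda>_. f m)" using i by simp
  also have "\<dots> \<le> integral {c..d} f" by (intro integral_le integrable_continuous_real cc m) auto
  finally show "integral {c..d} f > 0" .
  show "integral {c..d} f \<le> integral {a..b} f"
    by (intro integral_subset_le integrable_continuous_real c cc) (use nn i in auto)
qed

text \<open>Since cos integrates to 0 over a half turn, the constant \<open>kk1 (0, p) 0\<close> may
  be subtracted inside the integral defining \<open>dp\<close>. Afterwards the integrand has one
  sign, because the sign of k' - k'(0) follows that of z = - r cos \<phi>.\<close>

lemma weighted_monotone: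
  assumes p: "p > 0" "p \<noteq> 1" and r: "0 < r" "r \<le> rad (0, p)" and \<phi>: "0 < \<phi>" "\<phi> < pi"
  defines "w \<equiv> \<lambda>\<phi>. sgn (1 - p) * (cos \<phi> * (kk1 (0, p) (- r * cos \<phi>) - kk1 (0, p) 0))"
  shows "w \<phi> \<ge> 0" "\<phi> < pi / 2 \<Longrightarrow> w \<phi> > 0"
proof -
  have pos: "w \<phi> > 0" if "\<phi> \<noteq> pi / 2"
  proof -
    have \<phi>': "\<phi> \<in> {0<..<pi} - {pi/2}" using \<phi> that by auto
    let ?z = "- r * cos \<phi>" and ?d = "kk1 (0, p) (- r * cos \<phi>) - kk1 (0, p) 0"
    have "(1 - p) * ?z * ?d < 0" by (rule kk1_monotone[OF p]) (use arg_bound[OF r \<phi>'] in auto)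
    hence "r * ((1 - p) * cos \<phi> * ?d) > 0" by (simp add: mult_ac)
    hence "(1 - p) * cos \<phi> * ?d > 0" using r(1) by (simp add: zero_less_mult_iff)
    hence "(sgn (1 - p) * \<bar>1 - p\<bar>) * cos \<phi> * ?d > 0" by (simp only: sgn_mult_abs)
    hence "\<bar>1 - p\<bar> * w \<phi> > 0" by (simp only: w_def mult_ac)
    thus ?thesis using p(2) by (simp add: zero_less_mult_iff)
  qed
  have "w (pi / 2) = 0" by (simp add: w_def)
  thus "w \<phi> \<ge> 0" using pos by (metis less_imp_le order_refl)
  show "\<phi> < pi / 2 \<Longrightarrow> w \<phi> > 0" using pos by simp
qed

text \<open>The sign at q = 0 on an interior orbit persists for nearby parameters. This supplies the
  inner end of the interval in which a zero is later trapped for q \<noteq> 0.\<close>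

lemma dp_sign_interior:
  assumes p: "p > 0" "p \<noteq> 1" and r: "0 < r" "r < rad (0, p)"
  shows "eventually (\<lambda>\<theta>. sgn (1 - p) * dp (fst \<theta>) (snd \<theta>) > 0) (at ((0, p), r) within Dom)"
proof -
  let ?\<mu> = "(0::real, p)" and ?\<sigma> = "sgn (1 - p)"
  have \<mu>: "?\<mu> \<in> Lam" using p by (simp add: Lam_def)
  \<comment> \<open>The midpoint between -1 and the leftmost point of the orbit, so that nearby
    orbits stay to its right.\<close>
  define \<alpha> where "\<alpha> = (xinv ?\<mu> (- r) - 1) / 2"
  have x: "xinv ?\<mu> (-r) > -1" "xinv ?\<mu> (-r) < 0"
    using ginv_eq_xinv(2)[OF \<mu>, of "-r"] xinv_neg[OF \<mu>, of "-r"] r by auto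
  have \<alpha>: "-1 < \<alpha>" "\<alpha> \<le> 0" "\<alpha> < xinv ?\<mu> (-r)" using x by (auto simp: \<alpha>_def field_simps)
  obtain M where M: "M > 0" "eventually (\<lambda>m. m \<in> Lam \<and> (\<forall>z. \<bar>z\<bar> < rad m \<and> z \<noteq> 0 \<and> \<alpha> \<le> xinv m z \<longrightarrow>
     \<bar>kk m z\<bar> \<le> M \<and> \<bar>kk1 m z\<bar> \<le> M \<and> \<bar>kk2 m z\<bar> \<le> M)) (nhds ?\<mu>)"
    by (rule kk_bounded[OF \<mu> \<alpha>(1,2)])
  have "((\<lambda>\<theta>. xinv (fst \<theta>) (- snd \<theta>)) \<longlongrightarrow> xinv ?\<mu> (- r)) (at (?\<mu>, r) within Dom)"
  proof (rule xinv_tendsto[OF fst_at \<mu>])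
    show "eventually (\<lambda>\<theta>. \<bar>- snd \<theta>\<bar> \<le> rad (fst \<theta>)) (at (?\<mu>, r) within Dom)"
      using ev_in by eventually_elim (auto simp: Dom_def)
  qed (use r in \<open>auto intro!: tendsto_intros snd_at\<close>)
  hence ex: "eventually (\<lambda>\<theta>. xinv (fst \<theta>) (- snd \<theta>) > \<alpha>) (at (?\<mu>, r) within Dom)"
    using \<alpha>(3) by (rule order_tendstoD(1))
  let ?h = "\<lambda>\<phi>. ?\<sigma> * (cos \<phi> * kk1 ?\<mu> (- r * cos \<phi>))"
  let ?w = "\<lambda>\<phi>. ?\<sigma> * (cos \<phi> * (kk1 ?\<mu> (- r * cos \<phi>) - kk1 ?\<mu> 0))"
  have hc: "continuous_on S ?h" for S by (intro continuous_intros Dom_cont \<mu> r)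
  have wc: "continuous_on S ?w" for S by (intro continuous_intros Dom_cont \<mu> r)
  have int: "integral {0..pi} ?h > 0"
  proof -
    have cosi: "((\<lambda>\<phi>. ?\<sigma> * (cos \<phi> * kk1 ?\<mu> 0)) has_integral 0) {0..pi}"
    proof -
      have "(cos has_integral (sin pi - sin 0)) {0..pi}"
        by (rule fundamental_theorem_of_calculus)
           (auto intro!: derivative_eq_intros simp flip: has_real_derivative_iff_has_vector_derivative)
      hence "((\<lambda>\<phi>. (?\<sigma> * kk1 ?\<mu> 0) * cos \<phi>) has_integral (?\<sigma> * kk1 ?\<mu> 0) * (sin pi - sin 0)) {0..pi}"
        by (rule has_integral_mult_right)
      thus ?thesis by (simp add: mult_ac)
    qed
    have "(?w has_integral integral {0..pi} ?w) {0..pi}" by (intro integrable_integral integrable_continuous_real wc)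
    from has_integral_add[OF this cosi] have "(?h has_integral integral {0..pi} ?w) {0..pi}"
      by (simp add: algebra_simps)
    moreover have nn: "?w \<phi> \<ge> 0" if "\<phi> \<in> {0..pi}" for \<phi>
    proof -
      from that consider "\<phi> = 0" | "\<phi> = pi" | "0 < \<phi>" "\<phi> < pi" by fastforce
      thus "?w \<phi> \<ge> 0"
      proof cases
        case 3 thus ?thesis using weighted_monotone(1)[OF p r(1) less_imp_le[OF r(2)]] by blast
      next
        case 1
        have "(1 - p) * (- r) * (kk1 ?\<mu> (- r) - kk1 ?\<mu> 0) < 0" by (rule kk1_monotone[OF p]) (use r in auto)
        hence "r * ((1 - p) * (kk1 ?\<mu> (- r) - kk1 ?\<mu> 0)) > 0" by (simp add: mult_ac)
        hence "(1 - p) * (kk1 ?\<mu> (- r) - kk1 ?\<mu> 0) > 0" using r by (simp add: zero_less_mult_iff)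
        thus ?thesis using 1 by (auto simp: zero_less_mult_iff sgn_real_def)
      next
        case 2
        have "(1 - p) * r * (kk1 ?\<mu> r - kk1 ?\<mu> 0) < 0" by (rule kk1_monotone[OF p]) (use r in auto)
        hence "r * ((1 - p) * (kk1 ?\<mu> 0 - kk1 ?\<mu> r)) > 0" by (simp add: algebra_simps)
        hence "(1 - p) * (kk1 ?\<mu> 0 - kk1 ?\<mu> r) > 0" using r by (simp add: zero_less_mult_iff)
        thus ?thesis using 2 by (auto simp: zero_less_mult_iff sgn_real_def)
      qed
    qed
    \<comment> \<open>A sample interval strictly inside (0, pi/2), where the inequality is
      strict.\<close>
    moreover have pp: "?w \<phi> > 0" if "\<phi> \<in> {pi/6..pi/3}" for \<phi>
    proof -
      have "pi / 6 \<le> \<phi>" "\<phi> \<le> pi / 3" using that by auto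
      hence "0 < \<phi>" "\<phi> < pi" "\<phi> < pi / 2" using pi_gt_zero by linarith+
      thus "?w \<phi> > 0" using weighted_monotone(2)[OF p r(1) less_imp_le[OF r(2)]] by blast
    qed
    moreover have "integral {pi/6..pi/3} ?w > 0"
      by (rule integral_pos_on(1)[where a = 0 and b = pi, OF wc nn]) (use pp in auto)
    moreover have "integral {pi/6..pi/3} ?w \<le> integral {0..pi} ?w"
      by (rule integral_pos_on(2)[OF wc nn]) (use pp in auto)
    ultimately show ?thesis using integral_unique[of ?h] by simp
  qed
  have "eventually (\<lambda>\<theta>. integral {0..pi} (\<lambda>\<phi>. ?\<sigma> * (cos \<phi> * kk1 (fst \<theta>) (- snd \<theta> * cos \<phi>))) > 0) (at (?\<mu>, r) within Dom)"
  proof (rule integral_eventually_gt[where M = M and h = ?h and a = 0 and b = pi and ?g0.0 = ?h])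
    show "continuous_on {0..pi} (\<lambda>\<phi>. ?\<sigma> * (cos \<phi> * kk1 (fst \<theta>) (- snd \<theta> * cos \<phi>)))" if "\<theta> \<in> Dom" for \<theta>
      using that by (intro continuous_intros Dom_cont) (auto simp: Dom_def)
    show "((\<lambda>\<theta>. ?\<sigma> * (cos \<phi> * kk1 (fst \<theta>) (- snd \<theta> * cos \<phi>))) \<longlongrightarrow> ?h \<phi>) (at (?\<mu>, r) within Dom)"
      if "\<phi> \<in> {0<..<pi} - {pi/2}" for \<phi>
      by (intro tendsto_intros pointwise) (use \<mu> r that in auto)
    show "eventually (\<lambda>\<theta>. \<forall>\<phi>\<in>{0<..<pi} - {pi/2}. - M \<le> ?\<sigma> * (cos \<phi> * kk1 (fst \<theta>) (- snd \<theta> * cos \<phi>))) (at (?\<mu>, r) within Dom)"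
      using ev_fst[OF M(2)] ex ev_in
    proof eventually_elim
      case (elim \<theta>)
      show ?case
      proof
        fix \<phi> assume \<phi>: "\<phi> \<in> {0<..<pi} - {pi/2}"
        let ?z = "- snd \<theta> * cos \<phi>"
        have d: "fst \<theta> \<in> Lam" "0 < snd \<theta>" "snd \<theta> < rad (fst \<theta>)" using elim(3) by (auto simp: Dom_def)
        have z: "\<bar>?z\<bar> < rad (fst \<theta>)" "?z \<noteq> 0" using arg_bound[OF d(2) less_imp_le[OF d(3)] \<phi>] by auto
        have "snd \<theta> * cos \<phi> \<le> snd \<theta> * 1" using d(2) by (intro mult_left_mono) auto
        hence "- snd \<theta> \<le> ?z" by simp
        moreover have "Gc (fst \<theta>) (xinv (fst \<theta>) (- snd \<theta>)) = - snd \<theta>" "xinv (fst \<theta>) (- snd \<theta>) \<ge> -1"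
          using xinv_props[OF d(1), of "- snd \<theta>"] d by auto
        ultimately have "xinv (fst \<theta>) (- snd \<theta>) \<le> xinv (fst \<theta>) ?z"
          using xinv_less_iff(1)[OF d(1), of ?z "xinv (fst \<theta>) (- snd \<theta>)"] z(1) by force
        hence "\<bar>kk1 (fst \<theta>) ?z\<bar> \<le> M" using elim(1,2) z by force
        hence "\<bar>cos \<phi>\<bar> * \<bar>kk1 (fst \<theta>) ?z\<bar> \<le> 1 * M" using M by (intro mult_mono) auto
        hence "\<bar>?\<sigma> * (cos \<phi> * kk1 (fst \<theta>) ?z)\<bar> \<le> M" using p(2) by (simp add: abs_mult abs_sgn_eq)
        thus "- M \<le> ?\<sigma> * (cos \<phi> * kk1 (fst \<theta>) ?z)" by linarith
      qed
    qed
  qed (use hc int in auto)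
  thus ?thesis by (simp add: dp_def)
qed

section \<open>Integration by parts on the boundary orbit for \<open>q = 0\<close>\<close>

context smooth_well begin

text \<open>The antiderivative from \<open>EE_eq\<close> at r = R and A = 1: the terms with R^2 -
  r^2 drop out and only the integrand of T' remains. Only the open half turn is covered because the
  derivative rules for \<open>k\<close> and \<open>k1\<close> require |z| < R.\<close>

lemma boundary_antideriv:
  assumes \<phi>: "0 < \<phi>" "\<phi> < pi"
  shows "((\<lambda>\<phi>. R / 2 * (sin \<phi> - 2 * sin \<phi> ^ 3) * k1 (- R * cos \<phi>) + sin \<phi> * cos \<phi> * k (- R * cos \<phi>)) has_real_derivative
     \<Phi> 1 (- R * cos \<phi>) * ((cos \<phi>)\<^sup>2 - (sin \<phi>)\<^sup>2) - R / 2 * (cos \<phi> * k1 (- R * cos \<phi>))) (at \<phi>)"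
proof -
  let ?z = "\<lambda>\<phi>. - R * cos \<phi>"
  have "cos \<phi> < 1" "cos \<phi> > -1" using cos_monotone_0_pi[of 0 \<phi>] cos_monotone_0_pi[of \<phi> pi] \<phi> by auto
  hence c: "\<bar>cos \<phi>\<bar> < 1" by (simp add: abs_less_iff)
  have z: "\<bar>?z \<phi>\<bar> < R" using mult_strict_left_mono[OF c R_pos] R_pos by (simp add: abs_mult)
  have dz: "(?z has_real_derivative R * sin \<phi>) (at \<phi>)" by (auto intro!: derivative_eq_intros)
  define \<kappa> where "\<kappa> \<phi> = k (?z \<phi>)" for \<phi>
  define \<kappa>1 where "\<kappa>1 \<phi> = k1 (?z \<phi>)" for \<phi>
  define \<kappa>2 where "\<kappa>2 \<phi> = k2 (?z \<phi>)" for \<phi>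
  have d: "(\<kappa> has_real_derivative \<kappa>1 \<phi> * (R * sin \<phi>)) (at \<phi>)" "(\<kappa>1 has_real_derivative \<kappa>2 \<phi> * (R * sin \<phi>)) (at \<phi>)"
    unfolding \<kappa>_def[abs_def] \<kappa>1_def[abs_def] \<kappa>2_def
    by (rule DERIV_chain2[where f = k, OF k_deriv[OF z] dz] DERIV_chain2[where f = k1, OF k1_deriv[OF z] dz])+
  have s2: "(R\<^sup>2 - (?z \<phi>)\<^sup>2) / 2 = R\<^sup>2 * (sin \<phi>)\<^sup>2 / 2"
    by (simp add: power_mult_distrib cos_squared_eq field_simps)
  have c2: "cos \<phi> * cos \<phi> = 1 - sin \<phi> * sin \<phi>" using cos_squared_eq[of \<phi>] by (simp add: power2_eq_square)
  have c3: "cos \<phi> * (cos \<phi> * x) = (1 - sin \<phi> * sin \<phi>) * x" for x using c2 by (simp add: mult.assoc[symmetric])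
  have "((\<lambda>\<phi>. R / 2 * (sin \<phi> - 2 * sin \<phi> ^ 3) * \<kappa>1 \<phi> + sin \<phi> * cos \<phi> * \<kappa> \<phi>) has_real_derivative
     (R\<^sup>2 * (sin \<phi>)\<^sup>2 / 2 * \<kappa>2 \<phi> + (1 - 2) * (- R * cos \<phi>) * \<kappa>1 \<phi> + (2 * 1 - 1) * \<kappa> \<phi>) * ((cos \<phi>)\<^sup>2 - (sin \<phi>)\<^sup>2)
       - R / 2 * (cos \<phi> * \<kappa>1 \<phi>)) (at \<phi>)"
    apply (auto intro!: derivative_eq_intros d)
    apply (simp add: field_simps power2_eq_square power3_eq_cube c2 c3)
    done
  thus ?thesis unfolding \<Phi>_def s2 \<kappa>_def \<kappa>1_def \<kappa>2_def .
qed

end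

lemma left_filter:
  assumes \<mu>: "\<mu> \<in> Lam" and P: "eventually P (at_right 0)"
  shows "eventually (\<lambda>\<phi>. P (xinv \<mu> (- rad \<mu> * cos \<phi>) + 1)) (at_right 0)"
  using P left_near_boundary[OF \<mu>] by (rule eventually_compose_filterlim)

lemma left_limit_at:
  assumes "((\<lambda>(m, u). f m u) \<longlongrightarrow> L) (nhds \<mu> \<times>\<^sub>F at_right (0::real))"
  shows "((\<lambda>u. f \<mu> u) \<longlongrightarrow> L) (at_right 0)"
proof -
  have "filterlim (\<lambda>u. (\<mu>, u)) (nhds \<mu> \<times>\<^sub>F at_right 0) (at_right 0)"
    by (intro filterlim_Pair tendsto_const filterlim_ident)
  from filterlim_compose[OF assms this] show ?thesis by simp
qed

lemma sin_times_bounded: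
  assumes "eventually (\<lambda>a. \<bar>f a\<bar> \<le> M) (at_right (0::real))"
  shows "((\<lambda>a. sin a * f a) \<longlongrightarrow> 0) (at_right 0)"
proof (rule Lim_null_comparison)
  show "eventually (\<lambda>a. norm (sin a * f a) \<le> \<bar>sin a\<bar> * M) (at_right 0)"
    using assms by eventually_elim (simp add: abs_mult mult_left_mono)
  show "((\<lambda>a. \<bar>sin a\<bar> * M) \<longlongrightarrow> 0) (at_right 0)" by (auto intro!: tendsto_eq_intros)
qed

lemma powr_at_right_0:
  assumes "(e::real) > 0" shows "((\<lambda>u::real. u powr e) \<longlongrightarrow> 0) (at_right 0)"
proof (rule tendsto_zero_powrI[where b = e])
  show "eventually (\<lambda>u::real. 0 \<le> u) (at_right 0)"
    using eventually_at_right_less[of "0::real"] by eventually_elim simp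
qed (use assms in \<open>auto intro: tendsto_ident_at\<close>)

lemma near_0_half_pi: "eventually (\<lambda>a::real. 0 < a \<and> a < pi / 6) (at_right 0)"
  using eventually_at_right_real[of 0 "pi/6"] by simp

lemma right_bounded:
  assumes \<mu>: "\<mu> \<in> Lam"
  obtains M where "eventually (\<lambda>a. \<bar>kk \<mu> (rad \<mu> * cos a)\<bar> \<le> M \<and> \<bar>kk1 \<mu> (rad \<mu> * cos a)\<bar> \<le> M) (at_right 0)"
proof -
  obtain M where M: "M > 0" "eventually (\<lambda>m. m \<in> Lam \<and> (\<forall>z. \<bar>z\<bar> < rad m \<and> z \<noteq> 0 \<and> 0 \<le> xinv m z \<longrightarrow>
     \<bar>kk m z\<bar> \<le> M \<and> \<bar>kk1 m z\<bar> \<le> M \<and> \<bar>kk2 m z\<bar> \<le> M)) (nhds \<mu>)"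
    using kk_bounded[OF \<mu>, of 0] by auto
  have b: "\<bar>kk \<mu> z\<bar> \<le> M \<and> \<bar>kk1 \<mu> z\<bar> \<le> M" if "0 < z" "z < rad \<mu>" for z
  proof -
    have "xinv \<mu> z \<ge> 0" using xinv_pos[OF \<mu>, of z] that by simp
    thus ?thesis using eventually_nhds_x_imp_x[OF M(2)] that by auto
  qed
  have "eventually (\<lambda>a. \<bar>kk \<mu> (rad \<mu> * cos a)\<bar> \<le> M \<and> \<bar>kk1 \<mu> (rad \<mu> * cos a)\<bar> \<le> M) (at_right 0)"
    using near_0_half_pi
  proof eventually_elim
    case (elim a)
    hence "0 < a" "a < pi / 2" using pi_gt_zero by linarith+
    hence "0 < cos a" "cos a < 1" using cos_gt_zero[of a] cos_monotone_0_pi[of 0 a] by auto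
    thus ?case using rad_pos[OF \<mu>] by (intro b) auto
  qed
  thus ?thesis using that by blast
qed

lemma left_kk_bounded:
  assumes \<mu>: "\<mu> \<in> Lam" and q: "fst \<mu> = 0"
  shows "eventually (\<lambda>a. \<bar>kk \<mu> (- rad \<mu> * cos a)\<bar> \<le> 2 * rad \<mu>) (at_right 0)"
proof -
  define p where "p = snd \<mu>"
  have p: "p > 0" using \<mu> q by (simp add: Lam_def p_def)
  from powr_at_right_0[OF p] have "eventually (\<lambda>u::real. u powr p < 1 / 2) (at_right 0)" by (rule order_tendstoD) simp
  hence "eventually (\<lambda>\<phi>. (xinv \<mu> (- rad \<mu> * cos \<phi>) + 1) powr p < 1 / 2) (at_right 0)" by (rule left_filter[OF \<mu>])
  thus ?thesis using near_0_half_pi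
  proof eventually_elim
    case (elim a)
    have a: "0 < a" "a < pi / 2" using elim pi_gt_zero by linarith+
    note z = left_sin(1,2)[OF \<mu> a]
    note lf = left_forms[OF \<mu> z]
    let ?u = "xinv \<mu> (- rad \<mu> * cos a) + 1"
    have "kk \<mu> (- rad \<mu> * cos a) = - (- rad \<mu> * cos a) / (1 - ?u powr p)" using lf(7) lf(1) by (simp add: q p_def)
    moreover have "\<bar>- (- rad \<mu> * cos a) / (1 - ?u powr p)\<bar> \<le> rad \<mu> / (1 / 2)"
      unfolding abs_divide using z elim(1) by (intro frac_le) auto
    ultimately show ?case by simp
  qed
qed

text \<open>On the boundary orbit sin is of order u powr (1/2), and k' equals B1 / u, where
  \<open>B1\<close> is O(u + u powr p) at q = 0. The product is O(u powr (1/2) + u powr (p - 1/2)),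
  which is where p > 1/2 enters.\<close>

lemma left_kk1_vanishing:
  assumes \<mu>: "\<mu> \<in> Lam" and q: "fst \<mu> = 0" and p: "snd \<mu> > 1/2"
  shows "((\<lambda>a. sin a * kk1 \<mu> (- rad \<mu> * cos a)) \<longlongrightarrow> 0) (at_right 0)"
proof (rule Lim_null_comparison)
  define p where "p = snd \<mu>"
  let ?u = "\<lambda>a. xinv \<mu> (- rad \<mu> * cos a) + 1"
  let ?b = "\<lambda>u. sqrt 2 / rad \<mu> * \<bar>u powr (- 1 / 2) * B1 \<mu> u\<bar>"
  show "eventually (\<lambda>a. norm (sin a * kk1 \<mu> (- rad \<mu> * cos a)) \<le> ?b (?u a)) (at_right 0)"
    using near_0_half_pi
  proof eventually_elim
    case (elim a)
    have a: "0 < a" "a < pi / 2" using elim pi_gt_zero by linarith+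
    note s = left_sin[OF \<mu> a]
    note lf = left_forms[OF \<mu> s(1,2)]
    define u where "u = ?u a"
    have u: "u > 0" using lf(1) by (simp add: u_def)
    have R: "rad \<mu> > 0" by (rule rad_pos[OF \<mu>])
    have "(rad \<mu>)\<^sup>2 * (sin a)\<^sup>2 = 2 * u * (1 - u powr snd \<mu> / (snd \<mu> + 1))"
      using s(3)[folded u_def] u by (simp add: q)
    also have "\<dots> \<le> 2 * u * 1" using u p by (intro mult_left_mono) auto
    finally have "(rad \<mu>)\<^sup>2 * (sin a)\<^sup>2 \<le> 2 * u" by simp
    hence "(rad \<mu> * sin a)\<^sup>2 \<le> (sqrt (2 * u))\<^sup>2" using u by (simp add: power_mult_distrib)
    hence "rad \<mu> * sin a \<le> sqrt (2 * u)" by (rule power2_le_imp_le) (use u in simp)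
    hence sa: "sin a \<le> sqrt 2 / rad \<mu> * u powr (1 / 2)" using R u by (simp add: field_simps real_sqrt_mult powr_half_sqrt)
    have "\<bar>kk1 \<mu> (- rad \<mu> * cos a)\<bar> = \<bar>B1 \<mu> u\<bar> * u powr (- 1)"
      using lf(5) by (simp add: q u_def abs_mult)
    hence "norm (sin a * kk1 \<mu> (- rad \<mu> * cos a)) = sin a * (\<bar>B1 \<mu> u\<bar> * u powr (- 1))"
      using sin_gt_zero[of a] a by (simp add: abs_mult)
    also have "\<dots> \<le> (sqrt 2 / rad \<mu> * u powr (1 / 2)) * (\<bar>B1 \<mu> u\<bar> * u powr (- 1))"
      by (intro mult_right_mono sa) simp
    also have "\<dots> = sqrt 2 / rad \<mu> * \<bar>B1 \<mu> u\<bar> * (u powr (1 / 2) * u powr (- 1))" by simp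
    also have "u powr (1 / 2) * u powr (- 1) = u powr (- 1 / 2)" by (simp only: powr_add[symmetric]) simp
    finally show ?case by (simp add: u_def abs_mult mult_ac)
  qed
  note pw = powr_at_right_0
  have Z: "((\<lambda>u. sqz \<mu> u) \<longlongrightarrow> (rad \<mu>)\<^sup>2) (at_right 0)" by (rule left_limit_at[OF left_limits(3)[OF \<mu>]])
  have lim: "((\<lambda>u. - (u powr (1/2)) / (1 - u powr p) + sqz \<mu> u * (p * u powr (p - 1/2)) / (1 - u powr p) ^ 3) \<longlongrightarrow> 0) (at_right 0)"
  proof -
    have w: "((\<lambda>u::real. u powr (1/2)) \<longlongrightarrow> 0) (at_right 0)" "((\<lambda>u::real. u powr p) \<longlongrightarrow> 0) (at_right 0)"
      "((\<lambda>u::real. u powr (p - 1/2)) \<longlongrightarrow> 0) (at_right 0)" using p by (auto intro!: pw simp: p_def)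
    show ?thesis by (rule w Z tendsto_eq_intros refl | simp; fail)+
  qed
  have "((\<lambda>u. u powr (- 1 / 2) * B1 \<mu> u) \<longlongrightarrow> 0) (at_right 0)"
  proof (rule Lim_transform_eventually[OF lim])
    show "eventually (\<lambda>u. - (u powr (1/2)) / (1 - u powr p) + sqz \<mu> u * (p * u powr (p - 1/2)) / (1 - u powr p) ^ 3 = u powr (- 1 / 2) * B1 \<mu> u) (at_right 0)"
      using eventually_at_right_less[of "0::real"]
    proof eventually_elim
      case (elim u)
      have 1: "u powr (- 1 / 2) * u = u powr (1 / 2)" 
        using elim powr_add[of u "- 1 / 2" 1] by simp
      have 2: "u powr (- 1 / 2) * u powr p = u powr (p - 1 / 2)" using elim by (simp add: powr_add[symmetric])
      have "u powr (- 1 / 2) * B1 \<mu> u = - (u powr (- 1 / 2) * u) / (1 - u powr p) + sqz \<mu> u * (p * (u powr (- 1 / 2) * u powr p)) / (1 - u powr p) ^ 3"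
        using elim by (simp add: B1_def Let_def q p_def[symmetric] algebra_simps)
      thus ?case unfolding 1 2 by simp
    qed
  qed
  from tendsto_mult[OF tendsto_const tendsto_rabs[OF this], of "sqrt 2 / rad \<mu>"]
  have "((\<lambda>u. ?b u) \<longlongrightarrow> 0) (at_right 0)" by simp
  thus "((\<lambda>a. ?b (?u a)) \<longlongrightarrow> 0) (at_right 0)" using left_near_boundary[OF \<mu>] by (rule filterlim_compose)
qed

text \<open>For \<open>q = 0\<close> and \<open>p > 1/2\<close> integration by parts over the truncated half orbit turns the integral of \<open>Phi\<close> into
  one of the monotone function \<open>k'\<close>; the boundary terms vanish in the limit.\<close>

lemma boundary_integral_Phi:
  assumes p: "p > 1/2" "p \<noteq> 1"
  defines "I \<equiv> \<lambda>\<phi>. sgn (1 - p) * (Phi (0, p) (- rad (0, p) * cos \<phi>) * ((cos \<phi>)\<^sup>2 - (sin \<phi>)\<^sup>2))"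
  shows "\<exists>\<eta>>0. eventually (\<lambda>a. integral {a..pi - a} I > \<eta>) (at_right 0)"
    "0 < a \<Longrightarrow> a < pi \<Longrightarrow> continuous_on {a..pi - a} I"
proof -
  let ?\<mu> = "(0::real, p)" and ?\<sigma> = "sgn (1 - p)" and ?R = "rad (0, p)"
  have p0: "p > 0" using p by simp
  have \<mu>: "?\<mu> \<in> Lam" using p by (simp add: Lam_def)
  have R: "?R > 0" by (rule rad_pos[OF \<mu>])
  interpret smooth_well "pot 0 p" "frc 0 p" "frc1 0 p" "rad (0, p)" "frc2 0 p" "frc3 0 p"
    using Lam_well[OF \<mu>] by simp
  have kk: "kk ?\<mu> = k" "kk1 ?\<mu> = k1" "kk2 ?\<mu> = k2" by (simp_all add: kk_def kk1_def kk2_def)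
  have Phi: "Phi ?\<mu> = \<Phi> 1" by (simp add: fun_eq_iff Phi_def \<Phi>_def kk)
  have arg: "\<bar>- ?R * cos \<phi>\<bar> < ?R" if "0 < \<phi>" "\<phi> < pi" for \<phi>
  proof (cases "\<phi> = pi / 2")
    case False thus ?thesis using arg_bound(1)[OF R order_refl, of \<phi>] that by simp
  next
    case True
    hence "cos \<phi> = 0" by (simp only: cos_pi_half)
    thus ?thesis using R by simp
  qed
  have cont: "continuous_on {a..pi - a} (\<lambda>\<phi>. h (- ?R * cos \<phi>))" if a: "0 < a" and h: "\<And>z. \<bar>z\<bar> < ?R \<Longrightarrow> isCont h z" for h a
  proof (rule continuous_at_imp_continuous_on, rule ballI)
    fix \<phi> assume "\<phi> \<in> {a..pi - a}"
    hence "0 < \<phi>" "\<phi> < pi" using a by auto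
    thus "isCont (\<lambda>\<phi>. h (- ?R * cos \<phi>)) \<phi>"
      by (intro isCont_o2[where g = h and f = "\<lambda>\<phi>. - ?R * cos \<phi>"] continuous_intros h arg)
  qed
  have Ic: "continuous_on {a..pi - a} I" if "0 < a" for a
    unfolding I_def Phi \<Phi>_def by (intro continuous_intros cont k_cont k1_cont k2_cont that) auto
  thus "0 < a \<Longrightarrow> a < pi \<Longrightarrow> continuous_on {a..pi - a} I" by blast
  define Q where "Q \<phi> = ?R / 2 * (sin \<phi> - 2 * sin \<phi> ^ 3) * k1 (- ?R * cos \<phi>) + sin \<phi> * cos \<phi> * k (- ?R * cos \<phi>)" for \<phi>
  let ?w = "\<lambda>\<phi>. ?\<sigma> * (cos \<phi> * (k1 (- ?R * cos \<phi>) - k1 0))"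
  have wc: "continuous_on {a..pi - a} ?w" if "0 < a" for a
    by (intro continuous_intros cont k1_cont that) auto
  note wm = weighted_monotone[OF p0 p(2) R order_refl, unfolded kk]
  define \<eta> where "\<eta> = integral {pi/6..pi/3} ?w"
  have wint: "integral {a..pi - a} ?w \<ge> \<eta>" "\<eta> > 0" if a: "0 < a" "a < pi / 6" for a
  proof -
    have i: "a \<le> pi/6" "pi/6 < pi/3" "pi/3 \<le> pi - a" using a pi_gt_zero by linarith+
    have nn: "?w x \<ge> 0" if "x \<in> {a..pi - a}" for x using wm(1)[of x] that a by auto
    have pp: "?w x > 0" if "x \<in> {pi/6..pi/3}" for x
    proof -
      have "pi / 6 \<le> x" "x \<le> pi / 3" using that by auto
      hence "0 < x" "x < pi" "x < pi / 2" using pi_gt_zero by linarith+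
      thus ?thesis using wm(2)[of x] by blast
    qed
    show "\<eta> > 0" unfolding \<eta>_def by (rule integral_pos_on(1)[OF wc[OF a(1)] nn i pp])
    show "integral {a..pi - a} ?w \<ge> \<eta>" unfolding \<eta>_def by (rule integral_pos_on(2)[OF wc[OF a(1)] nn i pp])
  qed
  have eq: "integral {a..pi - a} I = ?\<sigma> * (Q (pi - a) - Q a) + ?R / 2 * integral {a..pi - a} ?w" if a: "0 < a" "a < pi / 6" for a
  proof -
    have le: "a \<le> pi - a" using a pi_gt_zero by linarith
    have "((\<lambda>\<phi>. \<Phi> 1 (- ?R * cos \<phi>) * ((cos \<phi>)\<^sup>2 - (sin \<phi>)\<^sup>2) - ?R / 2 * (cos \<phi> * k1 (- ?R * cos \<phi>))) has_integral Q (pi - a) - Q a) {a..pi - a}"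
    proof (rule fundamental_theorem_of_calculus[OF le])
      fix x assume "x \<in> {a..pi - a}"
      hence "0 < x" "x < pi" using a by auto
      from has_field_derivative_at_within[OF boundary_antideriv[OF this]]
      show "(Q has_vector_derivative \<Phi> 1 (- ?R * cos x) * ((cos x)\<^sup>2 - (sin x)\<^sup>2) - ?R / 2 * (cos x * k1 (- ?R * cos x))) (at x within {a..pi - a})"
        unfolding Q_def[abs_def] has_real_derivative_iff_has_vector_derivative .
    qed
    from has_integral_mult_right[OF this, of ?\<sigma>]
    have 1: "((\<lambda>\<phi>. ?\<sigma> * (\<Phi> 1 (- ?R * cos \<phi>) * ((cos \<phi>)\<^sup>2 - (sin \<phi>)\<^sup>2) - ?R / 2 * (cos \<phi> * k1 (- ?R * cos \<phi>)))) has_integral ?\<sigma> * (Q (pi - a) - Q a)) {a..pi - a}" .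
    have 2: "((\<lambda>\<phi>. ?R / 2 * ?w \<phi>) has_integral ?R / 2 * integral {a..pi - a} ?w) {a..pi - a}"
      by (intro has_integral_mult_right integrable_integral integrable_continuous_real wc a)
    \<comment> \<open>The constant \<open>k1 0\<close> introduced by \<open>?w\<close> integrates to
      a multiple of sin (pi - a) - sin a = 0; this is why the truncation is symmetric.\<close>
    have 3: "((\<lambda>\<phi>. (?R / 2 * ?\<sigma> * k1 0) * cos \<phi>) has_integral (?R / 2 * ?\<sigma> * k1 0) * (sin (pi - a) - sin a)) {a..pi - a}"
    proof (intro has_integral_mult_right fundamental_theorem_of_calculus[OF le])
      fix x
      show "(sin has_vector_derivative cos x) (at x within {a..pi - a})"
        by (auto intro!: derivative_eq_intros simp flip: has_real_derivative_iff_has_vector_derivative)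
    qed
    have "(I has_integral ?\<sigma> * (Q (pi - a) - Q a) + ?R / 2 * integral {a..pi - a} ?w + (?R / 2 * ?\<sigma> * k1 0) * (sin (pi - a) - sin a)) {a..pi - a}"
      using has_integral_add[OF has_integral_add[OF 1 2] 3] unfolding I_def Phi
      by (rule has_integral_eq[rotated]) (simp add: algebra_simps)
    thus ?thesis by (simp add: integral_unique)
  qed
  have S1: "((\<lambda>a. sin a * k1 (- ?R * cos a)) \<longlongrightarrow> 0) (at_right 0)"
    using left_kk1_vanishing[OF \<mu>] p by (simp add: kk)
  have S3: "((\<lambda>a. sin a * k (- ?R * cos a)) \<longlongrightarrow> 0) (at_right 0)"
    using sin_times_bounded[OF left_kk_bounded[OF \<mu>]] by (simp add: kk)
  obtain M where M: "eventually (\<lambda>a. \<bar>kk ?\<mu> (?R * cos a)\<bar> \<le> M \<and> \<bar>kk1 ?\<mu> (?R * cos a)\<bar> \<le> M) (at_right 0)"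
    by (rule right_bounded[OF \<mu>])
  have S2: "((\<lambda>a. sin a * k1 (?R * cos a)) \<longlongrightarrow> 0) (at_right 0)"
    by (rule sin_times_bounded[of _ M]) (use M in \<open>auto simp: kk elim!: eventually_mono\<close>)
  have S4: "((\<lambda>a. sin a * k (?R * cos a)) \<longlongrightarrow> 0) (at_right 0)"
    by (rule sin_times_bounded[of _ M]) (use M in \<open>auto simp: kk elim!: eventually_mono\<close>)
  have A: "((\<lambda>a. ?R / 2 * (1 - 2 * (sin a)\<^sup>2)) \<longlongrightarrow> ?R / 2) (at_right 0)"
    and B: "((\<lambda>a. cos a) \<longlongrightarrow> 1) (at_right (0::real))"
    by (auto intro!: tendsto_eq_intros)
  have Qa: "(Q \<longlongrightarrow> 0) (at_right 0)"
  proof -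
    have "((\<lambda>a. ?R / 2 * (1 - 2 * (sin a)\<^sup>2) * (sin a * k1 (- ?R * cos a)) + cos a * (sin a * k (- ?R * cos a))) \<longlongrightarrow> 0) (at_right 0)"
      using tendsto_add[OF tendsto_mult[OF A S1] tendsto_mult[OF B S3]] by simp
    thus ?thesis unfolding Q_def[abs_def] by (simp add: algebra_simps power2_eq_square power3_eq_cube)
  qed
  have Qb: "((\<lambda>a. Q (pi - a)) \<longlongrightarrow> 0) (at_right 0)"
  proof -
    have "((\<lambda>a. ?R / 2 * (1 - 2 * (sin a)\<^sup>2) * (sin a * k1 (?R * cos a)) - cos a * (sin a * k (?R * cos a))) \<longlongrightarrow> 0) (at_right 0)"
      using tendsto_diff[OF tendsto_mult[OF A S2] tendsto_mult[OF B S4]] by simp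
    thus ?thesis unfolding Q_def[abs_def] by (simp add: algebra_simps power2_eq_square power3_eq_cube)
  qed
  have \<eta>: "\<eta> > 0" using wint(2)[of "pi/12"] by simp
  have "((\<lambda>a. ?\<sigma> * (Q (pi - a) - Q a)) \<longlongrightarrow> 0) (at_right 0)" by (auto intro!: tendsto_eq_intros Qa Qb)
  \<comment> \<open>The boundary terms may consume half of the main contribution R / 2 *
    \<eta>.\<close>
  moreover have "- (?R / 4 * \<eta>) < 0" using R \<eta> by simp
  ultimately have "eventually (\<lambda>a. ?\<sigma> * (Q (pi - a) - Q a) > - (?R / 4 * \<eta>)) (at_right 0)" by (rule order_tendstoD)
  hence "eventually (\<lambda>a. integral {a..pi - a} I > ?R / 4 * \<eta>) (at_right 0)" using near_0_half_pi
  proof eventually_elim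
    case (elim a)
    have "?R / 2 * integral {a..pi - a} ?w \<ge> ?R / 2 * \<eta>" using wint(1)[of a] elim R by (intro mult_left_mono) auto
    thus ?case using eq[of a] elim by linarith
  qed
  moreover have "?R / 4 * \<eta> > 0" using R \<eta> by simp
  ultimately show "\<exists>\<eta>>0. eventually (\<lambda>a. integral {a..pi - a} I > \<eta>) (at_right 0)" by blast
qed

section \<open>The sign of \<open>ee\<close> near the boundary orbit\<close>

lemma cos_sq_minus_sin_sq_bounds:
  fixes \<phi> :: real
  shows "\<bar>(cos \<phi>)\<^sup>2 - (sin \<phi>)\<^sup>2\<bar> \<le> 1" "(cos \<phi>)\<^sup>2 - (sin \<phi>)\<^sup>2 = 2 * (cos \<phi>)\<^sup>2 - 1"
  using cos_double[of \<phi>] abs_cos_le_one[of "2 * \<phi>"] cos_double_cos[of \<phi>] by auto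

lemma Phi_bounded:
  assumes \<mu>: "\<mu> \<in> Lam" and \<alpha>: "-1 < \<alpha>" "\<alpha> \<le> 0"
  obtains M where "M > 0" "eventually (\<lambda>m. m \<in> Lam \<and> (\<forall>z. \<bar>z\<bar> < rad m \<and> z \<noteq> 0 \<and> \<alpha> \<le> xinv m z \<longrightarrow> \<bar>Phi m z\<bar> \<le> M)) (nhds \<mu>)"
proof -
  obtain M where M: "M > 0" "eventually (\<lambda>m. m \<in> Lam \<and> (\<forall>z. \<bar>z\<bar> < rad m \<and> z \<noteq> 0 \<and> \<alpha> \<le> xinv m z \<longrightarrow>
     \<bar>kk m z\<bar> \<le> M \<and> \<bar>kk1 m z\<bar> \<le> M \<and> \<bar>kk2 m z\<bar> \<le> M)) (nhds \<mu>)"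
    by (rule kk_bounded[OF \<mu> \<alpha>])
  let ?B = "\<lambda>m. (rad m)\<^sup>2 / 2 * M + \<bar>1 / (fst m + 1) - 2\<bar> * rad m * M + \<bar>2 / (fst m + 1) - 1\<bar> * M"
  have m: "((\<lambda>m. m) \<longlongrightarrow> \<mu>) (nhds \<mu>)" by (rule filterlim_ident)
  have "(?B \<longlongrightarrow> ?B \<mu>) (nhds \<mu>)" using \<mu> by (intro tendsto_intros rad_tendsto m) (auto simp: Lam_def)
  hence "eventually (\<lambda>m. ?B m < ?B \<mu> + 1) (nhds \<mu>)" by (rule order_tendstoD) simp
  with M(2) have "eventually (\<lambda>m. m \<in> Lam \<and> (\<forall>z. \<bar>z\<bar> < rad m \<and> z \<noteq> 0 \<and> \<alpha> \<le> xinv m z \<longrightarrow> \<bar>Phi m z\<bar> \<le> ?B \<mu> + 1)) (nhds \<mu>)"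
  proof eventually_elim
    case (elim m)
    have "\<bar>Phi m z\<bar> \<le> ?B \<mu> + 1" if z: "\<bar>z\<bar> < rad m" "z \<noteq> 0" "\<alpha> \<le> xinv m z" for z
    proof -
      have k: "\<bar>kk m z\<bar> \<le> M" "\<bar>kk1 m z\<bar> \<le> M" "\<bar>kk2 m z\<bar> \<le> M" using elim(1) z by auto
      have "z\<^sup>2 \<le> (rad m)\<^sup>2" using z(1) power_mono[of "\<bar>z\<bar>" "rad m" 2] by simp
      hence "\<bar>((rad m)\<^sup>2 - z\<^sup>2) / 2\<bar> * \<bar>kk2 m z\<bar> \<le> (rad m)\<^sup>2 / 2 * M" using k by (intro mult_mono) auto
      moreover have "\<bar>1 / (fst m + 1) - 2\<bar> * \<bar>z\<bar> * \<bar>kk1 m z\<bar> \<le> \<bar>1 / (fst m + 1) - 2\<bar> * rad m * M"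
        using k z by (intro mult_mono) auto
      moreover have "\<bar>2 / (fst m + 1) - 1\<bar> * \<bar>kk m z\<bar> \<le> \<bar>2 / (fst m + 1) - 1\<bar> * M" using k by (intro mult_left_mono) auto
      moreover have "\<bar>Phi m z\<bar> \<le> \<bar>((rad m)\<^sup>2 - z\<^sup>2) / 2\<bar> * \<bar>kk2 m z\<bar> + \<bar>1 / (fst m + 1) - 2\<bar> * \<bar>z\<bar> * \<bar>kk1 m z\<bar> + \<bar>2 / (fst m + 1) - 1\<bar> * \<bar>kk m z\<bar>"
      proof -
        have "\<bar>a + b + c\<bar> \<le> \<bar>a\<bar> + \<bar>b\<bar> + \<bar>c\<bar>" for a b c :: real by linarith
        thus ?thesis unfolding Phi_def abs_mult[symmetric] .
      qed
      ultimately show ?thesis using elim(2) by linarith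
    qed
    thus ?case using elim(1) by blast
  qed
  moreover have "?B \<mu> + 1 > 0" using M(1) rad_pos[OF \<mu>] by (intro add_nonneg_pos add_nonneg_nonneg mult_nonneg_nonneg) auto
  ultimately show ?thesis using that by blast
qed

text \<open>Near the left end \<open>Phi\<close> is nonnegative because the limit of
  \<open>B2\<close> at q = 0 is R^2 p (p + 1) > 0, and cos 2\<phi> > 0 there. For p < 1 the
  integrand is thus nonnegative. For p > 1 the factor \<open>sgn (1 - p)\<close> reverses the sign,
  but then the exponent p - 1 - 3 q is positive for nearby parameters and \<open>Phi\<close> is
  bounded.\<close>

lemma Phi_left_sign:
  assumes p: "p > 0" "p \<noteq> 1"
  obtains u0 M where "0 < u0" "u0 < 1" "M > 0" 
    "eventually (\<lambda>\<theta>. \<forall>\<phi>\<in>{0<..<pi} - {pi/2}. xinv (fst \<theta>) (- snd \<theta> * cos \<phi>) + 1 < u0 \<longrightarrow>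
       - M \<le> sgn (1 - p) * (Phi (fst \<theta>) (- snd \<theta> * cos \<phi>) * ((cos \<phi>)\<^sup>2 - (sin \<phi>)\<^sup>2))) (at ((0, p), r) within Dom)"
proof -
  let ?\<mu> = "(0::real, p)"
  have \<mu>: "?\<mu> \<in> Lam" using p by (simp add: Lam_def)
  have R: "rad ?\<mu> > 0" by (rule rad_pos[OF \<mu>])
  let ?F = "nhds ?\<mu> \<times>\<^sub>F at_right (0::real)"
  have fs: "filterlim fst (nhds ?\<mu>) ?F" by (rule filterlim_fst)
  have B2: "((\<lambda>t. B2 (fst t) (snd t)) \<longlongrightarrow> (rad ?\<mu>)\<^sup>2 * ((p + 1) * p)) ?F"
    using left_limits(2)[OF \<mu>] by (simp add: case_prod_unfold)
  have "(rad ?\<mu>)\<^sup>2 * ((p + 1) * p) > 0" using R p by simp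
  with B2 have e1: "eventually (\<lambda>t. B2 (fst t) (snd t) > 0) ?F" by (rule order_tendstoD)
  \<comment> \<open>z^2 > 3/4 R^2 together with r < R forces cos^2 \<phi> > 3/4, hence cos 2\<phi> >
    1/2.\<close>
  have "((\<lambda>t. sqz (fst t) (snd t) - 3 / 4 * (rad (fst t))\<^sup>2) \<longlongrightarrow> (rad ?\<mu>)\<^sup>2 - 3 / 4 * (rad ?\<mu>)\<^sup>2) ?F"
    using left_limits(3)[OF \<mu>] by (intro tendsto_intros rad_tendsto[OF fs \<mu>]) (simp add: case_prod_unfold)
  moreover have "(rad ?\<mu>)\<^sup>2 - 3 / 4 * (rad ?\<mu>)\<^sup>2 > 0" using R by simp
  ultimately have e2: "eventually (\<lambda>t. sqz (fst t) (snd t) - 3 / 4 * (rad (fst t))\<^sup>2 > 0) ?F" by (rule order_tendstoD)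
  let ?C = "\<lambda>t. rad (fst t) * (1 / (fst (fst t) + 1) - 1 / (snd (fst t) + 1)) * B2 (fst t) (snd t)"
  have "((\<lambda>t. fst (fst t)) \<longlongrightarrow> fst ?\<mu>) ?F" "((\<lambda>t. snd (fst t)) \<longlongrightarrow> snd ?\<mu>) ?F"
    using tendsto_fst[OF fs] tendsto_snd[OF fs] by simp_all
  hence C: "(?C \<longlongrightarrow> rad ?\<mu> * (1 / (0 + 1) - 1 / (p + 1)) * ((rad ?\<mu>)\<^sup>2 * ((p + 1) * p))) ?F" (is "(_ \<longlongrightarrow> ?Kc) _")
    using p by (intro tendsto_intros rad_tendsto[OF fs \<mu>] B2) auto
  hence e3: "eventually (\<lambda>t. ?C t < ?Kc + 1) ?F" by (rule order_tendstoD) simp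
  have C0: "?Kc > 0" using p R by (intro mult_pos_pos) (auto simp: field_simps)
  have "eventually (\<lambda>(m, u). B2 m u > 0 \<and> sqz m u - 3 / 4 * (rad m)\<^sup>2 > 0 \<and> ?C (m, u) < ?Kc + 1) ?F"
    unfolding case_prod_unfold using e1 e2 e3 by eventually_elim simp
  then obtain u0 where u0: "0 < u0" "u0 < 1" 
    "eventually (\<lambda>m. \<forall>u. 0 < u \<and> u < u0 \<longrightarrow> B2 m u > 0 \<and> sqz m u - 3 / 4 * (rad m)\<^sup>2 > 0 \<and> ?C (m, u) < ?Kc + 1) (nhds ?\<mu>)"
    by (rule eventually_left)
  have m: "((\<lambda>m. m) \<longlongrightarrow> ?\<mu>) (nhds ?\<mu>)" by (rule filterlim_ident)
  have e4: "eventually (\<lambda>m. p > 1 \<longrightarrow> snd m - 1 - 3 * fst m > 0) (nhds ?\<mu>)"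
  proof (cases "p > 1")
    case True
    have "((\<lambda>m. snd m - 1 - 3 * fst m) \<longlongrightarrow> snd ?\<mu> - 1 - 3 * fst ?\<mu>) (nhds ?\<mu>)"
      by (intro tendsto_diff tendsto_mult tendsto_const tendsto_fst[OF m, simplified] tendsto_snd[OF m, simplified]
            tendsto_fst[OF m] tendsto_snd[OF m])
    hence "eventually (\<lambda>m. snd m - 1 - 3 * fst m > 0) (nhds ?\<mu>)" by (rule order_tendstoD) (use True in simp)
    thus ?thesis by eventually_elim simp
  qed simp
  have "eventually (\<lambda>\<theta>. \<forall>\<phi>\<in>{0<..<pi} - {pi/2}. xinv (fst \<theta>) (- snd \<theta> * cos \<phi>) + 1 < u0 \<longrightarrow>
       - (?Kc + 1) \<le> sgn (1 - p) * (Phi (fst \<theta>) (- snd \<theta> * cos \<phi>) * ((cos \<phi>)\<^sup>2 - (sin \<phi>)\<^sup>2))) (at (?\<mu>, r) within Dom)"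
    using ev_fst[OF u0(3)] ev_fst[OF e4] ev_in
  proof eventually_elim
    case (elim \<theta>)
    show ?case
    proof (intro ballI impI)
      fix \<phi> assume \<phi>: "\<phi> \<in> {0<..<pi} - {pi/2}" and lt: "xinv (fst \<theta>) (- snd \<theta> * cos \<phi>) + 1 < u0"
      let ?z = "- snd \<theta> * cos \<phi>" and ?m = "fst \<theta>"
      have d: "fst \<theta> \<in> Lam" "0 < snd \<theta>" "snd \<theta> < rad (fst \<theta>)" using elim(3) by (auto simp: Dom_def)
      have z: "\<bar>?z\<bar> < rad ?m" "?z \<noteq> 0" using arg_bound[OF d(2) less_imp_le[OF d(3)] \<phi>] by auto
      have zn: "?z < 0"
      proof (rule ccontr)
        assume "\<not> ?z < 0"
        hence "?z > 0" using z(2) by linarith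
        hence "xinv ?m ?z > 0" by (rule xinv_pos[OF d(1) less_imp_le[OF z(1)]])
        thus False using lt u0 by linarith
      qed
      note lf = left_forms[OF d(1) z(1) zn]
      let ?u = "xinv ?m ?z + 1"
      have B: "B2 ?m ?u > 0" "sqz ?m ?u > 3 / 4 * (rad ?m)\<^sup>2" "?C (?m, ?u) < ?Kc + 1" using elim(1) lf(1) lt by auto
      have \<kappa>: "1 / (fst ?m + 1) - 1 / (snd ?m + 1) > 0" using d(1) by (simp add: Lam_def frac_less2)
      have Ppos: "Phi ?m ?z \<ge> 0" unfolding lf(6) using zn \<kappa> B(1) by (intro mult_nonneg_nonneg) auto
      have c34: "(cos \<phi>)\<^sup>2 > 3 / 4"
      proof -
        have "(snd \<theta>)\<^sup>2 * (cos \<phi>)\<^sup>2 > 3 / 4 * (rad ?m)\<^sup>2" using lf(3) B(2) by (simp add: power_mult_distrib)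
        moreover have "(snd \<theta>)\<^sup>2 \<le> (rad ?m)\<^sup>2" using d by (intro power_mono) auto
        ultimately have "(snd \<theta>)\<^sup>2 * (cos \<phi>)\<^sup>2 > (snd \<theta>)\<^sup>2 * (3 / 4)" by linarith
        thus ?thesis using d(2) by (simp add: mult_less_cancel_left)
      qed
      show "- (?Kc + 1) \<le> sgn (1 - p) * (Phi ?m ?z * ((cos \<phi>)\<^sup>2 - (sin \<phi>)\<^sup>2))"
      proof (cases "p < 1")
        case True
        have "Phi ?m ?z * ((cos \<phi>)\<^sup>2 - (sin \<phi>)\<^sup>2) \<ge> 0"
          using Ppos c34 cos_sq_minus_sin_sq_bounds(2)[of \<phi>] by (intro mult_nonneg_nonneg) auto
        thus ?thesis using True C0 by simp
      next
        case False
        hence p1: "p > 1" using p by simp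
        have e: "?u powr (snd ?m - 1 - 3 * fst ?m) \<le> 1"
          using elim(2) p1 lf(1,2) powr_le_one_le[of ?u "snd ?m - 1 - 3 * fst ?m"] powr_mono2[of "snd ?m - 1 - 3 * fst ?m" ?u 1] by simp
        have "Phi ?m ?z \<le> rad ?m * (1 / (fst ?m + 1) - 1 / (snd ?m + 1)) * B2 ?m ?u * 1"
          unfolding lf(6) using e z zn \<kappa> B(1) rad_pos[OF d(1)]
          by (intro mult_mono mult_nonneg_nonneg) auto
        hence "Phi ?m ?z \<le> ?Kc + 1" using B(3) by simp
        hence "\<bar>Phi ?m ?z\<bar> * \<bar>(cos \<phi>)\<^sup>2 - (sin \<phi>)\<^sup>2\<bar> \<le> (?Kc + 1) * 1"
          using Ppos C0 cos_sq_minus_sin_sq_bounds(1)[of \<phi>] by (intro mult_mono) auto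
        hence "\<bar>sgn (1 - p) * (Phi ?m ?z * ((cos \<phi>)\<^sup>2 - (sin \<phi>)\<^sup>2))\<bar> \<le> ?Kc + 1" using p1 by (simp add: abs_mult)
        thus ?thesis by linarith
      qed
    qed
  qed
  thus ?thesis using that[of u0 "?Kc + 1"] u0 C0 by simp
qed

text \<open>For p > 1/2 the limit integrand has a positive integral over a slightly truncated half
  turn, by \<open>boundary_integral_Phi\<close>. For p \<le> 1/2 \<open>Phi\<close> behaves like u
  powr (p - 1), and 1 - p \<ge> 1/2 makes it diverge at least like 1 / \<phi> with positive sign, so
  that nothing has to be evaluated.\<close>

theorem ee_sign:
  assumes p: "p > 0" "p \<noteq> 1"
  shows "eventually (\<lambda>\<theta>. sgn (1 - p) * ee (fst \<theta>) (snd \<theta>) > 0) (at ((0, p), rad (0, p)) within Dom)"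
proof -
  let ?\<mu> = "(0::real, p)" and ?\<sigma> = "sgn (1 - p)"
  have \<mu>: "?\<mu> \<in> Lam" using p by (simp add: Lam_def)
  have R: "rad ?\<mu> > 0" by (rule rad_pos[OF \<mu>])
  obtain u0 M0 where u0: "0 < u0" "u0 < 1" "M0 > 0" 
    "eventually (\<lambda>\<theta>. \<forall>\<phi>\<in>{0<..<pi} - {pi/2}. xinv (fst \<theta>) (- snd \<theta> * cos \<phi>) + 1 < u0 \<longrightarrow>
       - M0 \<le> ?\<sigma> * (Phi (fst \<theta>) (- snd \<theta> * cos \<phi>) * ((cos \<phi>)\<^sup>2 - (sin \<phi>)\<^sup>2))) (at (?\<mu>, rad ?\<mu>) within Dom)"
    by (rule Phi_left_sign[OF p])
  obtain M1 where M1: "M1 > 0" "eventually (\<lambda>m. m \<in> Lam \<and> (\<forall>z. \<bar>z\<bar> < rad m \<and> z \<noteq> 0 \<and> u0 - 1 \<le> xinv m z \<longrightarrow> \<bar>Phi m z\<bar> \<le> M1)) (nhds ?\<mu>)"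
    by (rule Phi_bounded[OF \<mu>, of "u0 - 1"]) (use u0 in auto)
  define M where "M = max M0 M1"
  define g where "g \<theta> \<phi> = ?\<sigma> * (Phi (fst \<theta>) (- snd \<theta> * cos \<phi>) * ((cos \<phi>)\<^sup>2 - (sin \<phi>)\<^sup>2))" for \<theta> :: "(real \<times> real) \<times> real" and \<phi>
  define g0 where "g0 \<phi> = ?\<sigma> * (Phi ?\<mu> (- rad ?\<mu> * cos \<phi>) * ((cos \<phi>)\<^sup>2 - (sin \<phi>)\<^sup>2))" for \<phi>
  have cont: "continuous_on {0..pi} (g \<theta>)" if "\<theta> \<in> Dom" for \<theta>
    using that unfolding g_def[abs_def] by (intro continuous_intros Dom_cont) (auto simp: Dom_def)
  have lim: "((\<lambda>\<theta>. g \<theta> \<phi>) \<longlongrightarrow> g0 \<phi>) (at (?\<mu>, rad ?\<mu>) within Dom)" if "\<phi> \<in> {0<..<pi} - {pi/2}" for \<phi>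
    unfolding g_def g0_def by (intro tendsto_intros pointwise) (use \<mu> R that in auto)
  have lower: "eventually (\<lambda>\<theta>. \<forall>\<phi>\<in>{0<..<pi} - {pi/2}. - M \<le> g \<theta> \<phi>) (at (?\<mu>, rad ?\<mu>) within Dom)"
    using u0(4) ev_fst[OF M1(2)] ev_in
  proof eventually_elim
    case (elim \<theta>)
    show ?case
    proof
      fix \<phi> assume \<phi>: "\<phi> \<in> {0<..<pi} - {pi/2}"
      let ?z = "- snd \<theta> * cos \<phi>"
      have d: "fst \<theta> \<in> Lam" "0 < snd \<theta>" "snd \<theta> < rad (fst \<theta>)" using elim(3) by (auto simp: Dom_def)
      have z: "\<bar>?z\<bar> < rad (fst \<theta>)" "?z \<noteq> 0" using arg_bound[OF d(2) less_imp_le[OF d(3)] \<phi>] by auto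
      show "- M \<le> g \<theta> \<phi>"
      proof (cases "u0 - 1 \<le> xinv (fst \<theta>) ?z")
        case True
        hence "\<bar>Phi (fst \<theta>) ?z\<bar> \<le> M1" using elim(2) z by blast
        hence "\<bar>Phi (fst \<theta>) ?z\<bar> * \<bar>(cos \<phi>)\<^sup>2 - (sin \<phi>)\<^sup>2\<bar> \<le> M1 * 1"
          using cos_sq_minus_sin_sq_bounds(1)[of \<phi>] M1 by (intro mult_mono) auto
        hence "\<bar>g \<theta> \<phi>\<bar> \<le> M1" using p(2) by (simp add: g_def abs_mult abs_sgn_eq)
        thus ?thesis unfolding M_def by linarith
      next
        case False
        hence "xinv (fst \<theta>) ?z + 1 < u0" by simp
        hence "- M0 \<le> g \<theta> \<phi>" using elim(1) \<phi> unfolding g_def by blast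
        thus ?thesis unfolding M_def by linarith
      qed
    qed
  qed
  have "eventually (\<lambda>\<theta>. integral {0..pi} (g \<theta>) > 0) (at (?\<mu>, rad ?\<mu>) within Dom)"
  proof (cases "p > 1/2")
    case True
    obtain \<eta> where \<eta>: "\<eta> > 0" "eventually (\<lambda>a. integral {a..pi - a} g0 > \<eta>) (at_right 0)"
      using boundary_integral_Phi(1)[OF True p(2)] unfolding g0_def[abs_def] by blast
    \<comment> \<open>The truncation discards total length 2 a, which costs at most M * (2 *
      a).\<close>
    have "((\<lambda>a. M * (2 * a)) \<longlongrightarrow> M * (2 * 0)) (at_right 0)" by (intro tendsto_intros)
    hence "eventually (\<lambda>a. M * (2 * a) < \<eta>) (at_right 0)" by (rule order_tendstoD) (use \<eta> in simp)
    with \<eta>(2) near_0_half_pi have "eventually (\<lambda>a. integral {a..pi - a} g0 > M * (2 * a) \<and> 0 < a \<and> a < pi / 6) (at_right 0)"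
      by eventually_elim auto
    then obtain a where a: "integral {a..pi - a} g0 > M * (2 * a)" "0 < a" "a < pi / 6"
      using eventually_happens[of _ "at_right (0::real)"] by (auto simp: trivial_limit_at_right_real)
    show ?thesis
    proof (rule integral_eventually_gt[OF cont lower lim, where a = a and b = "pi - a" and h = g0])
      show "continuous_on {a..pi - a} g0"
        using boundary_integral_Phi(2)[OF True p(2), of a] a pi_gt_zero unfolding g0_def[abs_def] by simp
      have e: "pi - (pi - a - a) = 2 * a" by linarith
      show "0 + M * (pi - (pi - a - a)) < integral {a..pi - a} g0" unfolding e add_0 by (rule a(1))
      show "a \<le> pi - a" using a pi_gt_zero by linarith
    qed (use a in auto)
  next
    case False
    hence s: "?\<sigma> = 1" using p by simp
    obtain C where C: "C > 0" "\<And>\<phi> e. 0 < \<phi> \<Longrightarrow> \<phi> < pi / 2 \<Longrightarrow> e \<ge> (fst ?\<mu> + 1) / 2 \<Longrightarrow>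
      C / \<phi> \<le> (xinv ?\<mu> (- rad ?\<mu> * cos \<phi>) + 1) powr (- e)" by (rule left_divergence[OF \<mu>]) blast
    let ?u = "\<lambda>\<phi>. xinv ?\<mu> (- rad ?\<mu> * cos \<phi>) + 1"
    let ?L = "(rad ?\<mu>)\<^sup>2 * ((p + 1) * p)" and ?\<kappa> = "1 - 1 / (p + 1)"
    have L: "?L > 0" using R p by (intro mult_pos_pos) auto
    have \<kappa>0: "?\<kappa> > 0" using p by (simp add: field_simps)
    have "((\<lambda>u. B2 ?\<mu> u) \<longlongrightarrow> ?L) (at_right 0)" using left_limit_at[OF left_limits(2)[OF \<mu>]] by simp
    moreover have "?L / 2 < ?L" using L by linarith
    ultimately have "eventually (\<lambda>u. B2 ?\<mu> u > ?L / 2) (at_right 0)" by (rule order_tendstoD)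
    hence "eventually (\<lambda>\<phi>. B2 ?\<mu> (?u \<phi>) > ?L / 2) (at_right 0)" by (rule left_filter[OF \<mu>])
    then obtain b0 where b0: "b0 > 0" "\<And>\<phi>. 0 < \<phi> \<Longrightarrow> \<phi> < b0 \<Longrightarrow> B2 ?\<mu> (?u \<phi>) > ?L / 2"
      unfolding eventually_at_right_field by blast
    define b where "b = min b0 (pi / 6)"
    \<comment> \<open>Product of lower bounds for rad cos \<phi>, the energy factor,
      \<open>B2\<close>, u powr (p - 1) up to the factor 1 / \<phi>, and cos 2\<phi>, valid for
      \<phi> < pi / 6.\<close>
    define C' where "C' = (rad ?\<mu> * (1 / 2)) * ?\<kappa> * (?L / 2) * C * (1 / 2)"
    show ?thesis
    proof (rule integral_eventually_gt_divergent[OF cont lower lim, where C = C' and b = b])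
      show "C' > 0" unfolding C'_def using R p C \<kappa>0 by (intro mult_pos_pos) auto
      show "0 < b" using b0 by (simp add: b_def)
      show "b \<le> pi" unfolding b_def using pi_gt_zero by linarith
      fix \<phi> assume \<phi>: "\<phi> \<in> {0<..<b} - {pi/2}"
      hence \<phi>': "0 < \<phi>" "\<phi> < pi / 6" "\<phi> < b0" by (auto simp: b_def)
      hence \<phi>2: "\<phi> < pi / 2" using pi_gt_zero by linarith
      note lf = left_forms[OF \<mu> left_sin(1,2)[OF \<mu> \<phi>'(1) \<phi>2]]
      have c30: "cos \<phi> \<ge> sqrt 3 / 2" using cos_monotone_0_pi_le[of \<phi> "pi/6"] \<phi>' cos_30 pi_gt_zero by simp
      have s3: "sqrt 3 \<ge> (1::real)" by simp
      have c: "cos \<phi> \<ge> 1 / 2" using c30 s3 by linarith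
      have "(sqrt 3 / 2)\<^sup>2 \<le> (cos \<phi>)\<^sup>2" using c30 by (intro power_mono) auto
      hence cs: "(cos \<phi>)\<^sup>2 - (sin \<phi>)\<^sup>2 \<ge> 1 / 2" by (simp add: cos_sq_minus_sin_sq_bounds(2) power_divide)
      have up: "C / \<phi> \<le> ?u \<phi> powr (- (1 - p))" using False by (intro C(2) \<phi>' \<phi>2) auto
      have "(rad ?\<mu> * (1 / 2)) * ?\<kappa> * (?L / 2) * (C / \<phi>) * (1 / 2) \<le> (rad ?\<mu> * cos \<phi>) * ?\<kappa> * B2 ?\<mu> (?u \<phi>) * ?u \<phi> powr (- (1 - p)) * ((cos \<phi>)\<^sup>2 - (sin \<phi>)\<^sup>2)"
      proof -
        have B: "?L / 2 \<le> B2 ?\<mu> (?u \<phi>)" "0 \<le> B2 ?\<mu> (?u \<phi>)" "0 \<le> ?L / 2" using b0(2)[OF \<phi>'(1,3)] L by linarith+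
        show ?thesis by (intro mult_mono mult_nonneg_nonneg B) (use c up cs \<kappa>0 R C(1) \<phi>'(1) in auto)
      qed
      also have "\<dots> = g0 \<phi>" unfolding g0_def s using lf(6) by simp
      finally show "C' / \<phi> \<le> g0 \<phi>" by (simp add: C'_def)
    qed
  qed
  moreover have "integral {0..pi} (g \<theta>) = ?\<sigma> * ee (fst \<theta>) (snd \<theta>)" for \<theta>
    unfolding ee_def g_def[abs_def] by (rule integral_mult_right)
  ultimately show ?thesis by simp
qed

section \<open>The outer boundary and the Hausdorff distance\<close>

context potential_well begin

lemma level_eq_image:
  assumes "0 < r" "r < R"
  shows "level r = (\<lambda>w. (ginv (fst w), snd w)) ` sphere 0 r"
proof
  show "level r \<subseteq> (\<lambda>w. (ginv (fst w), snd w)) ` sphere 0 r"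
  proof
    fix z assume z: "z \<in> level r"
    hence "norm (G (fst z), snd z) = r" using level_fst(2)[OF z assms(1)] assms(1) by (simp add: norm_Pair)
    thus "z \<in> (\<lambda>w. (ginv (fst w), snd w)) ` sphere 0 r"
      using z by (intro image_eqI[of _ _ "(G (fst z), snd z)"]) (auto simp: level_def ginv_G)
  qed
  show "(\<lambda>w. (ginv (fst w), snd w)) ` sphere 0 r \<subseteq> level r"
  proof safe
    fix a b :: real assume "(a, b) \<in> sphere 0 r"
    hence n: "norm (a, b) = r" by simp
    hence "\<bar>a\<bar> < R" using assms norm_fst_le[of a b] by simp
    moreover have "a\<^sup>2 + b\<^sup>2 = r\<^sup>2" using n by (auto simp: norm_Pair)
    ultimately show "(ginv (fst (a, b)), snd (a, b)) \<in> level r"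
      using ginv_props[of a] F_ginv[of a] by (simp add: level_def energy_def)
  qed
qed

end

text \<open>Extends the straightening coordinates to the closed ball of radius
  \<open>rad \<mu>\<close>, whose bounding circle goes to the outer boundary curve.\<close>

definition chart :: "real \<times> real \<Rightarrow> real \<times> real \<Rightarrow> real \<times> real"
  where "chart \<mu> w = (xinv \<mu> (fst w), snd w)"

definition lev :: "real \<times> real \<Rightarrow> real \<Rightarrow> (real \<times> real) set"
  where "lev \<mu> r = chart \<mu> ` sphere 0 r"

lemma fst_le_norm: "\<bar>fst w\<bar> \<le> norm (w :: real \<times> real)"
  using norm_fst_le[of "fst w" "snd w"] by simp

lemma chart_tendsto:
  assumes "(m \<longlongrightarrow> \<mu>) F" "\<mu> \<in> Lam" "(W \<longlongrightarrow> w) F" "eventually (\<lambda>t. norm (W t) \<le> rad (m t)) F" "norm w \<le> rad \<mu>"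
  shows "((\<lambda>t. chart (m t) (W t)) \<longlongrightarrow> chart \<mu> w) F"
  unfolding chart_def
proof (intro tendsto_Pair tendsto_snd assms xinv_tendsto[OF assms(1,2)] tendsto_fst)
  show "eventually (\<lambda>t. \<bar>fst (W t)\<bar> \<le> rad (m t)) F" using assms(4) by eventually_elim (rule order_trans[OF fst_le_norm])
  show "\<bar>fst w\<bar> \<le> rad \<mu>" using assms(5) fst_le_norm order_trans by blast
qed

lemma chart_cont:
  assumes "\<mu> \<in> Lam" shows "continuous_on (cball 0 (rad \<mu>)) (chart \<mu>)"
  unfolding continuous_on_def
proof
  fix w :: "real \<times> real" assume w: "w \<in> cball 0 (rad \<mu>)"
  show "(chart \<mu> \<longlongrightarrow> chart \<mu> w) (at w within cball 0 (rad \<mu>))"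
    by (rule chart_tendsto[OF tendsto_const assms tendsto_ident_at]) (use w in \<open>auto simp: eventually_at_filter\<close>)
qed

lemma chart_inj: assumes "\<mu> \<in> Lam" shows "inj_on (chart \<mu>) (cball 0 (rad \<mu>))"
proof (rule inj_onI)
  fix v w :: "real \<times> real" assume "v \<in> cball 0 (rad \<mu>)" "w \<in> cball 0 (rad \<mu>)" and e: "chart \<mu> v = chart \<mu> w"
  hence "norm v \<le> rad \<mu>" "norm w \<le> rad \<mu>" by simp_all
  hence "\<bar>fst v\<bar> \<le> rad \<mu>" "\<bar>fst w\<bar> \<le> rad \<mu>" using fst_le_norm[of v] fst_le_norm[of w] by linarith+
  hence "fst v = fst w" using e xinv_props(2)[OF assms] by (metis chart_def fst_conv)
  thus "v = w" using e by (simp add: chart_def prod_eq_iff)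
qed

lemma chart_0: "\<mu> \<in> Lam \<Longrightarrow> chart \<mu> 0 = (0, 0)"
  by (simp add: chart_def xinv_0)

lemma X_field_well: "potential_well (pot (fst \<mu>) (snd \<mu>)) (frc (fst \<mu>) (snd \<mu>)) (frc1 (fst \<mu>) (snd \<mu>)) r \<Longrightarrow>
  X_field \<mu> = potential_well.X (frc (fst \<mu>) (snd \<mu>))"
  using X_field_eq[of "fst \<mu>" "snd \<mu>"] by (simp add: fun_eq_iff potential_well.X_def)

lemma lev_eq_level:
  assumes \<mu>: "\<mu> \<in> Lam" and r: "0 < r" "r < rad \<mu>"
  shows "potential_well.level (pot (fst \<mu>) (snd \<mu>)) r = lev \<mu> r"
proof -
  interpret smooth_well "pot (fst \<mu>) (snd \<mu>)" "frc (fst \<mu>) (snd \<mu>)" "frc1 (fst \<mu>) (snd \<mu>)" "rad \<mu>" 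
    "frc2 (fst \<mu>) (snd \<mu>)" "frc3 (fst \<mu>) (snd \<mu>)" by (rule Lam_well[OF \<mu>])
  show ?thesis unfolding level_eq_image[OF r] lev_def
  proof (rule image_cong[OF refl])
    fix w :: "real \<times> real" assume "w \<in> sphere 0 r"
    hence "\<bar>fst w\<bar> < rad \<mu>" using fst_le_norm[of w] r by simp
    thus "(ginv (fst w), snd w) = chart \<mu> w" using ginv_eq_xinv(1)[OF \<mu>] by (simp add: chart_def)
  qed
qed

text \<open>\<open>chart\<close> is continuous and injective on the compact ball, so off the
  puncture the frontier of the annulus is the image of the bounding circle. The annulus is bounded,
  hence nothing is added at infinity.\<close>

lemma outer_boundary_eq:
  assumes \<mu>: "\<mu> \<in> Lam"
  shows "outer_boundary half_plane (X_field \<mu>) (0, 0) = to_rp2 ` lev \<mu> (rad \<mu>)"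
proof -
  interpret smooth_well "pot (fst \<mu>) (snd \<mu>)" "frc (fst \<mu>) (snd \<mu>)" "frc1 (fst \<mu>) (snd \<mu>)" "rad \<mu>" 
    "frc2 (fst \<mu>) (snd \<mu>)" "frc3 (fst \<mu>) (snd \<mu>)" by (rule Lam_well[OF \<mu>])
  let ?R = "rad \<mu>" and ?A = "disc (rad \<mu>) - {(0, 0)}"
  have X: "X_field \<mu> = X" by (rule X_field_well) (rule potential_well_axioms)
  have R: "?R > 0" by (rule rad_pos[OF \<mu>])
  have disc: "disc ?R = chart \<mu> ` ball 0 ?R"
    unfolding disc_eq_image[OF R order_refl]
  proof (rule image_cong[OF refl])
    fix w :: "real \<times> real" assume "w \<in> ball 0 ?R"
    hence "\<bar>fst w\<bar> < rad \<mu>" using fst_le_norm[of w] by simp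
    thus "(ginv (fst w), snd w) = chart \<mu> w" using ginv_eq_xinv(1)[OF \<mu>] by (simp add: chart_def)
  qed
  have A: "?A = chart \<mu> ` (ball 0 ?R - {0})"
  proof -
    have "chart \<mu> ` (ball 0 ?R - {0}) = chart \<mu> ` ball 0 ?R - chart \<mu> ` {0}"
      by (rule inj_on_image_set_diff[OF chart_inj[OF \<mu>]]) (use R in auto)
    thus ?thesis unfolding disc using chart_0[OF \<mu>] by simp
  qed
  have comp: "compact (chart \<mu> ` cball 0 ?R)" by (intro compact_continuous_image chart_cont \<mu> compact_cball)
  have cl1: "closure ?A \<subseteq> chart \<mu> ` cball 0 ?R"
    by (rule closure_minimal) (use A comp in \<open>auto intro: compact_imp_closed\<close>)
  have cl2: "lev \<mu> ?R \<subseteq> closure ?A"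
  proof -
    have "closure (ball 0 ?R - {0 :: real \<times> real}) \<union> {0} = cball 0 ?R"
    proof -
      have "closure ((ball 0 ?R - {0 :: real \<times> real}) \<union> {0}) = closure (ball 0 ?R - {0}) \<union> {0}" by (subst closure_Un) simp
      moreover have "(ball 0 ?R - {0 :: real \<times> real}) \<union> {0} = ball 0 ?R" using R by auto
      ultimately show ?thesis using R by simp
    qed
    hence s: "closure (ball 0 ?R - {0 :: real \<times> real}) \<subseteq> cball 0 ?R"
      and s': "cball 0 ?R - {0} \<subseteq> closure (ball 0 ?R - {0 :: real \<times> real})" by blast+
    have "sphere 0 ?R \<subseteq> cball 0 ?R - {0 :: real \<times> real}" using R by auto
    with s' have s2: "sphere 0 ?R \<subseteq> closure (ball 0 ?R - {0 :: real \<times> real})" by blast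
    have "chart \<mu> ` closure (ball 0 ?R - {0}) \<subseteq> closure ?A"
      unfolding A by (rule image_closure_subset[OF continuous_on_subset[OF chart_cont[OF \<mu>] s]]) (auto intro: closure_subset[THEN subsetD])
    thus ?thesis using s2 unfolding lev_def by blast
  qed
  have opA: "open ?A" using disc_open by (intro open_Diff) auto
  have "frontier ?A - {(0, 0)} = lev \<mu> ?R"
  proof
    have "frontier ?A - {(0, 0)} \<subseteq> chart \<mu> ` cball 0 ?R - chart \<mu> ` ball 0 ?R"
      using cl1 opA disc by (auto simp: frontier_def interior_open)
    also have "\<dots> \<subseteq> lev \<mu> ?R"
    proof -
      have "cball 0 ?R = ball 0 ?R \<union> sphere (0 :: real \<times> real) ?R" by auto
      thus ?thesis unfolding lev_def by blast
    qed
    finally show "frontier ?A - {(0, 0)} \<subseteq> lev \<mu> ?R" .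
    have "lev \<mu> ?R \<inter> disc ?R = {}"
      unfolding disc lev_def using inj_on_image_Int[OF chart_inj[OF \<mu>], of "sphere 0 ?R" "ball 0 ?R"] by auto
    thus "lev \<mu> ?R \<subseteq> frontier ?A - {(0, 0)}"
      using cl2 opA origin_in_disc[OF R] by (auto simp: frontier_def interior_open)
  qed
  moreover have "bounded ?A" using A bounded_subset[OF compact_imp_bounded[OF comp]] by (metis (no_types) Diff_subset ball_subset_cball image_mono order_trans)
  ultimately show ?thesis
    unfolding outer_boundary_def X period_annulus_eq using to_rp2_frontier[of ?A] to_rp2_inj
    by (simp add: image_set_diff[symmetric, of to_rp2 _ "{(0, 0)}", simplified])
qed

definition Dom_closed :: "((real \<times> real) \<times> real) set"
  where "Dom_closed = {\<theta>. fst \<theta> \<in> Lam \<and> 0 < snd \<theta> \<and> snd \<theta> \<le> rad (fst \<theta>)}"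

lemma lev_scaled: "r > 0 \<Longrightarrow> to_rp2 ` lev \<mu> r = (\<lambda>e. to_rp2 (chart \<mu> (r *\<^sub>R e))) ` sphere 0 1"
proof -
  assume r: "r > 0"
  have "sphere (0 :: real \<times> real) r = (\<lambda>e. r *\<^sub>R e) ` sphere 0 1"
  proof
    show "sphere (0 :: real \<times> real) r \<subseteq> (\<lambda>e. r *\<^sub>R e) ` sphere 0 1"
    proof
      fix x :: "real \<times> real" assume "x \<in> sphere 0 r"
      thus "x \<in> (\<lambda>e. r *\<^sub>R e) ` sphere 0 1" using r by (intro image_eqI[of _ _ "x /\<^sub>R r"]) auto
    qed
  next
    show "(\<lambda>e. r *\<^sub>R e) ` sphere 0 1 \<subseteq> sphere (0 :: real \<times> real) r"
    proof
      fix x :: "real \<times> real" assume "x \<in> (\<lambda>e. r *\<^sub>R e) ` sphere 0 1"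
      then obtain e :: "real \<times> real" where "norm e = 1" "x = r *\<^sub>R e" by auto
      hence "norm x = r" using r by simp
      thus "x \<in> sphere 0 r" by simp
    qed
  qed
  thus ?thesis by (simp add: lev_def image_image)
qed

lemma sphere_nonempty: "sphere (0 :: real \<times> real) 1 \<noteq> {}"
proof -
  have "(1::real, 0::real) \<in> sphere 0 1" by (simp add: norm_Pair)
  thus ?thesis by blast
qed

text \<open>Both curves are indexed by the unit circle, so it suffices to compare points of equal
  index uniformly. If that failed along a sequence, compactness of the circle would give a
  convergent index and contradict the joint continuity of \<open>chart\<close>.\<close>

lemma lev_hausdorff_small:
  assumes \<mu>: "\<mu> \<in> Lam" and \<epsilon>: "\<epsilon> > 0"
  shows "eventually (\<lambda>\<theta>. hausdorff_dist (to_rp2 ` lev (fst \<theta>) (snd \<theta>)) (to_rp2 ` lev \<mu> (rad \<mu>)) \<le> \<epsilon>) (at (\<mu>, rad \<mu>) within Dom_closed)"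
proof (rule sequentially_imp_eventually_within, intro allI impI)
  fix \<theta> :: "nat \<Rightarrow> (real \<times> real) \<times> real" assume \<theta>: "(\<forall>n. \<theta> n \<in> Dom_closed \<and> \<theta> n \<noteq> (\<mu>, rad \<mu>)) \<and> \<theta> \<longlonglongrightarrow> (\<mu>, rad \<mu>)"
  let ?P = "\<lambda>n. hausdorff_dist (to_rp2 ` lev (fst (\<theta> n)) (snd (\<theta> n))) (to_rp2 ` lev \<mu> (rad \<mu>)) \<le> \<epsilon>"
  show "eventually ?P sequentially"
  proof (rule ccontr)
    assume "\<not> ?thesis"
    then obtain s :: "nat \<Rightarrow> nat" where s: "strict_mono s" "\<And>n. \<not> ?P (s n)"
      using not_eventually_sequentiallyD[of ?P] by blast
    have "\<exists>e\<in>sphere 0 1. dist (to_rp2 (chart (fst (\<theta> (s n))) (snd (\<theta> (s n)) *\<^sub>R e))) (to_rp2 (chart \<mu> (rad \<mu> *\<^sub>R e))) > \<epsilon>" for n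
    proof (rule ccontr)
      assume a: "\<not> ?thesis"
      have "snd (\<theta> (s n)) > 0" using \<theta> by (auto simp: Dom_closed_def)
      hence "?P (s n)" unfolding lev_scaled[OF rad_pos[OF \<mu>]]
        by (subst lev_scaled) (use a in \<open>auto intro!: hausdorff_dist_images_le sphere_nonempty simp: not_less\<close>)
      thus False using s(2) by blast
    qed
    then obtain e where e: "\<And>n. e n \<in> sphere 0 1"
      "\<And>n. dist (to_rp2 (chart (fst (\<theta> (s n))) (snd (\<theta> (s n)) *\<^sub>R e n))) (to_rp2 (chart \<mu> (rad \<mu> *\<^sub>R e n))) > \<epsilon>" by metis
    obtain e0 t where e0: "e0 \<in> sphere 0 1" "strict_mono t" "(e \<circ> t) \<longlonglongrightarrow> e0"
      using compact_sphere[of "0 :: real \<times> real" 1] e(1) unfolding compact_def by metis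
    define \<theta>' where "\<theta>' n = \<theta> (s (t n))" for n
    have \<theta>': "\<theta>' \<longlonglongrightarrow> (\<mu>, rad \<mu>)"
      using LIMSEQ_subseq_LIMSEQ[OF LIMSEQ_subseq_LIMSEQ[OF conjunct2[OF \<theta>] s(1)] e0(2)] by (simp add: \<theta>'_def[abs_def] o_def)
    have D: "\<theta>' n \<in> Dom_closed" for n using \<theta> by (simp add: \<theta>'_def)
    have et: "(\<lambda>n. e (t n)) \<longlonglongrightarrow> e0" using e0(3) by (simp add: o_def)
    have n1: "norm (e n) = 1" for n using e(1)[of n] by simp
    have lim1: "(\<lambda>n. chart (fst (\<theta>' n)) (snd (\<theta>' n) *\<^sub>R e (t n))) \<longlonglongrightarrow> chart \<mu> (rad \<mu> *\<^sub>R e0)"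
    proof (rule chart_tendsto[OF _ \<mu>])
      show "(\<lambda>n. fst (\<theta>' n)) \<longlonglongrightarrow> \<mu>" using tendsto_fst[OF \<theta>'] by simp
      show "(\<lambda>n. snd (\<theta>' n) *\<^sub>R e (t n)) \<longlonglongrightarrow> rad \<mu> *\<^sub>R e0" using tendsto_snd[OF \<theta>'] by (intro tendsto_scaleR et) simp
      show "eventually (\<lambda>n. norm (snd (\<theta>' n) *\<^sub>R e (t n)) \<le> rad (fst (\<theta>' n))) sequentially"
        using D by (auto simp: Dom_closed_def n1 abs_of_pos intro!: always_eventually)
    qed (use e0(1) rad_pos[OF \<mu>] in auto)
    have lim2: "(\<lambda>n. chart \<mu> (rad \<mu> *\<^sub>R e (t n))) \<longlonglongrightarrow> chart \<mu> (rad \<mu> *\<^sub>R e0)"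
      by (rule chart_tendsto[OF tendsto_const \<mu>]) (use e0(1) rad_pos[OF \<mu>] n1 et in \<open>auto intro!: tendsto_intros\<close>)
    have c: "isCont to_rp2 z" for z using to_rp2_cont[of UNIV] continuous_on_eq_continuous_at[OF open_UNIV] by blast
    have "(\<lambda>n. dist (to_rp2 (chart (fst (\<theta>' n)) (snd (\<theta>' n) *\<^sub>R e (t n)))) (to_rp2 (chart \<mu> (rad \<mu> *\<^sub>R e (t n))))) \<longlonglongrightarrow>
       dist (to_rp2 (chart \<mu> (rad \<mu> *\<^sub>R e0))) (to_rp2 (chart \<mu> (rad \<mu> *\<^sub>R e0)))"
      by (intro tendsto_dist isCont_tendsto_compose[OF c] lim1 lim2)
    moreover have "dist (to_rp2 (chart (fst (\<theta>' n)) (snd (\<theta>' n) *\<^sub>R e (t n)))) (to_rp2 (chart \<mu> (rad \<mu> *\<^sub>R e (t n)))) \<ge> \<epsilon>" for n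
      using e(2)[of "t n"] by (simp add: \<theta>'_def)
    ultimately have "\<epsilon> \<le> dist (to_rp2 (chart \<mu> (rad \<mu> *\<^sub>R e0))) (to_rp2 (chart \<mu> (rad \<mu> *\<^sub>R e0)))"
      by (intro LIMSEQ_le_const) auto
    thus False using \<epsilon> by simp
  qed
qed

text \<open>The filter at a point omits the point itself; the box includes it, and there the two
  curves coincide.\<close>

lemma lev_hausdorff_box:
  assumes \<mu>: "\<mu> \<in> Lam" and \<epsilon>: "\<epsilon> > 0"
  obtains \<eta> where "\<eta> > 0" "\<And>m r. m \<in> Lam \<Longrightarrow> 0 < r \<Longrightarrow> r \<le> rad m \<Longrightarrow> dist m \<mu> < \<eta> \<Longrightarrow> \<bar>r - rad \<mu>\<bar> < \<eta> \<Longrightarrow>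
    hausdorff_dist (to_rp2 ` lev m r) (to_rp2 ` lev \<mu> (rad \<mu>)) \<le> \<epsilon>"
proof -
  obtain d where d: "d > 0" "\<And>\<theta>. \<theta> \<in> Dom_closed \<Longrightarrow> \<theta> \<noteq> (\<mu>, rad \<mu>) \<Longrightarrow> dist \<theta> (\<mu>, rad \<mu>) < d \<Longrightarrow>
     hausdorff_dist (to_rp2 ` lev (fst \<theta>) (snd \<theta>)) (to_rp2 ` lev \<mu> (rad \<mu>)) \<le> \<epsilon>"
    using lev_hausdorff_small[OF assms] unfolding eventually_at by blast
  show ?thesis
  proof (rule that[of "d / 2"])
    fix m r assume m: "m \<in> Lam" "0 < r" "r \<le> rad m" "dist m \<mu> < d / 2" "\<bar>r - rad \<mu>\<bar> < d / 2"
    show "hausdorff_dist (to_rp2 ` lev m r) (to_rp2 ` lev \<mu> (rad \<mu>)) \<le> \<epsilon>"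
    proof (cases "(m, r) = (\<mu>, rad \<mu>)")
      case True
      thus ?thesis using \<epsilon> hausdorff_dist_images_le[OF sphere_nonempty, of "\<lambda>e. to_rp2 (chart \<mu> (rad \<mu> *\<^sub>R e))" "\<lambda>e. to_rp2 (chart \<mu> (rad \<mu> *\<^sub>R e))" \<epsilon>]
        by (simp add: lev_scaled[OF rad_pos[OF \<mu>]])
    next
      case False
      have "dist (m, r) (\<mu>, rad \<mu>) \<le> dist m \<mu> + dist r (rad \<mu>)"
        unfolding dist_Pair_Pair by (rule sqrt_sum_squares_le_sum) auto
      hence "dist (m, r) (\<mu>, rad \<mu>) < d" using m by (simp add: dist_real_def)
      thus ?thesis using d(2)[of "(m, r)"] m False by (simp add: Dom_closed_def)
    qed
  qed (use d in simp)
qed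

lemma outer_boundary_continuous:
  assumes \<mu>: "\<mu> \<in> Lam"
  shows "outer_boundary_continuous_at param_space half_plane X_field (0, 0) \<mu>"
  unfolding outer_boundary_continuous_at_def
proof (intro allI impI)
  fix \<epsilon> :: real assume \<epsilon>: "\<epsilon> > 0"
  obtain \<eta> where \<eta>: "\<eta> > 0" "\<And>m r. m \<in> Lam \<Longrightarrow> 0 < r \<Longrightarrow> r \<le> rad m \<Longrightarrow> dist m \<mu> < \<eta> \<Longrightarrow> \<bar>r - rad \<mu>\<bar> < \<eta> \<Longrightarrow>
    hausdorff_dist (to_rp2 ` lev m r) (to_rp2 ` lev \<mu> (rad \<mu>)) \<le> \<epsilon>" by (rule lev_hausdorff_box[OF \<mu> \<epsilon>]) blast
  have m: "((\<lambda>m. m) \<longlongrightarrow> \<mu>) (nhds \<mu>)" by (rule filterlim_ident)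
  have "eventually (\<lambda>m. dist (rad m) (rad \<mu>) < \<eta>) (nhds \<mu>)" by (rule tendstoD[OF rad_tendsto[OF m \<mu>] \<eta>(1)])
  hence "eventually (\<lambda>m. m \<in> Lam \<and> dist (rad m) (rad \<mu>) < \<eta>) (nhds \<mu>)" using eventually_Lam[OF m \<mu>] by eventually_elim simp
  then obtain d where d: "d > 0" "\<And>m. dist m \<mu> < d \<Longrightarrow> m \<in> Lam \<and> dist (rad m) (rad \<mu>) < \<eta>" unfolding eventually_nhds_metric by blast
  show "\<exists>\<delta>>0. \<forall>m\<in>param_space. dist m \<mu> \<le> \<delta> \<longrightarrow>
      hausdorff_dist (outer_boundary half_plane (X_field m) (0, 0)) (outer_boundary half_plane (X_field \<mu>) (0, 0)) \<le> \<epsilon>"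
  proof (intro exI[of _ "min d \<eta> / 2"] conjI ballI impI)
    fix m assume "dist m \<mu> \<le> min d \<eta> / 2"
    hence "dist m \<mu> < d" "dist m \<mu> < \<eta>" using d(1) \<eta>(1) by (auto simp: min_def split: if_splits)
    thus "hausdorff_dist (outer_boundary half_plane (X_field m) (0, 0)) (outer_boundary half_plane (X_field \<mu>) (0, 0)) \<le> \<epsilon>"
      using d(2)[of m] \<eta>(2)[of m "rad m"] rad_pos[of m] by (simp add: outer_boundary_eq \<mu> dist_real_def)
  qed (use d \<eta> in simp)
qed

text \<open>One test point suffices: the outer boundary contains (0, \<open>rad \<mu>\<close>), a
  curve close to it has a point nearby, and \<open>energy\<close> at that point is r^2.\<close>

lemma hausdorff_forces_radius:
  assumes \<mu>: "\<mu> \<in> Lam" and \<eta>: "\<eta> > 0"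
  obtains \<delta> \<epsilon> where "\<delta> > 0" "\<epsilon> > 0" "\<And>m r. m \<in> Lam \<Longrightarrow> dist m \<mu> \<le> \<delta> \<Longrightarrow> 0 < r \<Longrightarrow> r < rad m \<Longrightarrow>
    hausdorff_dist (to_rp2 ` lev m r) (to_rp2 ` lev \<mu> (rad \<mu>)) \<le> \<epsilon> \<Longrightarrow> \<bar>r - rad \<mu>\<bar> < \<eta>"
proof -
  let ?R = "rad \<mu>"
  let ?g = "\<lambda>t. sqrt ((snd (snd t))\<^sup>2 + 2 * pot (fst (fst t)) (snd (fst t)) (fst (snd t)))"
  let ?F = "nhds \<mu> \<times>\<^sub>F nhds (0, ?R)"
  have R: "?R > 0" by (rule rad_pos[OF \<mu>])
  have f: "filterlim fst (nhds \<mu>) ?F" "filterlim snd (nhds (0, ?R)) ?F" by (rule filterlim_fst filterlim_snd)+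
  have f2: "((\<lambda>t. fst (snd t)) \<longlongrightarrow> 0) ?F" "((\<lambda>t. snd (snd t)) \<longlongrightarrow> ?R) ?F"
    using tendsto_fst[OF f(2)] tendsto_snd[OF f(2)] by simp_all
  have "(?g \<longlongrightarrow> sqrt (?R\<^sup>2 + 2 * pot (fst \<mu>) (snd \<mu>) 0)) ?F"
    by (intro tendsto_intros f2 pot_tendsto[OF f(1) \<mu> f2(1)]) simp
  hence "(?g \<longlongrightarrow> ?R) ?F" using R by simp
  hence "eventually (\<lambda>t. dist (?g t) ?R < \<eta>) ?F" using \<eta> by (rule tendstoD)
  then obtain Pf Pg where P: "eventually Pf (nhds \<mu>)" "eventually Pg (nhds (0, ?R))" "\<And>m w. Pf m \<Longrightarrow> Pg w \<Longrightarrow> dist (?g (m, w)) ?R < \<eta>"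
    unfolding eventually_prod_filter by auto
  obtain d where d: "d > 0" "\<And>m. dist m \<mu> < d \<Longrightarrow> Pf m" using P(1) unfolding eventually_nhds_metric by blast
  obtain e where e: "e > 0" "\<And>w. dist w (0, ?R) < e \<Longrightarrow> Pg w" using P(2) unfolding eventually_nhds_metric by blast
  obtain \<delta>' where \<delta>': "\<delta>' > 0" "\<And>L. dist L (to_rp2 (0, ?R)) < \<delta>' \<Longrightarrow> \<exists>w. L = to_rp2 w \<and> dist w (0, ?R) < e"
    using to_rp2_local_inverse[OF e(1), of "(0, ?R)"] by blast
  have b: "to_rp2 (0, ?R) \<in> to_rp2 ` lev \<mu> ?R"
    unfolding lev_def using R by (intro imageI image_eqI[of _ _ "(0, ?R)"]) (auto simp: chart_def xinv_0[OF \<mu>] norm_Pair)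
  show ?thesis
  proof (rule that[of "d / 2" "\<delta>' / 2"])
    fix m r assume m: "m \<in> Lam" "dist m \<mu> \<le> d / 2" and r: "0 < r" "r < rad m"
      and h: "hausdorff_dist (to_rp2 ` lev m r) (to_rp2 ` lev \<mu> ?R) \<le> \<delta>' / 2"
    have lt: "hausdorff_dist (to_rp2 ` lev m r) (to_rp2 ` lev \<mu> ?R) < \<delta>'" using h \<delta>'(1) by linarith
    have ne: "to_rp2 ` lev m r \<noteq> {}" using sphere_nonempty by (simp add: lev_scaled[OF r(1)])
    obtain L where L: "L \<in> to_rp2 ` lev m r" "dist (to_rp2 (0, ?R)) L < \<delta>'"
      by (rule hausdorff_dist_rp2_near[OF lt ne b])
    obtain w where w: "L = to_rp2 w" "dist w (0, ?R) < e" using \<delta>'(2)[of L] L(2) by (auto simp: dist_commute)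
    have "w \<in> lev m r" using L(1) w(1) to_rp2_inj by (auto dest: injD)
    hence "w \<in> potential_well.level (pot (fst m) (snd m)) r" using lev_eq_level[OF m(1) r] by simp
    hence "?g (m, w) = r"
    proof -
      assume a: "w \<in> potential_well.level (pot (fst m) (snd m)) r"
      interpret smooth_well "pot (fst m) (snd m)" "frc (fst m) (snd m)" "frc1 (fst m) (snd m)" "rad m" 
      "frc2 (fst m) (snd m)" "frc3 (fst m) (snd m)" by (rule Lam_well[OF m(1)])
      show "?g (m, w) = r" using a r by (simp add: level_def energy_def)
    qed
    moreover have "dist (?g (m, w)) ?R < \<eta>" using m(2) d w(2) e(2) by (intro P(3)) auto
    ultimately show "\<bar>r - ?R\<bar> < \<eta>" by (simp add: dist_real_def)
  qed (use d \<delta>' in auto)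
qed

section \<open>The zero of \<open>f_fun\<close>\<close>

text \<open>With \<open>t = (3 + 3 p) / 2\<close> the equation \<open>f_fun p = 0\<close> reads \<open>t ln t = (t - 1) ln (2 t - 1)\<close>.\<close>

definition log_gap :: "real \<Rightarrow> real" where "log_gap t = t * ln t - (t - 1) * ln (2 * t - 1)"

definition log_gap' :: "real \<Rightarrow> real" where "log_gap' t = ln t - ln (2 * t - 1) + 1 / (2 * t - 1)"

lemma log_gap_deriv: assumes "t > 1/2" shows "(log_gap has_real_derivative log_gap' t) (at t)"
proof -
  have "(log_gap has_real_derivative (ln t + 1) - (ln (2 * t - 1) + (t - 1) * (2 / (2 * t - 1)))) (at t)"
    unfolding log_gap_def[abs_def] using assms by (auto intro!: derivative_eq_intros)
  moreover have "(t - 1) * (2 / (2 * t - 1)) = 1 - 1 / (2 * t - 1)" using assms by (simp add: field_simps)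
  ultimately have "(log_gap has_real_derivative (ln t + 1) - (ln (2 * t - 1) + (1 - 1 / (2 * t - 1)))) (at t)" by (simp only:)
  moreover have "(ln t + 1) - (ln (2 * t - 1) + (1 - 1 / (2 * t - 1))) = log_gap' t" by (simp add: log_gap'_def)
  ultimately show ?thesis by (simp only:)
qed

lemma log_gap'_deriv: "t > 1/2 \<Longrightarrow> (log_gap' has_real_derivative 1 / t - 2 / (2 * t - 1) - 2 / (2 * t - 1)\<^sup>2) (at t)"
  unfolding log_gap'_def by (auto intro!: derivative_eq_intros simp: field_simps power2_eq_square)

lemma log_gap'_strict_antimono:
  assumes "1 \<le> s" "s < t" shows "log_gap' t < log_gap' s"
proof (rule DERIV_neg_imp_decreasing[OF assms(2)])
  fix x assume x: "s \<le> x" "x \<le> t"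
  hence x1: "x \<ge> 1" using assms by simp
  have "1 / x - 2 / (2 * x - 1) - 2 / (2 * x - 1)\<^sup>2 = (1 - 4 * x) / (x * (2 * x - 1)\<^sup>2)"
    using x1 by (simp add: divide_simps power2_eq_square)
  also have "\<dots> < 0" using x1 by (intro divide_neg_pos mult_pos_pos) auto
  finally show "\<exists>y. (log_gap' has_real_derivative y) (at x) \<and> y < 0" using log_gap'_deriv[of x] x1 by (intro exI conjI) auto
qed

text \<open>\<open>log_gap\<close> also vanishes at 1, so two zeros beyond 1 would give, by Rolle,
  two zeros of its strictly decreasing derivative.\<close>

lemma log_gap_zero_unique:
  assumes "1 < s" "s < t" "log_gap s = 0" "log_gap t = 0" shows False
proof -
  have one: "log_gap 1 = 0" by (simp add: log_gap_def)
  have "\<exists>z. 1 < z \<and> z < s \<and> log_gap s - log_gap 1 = (s - 1) * log_gap' z"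
    by (rule MVT2) (use assms in \<open>auto intro!: log_gap_deriv\<close>)
  then obtain z1 where z1: "1 < z1" "z1 < s" "log_gap' z1 = 0" using assms one by auto
  have "\<exists>z. s < z \<and> z < t \<and> log_gap t - log_gap s = (t - s) * log_gap' z"
    by (rule MVT2) (use assms in \<open>auto intro!: log_gap_deriv\<close>)
  then obtain z2 where z2: "s < z2" "z2 < t" "log_gap' z2 = 0" using assms by auto
  show False using log_gap'_strict_antimono[of z1 z2] z1 z2 by simp
qed

lemma f_fun_zero_iff:
  assumes p: "p > -1/3"
  shows "f_fun p = 0 \<longleftrightarrow> log_gap ((3 + 3 * p) / 2) = 0"
proof -
  define t where "t = (3 + 3 * p) / 2"
  have t: "t > 1" using p by (simp add: t_def field_simps)
  have e: "(3 + 3 * p) / (1 + 3 * p) = t / (t - 1)" using p by (simp add: t_def field_simps)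
  have "f_fun p = t powr (t / (t - 1)) - (2 * t - 1)"
  proof -
    have "2 * t - 1 = 3 * p + 2" by (simp add: t_def field_simps)
    thus ?thesis unfolding f_fun_def e t_def[symmetric] by simp
  qed
  hence "f_fun p = 0 \<longleftrightarrow> t powr (t / (t - 1)) = 2 * t - 1" by auto
  also have "\<dots> \<longleftrightarrow> ln (t powr (t / (t - 1))) = ln (2 * t - 1)"
    using t by (subst ln_inj_iff) auto
  also have "\<dots> \<longleftrightarrow> t / (t - 1) * ln t = ln (2 * t - 1)" using t by (simp add: ln_powr)
  also have "\<dots> \<longleftrightarrow> log_gap t = 0" using t by (simp add: log_gap_def field_simps)
  finally show ?thesis by (simp add: t_def)
qed

section \<open>Rational bounds for the logarithms that locate the zero\<close>

lemma ln_explicit: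
  fixes x :: real assumes "x > 1" and y: "y = (x - 1) / (x + 1)"
  shows "2 * (y + y^3/3 + y^5/5 + y^7/7 + y^9/9 + y^11/11 + y^13/13 + y^15/15) \<le> ln x"
    "ln x \<le> 2 * (y + y^3/3 + y^5/5 + y^7/7 + y^9/9 + y^11/11 + y^13/13 + y^15/15) + 2 * (y^17 / (1 - y\<^sup>2) / 17)"
proof -
  have s: "(\<Sum>k<8. 2 * y ^ (2 * k + 1) / real (2 * k + 1)) = 2 * (y + y^3/3 + y^5/5 + y^7/7 + y^9/9 + y^11/11 + y^13/13 + y^15/15)"
    by (simp add: numeral_eq_Suc)
  show "2 * (y + y^3/3 + y^5/5 + y^7/7 + y^9/9 + y^11/11 + y^13/13 + y^15/15) \<le> ln x"
    "ln x \<le> 2 * (y + y^3/3 + y^5/5 + y^7/7 + y^9/9 + y^11/11 + y^13/13 + y^15/15) + 2 * (y^17 / (1 - y\<^sup>2) / 17)"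
    using ln_approx_bounds[OF assms(1), of 8] unfolding y[symmetric] s by simp_all
qed

text \<open>Eight terms of the series of artanh l in Horner form, with l^2 replaced by an
  independent variable s so that both can be rounded separately; ln x is twice artanh of (x - 1) /
  (x + 1).\<close>

definition artanh_sum :: "real \<Rightarrow> real \<Rightarrow> real"
  where "artanh_sum l s = l * (1 + s * (1/3 + s * (1/5 + s * (1/7 + s * (1/9 + s * (1/11 + s * (1/13 + s * (1/15))))))))"

lemma artanh_sum_eq:
  "artanh_sum y (y\<^sup>2) = y + y^3/3 + y^5/5 + y^7/7 + y^9/9 + y^11/11 + y^13/13 + y^15/15"
  by (simp add: artanh_sum_def numeral_eq_Suc algebra_simps)

lemma artanh_sum_mono:
  assumes "0 \<le> l" "l \<le> l'" "0 \<le> s" "s \<le> s'" shows "artanh_sum l s \<le> artanh_sum l' s'"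
  unfolding artanh_sum_def using assms
  by (intro mult_mono add_mono order_refl add_nonneg_nonneg mult_nonneg_nonneg) auto

lemma ln_lower:
  fixes x :: real
  assumes "x > 1" "0 \<le> l" "l \<le> (x - 1) / (x + 1)" "0 \<le> s" "s \<le> l * l"
  shows "2 * artanh_sum l s \<le> ln x"
proof -
  have "l * l \<le> ((x - 1) / (x + 1))\<^sup>2" unfolding power2_eq_square using assms by (intro mult_mono) auto
  hence "artanh_sum l s \<le> artanh_sum ((x - 1) / (x + 1)) (((x - 1) / (x + 1))\<^sup>2)"
    using assms by (intro artanh_sum_mono) auto
  thus ?thesis using ln_explicit(1)[OF assms(1) refl, folded artanh_sum_eq] by linarith
qed

lemma ln_upper:
  fixes x :: real
  assumes "x > 1" "(x - 1) / (x + 1) \<le> u" "u * u \<le> s" "s < 1"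
  shows "ln x \<le> 2 * artanh_sum u s + 2 * (u * s ^ 8 / (1 - s) / 17)"
proof -
  define y where "y = (x - 1) / (x + 1)"
  have y: "0 \<le> y" "y \<le> u" using assms by (auto simp: y_def)
  have "y\<^sup>2 \<le> u * u" unfolding power2_eq_square using y by (intro mult_mono) auto
  hence y2: "y\<^sup>2 \<le> s" using assms by simp
  have "artanh_sum y (y\<^sup>2) \<le> artanh_sum u s" using y y2 by (intro artanh_sum_mono) auto
  moreover have "y ^ 17 / (1 - y\<^sup>2) \<le> u * s ^ 8 / (1 - s)"
  proof (rule frac_le)
    have "y ^ 17 = y * (y\<^sup>2) ^ 8" by (simp add: power_mult[symmetric] power_Suc[symmetric] del: power_Suc)
    also have "\<dots> \<le> u * s ^ 8" using y y2 by (intro mult_mono power_mono) auto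
    finally show "y ^ 17 \<le> u * s ^ 8" .
    show "0 \<le> u * s ^ 8" using y y2 by (intro mult_nonneg_nonneg zero_le_power) (auto intro: order_trans[of 0 "y\<^sup>2"])
  qed (use y2 assms in auto)
  moreover have "A \<le> 2 * B' + 2 * (C' / 17)" if "A \<le> 2 * B + 2 * (C / 17)" "B \<le> B'" "C \<le> C'" for A B B' C C' :: real
    using that by linarith
  ultimately show ?thesis using ln_explicit(2)[OF assms(1) y_def, folded artanh_sum_eq] by blast
qed

text \<open>The non-integer arguments are t / 2 and (2 t - 1) / 4 for t = (3 + 3 p) / 2 at p =
  1.15685 \<plusminus> 0.000005. Dividing by 2 and 4 brings them near 1, where the series converges
  fast, at the price of a ln 2 term.\<close>

lemma ln_numeric:
  "ln (1.61763375 :: real) \<ge> 0.48096440" "ln (1.36763375 :: real) \<le> 0.31308209"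
  "ln (1.61764125 :: real) \<le> 0.48096910" "ln (1.36764125 :: real) \<ge> 0.31308752"
  "ln (2 :: real) \<le> 0.69314720" "ln (2 :: real) \<ge> 0.69314717"
proof -
  show "ln (1.61763375 :: real) \<ge> 0.48096440"
    by (rule order_trans[OF _ ln_lower[where l = "0.235951171" and s = "0.055672955"]]) (simp_all add: artanh_sum_def)
  show "ln (1.36763375 :: real) \<le> 0.31308209"
    \<comment> \<open>For upper bounds \<open>u\<close> and \<open>s\<close> round (x - 1) / (x + 1)
      and its square upwards; the lower bounds round them downwards.\<close>
    by (rule order_trans[OF ln_upper[where u = "0.155274755" and s = "0.02411025"]]) (simp_all add: artanh_sum_def power_divide)
  show "ln (1.61764125 :: real) \<le> 0.48096910"
    by (rule order_trans[OF ln_upper[where u = "0.235953361" and s = "0.055673989"]]) (simp_all add: artanh_sum_def power_divide)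
  show "ln (1.36764125 :: real) \<ge> 0.31308752"
    by (rule order_trans[OF _ ln_lower[where l = "0.15527743" and s = "0.02411108"]]) (simp_all add: artanh_sum_def)
  show "ln (2 :: real) \<le> 0.69314720"
    by (rule order_trans[OF ln_upper[where u = "1/3" and s = "1/9"]]) (simp_all add: artanh_sum_def power_divide)
  show "ln (2 :: real) \<ge> 0.69314717"
    by (rule order_trans[OF _ ln_lower[where l = "1/3" and s = "1/9"]]) (simp_all add: artanh_sum_def)
qed

lemma log_gap_numeric: "log_gap 3.2352675 > 0" "log_gap 3.2352825 < 0"
proof -
  have split: "log_gap t = t * ln (t / 2) - (t - 1) * ln ((2 * t - 1) / 4) + (2 - t) * ln 2" if "t > 1" for t
  proof -
    have "ln (4::real) = 2 * ln 2" using ln_realpow[of 2 2] by simp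
    thus ?thesis using that by (simp add: log_gap_def ln_div algebra_simps)
  qed
  have "log_gap 3.2352675 = 3.2352675 * ln 1.61763375 - 2.2352675 * ln 1.36763375 - 1.2352675 * ln 2"
    by (subst split) simp_all
  also have "\<dots> > 0" using ln_numeric by simp
  finally show "log_gap 3.2352675 > 0" .
  have "log_gap 3.2352825 = 3.2352825 * ln 1.61764125 - 2.2352825 * ln 1.36764125 - 1.2352825 * ln 2"
    by (subst split) simp_all
  also have "\<dots> < 0" using ln_numeric by simp
  finally show "log_gap 3.2352825 < 0" .
qed

lemma f_fun_zero:
  obtains p1 where "{p. p > -1/3 \<and> f_fun p = 0} = {p1}" "\<bar>p1 - 1.15685\<bar> < 0.000005"
proof -
  have "\<exists>t\<ge>3.2352675. t \<le> 3.2352825 \<and> log_gap t = 0"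
    by (rule IVT2') (use log_gap_numeric in \<open>auto intro!: continuous_at_imp_continuous_on DERIV_isCont[OF log_gap_deriv]\<close>)
  then obtain t where t: "3.2352675 \<le> t" "t \<le> 3.2352825" "log_gap t = 0" by blast
  have "False" if "t = s" "log_gap s > 0 \<or> log_gap s < 0" for s using that t(3) by auto
  hence tn: "t \<noteq> 3.2352675" "t \<noteq> 3.2352825" using log_gap_numeric by blast+
  define p1 where "p1 = (2 * t - 3) / 3"
  have tp: "(3 + 3 * p1) / 2 = t" by (simp add: p1_def field_simps)
  have p1: "p1 > -1/3" using t by (simp add: p1_def field_simps)
  have "p = p1" if p: "p > -1/3" "f_fun p = 0" for p
  proof -
    have "log_gap ((3 + 3 * p) / 2) = 0" "(3 + 3 * p) / 2 > 1" using p f_fun_zero_iff[OF p(1)] by (auto simp: field_simps)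
    moreover have "t > 1" using t(1) by simp
    ultimately have "(3 + 3 * p) / 2 = t"
      using log_gap_zero_unique[of t "(3 + 3 * p) / 2"] log_gap_zero_unique[of "(3 + 3 * p) / 2" t] t(3)
      by (cases t "(3 + 3 * p) / 2" rule: linorder_cases) auto
    thus ?thesis by (simp add: p1_def field_simps)
  qed
  moreover have "f_fun p1 = 0" using f_fun_zero_iff[OF p1] t by (simp add: tp)
  ultimately have "{p. p > -1/3 \<and> f_fun p = 0} = {p1}" using p1 by blast
  moreover have "\<bar>p1 - 1.15685\<bar> < 0.000005"
  proof -
    have "3 * p1 = 2 * t - 3" by (simp add: p1_def)
    moreover have "t > 3.2352675" "t < 3.2352825" using t(1,2) tn by (simp_all only: less_le) simp_all
    ultimately show ?thesis unfolding abs_less_iff by auto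
  qed
  ultimately show ?thesis using that by blast
qed

section \<open>Criticality\<close>

lemma dper_eq:
  assumes "\<mu> \<in> Lam"
  shows "smooth_well.dper (pot (fst \<mu>) (snd \<mu>)) (frc (fst \<mu>) (snd \<mu>)) (frc1 (fst \<mu>) (snd \<mu>)) (frc2 (fst \<mu>) (snd \<mu>)) r = - dp \<mu> r"
    and "smooth_well.EE (pot (fst \<mu>) (snd \<mu>)) (frc (fst \<mu>) (snd \<mu>)) (frc1 (fst \<mu>) (snd \<mu>)) (rad \<mu>) (frc2 (fst \<mu>) (snd \<mu>)) (frc3 (fst \<mu>) (snd \<mu>))
       (1 / (fst \<mu> + 1)) r = ee \<mu> r"
proof -
  interpret smooth_well "pot (fst \<mu>) (snd \<mu>)" "frc (fst \<mu>) (snd \<mu>)" "frc1 (fst \<mu>) (snd \<mu>)" "rad \<mu>" 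
    "frc2 (fst \<mu>) (snd \<mu>)" "frc3 (fst \<mu>) (snd \<mu>)" by (rule Lam_well[OF assms])
  show "dper r = - dp \<mu> r"
    unfolding dper_def dp_def kk1_def by (subst integral_neg[symmetric]) simp
  show "EE (1 / (fst \<mu> + 1)) r = ee \<mu> r"
    unfolding EE_def ee_def \<Phi>_def Phi_def kk_def kk1_def kk2_def by simp
qed

lemma critical_iff:
  assumes \<mu>: "\<mu> \<in> Lam"
  shows "critical_periodic_orbit half_plane (X_field \<mu>) (0, 0) \<gamma> \<longleftrightarrow> (\<exists>r. 0 < r \<and> r < rad \<mu> \<and> \<gamma> = lev \<mu> r \<and> dp \<mu> r = 0)"
proof -
  interpret smooth_well "pot (fst \<mu>) (snd \<mu>)" "frc (fst \<mu>) (snd \<mu>)" "frc1 (fst \<mu>) (snd \<mu>)" "rad \<mu>" 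
    "frc2 (fst \<mu>) (snd \<mu>)" "frc3 (fst \<mu>) (snd \<mu>)" by (rule Lam_well[OF \<mu>])
  have X: "X_field \<mu> = X" by (rule X_field_well) (rule potential_well_axioms)
  show ?thesis
  proof
    assume "critical_periodic_orbit half_plane (X_field \<mu>) (0, 0) \<gamma>"
    then obtain r where "0 < r" "r < rad \<mu>" "\<gamma> = level r" "2 * dper r = 0"
      unfolding X using critical_imp_zero[of "\<lambda>r. 2 * dper r" \<gamma>, OF period_deriv] by blast
    thus "\<exists>r. 0 < r \<and> r < rad \<mu> \<and> \<gamma> = lev \<mu> r \<and> dp \<mu> r = 0" using lev_eq_level[OF \<mu>] dper_eq(1)[OF \<mu>] by auto
  next
    assume "\<exists>r. 0 < r \<and> r < rad \<mu> \<and> \<gamma> = lev \<mu> r \<and> dp \<mu> r = 0"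
    then obtain r where r: "0 < r" "r < rad \<mu>" "\<gamma> = lev \<mu> r" "dp \<mu> r = 0" by blast
    have "(period has_real_derivative 0) (at r)" using period_deriv[OF r(1,2)] dper_eq(1)[OF \<mu>, of r] r(4) by simp
    thus "critical_periodic_orbit half_plane (X_field \<mu>) (0, 0) \<gamma>"
      unfolding X using zero_imp_critical[OF r(1,2)] lev_eq_level[OF \<mu> r(1,2)] r(3) by simp
  qed
qed

lemma dp_zero_unique:
  assumes \<mu>: "\<mu> \<in> Lam" and r0: "0 \<le> r0" and sg: "\<sigma> \<noteq> 0" "\<And>r. r0 < r \<Longrightarrow> r < rad \<mu> \<Longrightarrow> \<sigma> * ee \<mu> r > 0"
    and a: "r0 < a" "a < rad \<mu>" "dp \<mu> a = 0" and b: "r0 < b" "b < rad \<mu>" "dp \<mu> b = 0"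
  shows "a = b"
proof -
  interpret smooth_well "pot (fst \<mu>) (snd \<mu>)" "frc (fst \<mu>) (snd \<mu>)" "frc1 (fst \<mu>) (snd \<mu>)" "rad \<mu>" 
    "frc2 (fst \<mu>) (snd \<mu>)" "frc3 (fst \<mu>) (snd \<mu>)" by (rule Lam_well[OF \<mu>])
  show ?thesis
    by (rule dper_zero_unique[OF r0 sg(1), where A = "1 / (fst \<mu> + 1)"])
       (use sg(2) a b in \<open>simp_all add: dper_eq[OF \<mu>]\<close>)
qed

lemma dp_cont: assumes \<mu>: "\<mu> \<in> Lam" and r: "0 < r" "r < rad \<mu>" shows "isCont (dp \<mu>) r"
proof -
  interpret smooth_well "pot (fst \<mu>) (snd \<mu>)" "frc (fst \<mu>) (snd \<mu>)" "frc1 (fst \<mu>) (snd \<mu>)" "rad \<mu>" 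
    "frc2 (fst \<mu>) (snd \<mu>)" "frc3 (fst \<mu>) (snd \<mu>)" by (rule Lam_well[OF \<mu>])
  have "isCont (\<lambda>r. - dper r) r" using DERIV_isCont[OF dper_deriv[OF r]] by (intro continuous_intros)
  thus ?thesis by (simp add: dper_eq(1)[OF \<mu>])
qed

lemma Lam_ball:
  assumes "\<mu> \<in> Lam" "\<eta> > 0"
  obtains d where "d > 0" "\<And>m. dist m \<mu> < d \<Longrightarrow> m \<in> Lam \<and> \<bar>rad m - rad \<mu>\<bar> < \<eta>"
proof -
  have m: "((\<lambda>m. m) \<longlongrightarrow> \<mu>) (nhds \<mu>)" by (rule filterlim_ident)
  have "eventually (\<lambda>m. m \<in> Lam \<and> dist (rad m) (rad \<mu>) < \<eta>) (nhds \<mu>)"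
    using eventually_Lam[OF m assms(1)] tendstoD[OF rad_tendsto[OF m assms(1)] assms(2)] by eventually_elim simp
  thus ?thesis using that unfolding eventually_nhds_metric dist_real_def by blast
qed

lemma eventually_Dom_box:
  assumes "eventually P (at (\<mu>, r) within Dom)" "(\<mu>, r) \<notin> Dom"
  obtains \<eta> where "\<eta> > 0" "\<And>m s. m \<in> Lam \<Longrightarrow> 0 < s \<Longrightarrow> s < rad m \<Longrightarrow> dist m \<mu> < \<eta> \<Longrightarrow> \<bar>s - r\<bar> < \<eta> \<Longrightarrow> P (m, s)"
proof -
  obtain d where d: "d > 0" "\<And>\<theta>. \<theta> \<in> Dom \<Longrightarrow> \<theta> \<noteq> (\<mu>, r) \<Longrightarrow> dist \<theta> (\<mu>, r) < d \<Longrightarrow> P \<theta>"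
    using assms(1) unfolding eventually_at by blast
  show ?thesis
  proof (rule that[of "d / 2"])
    fix m s assume m: "m \<in> Lam" "0 < s" "s < rad m" "dist m \<mu> < d / 2" "\<bar>s - r\<bar> < d / 2"
    have "dist (m, s) (\<mu>, r) \<le> dist m \<mu> + dist s r"
      unfolding dist_Pair_Pair by (rule sqrt_sum_squares_le_sum) auto
    hence "dist (m, s) (\<mu>, r) < d" using m by (simp add: dist_real_def)
    moreover have "(m, s) \<in> Dom" using m by (simp add: Dom_def)
    ultimately show "P (m, s)" using d(2)[of "(m, s)"] assms(2) by auto
  qed (use d in simp)
qed

text \<open>An orbit Hausdorff-close to the outer boundary has radius close to
  \<open>rad \<mu>\<close>, so counting critical orbits reduces to counting zeros of
  \<open>dp m\<close> in a short interval.\<close>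

lemma Crit_le:
  assumes \<mu>: "\<mu> \<in> Lam" and \<eta>: "\<eta> > 0"
    and few: "\<And>m. m \<in> Lam \<Longrightarrow> dist m \<mu> < \<eta> \<Longrightarrow> finite {r. 0 < r \<and> r < rad m \<and> \<bar>r - rad \<mu>\<bar> < \<eta> \<and> dp m r = 0} \<and>
        card {r. 0 < r \<and> r < rad m \<and> \<bar>r - rad \<mu>\<bar> < \<eta> \<and> dp m r = 0} \<le> n"
  shows "Crit param_space half_plane X_field (0, 0) \<mu> \<le> enat n"
proof -
  obtain \<delta> \<epsilon> where de: "\<delta> > 0" "\<epsilon> > 0" "\<And>m r. m \<in> Lam \<Longrightarrow> dist m \<mu> \<le> \<delta> \<Longrightarrow> 0 < r \<Longrightarrow> r < rad m \<Longrightarrow>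
    hausdorff_dist (to_rp2 ` lev m r) (to_rp2 ` lev \<mu> (rad \<mu>)) \<le> \<epsilon> \<Longrightarrow> \<bar>r - rad \<mu>\<bar> < \<eta>"
    by (rule hausdorff_forces_radius[OF \<mu> \<eta>]) blast
  obtain d where d: "d > 0" "\<And>m. dist m \<mu> < d \<Longrightarrow> m \<in> Lam \<and> \<bar>rad m - rad \<mu>\<bar> < \<eta>" by (rule Lam_ball[OF \<mu> \<eta>]) blast
  define \<delta>' where "\<delta>' = min \<delta> (min d \<eta> / 2)"
  have \<delta>': "\<delta>' > 0" "\<delta>' \<le> \<delta>" "\<delta>' < d" "\<delta>' < \<eta>" using de(1) d(1) \<eta> by (auto simp: \<delta>'_def min_def)
  have "crit_bound param_space half_plane X_field (0, 0) \<mu> \<delta>' \<epsilon> \<le> enat n"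
    unfolding crit_bound_def
  proof (rule SUP_least)
    fix m assume "m \<in> {m \<in> param_space. dist m \<mu> \<le> \<delta>'}"
    hence m: "dist m \<mu> \<le> \<delta>" "dist m \<mu> < \<eta>" "m \<in> Lam" using \<delta>' d(2)[of m] by auto
    let ?Z = "{r. 0 < r \<and> r < rad m \<and> \<bar>r - rad \<mu>\<bar> < \<eta> \<and> dp m r = 0}"
    let ?S = "{\<gamma>. critical_periodic_orbit half_plane (X_field m) (0, 0) \<gamma> \<and>
        hausdorff_dist (to_rp2 ` \<gamma>) (outer_boundary half_plane (X_field \<mu>) (0, 0)) \<le> \<epsilon>}"
    have sub: "?S \<subseteq> lev m ` ?Z"
      using de(3)[OF m(3,1)] by (auto simp: critical_iff[OF m(3)] outer_boundary_eq[OF \<mu>])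
    have fin: "finite ?Z" "card ?Z \<le> n" using few[OF m(3,2)] by auto
    have "finite ?S" using finite_subset[OF sub] fin by blast
    moreover have "card ?S \<le> n"
      using card_mono[OF finite_imageI[OF fin(1)] sub] card_image_le[OF fin(1), of "lev m"] fin(2) by linarith
    ultimately show "ecard ?S \<le> enat n" by (simp add: ecard_def)
  qed
  moreover have "Crit param_space half_plane X_field (0, 0) \<mu> \<le> crit_bound param_space half_plane X_field (0, 0) \<mu> \<delta>' \<epsilon>"
    unfolding Crit_def using \<delta>'(1) de(2)
    by (intro INF_lower2[of \<delta>'] INF_lower) auto
  ultimately show ?thesis by (rule order_trans[rotated])
qed

lemma Crit_eq_0:
  assumes p: "p > -1/3" shows "Crit param_space half_plane X_field (0, 0) (-1/3, p) = 0"
proof -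
  let ?\<mu> = "(-1/3, p)"
  have \<mu>: "?\<mu> \<in> Lam" using p by (simp add: Lam_def)
  have "eventually (\<lambda>\<theta>. dp (fst \<theta>) (snd \<theta>) > 0) (at (?\<mu>, rad ?\<mu>) within Dom)"
    using dp_diverges[OF \<mu>, of 0] by simp
  then obtain \<eta> where \<eta>: "\<eta> > 0" "\<And>m s. m \<in> Lam \<Longrightarrow> 0 < s \<Longrightarrow> s < rad m \<Longrightarrow> dist m ?\<mu> < \<eta> \<Longrightarrow> \<bar>s - rad ?\<mu>\<bar> < \<eta> \<Longrightarrow> dp m s > 0"
    by (rule eventually_Dom_box) (auto simp: Dom_def)
  have "Crit param_space half_plane X_field (0, 0) ?\<mu> \<le> enat 0"
  proof (rule Crit_le[OF \<mu> \<eta>(1)])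
    fix m assume m: "m \<in> Lam" "dist m ?\<mu> < \<eta>"
    have e: "{r. 0 < r \<and> r < rad m \<and> \<bar>r - rad ?\<mu>\<bar> < \<eta> \<and> dp m r = 0} = {}" using \<eta>(2)[OF m(1) _ _ m(2)] by fastforce
    show "finite {r. 0 < r \<and> r < rad m \<and> \<bar>r - rad ?\<mu>\<bar> < \<eta> \<and> dp m r = 0} \<and> card {r. 0 < r \<and> r < rad m \<and> \<bar>r - rad ?\<mu>\<bar> < \<eta> \<and> dp m r = 0} \<le> 0"
      unfolding e by simp
  qed
  thus ?thesis by (simp add: zero_enat_def[symmetric])
qed

lemma subsingleton_card:
  assumes "\<And>a b. a \<in> Z \<Longrightarrow> b \<in> Z \<Longrightarrow> a = b" shows "finite Z \<and> card Z \<le> 1"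
proof (cases "Z = {}")
  case False
  then obtain a where "a \<in> Z" by blast
  hence "Z = {a}" using assms by blast
  thus ?thesis by simp
qed simp

lemma Crit_le_1:
  assumes p: "p > 0" "p \<noteq> 1" shows "Crit param_space half_plane X_field (0, 0) (0, p) \<le> 1"
proof -
  let ?\<mu> = "(0 :: real, p)"
  have \<mu>: "?\<mu> \<in> Lam" using p by (simp add: Lam_def)
  obtain \<eta> where \<eta>: "\<eta> > 0" "\<And>m s. m \<in> Lam \<Longrightarrow> 0 < s \<Longrightarrow> s < rad m \<Longrightarrow> dist m ?\<mu> < \<eta> \<Longrightarrow> \<bar>s - rad ?\<mu>\<bar> < \<eta> \<Longrightarrow> sgn (1 - p) * ee m s > 0"
    by (rule eventually_Dom_box[OF ee_sign[OF p]]) (auto simp: Dom_def)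
  obtain d where d: "d > 0" "\<And>m. dist m ?\<mu> < d \<Longrightarrow> m \<in> Lam \<and> \<bar>rad m - rad ?\<mu>\<bar> < \<eta>" by (rule Lam_ball[OF \<mu> \<eta>(1)]) blast
  define \<eta>' where "\<eta>' = min d \<eta>"
  have "Crit param_space half_plane X_field (0, 0) ?\<mu> \<le> enat 1"
  proof (rule Crit_le[OF \<mu>, of \<eta>'])
    show "\<eta>' > 0" using d \<eta> by (simp add: \<eta>'_def)
    fix m assume m: "m \<in> Lam" "dist m ?\<mu> < \<eta>'"
    let ?Z = "{r. 0 < r \<and> r < rad m \<and> \<bar>r - rad ?\<mu>\<bar> < \<eta>' \<and> dp m r = 0}"
    have m': "dist m ?\<mu> < \<eta>" "\<bar>rad m - rad ?\<mu>\<bar> < \<eta>" using m d(2)[of m] by (auto simp: \<eta>'_def)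
    have one: "a = b" if "a \<in> ?Z" "b \<in> ?Z" for a b
    proof (rule dp_zero_unique[OF m(1), of "max 0 (rad ?\<mu> - \<eta>)" "sgn (1 - p)"])
      show "sgn (1 - p) * ee m r > 0" if "max 0 (rad ?\<mu> - \<eta>) < r" "r < rad m" for r
        using that m' by (intro \<eta>(2) m(1)) auto
    qed (use that p in \<open>auto simp: \<eta>'_def sgn_zero_iff\<close>)
    show "finite ?Z \<and> card ?Z \<le> 1" by (rule subsingleton_card) (rule one)
  qed
  thus ?thesis by (simp add: one_enat_def)
qed

text \<open>The parameter is moved to q = \<sigma> t. Near the boundary of the new well
  \<open>dp\<close> has the sign of - q, opposite to the sign \<sigma> that it inherits from q = 0
  at the fixed radius \<open>r1\<close>. The intermediate value theorem gives a zero in between, and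
  both radii are close enough to the boundary for the Hausdorff condition.\<close>

lemma Crit_ge_1:
  assumes p: "p > 0" "p \<noteq> 1" shows "Crit param_space half_plane X_field (0, 0) (0, p) \<ge> 1"
  unfolding Crit_def
proof (intro INF_greatest)
  fix \<delta> \<epsilon> :: real assume "\<delta> \<in> {0<..}" "\<epsilon> \<in> {0<..}"
  hence \<delta>: "\<delta> > 0" and \<epsilon>: "\<epsilon> > 0" by auto
  let ?\<mu> = "(0 :: real, p)" and ?\<sigma> = "sgn (1 - p)"
  have \<mu>: "?\<mu> \<in> Lam" using p by (simp add: Lam_def)
  have R: "rad ?\<mu> > 0" by (rule rad_pos[OF \<mu>])
  have \<sigma>: "?\<sigma> = 1 \<or> ?\<sigma> = -1" using p by (auto simp: sgn_real_def)
  obtain \<eta> where \<eta>: "\<eta> > 0" "\<And>m r. m \<in> Lam \<Longrightarrow> 0 < r \<Longrightarrow> r \<le> rad m \<Longrightarrow> dist m ?\<mu> < \<eta> \<Longrightarrow> \<bar>r - rad ?\<mu>\<bar> < \<eta> \<Longrightarrow>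
    hausdorff_dist (to_rp2 ` lev m r) (to_rp2 ` lev ?\<mu> (rad ?\<mu>)) \<le> \<epsilon>" by (rule lev_hausdorff_box[OF \<mu> \<epsilon>]) blast
  \<comment> \<open>Fixed before the parameter is moved: the first entry keeps it positive, the
    second within \<eta> of \<open>rad ?\<mu>\<close>.\<close>
  define r1 where "r1 = max (rad ?\<mu> / 2) (rad ?\<mu> - \<eta> / 2)"
  have r1: "0 < r1" "r1 < rad ?\<mu>" "rad ?\<mu> - r1 < \<eta>" using R \<eta>(1) by (auto simp: r1_def)
  obtain e where e: "e > 0" "\<And>\<theta>. \<theta> \<in> Dom \<Longrightarrow> \<theta> \<noteq> (?\<mu>, r1) \<Longrightarrow> dist \<theta> (?\<mu>, r1) < e \<Longrightarrow> ?\<sigma> * dp (fst \<theta>) (snd \<theta>) > 0"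
    using dp_sign_interior[OF p r1(1,2)] unfolding eventually_at by blast
  obtain d where d: "d > 0" "\<And>m. dist m ?\<mu> < d \<Longrightarrow> m \<in> Lam \<and> \<bar>rad m - rad ?\<mu>\<bar> < min \<eta> (rad ?\<mu> - r1)"
    by (rule Lam_ball[OF \<mu>, of "min \<eta> (rad ?\<mu> - r1)"]) (use \<eta>(1) r1 in auto)
  \<comment> \<open>The bound 1/3 keeps q \<ge> -1/3, as the divergence requires.\<close>
  define t where "t = min (min (1/3) \<delta>) (min (\<eta> / 2) (min (e / 2) (d / 2)))"
  have t: "t > 0" "t \<le> 1/3" "t \<le> \<delta>" "t < \<eta>" "t < e" "t < d" using \<delta> \<eta>(1) e(1) d(1) by (auto simp: t_def)
  define m where "m = (?\<sigma> * t, p)"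
  have dm: "dist m ?\<mu> = t" using \<sigma> t(1) by (auto simp: m_def dist_Pair_Pair dist_real_def)
  have mL: "m \<in> Lam" "\<bar>rad m - rad ?\<mu>\<bar> < min \<eta> (rad ?\<mu> - r1)" using d(2)[of m] dm t by auto
  have r1m: "r1 < rad m" using mL(2) by linarith
  have s1: "?\<sigma> * dp m r1 > 0"
  proof -
    have "(m, r1) \<in> Dom" using mL r1 r1m by (simp add: Dom_def)
    moreover have "(m, r1) \<noteq> (?\<mu>, r1)" using \<sigma> t(1) by (auto simp: m_def)
    moreover have "dist (m, r1) (?\<mu>, r1) < e" using dm t by (simp add: dist_Pair_Pair)
    ultimately show ?thesis using e(2)[of "(m, r1)"] by simp
  qed
  obtain r2 where r2: "r1 < r2" "r2 < rad m" "?\<sigma> * dp m r2 < 0"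
  proof -
    have sg: "sgn (fst m) = ?\<sigma>" using \<sigma> t(1) by (auto simp: m_def sgn_mult)
    have "eventually (\<lambda>\<theta>. - sgn (fst m) * dp (fst \<theta>) (snd \<theta>) > 0) (at (m, rad m) within Dom)"
      by (rule dp_diverges[OF mL(1)]) (use \<sigma> t in \<open>auto simp: m_def\<close>)
    then obtain \<zeta> where \<zeta>: "\<zeta> > 0" "\<And>m' s. m' \<in> Lam \<Longrightarrow> 0 < s \<Longrightarrow> s < rad m' \<Longrightarrow> dist m' m < \<zeta> \<Longrightarrow> \<bar>s - rad m\<bar> < \<zeta> \<Longrightarrow> - sgn (fst m) * dp m' s > 0"
      by (rule eventually_Dom_box) (auto simp: Dom_def)
    define r2 where "r2 = max ((r1 + rad m) / 2) (rad m - \<zeta> / 2)"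
    have r2: "r1 < r2" "r2 < rad m" "rad m - \<zeta> / 2 \<le> r2" using r1m \<zeta>(1) by (auto simp: r2_def less_max_iff_disj)
    hence "r1 < r2" "r2 < rad m" "\<bar>r2 - rad m\<bar> < \<zeta>" using \<zeta>(1) by linarith+
    moreover from this have "- ?\<sigma> * dp m r2 > 0" using \<zeta>(2)[OF mL(1), of r2] r1(1) \<zeta>(1) sg by simp
    ultimately show ?thesis using that[of r2] by simp
  qed
  have "\<exists>r\<ge>r1. r \<le> r2 \<and> ?\<sigma> * dp m r = 0"
  proof (rule IVT2')
    show "continuous_on {r1..r2} (\<lambda>r. ?\<sigma> * dp m r)"
      by (intro continuous_at_imp_continuous_on ballI continuous_intros dp_cont mL) (use r1 r2 in auto)
  qed (use s1 r2 in auto)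
  then obtain r where r: "r1 \<le> r" "r \<le> r2" "?\<sigma> * dp m r = 0" by blast
  hence rr: "0 < r" "r < rad m" "dp m r = 0" using r1 r2 \<sigma> by auto
  have "\<bar>r - rad ?\<mu>\<bar> < \<eta>" using r r1 r2 mL(2) by linarith
  hence h: "hausdorff_dist (to_rp2 ` lev m r) (outer_boundary half_plane (X_field ?\<mu>) (0, 0)) \<le> \<epsilon>"
    unfolding outer_boundary_eq[OF \<mu>] using \<eta>(2)[OF mL(1) rr(1) less_imp_le[OF rr(2)]] dm t by simp
  let ?S = "{\<gamma>. critical_periodic_orbit half_plane (X_field m) (0, 0) \<gamma> \<and>
        hausdorff_dist (to_rp2 ` \<gamma>) (outer_boundary half_plane (X_field ?\<mu>) (0, 0)) \<le> \<epsilon>}"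
  have "lev m r \<in> ?S" using h rr by (auto simp: critical_iff[OF mL(1)])
  hence "ecard ?S \<ge> 1"
    by (cases "finite ?S") (auto simp: ecard_def one_enat_def Suc_le_eq card_gt_0_iff)
  moreover have "m \<in> {m \<in> param_space. dist m ?\<mu> \<le> \<delta>}" using mL(1) dm t by (auto simp: param_space_def Lam_def)
  ultimately show "1 \<le> crit_bound param_space half_plane X_field (0, 0) ?\<mu> \<delta> \<epsilon>"
    unfolding crit_bound_def by (meson SUP_upper2)
qed

theorem theorem1:
  shows "(\<forall>\<mu>\<in>param_space. nondegenerate_center half_plane (X_field \<mu>) (0, 0)) \<and>
    (\<exists>p1. {p. p > -1/3 \<and> f_fun p = 0} = {p1} \<and> \<bar>p1 - 1.15685\<bar> < 0.000005 \<and>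
      (\<forall>p. p > -1/3 \<and> p \<noteq> p1 \<longrightarrow>
         outer_boundary_continuous_at param_space half_plane X_field (0, 0) (-1/3, p) \<and>
         Crit param_space half_plane X_field (0, 0) (-1/3, p) = 0)) \<and>
    (\<forall>p. p > 0 \<and> p \<noteq> 1 \<longrightarrow>
         outer_boundary_continuous_at param_space half_plane X_field (0, 0) (0, p) \<and>
         Crit param_space half_plane X_field (0, 0) (0, p) = 1)"
proof (intro conjI)
  show "\<forall>\<mu>\<in>param_space. nondegenerate_center half_plane (X_field \<mu>) (0, 0)"
    using center_X_field by (auto simp: param_space_def)
  obtain p1 where p1: "{p. p > -1/3 \<and> f_fun p = 0} = {p1}" "\<bar>p1 - 1.15685\<bar> < 0.000005" by (rule f_fun_zero)
  have "outer_boundary_continuous_at param_space half_plane X_field (0, 0) (-1/3, p) \<and>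
        Crit param_space half_plane X_field (0, 0) (-1/3, p) = 0" if "p > -1/3" for p
    using Crit_eq_0[OF that] outer_boundary_continuous[of "(-1/3, p)"] that by (simp add: Lam_def)
  thus "\<exists>p1. {p. p > -1/3 \<and> f_fun p = 0} = {p1} \<and> \<bar>p1 - 1.15685\<bar> < 0.000005 \<and>
      (\<forall>p. p > -1/3 \<and> p \<noteq> p1 \<longrightarrow>
         outer_boundary_continuous_at param_space half_plane X_field (0, 0) (-1/3, p) \<and>
         Crit param_space half_plane X_field (0, 0) (-1/3, p) = 0)"
    using p1 by blast
  show "\<forall>p. p > 0 \<and> p \<noteq> 1 \<longrightarrow>
         outer_boundary_continuous_at param_space half_plane X_field (0, 0) (0, p) \<and>
         Crit param_space half_plane X_field (0, 0) (0, p) = 1"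
    using Crit_le_1 Crit_ge_1 outer_boundary_continuous by (auto simp: Lam_def intro: order.antisym)
qed

end
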